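(* Let $0<\rho_0<\rho_1<1$ and $\varepsilon>0$. Let $U_\varepsilon:M\to\mathbb R$ be a lower semicontinuous functional such that $U_\varepsilon(\bar\rho_\varepsilon)=0$ and satisfying the following condition. For each $T>0$ and each smooth path $u:[-T,0]\times[0,1]\to(0,1)$ such that $u(t,0)=\rho_0$, $u(t,1)=\rho_1$ for $t\in[-T,0]$, to every partition $[-T,0)=\bigcup_{k=1}^n[-T_k,-T_{k-1})$ with $T_0=0$ and $T_n=T$ one can associate elements $h^k\in\mathcal H^1_0$, $k=1,\dots,n$, which are bounded in $\mathcal H^1_0$ uniformly (in $k$ and in the partition), such that $$\mathbb H\big(u(-T_k),h^k\big)\le0,\qquad k=1,\dots,n,$$ and $$\limsup_{\max_k|T_{k-1}-T_k|\to0}\ \sum_{k=1}^n\Big[U_\varepsilon(u(-T_{k-1}))-U_\varepsilon(u(-T_k))-\int_{-T_k}^{-T_{k-1}}\langle h^k,u_t\rangle\,dt\Big]\le0.$$ Then $V_\varepsilon\ge U_\varepsilon$ on $M$.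
   Context: $f(a)=\sigma(a)=a(1-a)$. $M=\{\rho\in L^\infty([0,1]):0\le\rho\le1\}$ with the relative weak* topology of $L^\infty=(L^1)^*$. $\langle\cdot,\cdot\rangle$ and $\langle\!\langle\cdot,\cdot\rangle\!\rangle$ are the inner products of $L^2([0,1])$ and $L^2([-T,0]\times[0,1])$. $\mathcal H^1_0$ is the Sobolev space of functions on $[0,1]$ vanishing at $0,1$, with norm $(\int_0^1h_x^2dx)^{1/2}$. For $\rho\in C^2([0,1])$ with $0<\rho<1$, $\rho(0)=\rho_0$, $\rho(1)=\rho_1$ and $h\in\mathcal H^1_0$, $$\mathbb H(\rho,h)=\varepsilon\langle h_x,\sigma(\rho)h_x\rangle-\langle\varepsilon\rho_x-f(\rho),h_x\rangle.$$ $\bar\rho_\varepsilon$ is the unique stationary solution of $u_t+f(u)_x=\varepsilon u_{xx}$, $u(t,0)=\rho_0$, $u(t,1)=\rho_1$: with $J_\varepsilon$ the unique number in $(-\infty,\min_{[\rho_0,\rho_1]}f)$ such that $\int_{\rho_0}^{\rho_1}\frac{\varepsilon}{f(r)-J_\varepsilon}dr=1$, it solves $f(\bar\rho_\varepsilon)-\varepsilon(\bar\rho_\varepsilon)_x=J_\varepsilon$, $\bar\rho_\varepsilon(0)=\rho_0$ (so $\bar\rho_\varepsilon(1)=\rho_1$). For $T>0$ and $u\in C([-T,0];M)$ (continuous paths): $C_0^\infty([-T,0]\times[0,1])$ is the set of smooth $H$ with $H(t,0)=H(t,1)=0$ and $H(-T,x)=H(0,x)=0$; $$L^\varepsilon_u(H)=-\langle\!\langle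 u,H_t\rangle\!\rangle-\langle\!\langle f(u),H_x\rangle\!\rangle-\varepsilon\langle\!\langle u,H_{xx}\rangle\!\rangle+\varepsilon\int_{-T}^0[\rho_1H_x(t,1)-\rho_0H_x(t,0)]dt;$$ $\langle\!\langle u_x,u_x\rangle\!\rangle=\sup_H\{-2\langle\!\langle u,H_x\rangle\!\rangle-\langle\!\langle H,H\rangle\!\rangle\}$ over smooth $H$ with $H(t,0)=H(t,1)=0$; $$I^\varepsilon_{[-T,0]}(u)=\sup_{H\in C_0^\infty([-T,0]\times[0,1])}\{L^\varepsilon_u(H)-\varepsilon\langle\!\langle H_x,\sigma(u)H_x\rangle\!\rangle\}\ \text{ if }\langle\!\langle u_x,u_x\rangle\!\rangle<+\infty,$$ and $+\infty$ otherwise. The quasi-potential is $$V_\varepsilon(\rho)=\inf_{T>0}\inf\{I^\varepsilon_{[-T,0]}(u):u\in C([-T,0];M),\ u(-T)=\bar\rho_\varepsilon,\ u(0)=\rho\},\quad\rho\in M.$$ *)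

theory Defs
  imports "HOL-Analysis.Analysis"
begin

definition flux :: "real \<Rightarrow> real" where
  "flux a = a * (1 - a)"

definition mobility :: "real \<Rightarrow> real" where
  "mobility a = a * (1 - a)"

definition inner1 :: "(real \<Rightarrow> real) \<Rightarrow> (real \<Rightarrow> real) \<Rightarrow> real" where
  "inner1 g h = (LINT x|lebesgue_on {0..1}. g x * h x)"

text \<open>The inner product of \<open>L\<^sup>2([-T,0] \<times> [0,1])\<close> is written as an iterated integral.
  A path in \<open>M\<close> is a family of functions of \<open>x\<close>, each fixed only up to a null set; the iterated
  integral does not depend on the representatives chosen at the individual times, whereas the
  double integral would require a jointly measurable choice.\<close>

definition inner2 :: "real \<Rightarrow> (real \<Rightarrow> real \<Rightarrow> real) \<Rightarrow> (real \<Rightarrow> real \<Rightarrow> real) \<Rightarrow> real" where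
  "inner2 T g h = (LINT t|lebesgue_on {-T..0}. inner1 (g t) (h t))"


section \<open>The space \<open>M\<close>\<close>

text \<open>As usual in the library, elements of \<open>L\<^sup>\<infinity>([0,1])\<close> are represented by
  functions; values outside \<open>[0,1]\<close> are irrelevant.  The weak* topology is the initial topology of
  the pairings with \<open>L\<^sup>1([0,1])\<close>.  Functions that are equal almost everywhere on \<open>[0,1]\<close> have the same
  neighbourhoods, so a lower semicontinuous functional agrees on them, and hence is a
  functional of the equivalence class.\<close>

definition M_space :: "(real \<Rightarrow> real) set" where
  "M_space = {\<rho>. \<rho> \<in> borel_measurable (lebesgue_on {0..1}) \<and>
                (AE x in lebesgue_on {0..1}. 0 \<le> \<rho> x \<and> \<rho> x \<le> 1)}"

definition L1_space :: "(real \<Rightarrow> real) set" where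
  "L1_space = {\<phi>. integrable (lebesgue_on {0..1}) \<phi>}"

definition M_top :: "(real \<Rightarrow> real) topology" where
  "M_top = pullback_topology M_space (\<lambda>\<rho>. restrict (\<lambda>\<phi>. inner1 \<rho> \<phi>) L1_space)
             (product_topology (\<lambda>_. euclidean) L1_space)"

definition lower_semicontinuous :: "'a topology \<Rightarrow> ('a \<Rightarrow> real) \<Rightarrow> bool" where
  "lower_semicontinuous X U \<longleftrightarrow> (\<forall>a. openin X {x \<in> topspace X. a < U x})"


section \<open>Smooth functions on \<open>[-T,0] \<times> [0,1]\<close>\<close>

text \<open>Smoothness up to the boundary: \<open>D i j\<close> is the derivative of order \<open>i\<close> in \<open>t\<close> and \<open>j\<close> in \<open>x\<close>,
  one-sided at the boundary.\<close>

definition smooth_rect :: "real \<Rightarrow> (real \<Rightarrow> real \<Rightarrow> real) \<Rightarrow> bool" where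
  "smooth_rect T u \<longleftrightarrow>
     (\<exists>D :: nat \<Rightarrow> nat \<Rightarrow> real \<Rightarrow> real \<Rightarrow> real.
        (\<forall>t\<in>{-T..0}. \<forall>x\<in>{0..1}. D 0 0 t x = u t x) \<and>
        (\<forall>i j. continuous_on ({-T..0} \<times> {0..1}) (\<lambda>(t, x). D i j t x) \<and>
          (\<forall>t\<in>{-T..0}. \<forall>x\<in>{0..1}.
             ((\<lambda>s. D i j s x) has_real_derivative D (Suc i) j t x) (at t within {-T..0}) \<and>
             ((\<lambda>y. D i j t y) has_real_derivative D i (Suc j) t x) (at x within {0..1}))))"

definition deriv01 :: "(real \<Rightarrow> real) \<Rightarrow> real \<Rightarrow> real" where
  "deriv01 g x = vector_derivative g (at x within {0..1})"

definition dt :: "real \<Rightarrow> (real \<Rightarrow> real \<Rightarrow> real) \<Rightarrow> real \<Rightarrow> real \<Rightarrow> real" where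
  "dt T H t x = vector_derivative (\<lambda>s. H s x) (at t within {-T..0})"

definition dx :: "(real \<Rightarrow> real \<Rightarrow> real) \<Rightarrow> real \<Rightarrow> real \<Rightarrow> real" where
  "dx H t = deriv01 (H t)"

definition test_lateral :: "real \<Rightarrow> (real \<Rightarrow> real \<Rightarrow> real) set" where
  "test_lateral T = {H. smooth_rect T H \<and> (\<forall>t\<in>{-T..0}. H t 0 = 0 \<and> H t 1 = 0)}"

definition test_C0 :: "real \<Rightarrow> (real \<Rightarrow> real \<Rightarrow> real) set" where
  "test_C0 T = {H \<in> test_lateral T. \<forall>x\<in>{0..1}. H (-T) x = 0 \<and> H 0 x = 0}"


section \<open>The space \<open>H\<^sup>1\<^sub>0\<close> and the Hamiltonian\<close>

definition Cc_infinity01 :: "(real \<Rightarrow> real) set" where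
  "Cc_infinity01 =
     {\<phi>. (\<forall>n x. ((deriv ^^ n) \<phi>) field_differentiable (at x)) \<and>
          (\<exists>a b. 0 < a \<and> a < b \<and> b < 1 \<and> (\<forall>x. x \<notin> {a..b} \<longrightarrow> \<phi> x = 0))}"

definition L2_space :: "(real \<Rightarrow> real) set" where
  "L2_space = {g. g \<in> borel_measurable (lebesgue_on {0..1}) \<and>
                integrable (lebesgue_on {0..1}) (\<lambda>x. (g x)\<^sup>2)}"

definition is_weak_deriv :: "(real \<Rightarrow> real) \<Rightarrow> (real \<Rightarrow> real) \<Rightarrow> bool" where
  "is_weak_deriv h g \<longleftrightarrow> g \<in> L2_space \<and>
     (\<forall>\<phi>\<in>Cc_infinity01. inner1 h (deriv \<phi>) = - inner1 g \<phi>)"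

text \<open>Elements of \<open>H\<^sup>1\<^sub>0\<close> are represented by their continuous representatives, for which
  the boundary values make sense.\<close>

definition H10 :: "(real \<Rightarrow> real) set" where
  "H10 = {h. continuous_on {0..1} h \<and> h 0 = 0 \<and> h 1 = 0 \<and> (\<exists>g. is_weak_deriv h g)}"

text \<open>The weak derivative is unique up to null sets, and it only enters through integrals.\<close>

definition weak_deriv :: "(real \<Rightarrow> real) \<Rightarrow> real \<Rightarrow> real" where
  "weak_deriv h = (SOME g. is_weak_deriv h g)"

definition H10_norm :: "(real \<Rightarrow> real) \<Rightarrow> real" where
  "H10_norm h = sqrt (LINT x|lebesgue_on {0..1}. (weak_deriv h x)\<^sup>2)"

definition Ham :: "real \<Rightarrow> (real \<Rightarrow> real) \<Rightarrow> (real \<Rightarrow> real) \<Rightarrow> real" where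
  "Ham \<epsilon> \<rho> h =
     \<epsilon> * inner1 (weak_deriv h) (\<lambda>x. mobility (\<rho> x) * weak_deriv h x)
     - inner1 (\<lambda>x. \<epsilon> * deriv01 \<rho> x - flux (\<rho> x)) (weak_deriv h)"


section \<open>Stationary solution and quasi-potential\<close>

text \<open>The number \<open>J\<close> and the values of \<open>\<rho>\<close> on \<open>[0,1]\<close> are uniquely determined by this property.\<close>

definition stationary :: "real \<Rightarrow> real \<Rightarrow> real \<Rightarrow> (real \<Rightarrow> real) \<Rightarrow> bool" where
  "stationary \<epsilon> \<rho>\<^sub>0 \<rho>\<^sub>1 \<rho> \<longleftrightarrow>
     (\<exists>J. (\<forall>r\<in>{\<rho>\<^sub>0..\<rho>\<^sub>1}. J < flux r) \<and>
          (LINT r|lebesgue_on {\<rho>\<^sub>0..\<rho>\<^sub>1}. \<epsilon> / (flux r - J)) = 1 \<and>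
          \<rho> 0 = \<rho>\<^sub>0 \<and>
          (\<forall>x\<in>{0..1}. \<exists>d. (\<rho> has_real_derivative d) (at x within {0..1}) \<and>
                            flux (\<rho> x) - \<epsilon> * d = J))"

definition L_fun :: "real \<Rightarrow> real \<Rightarrow> real \<Rightarrow> real \<Rightarrow> (real \<Rightarrow> real \<Rightarrow> real) \<Rightarrow> (real \<Rightarrow> real \<Rightarrow> real) \<Rightarrow> real" where
  "L_fun \<epsilon> \<rho>\<^sub>0 \<rho>\<^sub>1 T u H =
     - inner2 T u (dt T H)
     - inner2 T (\<lambda>t x. flux (u t x)) (dx H)
     - \<epsilon> * inner2 T u (dx (dx H))
     + \<epsilon> * (LINT t|lebesgue_on {-T..0}. \<rho>\<^sub>1 * dx H t 1 - \<rho>\<^sub>0 * dx H t 0)"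

definition energy :: "real \<Rightarrow> (real \<Rightarrow> real \<Rightarrow> real) \<Rightarrow> ereal" where
  "energy T u = (SUP H\<in>test_lateral T. ereal (- 2 * inner2 T u (dx H) - inner2 T H H))"

definition I_fun :: "real \<Rightarrow> real \<Rightarrow> real \<Rightarrow> real \<Rightarrow> (real \<Rightarrow> real \<Rightarrow> real) \<Rightarrow> ereal" where
  "I_fun \<epsilon> \<rho>\<^sub>0 \<rho>\<^sub>1 T u =
     (if energy T u < \<infinity>
      then (SUP H\<in>test_C0 T.
              ereal (L_fun \<epsilon> \<rho>\<^sub>0 \<rho>\<^sub>1 T u H
                     - \<epsilon> * inner2 T (dx H) (\<lambda>t x. mobility (u t x) * dx H t x)))
      else \<infinity>)"

text \<open>Equality in \<open>M\<close> is equality almost everywhere on \<open>[0,1]\<close>.\<close>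

definition paths :: "real \<Rightarrow> (real \<Rightarrow> real) \<Rightarrow> (real \<Rightarrow> real) \<Rightarrow> (real \<Rightarrow> real \<Rightarrow> real) set" where
  "paths T \<rho>\<^sub>i \<rho>\<^sub>f =
     {u. continuous_map (top_of_set {-T..0}) M_top u \<and>
         (AE x in lebesgue_on {0..1}. u (-T) x = \<rho>\<^sub>i x) \<and>
         (AE x in lebesgue_on {0..1}. u 0 x = \<rho>\<^sub>f x)}"

definition quasi_potential ::
    "real \<Rightarrow> real \<Rightarrow> real \<Rightarrow> (real \<Rightarrow> real) \<Rightarrow> (real \<Rightarrow> real) \<Rightarrow> ereal" where
  "quasi_potential \<epsilon> \<rho>\<^sub>0 \<rho>\<^sub>1 \<rho>bar \<rho> =
     (INF T\<in>{0<..}. INF u\<in>paths T \<rho>bar \<rho>. I_fun \<epsilon> \<rho>\<^sub>0 \<rho>\<^sub>1 T u)"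


section \<open>Partitions\<close>

text \<open>A partition \<open>0 = T\<^sub>0 < \<dots> < T\<^sub>n = T\<close> is the list of its \<open>n + 1\<close> points.\<close>

definition partitions :: "real \<Rightarrow> real list set" where
  "partitions T = {P. P \<noteq> [] \<and> sorted_wrt (<) P \<and> hd P = 0 \<and> last P = T}"

definition num_cells :: "real list \<Rightarrow> nat" where
  "num_cells P = length P - 1"

definition mesh :: "real list \<Rightarrow> real" where
  "mesh P = Max ((\<lambda>k. \<bar>P ! (k - 1) - P ! k\<bar>) ` {1..num_cells P})"

definition mesh_to_0 :: "real \<Rightarrow> real list filter" where
  "mesh_to_0 T = inf (filtercomap mesh (at_right 0)) (principal (partitions T))"

definition smooth_paths :: "real \<Rightarrow> real \<Rightarrow> real \<Rightarrow> (real \<Rightarrow> real \<Rightarrow> real) set" where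
  "smooth_paths \<rho>\<^sub>0 \<rho>\<^sub>1 T =
     {u. smooth_rect T u \<and>
         (\<forall>t\<in>{-T..0}. \<forall>x\<in>{0..1}. 0 < u t x \<and> u t x < 1) \<and>
         (\<forall>t\<in>{-T..0}. u t 0 = \<rho>\<^sub>0 \<and> u t 1 = \<rho>\<^sub>1)}"

end

theory Submission
  imports Defs "HOL-Computational_Algebra.Polynomial"
begin

text \<open>Let \<open>u\<close> be a path of finite action \<open>I\<close>. Expand \<open>u - \<rho>bar\<close> in sines, take Fejer means of
  order \<open>N\<close> in space and exponential means of scale \<open>\<tau>\<close> in time, and multiply by \<open>1 - \<lambda>\<close>; this gives a
  path \<open>v\<close> from \<open>\<rho>bar\<close> whose values lie in a compact subset of \<open>(0,1)\<close> for large \<open>N\<close>. With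
  \<open>W = \<epsilon> v\<^sub>x - \<integral>\<^sub>0\<^sup>x v\<^sub>t - f(v)\<close>, the Lagrangian
  of \<open>v\<close> is \<open>inf\<^sub>c \<integral> (W - c)\<^sup>2 / (4 \<epsilon> f(v)) = \<integral> (W p - \<epsilon> f(v) p\<^sup>2)\<close> for an explicit \<open>p\<close> of mean zero. Testing
  the action of \<open>u\<close> with the adjoint mean of \<open>p\<close> and using Jensen's inequality together with the
  concavity of \<open>f\<close>, one finds that the Lagrangian of \<open>v\<close> integrates to at most \<open>I\<close> up to an error
  that vanishes as \<open>N \<rightarrow> \<infinity>\<close> and \<open>\<tau>, \<lambda> \<rightarrow> 0\<close>; here the boundary effects of the Fejer means are absorbed by
  an energy estimate. After a polynomial approximation of the sine coefficients \<open>v\<close> is smooth, and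
  completing the square turns \<open>Ham \<epsilon> v h \<le> 0\<close> into a bound of \<open>\<langle>h, v\<^sub>t\<rangle>\<close> by the Lagrangian. Hence
  \<open>U(v(0)) \<le> I + o(1)\<close>, and lower semicontinuity gives \<open>U(u(0)) \<le> I\<close>.\<close>

section \<open>Integration on compact intervals\<close>

text \<open>Test functions vanish at \<open>0\<close> and \<open>1\<close>, so they see
  \<open>u - \<rho>bar\<close> through sines only, and the means that keep the boundary values are
  the Dirichlet means \<open>kerD\<close>. Jensen's inequality for the flux needs a probability
  kernel, and that is the Neumann kernel \<open>kerN\<close>. The difference of the two, applied to
  \<open>u - \<rho>bar\<close>, is small only because the time average of this function has a square
  integrable derivative and zero boundary values. The action itself has to supply this, and the
  bound at a fixed time is of order \<open>1 / \<tau>\<close>; hence \<open>N\<close> tends to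
  infinity first, for fixed \<open>\<tau>\<close> and \<open>\<lambda>\<close>, and a diagonal
  sequence follows. Exponential means in time need no extension of the path: the averaged path
  starts at \<open>\<rho>bar\<close>, and the adjoint mean vanishes at time \<open>0\<close>, as
  test functions must. The factor \<open>1 - \<lambda>\<close> leaves a share of
  \<open>\<rho>bar\<close> in the mean, which bounds the weight \<open>1 / f(v)\<close>. Mobility
  and flux are the same function, so the flux enters the action only as \<open>f(u)\<close> times
  \<open>y + \<epsilon> y\<^sup>2\<close>, with \<open>y\<close> the space derivative of the test
  function. This factor is convex and at least \<open>- 1 / (4 \<epsilon>)\<close>, which is why the
  concavity defect costs no more than its integral over \<open>4 \<epsilon>\<close>.\<close>

lemma integrable_lebesgue_on_bounded:
  fixes f :: "real \<Rightarrow> real"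
  assumes "f \<in> borel_measurable (lebesgue_on {a..b})"
    and "AE x in lebesgue_on {a..b}. \<bar>f x\<bar> \<le> B"
  shows "integrable (lebesgue_on {a..b}) f"
proof -
  interpret finite_measure "lebesgue_on {a..b}"
    by (rule finite_measure_lebesgue_on) simp
  show ?thesis
    using assms by (intro integrable_const_bound[of f B]) auto
qed

lemma AE_lebesgue_onI:
  assumes "\<And>x. x \<in> {a..b} \<Longrightarrow> P x"
  shows "AE x in lebesgue_on {a..b::real}. P x"
  using assms by (intro AE_I2) simp

lemma integral_lebesgue_on_cont:
  fixes f :: "real \<Rightarrow> real"
  assumes "continuous_on {a..b} f"
  shows "(LINT x|lebesgue_on {a..b}. f x) = integral {a..b} f"
  by (rule lebesgue_integral_eq_integral) (auto intro: continuous_imp_integrable_real assms)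

lemma integral_lebesgue_on_const:
  fixes a b c :: real
  assumes "a \<le> b"
  shows "(LINT x|lebesgue_on {a..b}. c) = c * (b - a)"
  using integral_lebesgue_on_cont[of a b "\<lambda>_. c"] assms by simp

lemma integral_lebesgue_on_mono:
  fixes f g :: "real \<Rightarrow> real"
  assumes "integrable (lebesgue_on {a..b}) f" "integrable (lebesgue_on {a..b}) g"
    and "\<And>x. x \<in> {a..b} \<Longrightarrow> f x \<le> g x"
  shows "(LINT x|lebesgue_on {a..b}. f x) \<le> (LINT x|lebesgue_on {a..b}. g x)"
  using assms by (intro integral_mono) auto

lemma integral_lebesgue_on_cong:
  fixes f g :: "real \<Rightarrow> real"
  assumes "\<And>x. x \<in> {a..b} \<Longrightarrow> f x = g x"
  shows "(LINT x|lebesgue_on {a..b}. f x) = (LINT x|lebesgue_on {a..b}. g x)"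
  using assms by (intro Bochner_Integration.integral_cong) auto

lemma integral_lebesgue_on_le_const:
  fixes f :: "real \<Rightarrow> real"
  assumes "integrable (lebesgue_on {a..b}) f" "a \<le> b" "\<And>x. x \<in> {a..b} \<Longrightarrow> f x \<le> B"
  shows "(LINT x|lebesgue_on {a..b}. f x) \<le> B * (b - a)"
  using integral_lebesgue_on_mono[of a b f "\<lambda>_. B"] assms
  by (simp add: integral_lebesgue_on_const del: lebesgue_integral_const)

lemma FTC_lebesgue_on:
  fixes f :: "real \<Rightarrow> real"
  assumes "a \<le> b" "continuous_on {a..b} f"
    and "\<And>x. x \<in> {a..b} \<Longrightarrow> (F has_real_derivative f x) (at x within {a..b})"
  shows "(LINT x|lebesgue_on {a..b}. f x) = F b - F a"
  unfolding integral_lebesgue_on_cont[OF assms(2)]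
  by (rule integral_unique, rule fundamental_theorem_of_calculus[OF assms(1)])
     (use assms(3) in \<open>auto simp: has_real_derivative_iff_has_vector_derivative\<close>)

lemma abs_integrable_lebesgue_on:
  fixes f :: "real \<Rightarrow> real"
  assumes "integrable (lebesgue_on {a..b}) f"
  shows "f absolutely_integrable_on {a..b}"
  using assms by (simp add: integrable_restrict_space set_integrable_def)

lemma integrable_mult_bounded:
  fixes f g :: "real \<Rightarrow> real"
  assumes f: "integrable (lebesgue_on {a..b}) f" and g: "g \<in> borel_measurable (lebesgue_on {a..b})"
    and B: "AE x in lebesgue_on {a..b}. \<bar>g x\<bar> \<le> B"
  shows "integrable (lebesgue_on {a..b}) (\<lambda>x. f x * g x)"
proof (rule Bochner_Integration.integrable_bound[where f="\<lambda>x. B * f x"])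
  show "AE x in lebesgue_on {a..b}. norm (f x * g x) \<le> norm (B * f x)"
    using B
  proof eventually_elim
    case (elim x)
    then have "\<bar>f x\<bar> * \<bar>g x\<bar> \<le> \<bar>f x\<bar> * \<bar>B\<bar>" by (intro mult_left_mono) auto
    then show ?case by (simp add: abs_mult mult.commute)
  qed
qed (use f g in auto)

lemma abs_integral_le_bound:
  fixes f g :: "real \<Rightarrow> real"
  assumes f: "integrable (lebesgue_on {a..b}) f" and g: "g \<in> borel_measurable (lebesgue_on {a..b})"
    and B: "AE x in lebesgue_on {a..b}. \<bar>g x\<bar> \<le> B"
  shows "\<bar>LINT x|lebesgue_on {a..b}. f x * g x\<bar> \<le> B * (LINT x|lebesgue_on {a..b}. \<bar>f x\<bar>)"
proof -
  have "norm (LINT x|lebesgue_on {a..b}. f x * g x) \<le> (LINT x|lebesgue_on {a..b}. norm (f x * g x))"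
    by (rule integral_norm_bound)
  also have "\<dots> \<le> (LINT x|lebesgue_on {a..b}. B * \<bar>f x\<bar>)"
  proof (rule integral_mono_AE)
    show "AE x in lebesgue_on {a..b}. norm (f x * g x) \<le> B * \<bar>f x\<bar>"
      using B
    proof eventually_elim
      case (elim x)
      then have "\<bar>f x\<bar> * \<bar>g x\<bar> \<le> \<bar>f x\<bar> * B" by (intro mult_left_mono) auto
      then show ?case by (simp add: abs_mult mult.commute)
    qed
  qed (use integrable_mult_bounded[OF f g B] f in auto)
  also have "\<dots> = B * (LINT x|lebesgue_on {a..b}. \<bar>f x\<bar>)" by simp
  finally show ?thesis by simp
qed

text \<open>Truncation reduces to bounded \<open>f\<close>, and a measurable function is an almost
  everywhere limit of continuous ones. Truncating these at the same height gives a dominating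
  constant, and a cut-off forces the value zero at both ends; with this boundary condition the
  Dirichlet means of \<open>g\<close> will converge uniformly.\<close>

lemma L1_dense_continuous:
  fixes f :: "real \<Rightarrow> real"
  assumes f: "integrable (lebesgue_on {a..b}) f" and e: "0 < e" and ab: "a < b"
  obtains g where "continuous_on UNIV g" "g a = 0" "g b = 0"
    "(LINT x|lebesgue_on {a..b}. \<bar>f x - g x\<bar>) < e"
proof -
  let ?L = "lebesgue_on {a..b}"
  have fm: "f \<in> borel_measurable ?L" using f by auto
  define tr where "tr = (\<lambda>k y::real. max (- k) (min k y))"
  have tr_cont: "continuous_on UNIV (tr k)" for k
    unfolding tr_def by (intro continuous_intros)
  have "(\<lambda>n. LINT x|?L. \<bar>f x - tr (real n) (f x)\<bar>) \<longlonglongrightarrow> (LINT x|?L. 0)"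
  proof (rule integral_dominated_convergence[where w="\<lambda>x. \<bar>f x\<bar>"])
    show "AE x in ?L. (\<lambda>n. \<bar>f x - tr (real n) (f x)\<bar>) \<longlonglongrightarrow> 0"
    proof (rule AE_I2)
      fix x
      have "eventually (\<lambda>n. \<bar>f x - tr (real n) (f x)\<bar> = 0) sequentially"
        using eventually_ge_at_top[of "nat \<lceil>\<bar>f x\<bar>\<rceil>"]
        by eventually_elim (auto simp: tr_def max_def min_def nat_ceiling_le_eq)
      then show "(\<lambda>n. \<bar>f x - tr (real n) (f x)\<bar>) \<longlonglongrightarrow> 0"
        by (rule tendsto_eventually)
    qed
    show "(\<lambda>x. \<bar>f x - tr (real n) (f x)\<bar>) \<in> borel_measurable ?L" for n
      using fm unfolding tr_def by measurable
    show "AE x in ?L. norm \<bar>f x - tr (real n) (f x)\<bar> \<le> \<bar>f x\<bar>" for n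
      by (rule AE_I2) (auto simp: tr_def)
  qed (use f in auto)
  then have "(\<lambda>n. LINT x|?L. \<bar>f x - tr (real n) (f x)\<bar>) \<longlonglongrightarrow> 0" by simp
  then have "eventually (\<lambda>n. (LINT x|?L. \<bar>f x - tr (real n) (f x)\<bar>) < e/2) sequentially"
    by (rule order_tendstoD) (use e in simp)
  then obtain k where k: "(LINT x|?L. \<bar>f x - tr (real k) (f x)\<bar>) < e/2"
    by (auto simp: eventually_sequentially)
  define h where "h = (\<lambda>x. tr (real k) (f x))"
  have hm: "h \<in> borel_measurable ?L"
    using fm unfolding h_def tr_def by measurable
  have hb: "\<bar>h x\<bar> \<le> real k" for x unfolding h_def tr_def by auto
  have hi: "integrable ?L h"
    using hm hb by (intro integrable_lebesgue_on_bounded[of _ _ _ "real k"]) auto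
  have "h measurable_on {a..b}"
    using hm by (simp add: measurable_on_iff_borel_measurable)
  then obtain N g where N: "negligible N" and g: "\<And>n. continuous_on UNIV (g n)"
    and lim: "\<And>x. x \<notin> N \<Longrightarrow> (\<lambda>n. g n x) \<longlonglongrightarrow> (if x \<in> {a..b} then h x else 0)"
    unfolding measurable_on_def by blast
  \<comment> \<open>A trapezoid of slope \<open>n\<close>: zero at \<open>a\<close> and
    \<open>b\<close>, and equal to one at each interior point for all large
    \<open>n\<close>.\<close>
  define cut where "cut = (\<lambda>n x. max 0 (min 1 (real n * min (x - a) (b - x))))"
  define G where "G = (\<lambda>n x. cut n x * tr (real k) (g n x))"
  have cut01: "0 \<le> cut n x" "cut n x \<le> 1" for n x unfolding cut_def by auto
  have Gcont: "continuous_on UNIV (G n)" for n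
    unfolding G_def cut_def
    by (intro continuous_intros continuous_on_compose2[OF tr_cont g]) auto
  have Gb: "\<bar>G n x\<bar> \<le> real k" for n x
  proof -
    have "\<bar>cut n x\<bar> * \<bar>tr (real k) (g n x)\<bar> \<le> 1 * real k"
      by (intro mult_mono) (use cut01[of n x] in \<open>auto simp: tr_def\<close>)
    then show ?thesis by (simp add: G_def abs_mult)
  qed
  have GmB: "G n \<in> borel_measurable ?L" for n
    using Gcont by (meson continuous_imp_integrable_real continuous_on_subset top_greatest borel_measurable_integrable)
  have "(\<lambda>n. LINT x|?L. \<bar>h x - G n x\<bar>) \<longlonglongrightarrow> (LINT x|?L. 0)"
  proof (rule integral_dominated_convergence[where w="\<lambda>x. 2 * real k"])
    have "AE x in lebesgue. x \<notin> insert a (insert b N)"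
      by (rule AE_not_in) (use N in \<open>simp add: negligible_iff_null_sets[symmetric]\<close>)
    then have "AE x in lebesgue. x \<in> {a..b} \<longrightarrow> x \<notin> insert a (insert b N)"
      by eventually_elim blast
    then have "AE x in ?L. x \<notin> insert a (insert b N)"
      by (subst AE_restrict_space_iff) simp_all
    moreover have "AE x in ?L. x \<in> {a..b}" by (rule AE_lebesgue_onI)
    ultimately show "AE x in ?L. (\<lambda>n. \<bar>h x - G n x\<bar>) \<longlonglongrightarrow> 0"
    proof eventually_elim
      case (elim x)
      then have x: "a < x" "x < b" "x \<notin> N" by auto
      have "(\<lambda>n. g n x) \<longlonglongrightarrow> h x" using lim[of x] x by auto
      moreover have "isCont (tr (real k)) (h x)"
        using tr_cont by (simp add: continuous_on_eq_continuous_at)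
      ultimately have 1: "(\<lambda>n. tr (real k) (g n x)) \<longlonglongrightarrow> tr (real k) (h x)"
        by (rule isCont_tendsto_compose[rotated])
      have "tr (real k) (h x) = h x" unfolding h_def tr_def by auto
      note 1 = 1[unfolded this]
      define d where "d = min (x - a) (b - x)"
      have d: "d > 0" using x by (simp add: d_def)
      have "eventually (\<lambda>n. cut n x = 1) sequentially"
        using eventually_ge_at_top[of "nat \<lceil>1/d\<rceil>"]
      proof eventually_elim
        case (elim n)
        then have "1/d \<le> real n" by (simp add: nat_ceiling_le_eq)
        then have "1 \<le> real n * d" using d by (simp add: field_simps)
        then show ?case unfolding cut_def d_def by auto
      qed
      then have "(\<lambda>n. cut n x) \<longlonglongrightarrow> 1" by (rule tendsto_eventually)
      from tendsto_mult[OF this 1] have "(\<lambda>n. G n x) \<longlonglongrightarrow> h x" by (simp add: G_def)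
      then show ?case
        using tendsto_rabs[OF tendsto_diff[OF tendsto_const[of "h x"] \<open>(\<lambda>n. G n x) \<longlonglongrightarrow> h x\<close>]] by simp
    qed
    show "(\<lambda>x. \<bar>h x - G n x\<bar>) \<in> borel_measurable ?L" for n using hm GmB by measurable
    show "AE x in ?L. norm \<bar>h x - G n x\<bar> \<le> 2 * real k" for n
    proof (rule AE_I2)
      fix x show "norm \<bar>h x - G n x\<bar> \<le> 2 * real k" using hb[of x] Gb[of n x] by auto
    qed
  qed auto
  then have "(\<lambda>n. LINT x|?L. \<bar>h x - G n x\<bar>) \<longlonglongrightarrow> 0" by simp
  then have "eventually (\<lambda>n. (LINT x|?L. \<bar>h x - G n x\<bar>) < e/2) sequentially"
    by (rule order_tendstoD) (use e in simp)
  then obtain n where n: "(LINT x|?L. \<bar>h x - G n x\<bar>) < e/2"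
    by (auto simp: eventually_sequentially)
  have Gi: "integrable ?L (G n)"
    using Gcont by (meson continuous_imp_integrable_real continuous_on_subset top_greatest)
  have "(LINT x|?L. \<bar>f x - G n x\<bar>) \<le> (LINT x|?L. \<bar>f x - h x\<bar> + \<bar>h x - G n x\<bar>)"
    by (rule integral_lebesgue_on_mono) (use f hi Gi in auto)
  also have "\<dots> = (LINT x|?L. \<bar>f x - h x\<bar>) + (LINT x|?L. \<bar>h x - G n x\<bar>)"
    using f hi Gi by (intro Bochner_Integration.integral_add) auto
  also have "\<dots> < e" using k n by (simp add: h_def)
  finally have "(LINT x|?L. \<bar>f x - G n x\<bar>) < e" .
  moreover have "G n a = 0" "G n b = 0" using ab by (auto simp: G_def cut_def)
  ultimately show ?thesis using that Gcont by blast
qed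

section \<open>Primitives of integrable functions and integration over a triangle\<close>

lemma primitive_continuous:
  fixes g :: "real \<Rightarrow> real"
  assumes "integrable (lebesgue_on {a..b}) g"
  shows "continuous_on {a..b} (\<lambda>x. integral {a..x} g)" "continuous_on {a..b} (\<lambda>x. integral {x..b} g)"
proof -
  have "g integrable_on {a..b}"
    using assms by (simp add: integrable_on_lebesgue_on)
  then show "continuous_on {a..b} (\<lambda>x. integral {a..x} g)" "continuous_on {a..b} (\<lambda>x. integral {x..b} g)"
    by (auto intro: indefinite_integral_continuous_1 indefinite_integral_continuous_1')
qed

lemma abs_integral_diff_le:
  fixes f g :: "real \<Rightarrow> real"
  assumes f: "integrable (lebesgue_on {a..b}) f" and g: "integrable (lebesgue_on {a..b}) g"
    and cd: "a \<le> c" "d \<le> b"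
  shows "\<bar>integral {c..d} f - integral {c..d} g\<bar> \<le> (LINT x|lebesgue_on {a..b}. \<bar>f x - g x\<bar>)"
proof -
  have i: "integrable (lebesgue_on {a..b}) (\<lambda>x. f x - g x)" using f g by simp
  then have ai: "(\<lambda>x. f x - g x) absolutely_integrable_on {a..b}" by (rule abs_integrable_lebesgue_on)
  then have ai': "(\<lambda>x. f x - g x) absolutely_integrable_on {c..d}"
    by (rule absolutely_integrable_on_subinterval) (use cd in auto)
  have sub: "f integrable_on {c..d}" "g integrable_on {c..d}"
    using integrable_on_subinterval[of f "{a..b}" c d] integrable_on_subinterval[of g "{a..b}" c d]
      f g cd by (auto simp: integrable_on_lebesgue_on)
  have "\<bar>integral {c..d} f - integral {c..d} g\<bar> = \<bar>integral {c..d} (\<lambda>x. f x - g x)\<bar>"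
    using sub by (simp add: Henstock_Kurzweil_Integration.integral_diff)
  also have "\<dots> \<le> integral {c..d} (\<lambda>x. \<bar>f x - g x\<bar>)"
    using ai' integral_norm_bound_integral[of "\<lambda>x. f x - g x" "{c..d}" "\<lambda>x. \<bar>f x - g x\<bar>"]
    by (auto simp: absolutely_integrable_on_def)
  also have "\<dots> \<le> integral {a..b} (\<lambda>x. \<bar>f x - g x\<bar>)"
    using ai ai' cd by (intro integral_subset_le) (auto simp: absolutely_integrable_on_def)
  also have "\<dots> = (LINT x|lebesgue_on {a..b}. \<bar>f x - g x\<bar>)"
    using i by (intro lebesgue_integral_eq_integral[symmetric]) auto
  finally show ?thesis .
qed

text \<open>Fubini on the triangle \<open>s \<le> t\<close>, with one factor merely integrable. For
  continuous \<open>q\<close> the difference of the two integrands is the derivative of the product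
  of the primitives, which vanishes at both ends. Both sides are Lipschitz in \<open>q\<close> for
  the L1 norm, so density extends the identity.\<close>

lemma integral_triangle_swap:
  fixes q r :: "real \<Rightarrow> real"
  assumes q: "integrable (lebesgue_on {a..b}) q" and r: "continuous_on {a..b} r" and ab: "a < b"
  shows "(LINT t|lebesgue_on {a..b}. r t * integral {a..t} q)
       = (LINT s|lebesgue_on {a..b}. q s * integral {s..b} r)"
proof -
  let ?L = "lebesgue_on {a..b}"
  have cont_case: "(LINT t|?L. r t * integral {a..t} k) = (LINT s|?L. k s * integral {s..b} r)"
    if k: "continuous_on {a..b} k" for k :: "real \<Rightarrow> real"
  proof -
    have kc: "continuous_on {a..b} (\<lambda>t. integral {a..t} k)"
      using k by (intro primitive_continuous continuous_imp_integrable_real)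
    have rc: "continuous_on {a..b} (\<lambda>t. integral {t..b} r)"
      using r by (intro primitive_continuous continuous_imp_integrable_real)
    have c1: "continuous_on {a..b} (\<lambda>t. r t * integral {a..t} k)" 
      and c2: "continuous_on {a..b} (\<lambda>t. k t * integral {t..b} r)"
      by (intro continuous_intros r k kc rc)+
    have "(LINT t|?L. k t * integral {t..b} r - r t * integral {a..t} k)
        = integral {a..b} k * integral {b..b} r - integral {a..a} k * integral {a..b} r"
    proof (rule FTC_lebesgue_on)
      fix x assume x: "x \<in> {a..b}"
      show "((\<lambda>t. integral {a..t} k * integral {t..b} r) has_real_derivative
         k x * integral {x..b} r - r x * integral {a..x} k) (at x within {a..b})"
        by (rule derivative_eq_intros integral_has_real_derivative[OF k x]
             integral_has_real_derivative'[OF r x] refl | simp)+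
    qed (use ab c1 c2 in \<open>auto intro!: continuous_intros\<close>)
    then have "(LINT t|?L. k t * integral {t..b} r - r t * integral {a..t} k) = 0" by simp
    then show ?thesis
      using c1 c2 by (subst (asm) Bochner_Integration.integral_diff)
        (auto intro: continuous_imp_integrable_real)
  qed
  have rb: "bounded (r ` {a..b})" by (intro compact_imp_bounded compact_continuous_image r) auto
  then obtain B where "B > 0" and "\<forall>y\<in>r ` {a..b}. norm y \<le> B"
    unfolding bounded_pos by blast
  then have B: "\<And>x. x \<in> {a..b} \<Longrightarrow> \<bar>r x\<bar> \<le> B" and B0: "B > 0" by auto
  have ri: "integrable ?L r" using r by (rule continuous_imp_integrable_real)
  have Rc: "continuous_on {a..b} (\<lambda>t. integral {t..b} r)" by (rule primitive_continuous[OF ri])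
  have RB: "\<bar>integral {t..b} r\<bar> \<le> B * (b - a)" if t: "t \<in> {a..b}" for t
  proof -
    have "norm (integral {t..b} r) \<le> B * (b - t)"
      by (rule integral_bound) (use B t in \<open>auto intro!: continuous_on_subset[OF r]\<close>)
    then have "\<bar>integral {t..b} r\<bar> \<le> B * (b - t)" using t by simp
    also have "\<dots> \<le> B * (b - a)" using t B0 by (intro mult_left_mono) auto
    finally show ?thesis .
  qed
  let ?x = "LINT t|?L. r t * integral {a..t} q"
  let ?y = "LINT s|?L. q s * integral {s..b} r"
  have meas: "f \<in> borel_measurable ?L" if "continuous_on {a..b} f" for f :: "real \<Rightarrow> real"
    using continuous_imp_integrable_real[OF that] by auto
  have key: "\<bar>?x - ?y\<bar> \<le> 0 + e" if e: "e > 0" for e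
  proof -
    define d where "d = e / (2 * B * (b - a) + 1)"
    have pos: "2 * B * (b - a) + 1 > 0" using B0 ab by (simp add: add_pos_pos)
    have d: "d > 0" using e pos by (simp add: d_def)
    obtain k where k: "continuous_on UNIV k" and kd: "(LINT x|?L. \<bar>q x - k x\<bar>) < d"
      using L1_dense_continuous[OF q d ab] by blast
    have kc: "continuous_on {a..b} k" using k continuous_on_subset by blast
    have ki: "integrable ?L k" using kc by (rule continuous_imp_integrable_real)
    have Qc: "continuous_on {a..b} (\<lambda>t. integral {a..t} q)" by (rule primitive_continuous[OF q])
    have Kc: "continuous_on {a..b} (\<lambda>t. integral {a..t} k)" by (rule primitive_continuous[OF ki])
    have "?x - (LINT t|?L. r t * integral {a..t} k) = (LINT t|?L. r t * (integral {a..t} q - integral {a..t} k))"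
      using r Qc Kc by (subst Bochner_Integration.integral_diff[symmetric])
        (auto intro!: continuous_imp_integrable_real continuous_intros simp: algebra_simps)
    also have "\<bar>\<dots>\<bar> \<le> d * (LINT t|?L. \<bar>r t\<bar>)"
    proof (rule abs_integral_le_bound[OF ri])
      show "AE t in ?L. \<bar>integral {a..t} q - integral {a..t} k\<bar> \<le> d"
      proof (rule AE_lebesgue_onI)
        fix t assume "t \<in> {a..b}"
        then have "\<bar>integral {a..t} q - integral {a..t} k\<bar> \<le> (LINT x|?L. \<bar>q x - k x\<bar>)"
          by (intro abs_integral_diff_le q ki) auto
        then show "\<bar>integral {a..t} q - integral {a..t} k\<bar> \<le> d" using kd by simp
      qed
    qed (auto intro!: meas continuous_intros Qc Kc)
    also have "\<dots> \<le> d * (B * (b - a))"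
      by (intro mult_left_mono integral_lebesgue_on_le_const) (use ri ab d B in auto)
    finally have 1: "\<bar>?x - (LINT t|?L. r t * integral {a..t} k)\<bar> \<le> d * (B * (b - a))" .
    have "?y - (LINT s|?L. k s * integral {s..b} r) = (LINT s|?L. (q s - k s) * integral {s..b} r)"
      using integrable_mult_bounded[OF q meas[OF Rc] AE_lebesgue_onI[OF RB]]
        integrable_mult_bounded[OF ki meas[OF Rc] AE_lebesgue_onI[OF RB]]
      by (subst Bochner_Integration.integral_diff[symmetric]) (auto simp: algebra_simps)
    also have "\<bar>\<dots>\<bar> \<le> B * (b - a) * (LINT s|?L. \<bar>q s - k s\<bar>)"
      by (rule abs_integral_le_bound[OF _ meas[OF Rc] AE_lebesgue_onI[OF RB]]) (use q ki in auto)
    also have "\<dots> \<le> B * (b - a) * d"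
      using kd B0 ab by (intro mult_left_mono) auto
    finally have 2: "\<bar>?y - (LINT s|?L. k s * integral {s..b} r)\<bar> \<le> B * (b - a) * d" .
    have "\<bar>?x - ?y\<bar> \<le> d * (2 * B * (b - a))"
      using 1 2 cont_case[OF kc] by (simp add: algebra_simps)
    also have "\<dots> \<le> d * (2 * B * (b - a) + 1)" using d by (intro mult_left_mono) auto
    also have "\<dots> = e" using pos by (simp add: d_def)
    finally show ?thesis by simp
  qed
  then have "\<bar>?x - ?y\<bar> \<le> 0" by (rule field_le_epsilon)
  then show ?thesis by simp
qed

section \<open>Compactly supported smooth functions and \<open>H\<^sup>1\<^sub>0\<close>\<close>

definition exp_germ :: "real poly \<Rightarrow> real \<Rightarrow> real" where
  "exp_germ p x = (if x > 0 then poly p (1 / x) * exp (- (1 / x)) else 0)"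

lemma poly_times_exp_tendsto_0: "((\<lambda>y. poly p y * exp (- y)) \<longlongrightarrow> (0::real)) at_top"
proof -
  have "((\<lambda>y. \<Sum>i\<le>degree p. coeff p i * (y ^ i / exp y)) \<longlongrightarrow> (\<Sum>i\<le>degree p. coeff p i * 0)) at_top"
    by (intro tendsto_intros tendsto_power_div_exp_0)
  then show ?thesis
    by (simp add: poly_altdef sum_divide_distrib exp_minus field_simps)
qed

text \<open>The chain rule produces the factor \<open>1 / x\<^sup>2\<close>, which is
  \<open>monom 1 2\<close> evaluated at \<open>1 / x\<close>; hence the functions
  \<open>exp_germ p\<close> form a class closed under differentiation. At \<open>0\<close> the
  difference quotient is again of this form, with \<open>p\<close> multiplied by the variable, and
  the exponential beats every polynomial.\<close>

lemma exp_germ_deriv: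
  "(exp_germ p has_real_derivative exp_germ (monom 1 2 * (p - pderiv p)) x) (at x)"
proof -
  consider "x > 0" | "x < 0" | "x = 0" by linarith
  then show ?thesis
  proof cases
    case 1
    have "((\<lambda>x. poly p (1 / x) * exp (- (1 / x))) has_real_derivative
        exp_germ (monom 1 2 * (p - pderiv p)) x) (at x)"
      using 1
      by (auto intro!: derivative_eq_intros DERIV_chain2[OF poly_DERIV]
           simp: exp_germ_def poly_monom power2_eq_square field_simps)
    then show ?thesis
      by (rule has_field_derivative_transform_within_open[where S="{0<..}"])
         (use 1 in \<open>auto simp: exp_germ_def\<close>)
  next
    case 2
    have "((\<lambda>x. 0) has_real_derivative exp_germ (monom 1 2 * (p - pderiv p)) x) (at x)"
      using 2 by (simp add: exp_germ_def)
    then show ?thesis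
      by (rule has_field_derivative_transform_within_open[where S="{..<0}"])
         (use 2 in \<open>auto simp: exp_germ_def\<close>)
  next
    case 3
    have "((\<lambda>h. exp_germ p h / h) \<longlongrightarrow> 0) (at_right 0)"
    proof -
      have lim: "filterlim (\<lambda>h::real. 1 / h) at_top (at_right 0)"
        using filterlim_inverse_at_top_right by (simp add: inverse_eq_divide)
      have "((\<lambda>h. poly (monom 1 1 * p) (1 / h) * exp (- (1 / h))) \<longlongrightarrow> 0) (at_right 0)"
        by (rule filterlim_compose[OF poly_times_exp_tendsto_0 lim])
      moreover have "\<forall>\<^sub>F h in at_right 0. poly (monom 1 1 * p) (1 / h) * exp (- (1 / h)) = exp_germ p h / h"
        unfolding eventually_at_filter by (auto simp: exp_germ_def poly_monom)
      ultimately show ?thesis by (rule Lim_transform_eventually)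
    qed
    moreover have "((\<lambda>h. exp_germ p h / h) \<longlongrightarrow> 0) (at_left 0)"
      by (rule tendsto_eventually) (auto simp: exp_germ_def eventually_at_filter)
    ultimately have "((\<lambda>h. exp_germ p h / h) \<longlongrightarrow> 0) (at 0)"
      by (simp add: filterlim_split_at)
    then show ?thesis
      using 3 by (simp add: has_field_derivative_iff exp_germ_def)
  qed
qed

text \<open>Smoothness is encoded by membership in a class closed under differentiation. The
  derivative of a product of two germs is a sum of two such products, so closing under sums is
  enough.\<close>

inductive bump_like :: "real \<Rightarrow> real \<Rightarrow> (real \<Rightarrow> real) \<Rightarrow> bool" for a b where
  prod: "bump_like a b (\<lambda>x. exp_germ p (x - a) * exp_germ q (b - x))"
| add: "bump_like a b f \<Longrightarrow> bump_like a b g \<Longrightarrow> bump_like a b (\<lambda>x. f x + g x)"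

lemma bump_like_deriv:
  "bump_like a b f \<Longrightarrow> \<exists>f'. bump_like a b f' \<and> (\<forall>x. (f has_real_derivative f' x) (at x))"
proof (induction rule: bump_like.induct)
  case (prod p q)
  let ?D = "\<lambda>p. monom 1 2 * (p - pderiv p) :: real poly"
  let ?f' = "\<lambda>x. exp_germ (?D p) (x - a) * exp_germ q (b - x) + exp_germ p (x - a) * exp_germ (- ?D q) (b - x)"
  have neg: "exp_germ (- r) y = - exp_germ r y" for r y by (simp add: exp_germ_def)
  have "((\<lambda>x. exp_germ p (x - a) * exp_germ q (b - x)) has_real_derivative ?f' x) (at x)" for x
    unfolding neg
    by (rule derivative_eq_intros DERIV_chain2[OF exp_germ_deriv] refl | simp)+
  moreover have "bump_like a b ?f'" by (intro bump_like.intros)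
  ultimately show ?case by blast
next
  case (add f g)
  then obtain f' g' where "bump_like a b f'" "bump_like a b g'"
    "\<forall>x. (f has_real_derivative f' x) (at x)" "\<forall>x. (g has_real_derivative g' x) (at x)" by blast
  then have "bump_like a b (\<lambda>x. f' x + g' x)"
    "\<forall>x. ((\<lambda>x. f x + g x) has_real_derivative (f' x + g' x)) (at x)"
    by (auto intro: bump_like.intros derivative_intros)
  then show ?case by blast
qed

lemma smooth_bump_like:
  assumes "bump_like a b f"
  shows "bump_like a b ((deriv ^^ n) f)"
proof (induction n)
  case (Suc n)
  then obtain f' where "bump_like a b f'" "\<forall>x. ((deriv ^^ n) f has_real_derivative f' x) (at x)"
    using bump_like_deriv by blast
  moreover from this(2) have "deriv ((deriv ^^ n) f) = f'" by (auto intro: DERIV_imp_deriv)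
  ultimately show ?case by simp
qed (use assms in simp)

lemma funpow_deriv_lincomb:
  assumes "\<And>n x. (deriv ^^ n) f field_differentiable at x"
    and "\<And>n x. (deriv ^^ n) g field_differentiable at (x::real)"
  shows "(deriv ^^ n) (\<lambda>x. \<alpha> * f x + \<gamma> * g x) = (\<lambda>x. \<alpha> * (deriv ^^ n) f x + \<gamma> * (deriv ^^ n) g x)"
proof (induction n)
  case (Suc n)
  have "deriv (\<lambda>x. \<alpha> * (deriv ^^ n) f x + \<gamma> * (deriv ^^ n) g x) x
      = \<alpha> * deriv ((deriv ^^ n) f) x + \<gamma> * deriv ((deriv ^^ n) g) x" for x
    using assms[of n x]
    by (intro DERIV_imp_deriv derivative_eq_intros) (auto simp: field_differentiable_derivI)
  then show ?case using Suc by auto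
qed simp

definition std_bump :: "real \<Rightarrow> real \<Rightarrow> real \<Rightarrow> real" where
  "std_bump a b x = exp_germ 1 (x - a) * exp_germ 1 (b - x)"

lemma std_bump_smooth: "(deriv ^^ n) (std_bump a b) field_differentiable at x"
proof -
  have "bump_like a b (std_bump a b)" unfolding std_bump_def[abs_def] by (rule bump_like.prod)
  then show ?thesis
    using smooth_bump_like bump_like_deriv field_differentiable_def by blast
qed

lemma std_bump_cont: "continuous_on S (std_bump a b)"
  using std_bump_smooth[of 0 a b]
  by (simp add: continuous_at_imp_continuous_on field_differentiable_imp_continuous_at)

lemma std_bump_nonneg: "0 \<le> std_bump a b x"
  by (simp add: std_bump_def exp_germ_def)

lemma std_bump_pos: "a < x \<Longrightarrow> x < b \<Longrightarrow> 0 < std_bump a b x"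
  by (simp add: std_bump_def exp_germ_def)

lemma std_bump_outside: "x \<notin> {a<..<b} \<Longrightarrow> std_bump a b x = 0"
  by (auto simp: std_bump_def exp_germ_def)

lemma std_bump_integral_pos:
  assumes "0 < a" "a < b" "b < 1"
  shows "integral {0..1} (std_bump a b) > 0"
proof -
  have "integral {0..1} (std_bump a b) \<noteq> 0"
  proof
    assume "integral {0..1} (std_bump a b) = 0"
    then have "\<forall>x\<in>{0..1}. std_bump a b x = 0"
      by (subst (asm) integral_eq_0_iff) (auto simp: std_bump_cont std_bump_nonneg)
    then have "std_bump a b ((a + b) / 2) = 0" using assms by auto
    then show False using std_bump_pos[of a "(a+b)/2" b] assms by simp
  qed
  moreover have "integral {0..1} (std_bump a b) \<ge> 0"
    by (intro Henstock_Kurzweil_Integration.integral_nonneg integrable_continuous_real) (auto simp: std_bump_cont std_bump_nonneg)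
  ultimately show ?thesis by simp
qed

text \<open>To the right of \<open>hi\<close> the primitive equals the full integral, which is zero.
  Every mean-zero bump is therefore the derivative of a test function and may be used to test a weak
  derivative.\<close>

lemma Cc_infinity01_primitive:
  assumes lo: "0 < lo" "lo < hi" "hi < 1"
    and sm: "\<And>n x. (deriv ^^ n) \<psi> field_differentiable at x"
    and out: "\<And>x. x \<notin> {lo..hi} \<Longrightarrow> \<psi> x = 0"
    and int0: "integral {0..1} \<psi> = 0"
  shows "(\<lambda>x. integral {0..x} \<psi>) \<in> Cc_infinity01" "deriv (\<lambda>x. integral {0..x} \<psi>) = \<psi>"
proof -
  let ?\<phi> = "\<lambda>x. integral {0..x} \<psi>"
  have cont: "continuous_on S \<psi>" for S
    using sm[of 0] by (simp add: continuous_at_imp_continuous_on field_differentiable_imp_continuous_at)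
  have low: "?\<phi> x = 0" if "x < lo" for x
  proof -
    have "?\<phi> x = integral {0..x} (\<lambda>x. 0)"
      by (rule Henstock_Kurzweil_Integration.integral_cong) (use out that in auto)
    then show ?thesis by simp
  qed
  have D: "(?\<phi> has_real_derivative \<psi> x) (at x)" for x
  proof (cases "x < lo")
    case True
    have "((\<lambda>x. 0) has_real_derivative \<psi> x) (at x)" using out[of x] True by simp
    then show ?thesis
      by (rule has_field_derivative_transform_within_open[where S="{..<lo}"]) (use low True in auto)
  next
    case False
    then have "(?\<phi> has_real_derivative \<psi> x) (at x within {0..x+1})"
      by (intro integral_has_real_derivative cont) (use lo in auto)
    moreover have "at x within {0..x+1} = at x"
      by (rule at_within_interior) (use False lo in \<open>auto simp: interior_atLeastAtMost_real\<close>)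
    ultimately show ?thesis by simp
  qed
  show d: "deriv ?\<phi> = \<psi>" using D by (auto intro: DERIV_imp_deriv)
  have "(deriv ^^ n) ?\<phi> field_differentiable at x" for n x
  proof (cases n)
    case 0 then show ?thesis using D field_differentiable_def by auto
  next
    case (Suc m)
    then show ?thesis using sm[of m x] by (simp add: funpow_Suc_right d del: funpow.simps)
  qed
  moreover have "?\<phi> x = 0" if "x \<notin> {lo..hi}" for x
  proof (cases "x < lo")
    case False
    then have x: "x > hi" using that by auto
    have zero: "integral {c..d} \<psi> = 0" if "hi < c" for c d
    proof -
      have "integral {c..d} \<psi> = integral {c..d} (\<lambda>x. 0)"
        by (rule Henstock_Kurzweil_Integration.integral_cong) (use out that in auto)
      then show ?thesis by simp
    qed
    have io: "\<psi> integrable_on S" if "S = {c..d}" for S c d 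
      unfolding that by (intro integrable_continuous_real cont)
    show ?thesis
    proof (cases "x \<le> 1")
      case True
      have "?\<phi> x + integral {x..1} \<psi> = integral {0..1} \<psi>"
        by (intro Henstock_Kurzweil_Integration.integral_combine) (use x lo True in \<open>auto simp: io\<close>)
      then show ?thesis using zero[OF x] int0 by simp
    next
      case F: False
      have "?\<phi> 1 + integral {1..x} \<psi> = ?\<phi> x"
        by (intro Henstock_Kurzweil_Integration.integral_combine) (use F in \<open>auto simp: io\<close>)
      then show ?thesis using zero[of 1 x] lo int0 by simp
    qed
  qed (use low in auto)
  ultimately show "?\<phi> \<in> Cc_infinity01"
    unfolding Cc_infinity01_def using lo by blast
qed

section \<open>Functions in \<open>H10\<close> as primitives of their weak derivatives\<close>

lemma std_bump_average_close:
  assumes w: "continuous_on {0..1} w" and r: "0 < c - r" "c + r < 1" "0 < r"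
    and close: "\<And>x. x \<in> {c-r<..<c+r} \<Longrightarrow> \<bar>w x - w c\<bar> \<le> \<delta>"
  shows "\<bar>integral {0..1} (\<lambda>x. w x * std_bump (c-r) (c+r) x) / integral {0..1} (std_bump (c-r) (c+r)) - w c\<bar> \<le> \<delta>"
proof -
  let ?\<beta> = "std_bump (c-r) (c+r)"
  let ?m = "integral {0..1} ?\<beta>"
  have m: "?m > 0" by (rule std_bump_integral_pos) (use r in auto)
  have \<beta>i: "?\<beta> integrable_on {0..1}" by (intro integrable_continuous_real std_bump_cont)
  have wi: "(\<lambda>x. w x * ?\<beta> x) integrable_on {0..1}"
    by (intro integrable_continuous_real continuous_intros w std_bump_cont)
  have "integral {0..1} (\<lambda>x. w x * ?\<beta> x) - w c * ?m = integral {0..1} (\<lambda>x. w x * ?\<beta> x - w c * ?\<beta> x)"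
    using Henstock_Kurzweil_Integration.integral_diff[OF wi integrable_on_mult_right[OF \<beta>i, of "w c"]]
    by simp
  also have "norm \<dots> \<le> integral {0..1} (\<lambda>x. \<delta> * ?\<beta> x)"
  proof (rule integral_norm_bound_integral)
    fix x :: real
    show "norm (w x * ?\<beta> x - w c * ?\<beta> x) \<le> \<delta> * ?\<beta> x"
    proof (cases "x \<in> {c-r<..<c+r}")
      case True
      have "\<bar>w x - w c\<bar> * ?\<beta> x \<le> \<delta> * ?\<beta> x"
        by (intro mult_right_mono close True std_bump_nonneg)
      then show ?thesis
        by (simp add: left_diff_distrib[symmetric] abs_mult std_bump_nonneg)
    qed (simp add: std_bump_outside)
  qed (intro integrable_continuous_real continuous_intros w std_bump_cont)+
  also have "\<dots> = \<delta> * ?m" by simp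
  finally have "\<bar>integral {0..1} (\<lambda>x. w x * ?\<beta> x) - w c * ?m\<bar> \<le> \<delta> * ?m" by simp
  then have "\<bar>integral {0..1} (\<lambda>x. w x * ?\<beta> x) - w c * ?m\<bar> / ?m \<le> \<delta>"
    using m by (simp add: divide_le_eq)
  moreover have "\<bar>integral {0..1} (\<lambda>x. w x * ?\<beta> x) - w c * ?m\<bar> / ?m
      = \<bar>(integral {0..1} (\<lambda>x. w x * ?\<beta> x) - w c * ?m) / ?m\<bar>" using m by simp
  ultimately show ?thesis using m by (simp add: diff_divide_distrib)
qed

lemma L2_space_integrable:
  assumes "g \<in> L2_space"
  shows "integrable (lebesgue_on {0..1}) g"
proof (rule Bochner_Integration.integrable_bound[where f="\<lambda>x. 1 + (g x)\<^sup>2"])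
  have *: "\<bar>x\<bar> \<le> 1 + x\<^sup>2" for x :: real
    using sum_squares_ge_zero[of "\<bar>x\<bar> - 1/2" 0] by (simp add: power2_eq_square algebra_simps)
  have "norm (g x) \<le> norm (1 + (g x)\<^sup>2)" for x
    using *[of "g x"] by simp
  then show "AE x in lebesgue_on {0..1}. norm (g x) \<le> norm (1 + (g x)\<^sup>2)" by simp
qed (use assms in \<open>auto simp: L2_space_def\<close>)

text \<open>The lemma of du Bois-Reymond. The difference \<open>w\<close> of \<open>h\<close> and
  the primitive of \<open>g\<close> is orthogonal to every mean-zero bump, so its averages over any
  two normalised bumps agree. Shrinking the bumps gives \<open>w c = w d\<close> in the interior;
  continuity and \<open>w 0 = 0\<close> finish.\<close>

lemma weak_deriv_primitive:
  assumes h: "continuous_on {0..1} h" "h 0 = 0" "h 1 = 0" and wd: "is_weak_deriv h g"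
  shows "\<And>x. x \<in> {0..1} \<Longrightarrow> h x = integral {0..x} g"
proof -
  let ?L = "lebesgue_on {0..1::real}"
  have gi: "integrable ?L g" using wd by (simp add: is_weak_deriv_def L2_space_integrable)
  define w where "w = (\<lambda>x. h x - integral {0..x} g)"
  have Gc: "continuous_on {0..1} (\<lambda>x. integral {0..x} g)" by (rule primitive_continuous[OF gi])
  have wc: "continuous_on {0..1} w" unfolding w_def by (intro continuous_intros h Gc)
  \<comment> \<open>The test function is the primitive of \<open>\<psi>\<close>. Since
    \<open>\<psi>\<close> has mean zero, minus its value at \<open>x\<close> is the integral of
    \<open>\<psi>\<close> over \<open>{x..1}\<close>, which is the form needed for the triangle
    swap.\<close>
  have ortho: "integral {0..1} (\<lambda>x. w x * \<psi> x) = 0"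
    if lo: "0 < lo" "lo < hi" "hi < 1"
    and sm: "\<And>n x. (deriv ^^ n) \<psi> field_differentiable at x"
    and out: "\<And>x. x \<notin> {lo..hi} \<Longrightarrow> \<psi> x = 0"
    and int0: "integral {0..1} \<psi> = 0" for \<psi> lo hi
  proof -
    have pc: "continuous_on S \<psi>" for S
      using sm[of 0] by (simp add: continuous_at_imp_continuous_on field_differentiable_imp_continuous_at)
    note prim = Cc_infinity01_primitive[OF lo sm out int0]
    have "inner1 h \<psi> = - inner1 g (\<lambda>x. integral {0..x} \<psi>)"
      using wd prim unfolding is_weak_deriv_def by metis
    also have "\<dots> = (LINT s|?L. g s * integral {s..1} \<psi>)"
      unfolding inner1_def Bochner_Integration.integral_minus[symmetric]
    proof (rule integral_lebesgue_on_cong)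
      fix x :: real assume x: "x \<in> {0..1}"
      have "integral {0..x} \<psi> + integral {x..1} \<psi> = integral {0..1} \<psi>"
        by (intro Henstock_Kurzweil_Integration.integral_combine integrable_continuous_real pc) (use x in auto)
      then show "- (g x * integral {0..x} \<psi>) = g x * integral {x..1} \<psi>" using int0
        by (metis add.inverse_unique minus_mult_right)
    qed
    also have "\<dots> = (LINT t|?L. \<psi> t * integral {0..t} g)"
      by (rule integral_triangle_swap[symmetric, OF gi pc]) simp
    finally have "(LINT x|?L. h x * \<psi> x) - (LINT t|?L. \<psi> t * integral {0..t} g) = 0"
      by (simp add: inner1_def)
    then have "(LINT x|?L. h x * \<psi> x - \<psi> x * integral {0..x} g) = 0"
      by (subst Bochner_Integration.integral_diff)
         (auto intro!: continuous_imp_integrable_real continuous_intros h pc Gc)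
    then have "(LINT x|?L. w x * \<psi> x) = 0" by (simp add: w_def algebra_simps)
    then show ?thesis
      by (subst (asm) integral_lebesgue_on_cont) (auto intro!: continuous_intros wc pc)
  qed
  have const: "\<bar>w c - w d\<bar> \<le> 0 + e" if c: "0 < c" "c < 1" and d: "0 < d" "d < 1" and e: "e > 0" for c d e
  proof -
    have near: "\<exists>r>0. 0 < c - r \<and> c + r < 1 \<and> (\<forall>x\<in>{c-r<..<c+r}. \<bar>w x - w c\<bar> \<le> e/2)"
      if c: "0 < c" "c < 1" for c
    proof -
      obtain r where r: "r > 0" and rc: "\<And>x. x \<in> {0..1} \<Longrightarrow> dist x c < r \<Longrightarrow> dist (w x) (w c) < e/2"
        using wc c e unfolding continuous_on_iff by (metis atLeastAtMost_iff half_gt_zero less_eq_real_def)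
      define r' where "r' = min r (min (c/2) ((1-c)/2))"
      have "r' \<le> (1-c)/2" unfolding r'_def by (intro min.coboundedI2 order_refl)
      then have r': "r' \<le> r" "r' \<le> c/2" "r' \<le> (1-c)/2" "r' > 0" using r c by (auto simp: r'_def)
      have "\<bar>w x - w c\<bar> \<le> e/2" if "x \<in> {c-r'<..<c+r'}" for x
      proof -
        from r' have "x \<in> {0..1}" "dist x c < r" using that c by (auto simp: dist_real_def)
        then show ?thesis using rc[of x] by (simp add: dist_real_def)
      qed
      then show ?thesis using r' c by (intro exI[of _ r']) auto
    qed
    obtain r where r: "r > 0" "0 < c - r" "c + r < 1" "\<forall>x\<in>{c-r<..<c+r}. \<bar>w x - w c\<bar> \<le> e/2"
      using near[OF c] by blast
    obtain s where s: "s > 0" "0 < d - s" "d + s < 1" "\<forall>x\<in>{d-s<..<d+s}. \<bar>w x - w d\<bar> \<le> e/2"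
      using near[OF d] by blast
    let ?b = "std_bump (c-r) (c+r)" and ?b' = "std_bump (d-s) (d+s)"
    let ?m = "integral {0..1} ?b" and ?m' = "integral {0..1} ?b'"
    have m: "?m > 0" "?m' > 0" by (rule std_bump_integral_pos; use r s in auto)+
    \<comment> \<open>The difference of two bumps of unit mass, hence of mean zero.\<close>
    let ?\<psi> = "\<lambda>x. inverse ?m * ?b x + (- inverse ?m') * ?b' x"
    have bi: "std_bump u v integrable_on {0..1}" for u v by (intro integrable_continuous_real std_bump_cont)
    have "integral {0..1} ?\<psi> = integral {0..1} (\<lambda>x. inverse ?m * ?b x) + integral {0..1} (\<lambda>x. (- inverse ?m') * ?b' x)"
      by (rule Henstock_Kurzweil_Integration.integral_add; rule integrable_on_mult_right; rule bi)
    also have "\<dots> = 0" using m by simp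
    finally have int0: "integral {0..1} ?\<psi> = 0" .
    have z0: "integral {0..1} (\<lambda>x. w x * ?\<psi> x) = 0"
    proof (rule ortho[OF _ _ _ _ _ int0])
      show "(deriv ^^ n) ?\<psi> field_differentiable at x" for n x
        unfolding funpow_deriv_lincomb[OF std_bump_smooth std_bump_smooth]
        by (intro derivative_intros field_differentiable_add field_differentiable_mult
             field_differentiable_const std_bump_smooth)
      show "0 < min (c-r) (d-s)" "min (c-r) (d-s) < max (c+r) (d+s)" "max (c+r) (d+s) < 1"
        using r s by (auto simp: min_def max_def)
      show "?\<psi> x = 0" if "x \<notin> {min (c-r) (d-s)..max (c+r) (d+s)}" for x
        using that by (subst (1 2) std_bump_outside) (auto simp: min_def max_def split: if_splits)
    qed
    have wbi: "(\<lambda>x. w x * std_bump u v x) integrable_on {0..1}" for u v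
      by (intro integrable_continuous_real continuous_intros wc std_bump_cont)
    have "integral {0..1} (\<lambda>x. w x * ?\<psi> x)
        = integral {0..1} (\<lambda>x. inverse ?m * (w x * ?b x) + (- inverse ?m') * (w x * ?b' x))"
      by (simp add: algebra_simps)
    also have "\<dots> = integral {0..1} (\<lambda>x. inverse ?m * (w x * ?b x)) + integral {0..1} (\<lambda>x. (- inverse ?m') * (w x * ?b' x))"
      by (rule Henstock_Kurzweil_Integration.integral_add; rule integrable_on_mult_right; rule wbi)
    also have "\<dots> = integral {0..1} (\<lambda>x. w x * ?b x) / ?m - integral {0..1} (\<lambda>x. w x * ?b' x) / ?m'"
      by (simp add: field_simps)
    finally have eq: "integral {0..1} (\<lambda>x. w x * ?b x) / ?m = integral {0..1} (\<lambda>x. w x * ?b' x) / ?m'"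
      using z0 by simp
    have "\<bar>integral {0..1} (\<lambda>x. w x * ?b x) / ?m - w c\<bar> \<le> e/2"
      by (rule std_bump_average_close[OF wc]) (use r in auto)
    moreover have "\<bar>integral {0..1} (\<lambda>x. w x * ?b' x) / ?m' - w d\<bar> \<le> e/2"
      by (rule std_bump_average_close[OF wc]) (use s in auto)
    ultimately show ?thesis using eq by linarith
  qed
  have w_in: "w x = w (1/2)" if "x \<in> {0<..<1}" for x
  proof -
    have "\<bar>w x - w (1/2)\<bar> \<le> 0" by (rule field_le_epsilon) (rule const, use that in auto)
    then show ?thesis by simp
  qed
  have cl: "closure {0<..<1::real} = {0..1}" by simp
  have wc': "continuous_on (closure {0<..<1}) w" unfolding cl by (rule wc)
  have w_half: "w x = w (1/2)" if "x \<in> {0..1}" for x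
    by (rule continuous_constant_on_closure[OF wc' w_in]) (use that in \<open>simp_all only: cl\<close>)
  have w0: "w 0 = 0" by (simp add: w_def h)
  fix x :: real assume "x \<in> {0..1}"
  then show "h x = integral {0..x} g"
    using w_half[of x] w_half[of 0] w0 by (simp add: w_def)
qed

lemma H10_weak_deriv:
  assumes "h \<in> H10"
  shows "is_weak_deriv h (weak_deriv h)" "weak_deriv h \<in> L2_space"
    "integrable (lebesgue_on {0..1}) (weak_deriv h)"
    "integrable (lebesgue_on {0..1}) (\<lambda>x. (weak_deriv h x)\<^sup>2)"
proof -
  show 1: "is_weak_deriv h (weak_deriv h)"
    unfolding weak_deriv_def using assms unfolding H10_def by (auto intro: someI[of "is_weak_deriv h"])
  then show 2: "weak_deriv h \<in> L2_space" by (simp add: is_weak_deriv_def)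
  then show "integrable (lebesgue_on {0..1}) (weak_deriv h)" by (rule L2_space_integrable)
  show "integrable (lebesgue_on {0..1}) (\<lambda>x. (weak_deriv h x)\<^sup>2)" using 2 by (simp add: L2_space_def)
qed

text \<open>Here \<open>A\<close> may be nonzero at the ends. Writing \<open>h\<close> as the
  primitive of its weak derivative and swapping the integrals leaves the extra term
  \<open>A 1\<close> times the total integral of the weak derivative, and that integral is
  \<open>h 1 = 0\<close>.\<close>

lemma H10_integration_by_parts:
  assumes h: "h \<in> H10" and A: "\<And>x. x \<in> {0..1} \<Longrightarrow> (A has_real_derivative A' x) (at x within {0..1})"
    and A': "continuous_on {0..1} A'"
  shows "inner1 h A' = - inner1 (weak_deriv h) A"
proof -
  let ?L = "lebesgue_on {0..1::real}" and ?g = "weak_deriv h"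
  note wd = H10_weak_deriv[OF h]
  have hg: "h x = integral {0..x} ?g" if "x \<in> {0..1}" for x
    by (rule weak_deriv_primitive) (use h wd that in \<open>auto simp: H10_def\<close>)
  have int0: "(LINT x|?L. ?g x) = 0"
    using hg[of 1] h lebesgue_integral_eq_integral[OF wd(3)] by (simp add: H10_def)
  have Ac: "continuous_on {0..1} A"
    by (rule DERIV_continuous_on) (rule A)
  then have "bounded (A ` {0..1})" by (intro compact_imp_bounded compact_continuous_image) auto
  then obtain B where B: "\<forall>y\<in>A ` {0..1}. norm y \<le> B" unfolding bounded_pos by blast
  have Am: "A \<in> borel_measurable ?L" using continuous_imp_integrable_real[OF Ac] by auto
  have Ai: "integrable ?L (\<lambda>x. ?g x * A x)"
    by (rule integrable_mult_bounded[OF wd(3) Am, of B]) (rule AE_lebesgue_onI, use B in auto)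
  have "inner1 h A' = (LINT t|?L. A' t * integral {0..t} ?g)"
    unfolding inner1_def by (rule integral_lebesgue_on_cong) (use hg in auto)
  also have "\<dots> = (LINT s|?L. ?g s * integral {s..1} A')"
    by (rule integral_triangle_swap[OF wd(3) A']) simp
  also have "\<dots> = (LINT s|?L. A 1 * ?g s - ?g s * A s)"
  proof (rule integral_lebesgue_on_cong)
    fix s :: real assume s: "s \<in> {0..1}"
    have *: "integral {s..1} A' = A 1 - A s"
      by (rule integral_unique, rule fundamental_theorem_of_calculus)
         (use s A in \<open>auto simp: has_real_derivative_iff_has_vector_derivative[symmetric] intro: DERIV_subset[of _ _ _ "{0..1}"]\<close>)
    show "?g s * integral {s..1} A' = A 1 * ?g s - ?g s * A s" unfolding * by (simp add: algebra_simps)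
  qed
  also have "\<dots> = - inner1 ?g A"
    using wd(3) Ai int0 by (simp add: inner1_def)
  finally show ?thesis .
qed

text \<open>Test with the constant \<open>1\<close>. This is why an arbitrary constant may be
  subtracted from the drift when the square is completed.\<close>

lemma H10_weak_deriv_integral_0:
  assumes "h \<in> H10"
  shows "(LINT x|lebesgue_on {0..1}. weak_deriv h x) = 0"
proof -
  have "inner1 h (\<lambda>_. 0) = - inner1 (weak_deriv h) (\<lambda>_. 1)"
    by (rule H10_integration_by_parts[OF assms]) auto
  then show ?thesis by (simp add: inner1_def)
qed

section \<open>Fejer kernels on the unit interval\<close>

definition cosn :: "nat \<Rightarrow> real \<Rightarrow> real" where "cosn n x = cos (real n * pi * x)"
definition sinn :: "nat \<Rightarrow> real \<Rightarrow> real" where "sinn n x = sin (real n * pi * x)"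

definition fejer_coeff :: "nat \<Rightarrow> nat \<Rightarrow> real" where "fejer_coeff N n = 1 - real n / real N"

text \<open>Half the classical Fejer kernel at the angle \<open>pi * z\<close>, so that
  \<open>kerN\<close>, a sum of two copies, has total mass one on the unit interval.\<close>

definition fejer :: "nat \<Rightarrow> real \<Rightarrow> real" where
  "fejer N z = 1/2 + (\<Sum>n\<in>{1..<N}. fejer_coeff N n * cosn n z)"

text \<open>The Neumann and Dirichlet kernels are the even and odd \<open>2\<close>-periodic reflections of the Fejer
  kernel; the derivative of the Dirichlet mean of a function vanishing at the end points is the
  Neumann mean of its derivative.\<close>

definition kerN :: "nat \<Rightarrow> real \<Rightarrow> real \<Rightarrow> real" where
  "kerN N x y = 1 + 2 * (\<Sum>n\<in>{1..<N}. fejer_coeff N n * cosn n x * cosn n y)"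
definition kerD :: "nat \<Rightarrow> real \<Rightarrow> real \<Rightarrow> real" where
  "kerD N x y = 2 * (\<Sum>n\<in>{1..<N}. fejer_coeff N n * sinn n x * sinn n y)"

lemma cosn_0 [simp]: "cosn 0 = (\<lambda>_. 1)" by (simp add: cosn_def fun_eq_iff)

lemma cosn_le_1: "\<bar>cosn n x\<bar> \<le> 1" and sinn_le_1: "\<bar>sinn n x\<bar> \<le> 1"
  by (auto simp: cosn_def sinn_def)

lemma continuous_on_cosn [continuous_intros]: "continuous_on S (cosn n)"
  unfolding cosn_def by (intro continuous_intros)
lemma continuous_on_sinn [continuous_intros]: "continuous_on S (sinn n)"
  unfolding sinn_def by (intro continuous_intros)
lemma continuous_on_kerN: "continuous_on S (kerN N x)"
  unfolding kerN_def by (intro continuous_intros)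
lemma continuous_on_kerD: "continuous_on S (kerD N x)"
  unfolding kerD_def by (intro continuous_intros)

lemma sinn_ends [simp]: "sinn n 0 = 0" "sinn n 1 = 0"
  by (simp_all add: sinn_def)

lemma cosn_deriv: "(cosn n has_real_derivative - (real n * pi) * sinn n x) (at x within A)"
  unfolding cosn_def sinn_def by (auto intro!: derivative_eq_intros)
lemma sinn_deriv: "(sinn n has_real_derivative real n * pi * cosn n x) (at x within A)"
  unfolding cosn_def sinn_def by (auto intro!: derivative_eq_intros)

lemma fejer_coeff_bounds: "n \<in> {1..<N} \<Longrightarrow> 0 \<le> fejer_coeff N n \<and> fejer_coeff N n \<le> 1"
  by (auto simp: fejer_coeff_def)

lemma cosn_add: "cosn n (x + y) = cosn n x * cosn n y - sinn n x * sinn n y"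
  by (simp add: cosn_def sinn_def cos_add distrib_left)
lemma cosn_diff: "cosn n (x - y) = cosn n x * cosn n y + sinn n x * sinn n y"
  by (simp add: cosn_def sinn_def cos_diff right_diff_distrib)

lemma kerN_fejer: "kerN N x y = fejer N (x - y) + fejer N (x + y)"
  by (simp add: kerN_def fejer_def cosn_add cosn_diff sum.distrib sum_subtractf algebra_simps sum_distrib_left)
lemma kerD_fejer: "kerD N x y = fejer N (x - y) - fejer N (x + y)"
  by (simp add: kerD_def fejer_def cosn_add cosn_diff sum.distrib sum_subtractf algebra_simps sum_distrib_left)

text \<open>The left side is the squared modulus of the sum of \<open>exp (i k t)\<close> over
  \<open>k < N\<close>, which is what makes the Fejer kernel nonnegative. In the induction the new
  cross terms are the functions \<open>cos ((N - k) t)\<close>; after reversal of the summation they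
  add one cosine for each \<open>n\<close> from \<open>1\<close> to \<open>N\<close>.\<close>

lemma fejer_square:
  "(\<Sum>k<N. cos (real k * t))\<^sup>2 + (\<Sum>k<N. sin (real k * t))\<^sup>2
    = real N + 2 * (\<Sum>n\<in>{1..<N}. (real N - real n) * cos (real n * t))"
proof (induction N)
  case (Suc N)
  let ?A = "\<Sum>k<N. cos (real k * t)" and ?B = "\<Sum>k<N. sin (real k * t)"
  have "?A * cos (real N * t) + ?B * sin (real N * t) = (\<Sum>k<N. cos ((real N - real k) * t))"
    by (simp only: sum_distrib_right sum.distrib[symmetric] cos_diff left_diff_distrib) (simp add: algebra_simps)
  also have "\<dots> = (\<Sum>n\<in>{1..<Suc N}. cos (real n * t))"
    by (rule sum.reindex_bij_witness[of _ "\<lambda>n. N - n" "\<lambda>k. N - k"]) (auto simp: of_nat_diff)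
  finally have *: "?A * cos (real N * t) + ?B * sin (real N * t) = (\<Sum>n\<in>{1..<Suc N}. cos (real n * t))" .
  have "(\<Sum>k<Suc N. cos (real k * t))\<^sup>2 + (\<Sum>k<Suc N. sin (real k * t))\<^sup>2
      = (?A\<^sup>2 + ?B\<^sup>2) + 2 * (?A * cos (real N * t) + ?B * sin (real N * t))
        + ((sin (real N * t))\<^sup>2 + (cos (real N * t))\<^sup>2)"
    by (simp add: power2_sum algebra_simps)
  also have "\<dots> = real N + 2 * (\<Sum>n\<in>{1..<N}. (real N - real n) * cos (real n * t))
      + 2 * (\<Sum>n\<in>{1..<Suc N}. cos (real n * t)) + 1"
    unfolding Suc.IH * by simp
  also have "(\<Sum>n\<in>{1..<N}. (real N - real n) * cos (real n * t))
      = (\<Sum>n\<in>{1..<Suc N}. (real N - real n) * cos (real n * t))"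
    by (cases "N = 0") auto
  also have "real N + 2 * (\<Sum>n\<in>{1..<Suc N}. (real N - real n) * cos (real n * t))
      + 2 * (\<Sum>n\<in>{1..<Suc N}. cos (real n * t)) + 1
      = real (Suc N) + 2 * (\<Sum>n\<in>{1..<Suc N}. (real (Suc N) - real n) * cos (real n * t))"
    by (simp add: sum.distrib[symmetric] distrib_left[symmetric] algebra_simps del: sum.op_ivl_Suc)
  finally show ?case .
qed simp

lemma fejer_nonneg: "0 \<le> fejer N z"
proof (cases "N = 0")
  case False
  have a: "real N * (fejer_coeff N n * c) = (real N - real n) * c" for n c
    using False by (simp add: fejer_coeff_def field_simps)
  have "2 * real N * fejer N z
     = real N + 2 * (\<Sum>n\<in>{1..<N}. (real N - real n) * cos (real n * (pi * z)))"
  proof -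
    have "2 * real N * fejer N z = real N + 2 * (\<Sum>n\<in>{1..<N}. real N * (fejer_coeff N n * cosn n z))"
      by (simp add: fejer_def distrib_left sum_distrib_left mult.assoc)
    then show ?thesis unfolding a by (simp add: cosn_def mult.assoc)
  qed
  also have "\<dots> \<ge> 0" unfolding fejer_square[symmetric] by simp
  finally show ?thesis using False by (simp add: zero_le_mult_iff)
qed (simp add: fejer_def)

lemma kerN_nonneg: "0 \<le> kerN N x y"
  by (simp add: kerN_fejer fejer_nonneg)

text \<open>Both reflected Fejer kernels are nonnegative, and the modulus of a difference is at most
  the sum.\<close>

lemma kerD_le_kerN: "\<bar>kerD N x y\<bar> \<le> kerN N x y"
  using fejer_nonneg[of N "x - y"] fejer_nonneg[of N "x + y"] unfolding kerN_fejer kerD_fejer by linarith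

section \<open>Orthogonality of cosines and sines and their pairings with the kernels\<close>

lemma integral_cos_int:
  "(LINT x|lebesgue_on {0..1}. cos (of_int k * pi * x)) = (if k = 0 then 1 else 0)"
proof (cases "k = 0")
  case True
  then show ?thesis by (simp add: integral_lebesgue_on_const del: lebesgue_integral_const)
next
  case False
  have "(LINT x|lebesgue_on {0..1}. cos (of_int k * pi * x))
      = sin (of_int k * pi * 1) / (of_int k * pi) - sin (of_int k * pi * 0) / (of_int k * pi)"
    by (rule FTC_lebesgue_on)
       (use False in \<open>auto intro!: continuous_intros derivative_eq_intros\<close>)
  moreover have "sin (of_int k * pi) = 0" by (simp add: sin_times_pi_eq_0)
  ultimately show ?thesis using False by simp
qed

lemma inner1_integrable:
  fixes f \<phi> :: "real \<Rightarrow> real"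
  assumes "integrable (lebesgue_on {0..1}) f" "continuous_on {0..1} \<phi>"
  shows "integrable (lebesgue_on {0..1}) (\<lambda>x. f x * \<phi> x)"
proof -
  have "bounded (\<phi> ` {0..1})" using assms(2) by (intro compact_imp_bounded compact_continuous_image) auto
  then obtain B where "\<forall>y\<in>\<phi> ` {0..1}. norm y \<le> B" unfolding bounded_pos by blast
  then show ?thesis
    using continuous_imp_integrable_real[OF assms(2)]
    by (intro integrable_mult_bounded[where B=B] assms AE_lebesgue_onI) auto
qed

lemma inner1_sum:
  assumes "integrable (lebesgue_on {0..1}) f" "\<And>n. n \<in> A \<Longrightarrow> continuous_on {0..1} (\<phi> n)"
  shows "inner1 f (\<lambda>x. \<Sum>n\<in>A. c n * \<phi> n x) = (\<Sum>n\<in>A. c n * inner1 f (\<phi> n))"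
proof -
  have "inner1 f (\<lambda>x. \<Sum>n\<in>A. c n * \<phi> n x) = (LINT x|lebesgue_on {0..1}. (\<Sum>n\<in>A. c n * (f x * \<phi> n x)))"
    unfolding inner1_def by (simp add: sum_distrib_left algebra_simps)
  also have "\<dots> = (\<Sum>n\<in>A. (LINT x|lebesgue_on {0..1}. c n * (f x * \<phi> n x)))"
    by (rule Bochner_Integration.integral_sum) (use inner1_integrable[OF assms(1) assms(2)] in auto)
  finally show ?thesis by (simp add: inner1_def)
qed

lemma inner1_add_right:
  assumes "integrable (lebesgue_on {0..1}) f" "continuous_on {0..1} \<phi>" "continuous_on {0..1} \<psi>"
  shows "inner1 f (\<lambda>x. \<phi> x + \<psi> x) = inner1 f \<phi> + inner1 f \<psi>"
  unfolding inner1_def using inner1_integrable[OF assms(1,2)] inner1_integrable[OF assms(1,3)]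
  by (simp add: distrib_left)

lemma inner1_diff_right:
  assumes "integrable (lebesgue_on {0..1}) f" "continuous_on {0..1} \<phi>" "continuous_on {0..1} \<psi>"
  shows "inner1 f (\<lambda>x. \<phi> x - \<psi> x) = inner1 f \<phi> - inner1 f \<psi>"
  unfolding inner1_def using inner1_integrable[OF assms(1,2)] inner1_integrable[OF assms(1,3)]
  by (simp add: right_diff_distrib)

lemma inner1_diff_left:
  assumes "integrable (lebesgue_on {0..1}) f" "integrable (lebesgue_on {0..1}) g" "continuous_on {0..1} \<phi>"
  shows "inner1 (\<lambda>x. f x - g x) \<phi> = inner1 f \<phi> - inner1 g \<phi>"
  unfolding inner1_def using inner1_integrable[OF assms(1,3)] inner1_integrable[OF assms(2,3)]
  by (simp add: left_diff_distrib)

lemma inner1_cmult_right: "inner1 f (\<lambda>x. c * \<phi> x) = c * inner1 f \<phi>"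
  unfolding inner1_def by (simp add: mult.left_commute)

lemma inner1_cmult_left: "inner1 (\<lambda>x. c * f x) \<phi> = c * inner1 f \<phi>"
  unfolding inner1_def by (simp add: mult.assoc)

lemma inner1_add_left:
  assumes "integrable (lebesgue_on {0..1}) f" "integrable (lebesgue_on {0..1}) g" "continuous_on {0..1} \<phi>"
  shows "inner1 (\<lambda>x. f x + g x) \<phi> = inner1 f \<phi> + inner1 g \<phi>"
  unfolding inner1_def using inner1_integrable[OF assms(1,3)] inner1_integrable[OF assms(2,3)]
  by (simp add: distrib_right)

lemma inner1_commute: "inner1 f g = inner1 g f"
  unfolding inner1_def by (simp add: mult.commute)

lemma inner1_cong:
  assumes "\<And>x. x \<in> {0..1} \<Longrightarrow> f x = f' x" "\<And>x. x \<in> {0..1} \<Longrightarrow> g x = g' x"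
  shows "inner1 f g = inner1 f' g'"
  unfolding inner1_def by (rule integral_lebesgue_on_cong) (use assms in auto)

lemma inner1_cosn_cosn:
  "inner1 (cosn n) (cosn m) = (if n = m then (if n = 0 then 1 else 1/2) else 0)"
proof -
  have "inner1 (cosn n) (cosn m) = (LINT x|lebesgue_on {0..1}.
      1/2 * cos (of_int (int n - int m) * pi * x) + 1/2 * cos (of_int (int n + int m) * pi * x))"
    unfolding inner1_def
    by (rule integral_lebesgue_on_cong) (simp add: cosn_def cos_add cos_diff left_diff_distrib distrib_right field_simps)
  also have "\<dots> = 1/2 * (if n = m then 1 else 0) + 1/2 * (if n = 0 \<and> m = 0 then 1 else 0)"
    by (subst Bochner_Integration.integral_add)
       (auto intro!: continuous_imp_integrable_real continuous_intros
         simp: integral_cos_int simp del: of_int_diff of_int_add of_int_of_nat_eq)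
  finally show ?thesis by auto
qed

lemma inner1_sinn_sinn:
  "inner1 (sinn n) (sinn m) = (if n = m \<and> n \<noteq> 0 then 1/2 else 0)"
proof -
  have "inner1 (sinn n) (sinn m) = (LINT x|lebesgue_on {0..1}.
      1/2 * cos (of_int (int n - int m) * pi * x) - 1/2 * cos (of_int (int n + int m) * pi * x))"
    unfolding inner1_def
    by (rule integral_lebesgue_on_cong) (simp add: sinn_def cos_add cos_diff left_diff_distrib distrib_right field_simps)
  also have "\<dots> = 1/2 * (if n = m then 1 else 0) - 1/2 * (if n = 0 \<and> m = 0 then 1 else 0)"
    by (subst Bochner_Integration.integral_diff)
       (auto intro!: continuous_imp_integrable_real continuous_intros
         simp: integral_cos_int simp del: of_int_diff of_int_add of_int_of_nat_eq)
  finally show ?thesis by auto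
qed

lemma inner1_kerN:
  assumes "integrable (lebesgue_on {0..1}) f"
  shows "inner1 f (kerN N x) = inner1 f (\<lambda>_. 1) + (\<Sum>n\<in>{1..<N}. 2 * fejer_coeff N n * cosn n x * inner1 f (cosn n))"
proof -
  have "kerN N x = (\<lambda>y. 1 + (\<Sum>n\<in>{1..<N}. (2 * fejer_coeff N n * cosn n x) * cosn n y))"
    by (simp add: kerN_def fun_eq_iff sum_distrib_left algebra_simps)
  then show ?thesis
    using assms by (simp add: inner1_add_right inner1_sum continuous_intros)
qed

lemma inner1_kerD:
  assumes "integrable (lebesgue_on {0..1}) f"
  shows "inner1 f (kerD N x) = (\<Sum>n\<in>{1..<N}. 2 * fejer_coeff N n * sinn n x * inner1 f (sinn n))"
proof -
  have "kerD N x = (\<lambda>y. (\<Sum>n\<in>{1..<N}. (2 * fejer_coeff N n * sinn n x) * sinn n y))"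
    by (simp add: kerD_def fun_eq_iff sum_distrib_left algebra_simps)
  then show ?thesis
    using assms by (simp add: inner1_sum continuous_intros)
qed

lemma continuous_on_inner1_kerN:
  assumes "integrable (lebesgue_on {0..1}) f"
  shows "continuous_on S (\<lambda>x. inner1 f (kerN N x))"
  unfolding inner1_kerN[OF assms] by (intro continuous_intros)

lemma continuous_on_inner1_kerD:
  assumes "integrable (lebesgue_on {0..1}) f"
  shows "continuous_on S (\<lambda>x. inner1 f (kerD N x))"
  unfolding inner1_kerD[OF assms] by (intro continuous_intros)

lemma integrable_const01 [simp]: "integrable (lebesgue_on {0..1::real}) (\<lambda>_. c::real)"
  by (intro continuous_imp_integrable_real continuous_intros)

lemma integrable_cosn [simp]: "integrable (lebesgue_on {0..1}) (cosn n)"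
  and integrable_sinn [simp]: "integrable (lebesgue_on {0..1}) (sinn n)"
  by (intro continuous_imp_integrable_real continuous_intros)+

lemma kerN_cosn:
  assumes "m < N"
  shows "inner1 (cosn m) (kerN N x) = fejer_coeff N m * cosn m x"
proof (cases "m = 0")
  case True
  have "inner1 (cosn m) (\<lambda>_. 1) = 1" using True inner1_cosn_cosn[of 0 0] by simp
  moreover have "(\<Sum>n\<in>{1..<N}. 2 * fejer_coeff N n * cosn n x * inner1 (cosn m) (cosn n)) = 0"
    unfolding inner1_cosn_cosn using True by (intro sum.neutral) auto
  ultimately show ?thesis using True
    by (subst inner1_kerN) (auto simp: fejer_coeff_def)
next
  case False
  have "inner1 (cosn m) (\<lambda>_. 1) = 0" using False inner1_cosn_cosn[of m 0] by simp
  moreover have "(\<Sum>n\<in>{1..<N}. 2 * fejer_coeff N n * cosn n x * inner1 (cosn m) (cosn n))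
     = (\<Sum>n\<in>{1..<N}. if n = m then fejer_coeff N m * cosn m x else 0)"
    unfolding inner1_cosn_cosn using False by (intro sum.cong) auto
  ultimately show ?thesis using False assms
    by (subst inner1_kerN) auto
qed

section \<open>Moments of the Neumann kernel and uniform convergence of its means\<close>

lemma kerN_one: "inner1 (\<lambda>_. 1) (kerN N x) = 1"
proof -
  have "inner1 (\<lambda>_. 1) (cosn n) = 0" if "n \<in> {1..<N}" for n
    using inner1_cosn_cosn[of 0 n] that by simp
  moreover have "inner1 (\<lambda>_. 1) (\<lambda>_. 1) = 1" using inner1_cosn_cosn[of 0 0] by simp
  ultimately show ?thesis by (subst inner1_kerN) auto
qed

lemma integral_kerN: "(LINT y|lebesgue_on {0..1}. kerN N x y) = 1"
  using kerN_one[of N x] by (simp add: inner1_def)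

text \<open>Korovkin's test function involves only the frequencies \<open>0\<close>,
  \<open>1\<close> and \<open>2\<close>, which the kernel damps by \<open>1\<close>,
  \<open>1 - 1/N\<close> and \<open>1 - 2/N\<close>. The condition \<open>3 \<le> N\<close> puts all
  of them in range, and the terms of order one cancel.\<close>

lemma kerN_second_moment:
  assumes "3 \<le> N"
  shows "inner1 (\<lambda>y. (cosn 1 x - cosn 1 y)\<^sup>2) (kerN N x) = 1 / real N"
proof -
  have sq: "(cosn 1 y)\<^sup>2 = 1/2 + 1/2 * cosn 2 y" for y
    using cos_double_cos[of "pi * y"] by (simp add: cosn_def mult.assoc field_simps)
  have "inner1 (\<lambda>y. (cosn 1 x - cosn 1 y)\<^sup>2) (kerN N x)
     = inner1 (kerN N x) (\<lambda>y. \<Sum>m\<in>{0,1,2::nat}. (if m = 0 then (cosn 1 x)\<^sup>2 + 1/2 else if m = 1 then - 2 * cosn 1 x else 1/2) * cosn m y)"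
    unfolding inner1_commute[of _ "kerN N x"]
    by (rule inner1_cong) (auto simp: power2_diff sq algebra_simps simp del: One_nat_def)
  also have "\<dots> = (\<Sum>m\<in>{0,1,2::nat}. (if m = 0 then (cosn 1 x)\<^sup>2 + 1/2 else if m = 1 then - 2 * cosn 1 x else 1/2) * inner1 (kerN N x) (cosn m))"
    by (intro inner1_sum continuous_imp_integrable_real continuous_on_kerN continuous_intros)
  also have "\<dots> = (\<Sum>m\<in>{0,1,2::nat}. (if m = 0 then (cosn 1 x)\<^sup>2 + 1/2 else if m = 1 then - 2 * cosn 1 x else 1/2) * (fejer_coeff N m * cosn m x))"
    by (intro sum.cong refl arg_cong2[where f="(*)"]) (use assms in \<open>auto simp: inner1_commute[of "kerN N x"] kerN_cosn simp del: cosn_0\<close>)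
  also have "\<dots> = 1 / real N"
    using assms sq[of x] by (simp add: fejer_coeff_def power2_eq_square field_simps)
  finally show ?thesis .
qed

text \<open>Near the diagonal uniform continuity gives \<open>e\<close>. Away from it compactness
  bounds the cosine difference from below, since \<open>cos\<close> is injective on
  \<open>{0..pi}\<close>, and the quadratic term dominates the total oscillation
  \<open>2 * B\<close>.\<close>

lemma cos_modulus:
  fixes \<phi> :: "real \<Rightarrow> real"
  assumes \<phi>: "continuous_on {0..1} \<phi>" and e: "0 < e"
  obtains K where "K \<ge> 0" "\<And>x y. x \<in> {0..1} \<Longrightarrow> y \<in> {0..1} \<Longrightarrow> \<bar>\<phi> y - \<phi> x\<bar> \<le> e + K * (cosn 1 x - cosn 1 y)\<^sup>2"
proof -
  have "uniformly_continuous_on {0..1} \<phi>" by (rule compact_uniformly_continuous[OF \<phi>]) simp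
  then obtain d where d: "d > 0" "\<And>x y. x \<in> {0..1} \<Longrightarrow> y \<in> {0..1} \<Longrightarrow> dist y x < d \<Longrightarrow> dist (\<phi> y) (\<phi> x) < e"
    using e unfolding uniformly_continuous_on_def by metis
  have "bounded (\<phi> ` {0..1})" using \<phi> by (intro compact_imp_bounded compact_continuous_image) auto
  then obtain B where B: "B > 0" "\<forall>y\<in>\<phi> ` {0..1}. norm y \<le> B" unfolding bounded_pos by blast
  define S where "S = ({0..1} \<times> {0..1}) \<inter> {p::real\<times>real. d \<le> \<bar>snd p - fst p\<bar>}"
  have "closed {p::real\<times>real. d \<le> \<bar>snd p - fst p\<bar>}"
    by (intro closed_Collect_le continuous_intros)
  then have S: "compact S" unfolding S_def by (intro compact_Int_closed compact_Times) auto
  have "\<exists>m>0. \<forall>p\<in>S. m \<le> (cosn 1 (fst p) - cosn 1 (snd p))\<^sup>2"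
  proof (cases "S = {}")
    case False
    have "continuous_on S (\<lambda>p. (cosn 1 (fst p) - cosn 1 (snd p))\<^sup>2)"
      unfolding cosn_def by (intro continuous_intros)
    then obtain p where p: "p \<in> S" "\<forall>q\<in>S. (cosn 1 (fst p) - cosn 1 (snd p))\<^sup>2 \<le> (cosn 1 (fst q) - cosn 1 (snd q))\<^sup>2"
      using continuous_attains_inf[OF S False] by blast
    have "fst p \<noteq> snd p" using p(1) d by (auto simp: S_def)
    then have "cosn 1 (fst p) \<noteq> cosn 1 (snd p)"
      using p(1) cos_inj_pi[of "pi * fst p" "pi * snd p"] by (auto simp: S_def cosn_def)
    then show ?thesis using p(2) by (intro exI[of _ "(cosn 1 (fst p) - cosn 1 (snd p))\<^sup>2"]) auto
  qed (auto intro: exI[of _ 1])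
  then obtain m where m: "m > 0" "\<And>p. p \<in> S \<Longrightarrow> m \<le> (cosn 1 (fst p) - cosn 1 (snd p))\<^sup>2" by blast
  show ?thesis
  proof (rule that[of "2 * B / m"])
    fix x y :: real assume xy: "x \<in> {0..1}" "y \<in> {0..1}"
    show "\<bar>\<phi> y - \<phi> x\<bar> \<le> e + 2 * B / m * (cosn 1 x - cosn 1 y)\<^sup>2"
    proof (cases "\<bar>y - x\<bar> < d")
      case True
      then have "\<bar>\<phi> y - \<phi> x\<bar> < e" using d(2)[OF xy] by (simp add: dist_real_def)
      moreover have "0 \<le> 2 * B / m * (cosn 1 x - cosn 1 y)\<^sup>2" using B m by simp
      ultimately show ?thesis by linarith
    next
      case False
      then have "m \<le> (cosn 1 x - cosn 1 y)\<^sup>2" using m(2)[of "(x,y)"] xy by (auto simp: S_def)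
      then have "2 * B / m * m \<le> 2 * B / m * (cosn 1 x - cosn 1 y)\<^sup>2"
        using B m by (intro mult_left_mono) auto
      moreover have "\<bar>\<phi> x\<bar> \<le> B" "\<bar>\<phi> y\<bar> \<le> B" using B(2) xy by auto
      then have "\<bar>\<phi> y - \<phi> x\<bar> \<le> 2 * B" by linarith
      ultimately show ?thesis using m e by simp
    qed
  qed (use B m in auto)
qed

lemma inner1_kerN_le:
  assumes "continuous_on {0..1} \<phi>" "continuous_on {0..1} \<psi>" "\<And>y. y \<in> {0..1} \<Longrightarrow> \<phi> y \<le> \<psi> y"
  shows "inner1 \<phi> (kerN N x) \<le> inner1 \<psi> (kerN N x)"
  unfolding inner1_def
  by (rule integral_lebesgue_on_mono)
     (use assms in \<open>auto intro!: continuous_imp_integrable_real continuous_intros continuous_on_kerN mult_right_mono kerN_nonneg\<close>)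

text \<open>Korovkin's argument: averaging the bound of \<open>cos_modulus\<close> against the
  kernel costs \<open>K\<close> times the second moment, that is \<open>K / N\<close>, uniformly in
  \<open>x\<close>.\<close>

lemma kerN_uniform:
  fixes \<phi> :: "real \<Rightarrow> real"
  assumes \<phi>: "continuous_on {0..1} \<phi>" and e: "0 < e"
  shows "\<forall>\<^sub>F N in sequentially. \<forall>x\<in>{0..1}. \<bar>inner1 \<phi> (kerN N x) - \<phi> x\<bar> \<le> e"
proof -
  obtain K where K: "K \<ge> 0"
    "\<And>x y. x \<in> {0..1} \<Longrightarrow> y \<in> {0..1} \<Longrightarrow> \<bar>\<phi> y - \<phi> x\<bar> \<le> e/2 + K * (cosn 1 x - cosn 1 y)\<^sup>2"
    using cos_modulus[OF \<phi>, of "e/2"] e by auto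
  have "(\<lambda>N. K / real N) \<longlonglongrightarrow> 0" by (rule lim_const_over_n)
  then have "\<forall>\<^sub>F N in sequentially. K / real N < e/2" by (rule order_tendstoD) (use e in simp)
  then show ?thesis
    using eventually_ge_at_top[of 3]
  proof eventually_elim
    case (elim N)
    show ?case
    proof
      fix x :: real assume x: "x \<in> {0..1}"
      have cc: "continuous_on {0..1} (\<lambda>y. e/2 + K * (cosn 1 x - cosn 1 y)\<^sup>2)" by (intro continuous_intros)
      have c2: "continuous_on {0..1} (\<lambda>y. (cosn 1 x - cosn 1 y)\<^sup>2)" by (intro continuous_intros)
      let ?k = "kerN N x"
      have ki: "integrable (lebesgue_on {0..1}) ?k" by (intro continuous_imp_integrable_real continuous_on_kerN)
      have "inner1 (\<lambda>y. e/2 + K * (cosn 1 x - cosn 1 y)\<^sup>2) ?k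
          = inner1 (\<lambda>y. e/2 * 1) ?k + inner1 (\<lambda>y. K * (cosn 1 x - cosn 1 y)\<^sup>2) ?k"
        using inner1_add_left[of "\<lambda>y. e/2 * 1" "\<lambda>y. K * (cosn 1 x - cosn 1 y)\<^sup>2" ?k]
        by (simp add: continuous_imp_integrable_real continuous_intros continuous_on_kerN)
      also have "\<dots> = e/2 * inner1 (\<lambda>_. 1) ?k + K * inner1 (\<lambda>y. (cosn 1 x - cosn 1 y)\<^sup>2) ?k"
        by (simp only: inner1_cmult_left)
      finally have "inner1 (\<lambda>y. e/2 + K * (cosn 1 x - cosn 1 y)\<^sup>2) ?k = \<dots>" .
      then have b: "inner1 (\<lambda>y. e/2 + K * (cosn 1 x - cosn 1 y)\<^sup>2) ?k \<le> e"
        using elim kerN_one[of N x] kerN_second_moment[of N x] by simp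
      have "inner1 (\<lambda>y. \<phi> y - \<phi> x) ?k = inner1 \<phi> ?k - \<phi> x * inner1 (\<lambda>_. 1) ?k"
        using inner1_diff_left[OF continuous_imp_integrable_real[OF \<phi>] integrable_const01[of "\<phi> x"] continuous_on_kerN[of _ N x]]
          inner1_cmult_right[of ?k "\<phi> x" "\<lambda>_. 1"]
        by (simp add: inner1_commute[of _ ?k])
      then have eq: "inner1 (\<lambda>y. \<phi> y - \<phi> x) ?k = inner1 \<phi> ?k - \<phi> x" by (simp add: kerN_one)
      have dc: "continuous_on {0..1} (\<lambda>y. \<phi> y - \<phi> x)" by (intro continuous_intros \<phi>)
      have up: "inner1 (\<lambda>y. \<phi> y - \<phi> x) ?k \<le> inner1 (\<lambda>y. e/2 + K * (cosn 1 x - cosn 1 y)\<^sup>2) ?k"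
        by (rule inner1_kerN_le[OF dc cc]) (use K(2)[OF x] in fastforce)
      have "inner1 (\<lambda>y. - (\<phi> y - \<phi> x)) ?k \<le> inner1 (\<lambda>y. e/2 + K * (cosn 1 x - cosn 1 y)\<^sup>2) ?k"
        by (rule inner1_kerN_le[OF _ cc]) (use K(2)[OF x] dc in \<open>fastforce intro: continuous_intros\<close>)+
      moreover have "inner1 (\<lambda>y. - (\<phi> y - \<phi> x)) ?k = - inner1 (\<lambda>y. \<phi> y - \<phi> x) ?k"
        unfolding inner1_def Bochner_Integration.integral_minus[symmetric] by (simp add: algebra_simps)
      ultimately show "\<bar>inner1 \<phi> (kerN N x) - \<phi> x\<bar> \<le> e" using up eq b by linarith
    qed
  qed
qed

section \<open>The corner kernel and convergence of the Dirichlet means\<close>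

lemma sinn_1_nonneg: "x \<in> {0..1} \<Longrightarrow> 0 \<le> sinn 1 x"
  by (auto simp: sinn_def intro!: sin_ge_zero)

lemma kerD_sinn:
  assumes "m < N" "0 < m"
  shows "inner1 (sinn m) (kerD N x) = fejer_coeff N m * sinn m x"
proof -
  have "(\<Sum>n\<in>{1..<N}. 2 * fejer_coeff N n * sinn n x * inner1 (sinn m) (sinn n))
     = (\<Sum>n\<in>{1..<N}. if n = m then fejer_coeff N m * sinn m x else 0)"
    unfolding inner1_sinn_sinn using assms by (intro sum.cong) auto
  then show ?thesis using assms by (subst inner1_kerD) auto
qed

text \<open>\<open>sinn 1\<close> is an eigenfunction of the Dirichlet mean with eigenvalue
  \<open>1 - 1/N\<close>, and its Neumann mean converges uniformly. This single function then
  controls every continuous function that vanishes at both ends.\<close>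

lemma corner_sinn:
  assumes e: "0 < e"
  shows "\<forall>\<^sub>F N in sequentially. \<forall>x\<in>{0..1}. inner1 (sinn 1) (\<lambda>y. kerN N x y - kerD N x y) \<le> e"
proof -
  have "(\<lambda>N. 1 / real N) \<longlonglongrightarrow> 0" by (rule lim_const_over_n)
  then have "\<forall>\<^sub>F N in sequentially. 1 / real N < e/2" by (rule order_tendstoD) (use e in simp)
  moreover have "\<forall>\<^sub>F N in sequentially. \<forall>x\<in>{0..1}. \<bar>inner1 (sinn 1) (kerN N x) - sinn 1 x\<bar> \<le> e/2"
    by (rule kerN_uniform) (use e in \<open>auto intro: continuous_intros\<close>)
  ultimately show ?thesis using eventually_ge_at_top[of 2]
  proof eventually_elim
    case (elim N)
    show ?case
    proof
      fix x :: real assume x: "x \<in> {0..1}"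
      have "inner1 (sinn 1) (\<lambda>y. kerN N x y - kerD N x y) = inner1 (sinn 1) (kerN N x) - fejer_coeff N 1 * sinn 1 x"
        using elim kerD_sinn[of 1 N x]
        by (subst inner1_diff_right) (auto intro: continuous_on_kerN continuous_on_kerD)
      also have "\<dots> = inner1 (sinn 1) (kerN N x) - sinn 1 x + sinn 1 x * (1 / real N)"
        by (simp add: fejer_coeff_def algebra_simps)
      also have "\<dots> \<le> e/2 + 1 * (e/2)"
      proof (intro add_mono mult_mono)
        have "\<bar>inner1 (sinn 1) (kerN N x) - sinn 1 x\<bar> \<le> e/2" using elim x by blast
        then show "inner1 (sinn 1) (kerN N x) - sinn 1 x \<le> e/2" by linarith
        show "sinn 1 x \<le> 1" using sinn_le_1[of 1 x] by linarith
        show "1 / real N \<le> e/2" using elim by linarith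
      qed auto
      finally show "inner1 (sinn 1) (\<lambda>y. kerN N x y - kerD N x y) \<le> e" by simp
    qed
  qed
qed

text \<open>The corner kernel \<open>kerN - kerD\<close> annihilates, in the limit, functions vanishing at the end points.\<close>

lemma corner_bound:
  fixes K \<delta> :: real
  assumes \<phi>: "integrable (lebesgue_on {0..1}) \<phi>"
    and b: "\<And>y. y \<in> {0..1} \<Longrightarrow> \<bar>\<phi> y\<bar> \<le> \<delta> + K * sinn 1 y" and \<delta>: "\<delta> \<ge> 0"
    and corner: "inner1 (sinn 1) (\<lambda>y. kerN N x y - kerD N x y) \<le> e" and K: "K \<ge> 0"
  shows "\<bar>inner1 \<phi> (\<lambda>y. kerN N x y - kerD N x y)\<bar> \<le> 2 * \<delta> + K * e"
proof -
  let ?k = "\<lambda>y. kerN N x y - kerD N x y"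
  have k: "0 \<le> ?k y" "?k y \<le> 2 * kerN N x y" for y
    using kerD_le_kerN[of N x y] by linarith+
  have kc: "continuous_on {0..1} ?k" by (intro continuous_intros continuous_on_kerN continuous_on_kerD)
  have i1: "integrable (lebesgue_on {0..1}) (\<lambda>y. \<phi> y * ?k y)" by (rule inner1_integrable[OF \<phi> kc])
  have i2: "integrable (lebesgue_on {0..1}) (\<lambda>y. 2 * \<delta> * kerN N x y)"
    by (intro continuous_imp_integrable_real continuous_intros continuous_on_kerN)
  have i3: "integrable (lebesgue_on {0..1}) (\<lambda>y. K * (sinn 1 y * ?k y))"
    by (intro continuous_imp_integrable_real continuous_intros continuous_on_kerN continuous_on_kerD)
  have "norm (inner1 \<phi> ?k) \<le> (LINT y|lebesgue_on {0..1}. norm (\<phi> y * ?k y))"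
    unfolding inner1_def by (rule integral_norm_bound)
  also have "\<dots> \<le> (LINT y|lebesgue_on {0..1}. 2 * \<delta> * kerN N x y + K * (sinn 1 y * ?k y))"
  proof (rule integral_lebesgue_on_mono)
    fix y :: real assume y: "y \<in> {0..1}"
    have "\<bar>\<phi> y\<bar> * ?k y \<le> (\<delta> + K * sinn 1 y) * ?k y" by (intro mult_right_mono b y k)
    also have "\<dots> \<le> 2 * \<delta> * kerN N x y + K * (sinn 1 y * ?k y)"
      using mult_left_mono[OF k(2)[of y] \<delta>] by (simp add: algebra_simps)
    finally show "norm (\<phi> y * ?k y) \<le> 2 * \<delta> * kerN N x y + K * (sinn 1 y * ?k y)"
      using k(1)[of y] by (simp add: abs_mult)
  qed (use i1 i2 i3 in auto)
  also have "\<dots> = 2 * \<delta> * (LINT y|lebesgue_on {0..1}. kerN N x y) + K * inner1 (sinn 1) ?k"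
    using i2 i3 by (simp add: inner1_def)
  also have "\<dots> \<le> 2 * \<delta> + K * e" using mult_left_mono[OF corner K] by (simp add: integral_kerN)
  finally show ?thesis by simp
qed

text \<open>Applying \<open>cos_modulus\<close> at the end points, where \<open>\<phi>\<close>
  vanishes, bounds it by the smaller of \<open>(1 - c)\<^sup>2\<close> and
  \<open>(1 + c)\<^sup>2\<close> with \<open>c = cos (pi y)\<close>. This is at most
  \<open>sin (pi y)\<close>: for \<open>t = 1 - |c|\<close> the squared sine is
  \<open>t (2 - t) \<ge> t\<^sup>2\<close>.\<close>

lemma vanishing_modulus:
  fixes \<phi> :: "real \<Rightarrow> real"
  assumes \<phi>: "continuous_on {0..1} \<phi>" "\<phi> 0 = 0" "\<phi> 1 = 0" and e: "0 < e"
  obtains K where "K \<ge> 0" "\<And>y. y \<in> {0..1} \<Longrightarrow> \<bar>\<phi> y\<bar> \<le> e + K * sinn 1 y"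
proof -
  obtain K where K: "K \<ge> 0"
    "\<And>x y. x \<in> {0..1} \<Longrightarrow> y \<in> {0..1} \<Longrightarrow> \<bar>\<phi> y - \<phi> x\<bar> \<le> e + K * (cosn 1 x - cosn 1 y)\<^sup>2"
    using cos_modulus[OF \<phi>(1) e] by auto
  have b: "\<bar>\<phi> y\<bar> \<le> e + K * sinn 1 y" if y: "y \<in> {0..1}" for y
  proof -
    have c: "\<bar>cosn 1 y\<bar> \<le> 1" by (rule cosn_le_1)
    have s: "0 \<le> sinn 1 y" by (rule sinn_1_nonneg[OF y])
    have sq: "(sinn 1 y)\<^sup>2 = 1 - (cosn 1 y)\<^sup>2" by (simp add: sinn_def cosn_def sin_squared_eq)
    have ends: "cosn 1 0 = 1" "cosn 1 1 = - 1" by (auto simp: cosn_def)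
    have "min ((1 - cosn 1 y)\<^sup>2) ((- 1 - cosn 1 y)\<^sup>2) \<le> sinn 1 y"
    proof -
      define t where "t = 1 - \<bar>cosn 1 y\<bar>"
      have t: "0 \<le> t" "t \<le> 1" using c by (auto simp: t_def)
      have "(sinn 1 y)\<^sup>2 = t * (2 - t)"
      proof -
        have "(cosn 1 y)\<^sup>2 = (1 - t)\<^sup>2" by (simp add: t_def)
        then show ?thesis using sq by (simp add: power2_eq_square algebra_simps)
      qed
      moreover have "t * (2 - t) \<ge> t * t" using t by (intro mult_left_mono) auto
      ultimately have "t\<^sup>2 \<le> (sinn 1 y)\<^sup>2" by (simp add: power2_eq_square)
      then have "t \<le> sinn 1 y" using s by (rule power2_le_imp_le)
      moreover have "t\<^sup>2 \<le> t" using t by (simp add: power2_eq_square mult_left_le)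
      moreover have "min ((1 - cosn 1 y)\<^sup>2) ((- 1 - cosn 1 y)\<^sup>2) \<le> t\<^sup>2"
      proof (cases "cosn 1 y \<ge> 0")
        case True then have "(1 - cosn 1 y)\<^sup>2 = t\<^sup>2" by (simp add: t_def)
        then show ?thesis by simp
      next
        case False then have "(- 1 - cosn 1 y)\<^sup>2 = t\<^sup>2" by (simp add: t_def power2_eq_square algebra_simps)
        then show ?thesis by simp
      qed
      ultimately show ?thesis by linarith
    qed
    then have "(1 - cosn 1 y)\<^sup>2 \<le> sinn 1 y \<or> (- 1 - cosn 1 y)\<^sup>2 \<le> sinn 1 y" by linarith
    then show ?thesis
    proof
      assume "(1 - cosn 1 y)\<^sup>2 \<le> sinn 1 y"
      then have "K * (1 - cosn 1 y)\<^sup>2 \<le> K * sinn 1 y" using K(1) by (rule mult_left_mono)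
      then show ?thesis using K(2)[of 0 y] y \<phi> ends by auto
    next
      assume "(- 1 - cosn 1 y)\<^sup>2 \<le> sinn 1 y"
      then have "K * (- 1 - cosn 1 y)\<^sup>2 \<le> K * sinn 1 y" using K(1) by (rule mult_left_mono)
      then show ?thesis using K(2)[of 1 y] y \<phi> ends by auto
    qed
  qed
  with K(1) show ?thesis by (rule that)
qed

text \<open>The Dirichlet mean is the Neumann mean minus the corner term, which
  \<open>corner_bound\<close> makes small for functions vanishing at both ends.\<close>

lemma kerD_uniform:
  fixes \<phi> :: "real \<Rightarrow> real"
  assumes \<phi>: "continuous_on {0..1} \<phi>" "\<phi> 0 = 0" "\<phi> 1 = 0" and e: "0 < e"
  shows "\<forall>\<^sub>F N in sequentially. \<forall>x\<in>{0..1}. \<bar>inner1 \<phi> (kerD N x) - \<phi> x\<bar> \<le> e"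
proof -
  obtain K where K: "K \<ge> 0" and b: "\<And>y. y \<in> {0..1} \<Longrightarrow> \<bar>\<phi> y\<bar> \<le> e/8 + K * sinn 1 y"
    using vanishing_modulus[OF \<phi>, of "e/8"] e by auto
  have "e / (4 * (K + 1)) > 0" using e K by simp
  from kerN_uniform[OF \<phi>(1), of "e/2"] e corner_sinn[OF this]
  have "\<forall>\<^sub>F N in sequentially. (\<forall>x\<in>{0..1}. \<bar>inner1 \<phi> (kerN N x) - \<phi> x\<bar> \<le> e/2) \<and>
     (\<forall>x\<in>{0..1}. inner1 (sinn 1) (\<lambda>y. kerN N x y - kerD N x y) \<le> e / (4 * (K + 1)))"
    by (auto intro: eventually_conj)
  then show ?thesis
  proof eventually_elim
    case (elim N)
    show ?case
    proof
      fix x :: real assume x: "x \<in> {0..1}"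
      have "inner1 \<phi> (\<lambda>y. kerN N x y - kerD N x y) = inner1 \<phi> (kerN N x) - inner1 \<phi> (kerD N x)"
        by (intro inner1_diff_right continuous_imp_integrable_real \<phi> continuous_on_kerN continuous_on_kerD)
      moreover have "\<bar>inner1 \<phi> (\<lambda>y. kerN N x y - kerD N x y)\<bar> \<le> 2 * (e/8) + K * (e / (4 * (K + 1)))"
        by (rule corner_bound[OF continuous_imp_integrable_real[OF \<phi>(1)] b]) (use elim x e K in auto)
      moreover have "K * (e / (4 * (K + 1))) \<le> e/4"
        using e K by (simp add: field_simps)
      moreover have "\<bar>inner1 \<phi> (kerN N x) - \<phi> x\<bar> \<le> e/2" using elim x by auto
      ultimately show "\<bar>inner1 \<phi> (kerD N x) - \<phi> x\<bar> \<le> e" by linarith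
    qed
  qed
qed

text \<open>\<open>kerD\<close> is dominated by \<open>kerN\<close>, and the latter has mass one in
  either variable.\<close>

lemma kerD_L1_contraction:
  assumes f: "integrable (lebesgue_on {0..1}) f"
  shows "(LINT x|lebesgue_on {0..1}. \<bar>inner1 f (kerD N x)\<bar>) \<le> (LINT x|lebesgue_on {0..1}. \<bar>f x\<bar>)"
proof -
  let ?L = "lebesgue_on {0..1::real}"
  have fa: "integrable ?L (\<lambda>x. \<bar>f x\<bar>)" using f by simp
  have "(LINT x|?L. \<bar>inner1 f (kerD N x)\<bar>) \<le> (LINT x|?L. inner1 (\<lambda>y. \<bar>f y\<bar>) (kerN N x))"
  proof (rule integral_lebesgue_on_mono)
    fix x :: real
    have "norm (inner1 f (kerD N x)) \<le> (LINT y|?L. norm (f y * kerD N x y))"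
      unfolding inner1_def by (rule integral_norm_bound)
    also have "\<dots> \<le> inner1 (\<lambda>y. \<bar>f y\<bar>) (kerN N x)"
      unfolding inner1_def
    proof (rule integral_lebesgue_on_mono)
      show "norm (f y * kerD N x y) \<le> \<bar>f y\<bar> * kerN N x y" for y
        by (simp add: abs_mult mult_left_mono kerD_le_kerN)
    qed (use inner1_integrable[OF f continuous_on_kerD] inner1_integrable[OF fa continuous_on_kerN] in auto)
    finally show "\<bar>inner1 f (kerD N x)\<bar> \<le> inner1 (\<lambda>y. \<bar>f y\<bar>) (kerN N x)" by simp
  qed (intro continuous_imp_integrable_real continuous_intros continuous_on_inner1_kerN
        continuous_on_inner1_kerD f fa)+
  also have "(LINT x|?L. inner1 (\<lambda>y. \<bar>f y\<bar>) (kerN N x)) = inner1 (\<lambda>y. \<bar>f y\<bar>) (\<lambda>_. 1)"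
  proof -
    have "(LINT x|?L. inner1 (\<lambda>y. \<bar>f y\<bar>) (kerN N x)) = inner1 (\<lambda>_. 1) (\<lambda>x. inner1 (\<lambda>y. \<bar>f y\<bar>) (\<lambda>_. 1) * 1
       + (\<Sum>n\<in>{1..<N}. (2 * fejer_coeff N n * inner1 (\<lambda>y. \<bar>f y\<bar>) (cosn n)) * cosn n x))"
      unfolding inner1_kerN[OF fa] by (simp add: inner1_def algebra_simps)
    also have "\<dots> = inner1 (\<lambda>y. \<bar>f y\<bar>) (\<lambda>_. 1) * inner1 (\<lambda>_. 1) (\<lambda>_. 1)
       + (\<Sum>n\<in>{1..<N}. (2 * fejer_coeff N n * inner1 (\<lambda>y. \<bar>f y\<bar>) (cosn n)) * inner1 (\<lambda>_. 1) (cosn n))"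
      by (subst inner1_add_right, simp, intro continuous_intros, intro continuous_intros,
          subst inner1_cmult_right, subst inner1_sum) (auto intro: continuous_intros)
    also have "(\<Sum>n\<in>{1..<N}. (2 * fejer_coeff N n * inner1 (\<lambda>y. \<bar>f y\<bar>) (cosn n)) * inner1 (\<lambda>_. 1) (cosn n)) = 0"
      using inner1_cosn_cosn[of 0] by (intro sum.neutral) auto
    finally show ?thesis using inner1_cosn_cosn[of 0 0] by simp
  qed
  finally show ?thesis by (simp add: inner1_def)
qed

text \<open>Density of the continuous functions that vanish at the ends, for which convergence is
  uniform, together with the contraction property. As the path is bounded, an L1 error in the
  function it is paired with suffices.\<close>

lemma kerD_L1_tendsto:
  assumes f: "integrable (lebesgue_on {0..1}) f"
  shows "(\<lambda>N. LINT x|lebesgue_on {0..1}. \<bar>inner1 f (kerD N x) - f x\<bar>) \<longlonglongrightarrow> 0"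
proof (rule LIMSEQ_I)
  let ?L = "lebesgue_on {0..1::real}"
  fix e :: real assume e: "0 < e"
  obtain g where g: "continuous_on UNIV g" "g 0 = 0" "g 1 = 0" "(LINT x|?L. \<bar>f x - g x\<bar>) < e/4"
    using L1_dense_continuous[OF f, of "e/4"] e by auto
  have gc: "continuous_on {0..1} g" using g(1) continuous_on_subset by blast
  have gi: "integrable ?L g" by (rule continuous_imp_integrable_real[OF gc])
  have fg: "integrable ?L (\<lambda>x. f x - g x)" using f gi by simp
  have "\<forall>\<^sub>F N in sequentially. \<forall>x\<in>{0..1}. \<bar>inner1 g (kerD N x) - g x\<bar> \<le> e/4"
    by (rule kerD_uniform) (use g gc e in auto)
  then obtain N0 where "\<forall>N\<ge>N0. \<forall>x\<in>{0..1}. \<bar>inner1 g (kerD N x) - g x\<bar> \<le> e/4"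
    unfolding eventually_sequentially by blast
  then have N0: "\<And>N x. N \<ge> N0 \<Longrightarrow> x \<in> {0..1} \<Longrightarrow> \<bar>inner1 g (kerD N x) - g x\<bar> \<le> e/4" by blast
  have "norm ((LINT x|?L. \<bar>inner1 f (kerD N x) - f x\<bar>) - 0) < e" if N: "N \<ge> N0" for N
  proof -
    note ii = continuous_imp_integrable_real[OF continuous_on_inner1_kerD]
    have "(LINT x|?L. \<bar>inner1 f (kerD N x) - f x\<bar>)
        \<le> (LINT x|?L. \<bar>inner1 (\<lambda>x. f x - g x) (kerD N x)\<bar> + (e/4 + \<bar>f x - g x\<bar>))"
    proof (rule integral_lebesgue_on_mono)
      fix x :: real assume x: "x \<in> {0..1}"
      have "inner1 (\<lambda>x. f x - g x) (kerD N x) = inner1 f (kerD N x) - inner1 g (kerD N x)"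
        by (intro inner1_diff_left f gi continuous_on_kerD)
      then show "\<bar>inner1 f (kerD N x) - f x\<bar> \<le> \<bar>inner1 (\<lambda>x. f x - g x) (kerD N x)\<bar> + (e/4 + \<bar>f x - g x\<bar>)"
        using N0[OF N x] by linarith
    qed (use ii[OF f] ii[OF fg] f fg in auto)
    also have "\<dots> = (LINT x|?L. \<bar>inner1 (\<lambda>x. f x - g x) (kerD N x)\<bar>) + (e/4 + (LINT x|?L. \<bar>f x - g x\<bar>))"
      using ii[OF fg] fg integral_lebesgue_on_const[of 0 1 "e/4"] by simp
    also have "\<dots> \<le> (LINT x|?L. \<bar>f x - g x\<bar>) + (e/4 + (LINT x|?L. \<bar>f x - g x\<bar>))"
      using kerD_L1_contraction[OF fg, of N] by simp
    also have "\<dots> < e" using g(4) e by simp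
    finally show ?thesis by simp
  qed
  then show "\<exists>no. \<forall>n\<ge>no. norm ((LINT x|?L. \<bar>inner1 f (kerD n x) - f x\<bar>) - 0) < e" by blast
qed

section \<open>Exponential averaging in time\<close>

text \<open>\<open>avg T \<tau> b\<close> solves \<open>\<tau> \<beta>' = b - \<beta>\<close>, \<open>\<beta>(-T) = 0\<close>, and \<open>adv \<tau>\<close> is its adjoint on \<open>L\<^sup>2([-T,0])\<close>.\<close>

definition avg :: "real \<Rightarrow> real \<Rightarrow> (real \<Rightarrow> real) \<Rightarrow> real \<Rightarrow> real" where
  "avg T \<tau> b t = exp (- t / \<tau>) / \<tau> * integral {-T..t} (\<lambda>s. exp (s / \<tau>) * b s)"

definition adv :: "real \<Rightarrow> (real \<Rightarrow> real) \<Rightarrow> real \<Rightarrow> real" where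
  "adv \<tau> r s = exp (s / \<tau>) / \<tau> * integral {s..0} (\<lambda>t. exp (- t / \<tau>) * r t)"

lemma integrable_mult_cont:
  fixes f \<phi> :: "real \<Rightarrow> real"
  assumes "integrable (lebesgue_on {a..b}) f" "continuous_on {a..b} \<phi>"
  shows "integrable (lebesgue_on {a..b}) (\<lambda>x. \<phi> x * f x)"
proof -
  have "bounded (\<phi> ` {a..b})" using assms(2) by (intro compact_imp_bounded compact_continuous_image) auto
  then obtain B where "\<forall>y\<in>\<phi> ` {a..b}. norm y \<le> B" unfolding bounded_pos by blast
  then have "integrable (lebesgue_on {a..b}) (\<lambda>x. f x * \<phi> x)"
    using continuous_imp_integrable_real[OF assms(2)]
    by (intro integrable_mult_bounded[where B=B] assms AE_lebesgue_onI) auto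
  then show ?thesis by (simp add: mult.commute)
qed

lemma integrable_lebesgue_on_imp_subinterval:
  fixes f :: "real \<Rightarrow> real"
  assumes "integrable (lebesgue_on {a..b}) f" "a \<le> c" "d \<le> b"
  shows "f integrable_on {c..d}"
  using integrable_on_subinterval[of f "{a..b}" c d] assms
  by (auto simp: integrable_on_lebesgue_on)

locale time_average =
  fixes T \<tau> :: real
  assumes T: "0 < T" and \<tau>: "0 < \<tau>"
begin

lemma weight_integrable:
  assumes "integrable (lebesgue_on {-T..0}) q" "-T \<le> c" "d \<le> 0"
  shows "(\<lambda>s. exp (s / \<tau>) * q s) integrable_on {c..d}"
    "(\<lambda>s. exp (- s / \<tau>) * q s) integrable_on {c..d}"
proof -
  have "continuous_on {-T..0} (\<lambda>s. exp (s / \<tau>))" "continuous_on {-T..0} (\<lambda>s. exp (- s / \<tau>))"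
    using \<tau> by (auto intro!: continuous_intros)
  then show "(\<lambda>s. exp (s / \<tau>) * q s) integrable_on {c..d}"
    "(\<lambda>s. exp (- s / \<tau>) * q s) integrable_on {c..d}"
    by (auto intro!: integrable_lebesgue_on_imp_subinterval[of "-T" 0] integrable_mult_cont assms)
qed

lemma avg_deriv:
  assumes b: "continuous_on {-T..0} b" and t: "t \<in> {-T..0}"
  shows "(avg T \<tau> b has_real_derivative (b t - avg T \<tau> b t) / \<tau>) (at t within {-T..0})"
proof -
  have c: "continuous_on {-T..0} (\<lambda>s. exp (s / \<tau>) * b s)"
    using \<tau> by (intro continuous_intros b) auto
  have E: "((\<lambda>t. exp (- t / \<tau>) / \<tau>) has_real_derivative - (exp (- t / \<tau>) / \<tau> / \<tau>)) (at t within {-T..0})"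
    using \<tau> by (auto intro!: derivative_eq_intros)
  have x: "exp (- t / \<tau>) * exp (t / \<tau>) = 1" by (simp add: exp_add[symmetric])
  have "exp (- t / \<tau>) / \<tau> * (exp (t / \<tau>) * b t) = (exp (- t / \<tau>) * exp (t / \<tau>)) * b t / \<tau>" by simp
  then have y: "exp (- t / \<tau>) / \<tau> * (exp (t / \<tau>) * b t) = b t / \<tau>" unfolding x by simp
  show ?thesis
    unfolding avg_def[abs_def]
    by (rule DERIV_cong[OF DERIV_mult'[OF E integral_has_real_derivative[OF c t]]])
       (simp only: y, simp add: diff_divide_distrib)
qed

lemma adv_deriv:
  assumes r: "continuous_on {-T..0} r" and t: "t \<in> {-T..0}"
  shows "(adv \<tau> r has_real_derivative (adv \<tau> r t - r t) / \<tau>) (at t within {-T..0})"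
proof -
  have c: "continuous_on {-T..0} (\<lambda>s. exp (- s / \<tau>) * r s)"
    using \<tau> by (intro continuous_intros r) auto
  have E: "((\<lambda>t. exp (t / \<tau>) / \<tau>) has_real_derivative (exp (t / \<tau>) / \<tau> / \<tau>)) (at t within {-T..0})"
    using \<tau> by (auto intro!: derivative_eq_intros)
  have x: "exp (t / \<tau>) * exp (- t / \<tau>) = 1" by (simp add: exp_add[symmetric])
  have "exp (t / \<tau>) / \<tau> * - (exp (- t / \<tau>) * r t) = - ((exp (t / \<tau>) * exp (- t / \<tau>)) * r t / \<tau>)" by simp
  then have y: "exp (t / \<tau>) / \<tau> * - (exp (- t / \<tau>) * r t) = - (r t / \<tau>)" unfolding x by simp
  show ?thesis
    unfolding adv_def[abs_def]
    by (rule DERIV_cong[OF DERIV_mult'[OF E integral_has_real_derivative'[OF c t]]])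
       (simp only: y, simp add: diff_divide_distrib)
qed

lemma avg_continuous:
  assumes "integrable (lebesgue_on {-T..0}) q"
  shows "continuous_on {-T..0} (avg T \<tau> q)"
proof -
  have "continuous_on {-T..0} (\<lambda>t. integral {-T..t} (\<lambda>s. exp (s / \<tau>) * q s))"
    by (rule indefinite_integral_continuous_1) (rule weight_integrable[OF assms], auto)
  then show ?thesis unfolding avg_def[abs_def] using \<tau> by (intro continuous_intros) auto
qed

lemma adv_continuous:
  assumes "integrable (lebesgue_on {-T..0}) q"
  shows "continuous_on {-T..0} (adv \<tau> q)"
proof -
  have "continuous_on {-T..0} (\<lambda>t. integral {t..0} (\<lambda>s. exp (- s / \<tau>) * q s))"
    by (rule indefinite_integral_continuous_1') (rule weight_integrable[OF assms], auto)
  then show ?thesis unfolding adv_def[abs_def] using \<tau> by (intro continuous_intros) auto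
qed

lemma avg_at_start [simp]: "avg T \<tau> b (-T) = 0" by (simp add: avg_def)
lemma adv_at_0 [simp]: "adv \<tau> r 0 = 0" by (simp add: adv_def)

text \<open>The kernel \<open>exp ((s - t) / \<tau>) / \<tau>\<close> on \<open>s \<le> t\<close> is
  a product of a function of \<open>s\<close> and a function of \<open>t\<close>, so
  \<open>integral_triangle_swap\<close> applies.\<close>

lemma avg_adv_duality:
  assumes q: "integrable (lebesgue_on {-T..0}) q" and r: "continuous_on {-T..0} r"
  shows "(LINT t|lebesgue_on {-T..0}. r t * avg T \<tau> q t) = (LINT s|lebesgue_on {-T..0}. q s * adv \<tau> r s)"
proof -
  have "integrable (lebesgue_on {-T..0}) (\<lambda>s. exp (s / \<tau>) * q s)"
    using \<tau> by (intro integrable_mult_cont q continuous_intros) auto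
  moreover have "continuous_on {-T..0} (\<lambda>t. exp (- t / \<tau>) / \<tau> * r t)"
    using \<tau> by (intro continuous_intros r) auto
  ultimately have "(LINT t|lebesgue_on {-T..0}. (exp (- t / \<tau>) / \<tau> * r t) * integral {-T..t} (\<lambda>s. exp (s / \<tau>) * q s))
      = (LINT s|lebesgue_on {-T..0}. (exp (s / \<tau>) * q s) * integral {s..0} (\<lambda>t. exp (- t / \<tau>) / \<tau> * r t))"
    using T by (intro integral_triangle_swap) auto
  moreover have "integral {s..0} (\<lambda>t. exp (- t / \<tau>) / \<tau> * r t) = integral {s..0} (\<lambda>t. exp (- t / \<tau>) * r t) / \<tau>" for s
    by (subst integral_divide[symmetric]) (simp add: field_simps)
  ultimately show ?thesis unfolding avg_def adv_def by (simp add: mult_ac)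
qed

lemma avg_mono:
  assumes "integrable (lebesgue_on {-T..0}) q" "integrable (lebesgue_on {-T..0}) q'"
    and "\<And>s. s \<in> {-T..0} \<Longrightarrow> q s \<le> q' s" "t \<in> {-T..0}"
  shows "avg T \<tau> q t \<le> avg T \<tau> q' t"
  unfolding avg_def using \<tau> assms
  by (intro mult_left_mono integral_le weight_integrable) auto

lemma adv_mono:
  assumes "integrable (lebesgue_on {-T..0}) q" "integrable (lebesgue_on {-T..0}) q'"
    and "\<And>s. s \<in> {-T..0} \<Longrightarrow> q s \<le> q' s" "t \<in> {-T..0}"
  shows "adv \<tau> q t \<le> adv \<tau> q' t"
  unfolding adv_def using \<tau> assms
  by (intro mult_left_mono integral_le weight_integrable) auto

lemma avg_cmult: "avg T \<tau> (\<lambda>s. c * q s) t = c * avg T \<tau> q t"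
  unfolding avg_def by (simp add: mult.left_commute[of _ c])

lemma adv_cmult: "adv \<tau> (\<lambda>s. c * q s) t = c * adv \<tau> q t"
  unfolding adv_def by (simp add: mult.left_commute[of _ c])

lemma avg_add:
  assumes "integrable (lebesgue_on {-T..0}) q" "integrable (lebesgue_on {-T..0}) q'" "t \<in> {-T..0}"
  shows "avg T \<tau> (\<lambda>s. q s + q' s) t = avg T \<tau> q t + avg T \<tau> q' t"
  unfolding avg_def using weight_integrable[OF assms(1), of "-T" t] weight_integrable[OF assms(2), of "-T" t] assms(3)
  by (simp add: Henstock_Kurzweil_Integration.integral_add distrib_left)

lemma adv_add:
  assumes "integrable (lebesgue_on {-T..0}) q" "integrable (lebesgue_on {-T..0}) q'" "t \<in> {-T..0}"
  shows "adv \<tau> (\<lambda>s. q s + q' s) t = adv \<tau> q t + adv \<tau> q' t"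
  unfolding adv_def using weight_integrable[OF assms(1), of t 0] weight_integrable[OF assms(2), of t 0] assms(3)
  by (simp add: Henstock_Kurzweil_Integration.integral_add distrib_left)

lemma avg_sum:
  assumes "finite A" "\<And>n. n \<in> A \<Longrightarrow> integrable (lebesgue_on {-T..0}) (q n)" "t \<in> {-T..0}"
  shows "avg T \<tau> (\<lambda>s. \<Sum>n\<in>A. c n * q n s) t = (\<Sum>n\<in>A. c n * avg T \<tau> (q n) t)"
  using assms(1,2)
proof (induction A rule: finite_induct)
  case (insert n A)
  have "avg T \<tau> (\<lambda>s. c n * q n s + (\<Sum>n\<in>A. c n * q n s)) t
     = avg T \<tau> (\<lambda>s. c n * q n s) t + avg T \<tau> (\<lambda>s. \<Sum>n\<in>A. c n * q n s) t"
    using insert by (intro avg_add assms(3)) auto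
  then show ?case using insert by (simp add: avg_cmult)
qed (simp add: avg_def)

lemma adv_sum:
  assumes "finite A" "\<And>n. n \<in> A \<Longrightarrow> integrable (lebesgue_on {-T..0}) (q n)" "t \<in> {-T..0}"
  shows "adv \<tau> (\<lambda>s. \<Sum>n\<in>A. c n * q n s) t = (\<Sum>n\<in>A. c n * adv \<tau> (q n) t)"
  using assms(1,2)
proof (induction A rule: finite_induct)
  case (insert n A)
  have "adv \<tau> (\<lambda>s. c n * q n s + (\<Sum>n\<in>A. c n * q n s)) t
     = adv \<tau> (\<lambda>s. c n * q n s) t + adv \<tau> (\<lambda>s. \<Sum>n\<in>A. c n * q n s) t"
    using insert by (intro adv_add assms(3)) auto
  then show ?case using insert by (simp add: adv_cmult)
qed (simp add: adv_def)

lemma avg_1: 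
  assumes "t \<in> {-T..0}"
  shows "avg T \<tau> (\<lambda>_. 1) t = 1 - exp (- (t + T) / \<tau>)"
proof -
  have "integral {-T..t} (\<lambda>s. exp (s / \<tau>)) = \<tau> * exp (t / \<tau>) - \<tau> * exp (- T / \<tau>)"
    by (rule integral_unique, rule fundamental_theorem_of_calculus)
       (use assms \<tau> in \<open>auto simp: has_real_derivative_iff_has_vector_derivative[symmetric] intro!: derivative_eq_intros\<close>)
  then have "avg T \<tau> (\<lambda>_. 1) t = exp (- t / \<tau>) / \<tau> * (\<tau> * exp (t / \<tau>) - \<tau> * exp (- T / \<tau>))"
    unfolding avg_def by simp
  also have "\<dots> = exp (- t / \<tau>) * exp (t / \<tau>) - exp (- t / \<tau>) * exp (- T / \<tau>)"
    using \<tau> by (simp add: right_diff_distrib)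
  also have "\<dots> = 1 - exp (- (t + T) / \<tau>)"
    by (simp add: exp_add[symmetric] add_divide_distrib diff_divide_distrib)
  finally show ?thesis .
qed

lemma adv_1:
  assumes "s \<in> {-T..0}"
  shows "adv \<tau> (\<lambda>_. 1) s = 1 - exp (s / \<tau>)"
proof -
  have "integral {s..0} (\<lambda>t. exp (- t / \<tau>)) = (- \<tau> * exp (- 0 / \<tau>)) - (- \<tau> * exp (- s / \<tau>))"
    by (rule integral_unique, rule fundamental_theorem_of_calculus)
       (use assms \<tau> in \<open>auto simp: has_real_derivative_iff_has_vector_derivative[symmetric] intro!: derivative_eq_intros\<close>)
  then have "adv \<tau> (\<lambda>_. 1) s = exp (s / \<tau>) / \<tau> * (\<tau> * exp (- s / \<tau>) - \<tau>)"
    unfolding adv_def by simp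
  also have "\<dots> = exp (s / \<tau>) * exp (- s / \<tau>) - exp (s / \<tau>)"
    using \<tau> by (simp add: right_diff_distrib)
  also have "\<dots> = 1 - exp (s / \<tau>)" by (simp add: exp_add[symmetric])
  finally show ?thesis .
qed

lemma avg_1_bounds: "t \<in> {-T..0} \<Longrightarrow> 0 \<le> avg T \<tau> (\<lambda>_. 1) t \<and> avg T \<tau> (\<lambda>_. 1) t \<le> 1"
  using \<tau> by (auto simp: avg_1 intro!: divide_nonpos_pos)

lemma adv_1_bounds: "t \<in> {-T..0} \<Longrightarrow> 0 \<le> adv \<tau> (\<lambda>_. 1) t \<and> adv \<tau> (\<lambda>_. 1) t \<le> 1"
  using \<tau> by (simp add: adv_1 divide_nonpos_pos)

lemma integrable_const_T [simp]: "integrable (lebesgue_on {-T..0::real}) (\<lambda>_. c::real)"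
  by (intro continuous_imp_integrable_real continuous_intros)

lemma avg_const: "avg T \<tau> (\<lambda>_. c) t = c * avg T \<tau> (\<lambda>_. 1) t"
  using avg_cmult[of c "\<lambda>_. 1"] by simp

lemma adv_const: "adv \<tau> (\<lambda>_. c) t = c * adv \<tau> (\<lambda>_. 1) t"
  using adv_cmult[of c "\<lambda>_. 1"] by simp

lemma avg_bound:
  assumes q: "integrable (lebesgue_on {-T..0}) q" and B: "\<And>s. s \<in> {-T..0} \<Longrightarrow> \<bar>q s\<bar> \<le> B"
    and t: "t \<in> {-T..0}"
  shows "\<bar>avg T \<tau> q t\<bar> \<le> B"
proof -
  have B0: "0 \<le> B" using B[of 0] T by auto
  have "avg T \<tau> q t \<le> avg T \<tau> (\<lambda>_. B) t" 
    by (rule avg_mono[OF q _ _ t]) (use B in \<open>auto simp: abs_le_iff\<close>)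
  moreover have "avg T \<tau> (\<lambda>_. - B) t \<le> avg T \<tau> q t"
    by (rule avg_mono[OF _ q _ t]) (use B in \<open>auto simp: abs_le_iff minus_le_iff\<close>)
  moreover have "B * avg T \<tau> (\<lambda>_. 1) t \<le> B" using avg_1_bounds[OF t] B0 by (simp add: mult_left_le)
  ultimately show ?thesis unfolding avg_const[of B] avg_const[of "- B"] by (simp add: abs_le_iff)
qed

text \<open>Jensen's inequality from the tangent of the square at the mean \<open>?c\<close>. The
  kernel has total mass at most one, and the deficit multiplies \<open>- ?c\<^sup>2\<close>, so it
  only helps.\<close>

lemma avg_square_le:
  assumes b: "continuous_on {-T..0} b" and t: "t \<in> {-T..0}"
  shows "(avg T \<tau> b t)\<^sup>2 \<le> avg T \<tau> (\<lambda>s. (b s)\<^sup>2) t"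
proof -
  let ?c = "avg T \<tau> b t"
  have bi: "integrable (lebesgue_on {-T..0}) b" "integrable (lebesgue_on {-T..0}) (\<lambda>s. (b s)\<^sup>2)"
    by (intro continuous_imp_integrable_real continuous_intros b)+
  have "avg T \<tau> (\<lambda>s. 2 * ?c * b s + (- ?c\<^sup>2)) t \<le> avg T \<tau> (\<lambda>s. (b s)\<^sup>2) t"
  proof (rule avg_mono[OF _ bi(2) _ t])
    fix s
    show "2 * ?c * b s + (- ?c\<^sup>2) \<le> (b s)\<^sup>2"
      using zero_le_power2[of "b s - ?c"] by (simp add: power2_diff algebra_simps)
  qed (use bi in simp)
  also have "avg T \<tau> (\<lambda>s. 2 * ?c * b s + (- ?c\<^sup>2)) t = 2 * ?c * ?c - ?c\<^sup>2 * avg T \<tau> (\<lambda>_. 1) t"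
    using bi t by (subst avg_add) (auto simp: avg_cmult avg_const[of "- ?c\<^sup>2"] simp del: mult.assoc)
  finally have "2 * ?c * ?c - ?c\<^sup>2 * avg T \<tau> (\<lambda>_. 1) t \<le> avg T \<tau> (\<lambda>s. (b s)\<^sup>2) t" .
  moreover have "?c\<^sup>2 * avg T \<tau> (\<lambda>_. 1) t \<le> ?c\<^sup>2 * 1"
    by (intro mult_left_mono) (use avg_1_bounds[OF t] in auto)
  ultimately show ?thesis by (simp add: power2_eq_square)
qed

lemma adv_square_le:
  assumes b: "continuous_on {-T..0} b" and t: "t \<in> {-T..0}"
  shows "(adv \<tau> b t)\<^sup>2 \<le> adv \<tau> (\<lambda>s. (b s)\<^sup>2) t"
proof -
  let ?c = "adv \<tau> b t"
  have bi: "integrable (lebesgue_on {-T..0}) b" "integrable (lebesgue_on {-T..0}) (\<lambda>s. (b s)\<^sup>2)"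
    by (intro continuous_imp_integrable_real continuous_intros b)+
  have "adv \<tau> (\<lambda>s. 2 * ?c * b s + (- ?c\<^sup>2)) t \<le> adv \<tau> (\<lambda>s. (b s)\<^sup>2) t"
  proof (rule adv_mono[OF _ bi(2) _ t])
    fix s
    show "2 * ?c * b s + (- ?c\<^sup>2) \<le> (b s)\<^sup>2"
      using zero_le_power2[of "b s - ?c"] by (simp add: power2_diff algebra_simps)
  qed (use bi in simp)
  also have "adv \<tau> (\<lambda>s. 2 * ?c * b s + (- ?c\<^sup>2)) t = 2 * ?c * ?c - ?c\<^sup>2 * adv \<tau> (\<lambda>_. 1) t"
    using bi t by (subst adv_add) (auto simp: adv_cmult adv_const[of "- ?c\<^sup>2"] simp del: mult.assoc)
  finally have "2 * ?c * ?c - ?c\<^sup>2 * adv \<tau> (\<lambda>_. 1) t \<le> adv \<tau> (\<lambda>s. (b s)\<^sup>2) t" .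
  moreover have "?c\<^sup>2 * adv \<tau> (\<lambda>_. 1) t \<le> ?c\<^sup>2 * 1"
    by (intro mult_left_mono) (use adv_1_bounds[OF t] in auto)
  ultimately show ?thesis by (simp add: power2_eq_square)
qed

text \<open>The averaging kernel is at most \<open>1 / \<tau>\<close>. This turns bounds integrated
  over time into bounds at every time.\<close>

lemma avg_le_integral:
  assumes q: "integrable (lebesgue_on {-T..0}) q" and q0: "\<And>s. s \<in> {-T..0} \<Longrightarrow> 0 \<le> q s" and t: "t \<in> {-T..0}"
  shows "avg T \<tau> q t \<le> (LINT s|lebesgue_on {-T..0}. q s) / \<tau>"
proof -
  have "avg T \<tau> q t = integral {-T..t} (\<lambda>s. exp (- t / \<tau>) / \<tau> * (exp (s / \<tau>) * q s))"
    by (simp add: avg_def)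
  also have "\<dots> \<le> integral {-T..t} (\<lambda>s. q s / \<tau>)"
  proof (rule integral_le)
    show "(\<lambda>s. exp (- t / \<tau>) / \<tau> * (exp (s / \<tau>) * q s)) integrable_on {-T..t}"
      by (rule integrable_on_mult_right, rule weight_integrable[OF q]) (use t in auto)
    show "(\<lambda>s. q s / \<tau>) integrable_on {-T..t}"
      using integrable_lebesgue_on_imp_subinterval[OF q, of "-T" t] t by (auto intro: integrable_on_divide)
    fix s assume s: "s \<in> {-T..t}"
    have "exp (- t / \<tau>) * exp (s / \<tau>) \<le> 1"
      using s \<tau> by (simp add: exp_add[symmetric] diff_divide_distrib[symmetric] divide_nonpos_pos)
    then have "exp (- t / \<tau>) * exp (s / \<tau>) * (q s / \<tau>) \<le> 1 * (q s / \<tau>)"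
      by (rule mult_right_mono) (use q0[of s] s t \<tau> in auto)
    then show "exp (- t / \<tau>) / \<tau> * (exp (s / \<tau>) * q s) \<le> q s / \<tau>" by simp
  qed
  also have "\<dots> \<le> integral {-T..0} (\<lambda>s. q s / \<tau>)"
    using t q0 \<tau> integrable_lebesgue_on_imp_subinterval[OF q]
    by (intro integral_subset_le) (auto intro!: integrable_on_divide divide_nonneg_nonneg)
  also have "\<dots> = integral {-T..0} q / \<tau>" by simp
  also have "integral {-T..0} q = (LINT s|lebesgue_on {-T..0}. q s)"
    by (rule lebesgue_integral_eq_integral[symmetric, OF q]) simp
  finally show ?thesis .
qed

text \<open>By duality the loss is the integral of \<open>exp (s / \<tau>) * q s\<close>, a layer of
  width \<open>\<tau>\<close> at the final time.\<close>

lemma integral_avg_ge: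
  assumes q: "integrable (lebesgue_on {-T..0}) q" and B: "\<And>s. s \<in> {-T..0} \<Longrightarrow> q s \<le> B" and B0: "0 \<le> B"
  shows "(LINT s|lebesgue_on {-T..0}. q s) - B * \<tau> \<le> (LINT t|lebesgue_on {-T..0}. avg T \<tau> q t)"
proof -
  let ?L = "lebesgue_on {-T..0}"
  have ec: "continuous_on {-T..0} (\<lambda>s. exp (s / \<tau>))" using \<tau> by (intro continuous_intros) auto
  have ei: "integrable ?L (\<lambda>s. exp (s / \<tau>) * q s)" by (rule integrable_mult_cont[OF q ec])
  have "(LINT t|?L. avg T \<tau> q t) = (LINT s|?L. q s * adv \<tau> (\<lambda>_. 1) s)"
    using avg_adv_duality[OF q, of "\<lambda>_. 1"] by simp
  also have "\<dots> = (LINT s|?L. q s - exp (s / \<tau>) * q s)"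
    by (rule integral_lebesgue_on_cong) (simp add: adv_1 algebra_simps)
  also have "\<dots> = (LINT s|?L. q s) - (LINT s|?L. exp (s / \<tau>) * q s)"
    by (rule Bochner_Integration.integral_diff[OF q ei])
  finally have 1: "(LINT t|?L. avg T \<tau> q t) = (LINT s|?L. q s) - (LINT s|?L. exp (s / \<tau>) * q s)" .
  have "(LINT s|?L. exp (s / \<tau>) * q s) \<le> (LINT s|?L. exp (s / \<tau>) * B)"
    by (rule integral_lebesgue_on_mono[OF ei])
       (auto intro!: continuous_imp_integrable_real continuous_intros ec mult_left_mono B)
  also have "\<dots> = B * \<tau> * exp (0 / \<tau>) - B * \<tau> * exp (- T / \<tau>)"
    by (rule FTC_lebesgue_on)
       (use T \<tau> in \<open>auto intro!: continuous_intros ec derivative_eq_intros\<close>)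
  also have "\<dots> \<le> B * \<tau>" using B0 \<tau> by simp
  finally show ?thesis using 1 by simp
qed

end

text \<open>The device of \<open>cos_modulus\<close> with \<open>|t - s|\<close> as majorant,
  because the exponential kernel has first moment at most \<open>\<tau>\<close>.\<close>

lemma modulus_linear:
  fixes b :: "real \<Rightarrow> real"
  assumes b: "continuous_on {c..d} b" and e: "0 < e"
  obtains K where "K \<ge> 0" "\<And>s t. s \<in> {c..d} \<Longrightarrow> t \<in> {c..d} \<Longrightarrow> \<bar>b s - b t\<bar> \<le> e + K * \<bar>t - s\<bar>"
proof -
  have "uniformly_continuous_on {c..d} b" by (rule compact_uniformly_continuous[OF b]) simp
  then obtain \<delta> where d: "\<delta> > 0" "\<And>x y. x \<in> {c..d} \<Longrightarrow> y \<in> {c..d} \<Longrightarrow> dist y x < \<delta> \<Longrightarrow> dist (b y) (b x) < e"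
    using e unfolding uniformly_continuous_on_def by metis
  have "bounded (b ` {c..d})" using b by (intro compact_imp_bounded compact_continuous_image) auto
  then obtain B where B: "B > 0" "\<forall>y\<in>b ` {c..d}. norm y \<le> B" unfolding bounded_pos by blast
  show ?thesis
  proof (rule that[of "2 * B / \<delta>"])
    fix s t assume st: "s \<in> {c..d}" "t \<in> {c..d}"
    show "\<bar>b s - b t\<bar> \<le> e + 2 * B / \<delta> * \<bar>t - s\<bar>"
    proof (cases "\<bar>t - s\<bar> < \<delta>")
      case True
      then have "\<bar>b s - b t\<bar> < e" using d(2)[OF st(2) st(1)] by (simp add: dist_real_def)
      moreover have "0 \<le> 2 * B / \<delta> * \<bar>t - s\<bar>" using B d by simp
      ultimately show ?thesis by linarith
    next
      case False
      then have "2 * B / \<delta> * \<delta> \<le> 2 * B / \<delta> * \<bar>t - s\<bar>"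
        using B d by (intro mult_left_mono) auto
      moreover have "\<bar>b s\<bar> \<le> B" "\<bar>b t\<bar> \<le> B" using B(2) st by auto
      then have "\<bar>b s - b t\<bar> \<le> 2 * B" by linarith
      ultimately show ?thesis using d e by simp
    qed
  qed (use B d in auto)
qed

text \<open>Split \<open>b s\<close> into \<open>b t\<close> and the increment
  \<open>b s - b t\<close>. The increment is averaged over a window of width \<open>\<tau>\<close>,
  while the missing mass \<open>R\<close> multiplies \<open>b t\<close>. Where \<open>R\<close> is
  not small, near the initial time, \<open>b t\<close> is, because \<open>b (-T) = 0\<close>;
  quantitatively \<open>(t + T) * R \<le> \<tau>\<close>, since
  \<open>z * exp (- z) \<le> 1\<close>.\<close>

lemma avg_uniform_limit:
  fixes b :: "real \<Rightarrow> real"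
  assumes T: "0 < T" and b: "continuous_on {-T..0} b" and b0: "b (-T) = 0" and e: "0 < e"
  shows "\<forall>\<^sub>F \<tau> in at_right 0. \<forall>t\<in>{-T..0}. \<bar>avg T \<tau> b t - b t\<bar> \<le> e"
proof -
  obtain K where K: "K \<ge> 0" "\<And>s t. s \<in> {-T..0} \<Longrightarrow> t \<in> {-T..0} \<Longrightarrow> \<bar>b s - b t\<bar> \<le> e/4 + K * \<bar>t - s\<bar>"
    using modulus_linear[OF b, of "e/4"] e by auto
  have "\<bar>avg T \<tau> b t - b t\<bar> \<le> e" if tp: "0 < \<tau>" "\<tau> \<le> e / (4 * (K + 1))" and t: "t \<in> {-T..0}" for \<tau> t
  proof -
    interpret time_average T \<tau> by unfold_locales (use T tp in auto)
    have bi: "integrable (lebesgue_on {-T..0}) b" by (rule continuous_imp_integrable_real[OF b])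
    have bti: "integrable (lebesgue_on {-T..0}) (\<lambda>s. b s + (- b t))" using bi by simp
    have Kt: "K * \<tau> \<le> e/4"
    proof -
      have "K * \<tau> \<le> (K + 1) * \<tau>" using \<tau> by simp
      also have "\<dots> \<le> (K + 1) * (e / (4 * (K + 1)))" using K by (intro mult_left_mono tp(2)) auto
      also have "\<dots> = e/4" using K(1) by (simp add: divide_simps)
      finally show ?thesis .
    qed
    have lin: "avg T \<tau> (\<lambda>s. t - s) t \<le> \<tau>"
    proof -
      have "integral {-T..t} (\<lambda>s. exp (s / \<tau>) * (t - s))
         = \<tau> * exp (t / \<tau>) * (t - t + \<tau>) - \<tau> * exp (- T / \<tau>) * (t - (- T) + \<tau>)"
        by (rule integral_unique, rule fundamental_theorem_of_calculus)
           (use t \<tau> in \<open>auto simp: has_real_derivative_iff_has_vector_derivative[symmetric] algebra_simps intro!: derivative_eq_intros\<close>)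
      also have "\<dots> \<le> \<tau> * \<tau> * exp (t / \<tau>)" using t \<tau> by simp
      finally have "avg T \<tau> (\<lambda>s. t - s) t \<le> exp (- t / \<tau>) / \<tau> * (\<tau> * \<tau> * exp (t / \<tau>))"
        unfolding avg_def using \<tau> by (intro mult_left_mono) auto
      also have "\<dots> = \<tau> * (exp (- t / \<tau>) * exp (t / \<tau>))" using \<tau> by simp
      also have "\<dots> = \<tau>" by (simp add: exp_add[symmetric])
      finally show ?thesis .
    qed
    define R where "R = exp (- (t + T) / \<tau>)"
    have "avg T \<tau> (\<lambda>s. b s + (- b t)) t = avg T \<tau> b t - b t * (1 - R)"
      using bi t by (subst avg_add) (auto simp: avg_const[of "- b t"] avg_1 R_def)
    then have eq: "avg T \<tau> b t - b t = avg T \<tau> (\<lambda>s. b s + (- b t)) t - b t * R" by (simp add: algebra_simps)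
    define f where "f = (\<lambda>s. e/4 + K * (t - s))"
    have up: "avg T \<tau> f t \<le> e/4 + K * \<tau>"
    proof -
      have "avg T \<tau> f t = e/4 * avg T \<tau> (\<lambda>_. 1) t + K * avg T \<tau> (\<lambda>s. t - s) t"
        unfolding f_def using t
        by (subst avg_add) (auto simp: avg_const[of "e/4"] avg_cmult intro!: continuous_imp_integrable_real continuous_intros)
      also have "\<dots> \<le> e/4 * 1 + K * \<tau>"
        using avg_1_bounds[OF t] e K lin by (intro add_mono mult_left_mono) auto
      finally show ?thesis by simp
    qed
    have fi: "integrable (lebesgue_on {-T..0}) f"
      unfolding f_def by (intro continuous_imp_integrable_real continuous_intros)
    have restrict: "avg T \<tau> h t \<le> avg T \<tau> f t"
      if hi: "integrable (lebesgue_on {-T..0}) h" and hf: "\<And>s. s \<in> {-T..t} \<Longrightarrow> h s \<le> f s" for h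
      unfolding avg_def using \<tau> t hf by (intro mult_left_mono integral_le weight_integrable hi fi) auto
    have 1: "avg T \<tau> (\<lambda>s. b s + (- b t)) t \<le> avg T \<tau> f t"
    proof (rule restrict[OF bti])
      fix s assume s: "s \<in> {-T..t}"
      then show "b s + (- b t) \<le> f s" using K(2)[of s t] t by (auto simp: f_def abs_le_iff)
    qed
    have nbti: "integrable (lebesgue_on {-T..0}) (\<lambda>s. (-1) * (b s + (- b t)))"
      by (intro Bochner_Integration.integrable_mult_right bti)
    have "avg T \<tau> (\<lambda>s. (-1) * (b s + (- b t))) t \<le> avg T \<tau> f t"
    proof (rule restrict[OF nbti])
      fix s assume s: "s \<in> {-T..t}"
      then show "(-1) * (b s + (- b t)) \<le> f s" using K(2)[of s t] t by (auto simp: f_def abs_le_iff)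
    qed
    then have 2: "- avg T \<tau> (\<lambda>s. b s + (- b t)) t \<le> avg T \<tau> f t" by (subst (asm) avg_cmult) linarith
    have "\<bar>b t\<bar> \<le> e/4 + K * (t + T)" using K(2)[of "-T" t] t b0 T by (auto simp: abs_le_iff)
    then have "\<bar>b t\<bar> * R \<le> (e/4 + K * (t + T)) * R" by (rule mult_right_mono) (simp add: R_def)
    also have "\<dots> = e/4 * R + K * ((t + T) * R)" by (simp add: algebra_simps)
    also have "\<dots> \<le> e/4 * 1 + K * \<tau>"
    proof (intro add_mono mult_left_mono)
      show "R \<le> 1" using t \<tau> by (simp add: R_def divide_nonpos_pos)
      have "(t + T) / \<tau> \<le> exp ((t + T) / \<tau>)" using exp_ge_add_one_self[of "(t + T) / \<tau>"] by linarith
      then have "(t + T) / \<tau> * R \<le> exp ((t + T) / \<tau>) * R" by (rule mult_right_mono) (simp add: R_def)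
      also have "\<dots> = 1" by (simp add: R_def exp_add[symmetric] add_divide_distrib diff_divide_distrib)
      finally show "(t + T) * R \<le> \<tau>" using \<tau> by (simp add: field_simps)
    qed (use e K in auto)
    finally have 3: "\<bar>b t * R\<bar> \<le> e/4 + K * \<tau>" by (simp add: abs_mult R_def)
    show ?thesis unfolding eq using 1 2 3 up Kt by linarith
  qed
  moreover have "e / (4 * (K + 1)) > 0" using e K by simp
  ultimately show ?thesis
    unfolding eventually_at_right_field by (intro exI[of _ "e / (4 * (K + 1))"]) (simp add: less_imp_le)
qed

section \<open>The stationary solution\<close>

lemma flux_le_quarter: "flux a \<le> 1/4"
  using zero_le_power2[of "a - 1/2"] by (simp add: flux_def power2_eq_square algebra_simps)

lemma continuous_on_flux [continuous_intros]:
  "continuous_on S f \<Longrightarrow> continuous_on S (\<lambda>x. flux (f x))"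
  unfolding flux_def by (intro continuous_intros)

text \<open>Apart from range and boundary values this supplies derivatives of all orders: the
  equation is autonomous with a polynomial right-hand side, so each derivative is a polynomial in
  \<open>\<rho>\<close>.\<close>

lemma stationary_facts:
  assumes st: "stationary \<epsilon> \<rho>\<^sub>0 \<rho>\<^sub>1 \<rho>" and \<epsilon>: "0 < \<epsilon>" and \<rho>01: "\<rho>\<^sub>0 < \<rho>\<^sub>1"
  obtains J Dr where "Dr 0 = \<rho>"
    "\<And>j x. x \<in> {0..1} \<Longrightarrow> (Dr j has_real_derivative Dr (Suc j) x) (at x within {0..1})"
    "\<And>x. x \<in> {0..1} \<Longrightarrow> \<epsilon> * Dr 1 x = flux (\<rho> x) - J"
    "\<And>x. x \<in> {0..1} \<Longrightarrow> \<rho>\<^sub>0 \<le> \<rho> x \<and> \<rho> x \<le> \<rho>\<^sub>1" "\<rho> 0 = \<rho>\<^sub>0" "\<rho> 1 = \<rho>\<^sub>1"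
proof -
  obtain J where J: "\<And>r. r \<in> {\<rho>\<^sub>0..\<rho>\<^sub>1} \<Longrightarrow> J < flux r"
    and int1: "(LINT r|lebesgue_on {\<rho>\<^sub>0..\<rho>\<^sub>1}. \<epsilon> / (flux r - J)) = 1" and \<rho>0: "\<rho> 0 = \<rho>\<^sub>0"
    and ode: "\<And>x. x \<in> {0..1} \<Longrightarrow> \<exists>d. (\<rho> has_real_derivative d) (at x within {0..1}) \<and> flux (\<rho> x) - \<epsilon> * d = J"
    using st unfolding stationary_def by blast
  have D: "(\<rho> has_real_derivative (flux (\<rho> x) - J) / \<epsilon>) (at x within {0..1})" if x: "x \<in> {0..1}" for x
  proof -
    obtain d where d: "(\<rho> has_real_derivative d) (at x within {0..1})" "flux (\<rho> x) - \<epsilon> * d = J"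
      using ode[OF x] by blast
    then have "d = (flux (\<rho> x) - J) / \<epsilon>" using \<epsilon> by (simp add: field_simps)
    then show ?thesis using d by simp
  qed
  have \<rho>c: "continuous_on {0..1} \<rho>" by (rule DERIV_continuous_on[OF D])
  \<comment> \<open>A barrier from below. At the last point of \<open>{0..x}\<close> with value at
    least \<open>\<rho>\<^sub>0\<close> the value is exactly \<open>\<rho>\<^sub>0\<close>, and the
    slope is positive there because \<open>J < flux \<rho>\<^sub>0\<close>; hence a later such point
    exists.\<close>
  have lower: "\<rho>\<^sub>0 \<le> \<rho> x" if x: "x \<in> {0..1}" for x
  proof (rule ccontr)
    assume "\<not> \<rho>\<^sub>0 \<le> \<rho> x"
    then have neg: "\<rho> x < \<rho>\<^sub>0" by simp
    define S where "S = {z \<in> {0..x}. \<rho>\<^sub>0 \<le> \<rho> z}"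
    have c0x: "continuous_on {0..x} \<rho>" using \<rho>c x by (auto intro: continuous_on_subset)
    have "closed S" unfolding S_def
      by (intro continuous_on_closed_Collect_le c0x continuous_on_const) auto
    moreover have "bounded S" unfolding S_def by (rule bounded_subset[of "{0..x}"]) auto
    ultimately have cS: "compact S" by (simp add: compact_eq_bounded_closed)
    have "0 \<in> S" using \<rho>0 x by (simp add: S_def)
    then obtain y where y: "y \<in> S" "\<And>z. z \<in> S \<Longrightarrow> z \<le> y"
      using compact_attains_sup[OF cS] by blast
    have yx: "y < x" using y(1) neg by (auto simp: S_def less_le)
    have y01: "y \<in> {0..1}" using y(1) yx x by (auto simp: S_def)
    have ry: "\<rho> y = \<rho>\<^sub>0"
    proof (rule ccontr)
      assume "\<rho> y \<noteq> \<rho>\<^sub>0"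
      then have "\<rho>\<^sub>0 < \<rho> y" using y(1) by (auto simp: S_def)
      moreover have "continuous_on {y..x} \<rho>" using c0x y01 by (auto intro: continuous_on_subset)
      ultimately obtain z where z: "y \<le> z" "z \<le> x" "\<rho> z = \<rho>\<^sub>0"
        using IVT2'[of \<rho> x \<rho>\<^sub>0 y] neg yx by auto
      then have "z \<in> S" using y01 by (simp add: S_def)
      then have "z = y" using y(2)[of z] z by simp
      then show False using z \<open>\<rho> y \<noteq> \<rho>\<^sub>0\<close> by simp
    qed
    have "(flux (\<rho> y) - J) / \<epsilon> > 0" using J[of \<rho>\<^sub>0] ry \<epsilon> \<rho>01 by simp
    from has_real_derivative_pos_inc_right[OF D[OF y01] this]
    obtain d where d: "d > 0" "\<And>h. h > 0 \<Longrightarrow> y + h \<in> {0..1} \<Longrightarrow> h < d \<Longrightarrow> \<rho> y < \<rho> (y + h)" by blast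
    define h where "h = min (d/2) (x - y)"
    have "h > 0" "h < d" "y + h \<le> x" using d yx by (auto simp: h_def min_def)
    then have "\<rho> y < \<rho> (y + h)" using d(2)[of h] y01 x by auto
    then have "y + h \<in> S" using \<open>h > 0\<close> \<open>y + h \<le> x\<close> y01 ry by (auto simp: S_def)
    then show False using y(2) \<open>h > 0\<close> by fastforce
  qed
  define k where "k = (\<lambda>r. \<epsilon> / (flux r - J))"
  have kc: "continuous_on {\<rho>\<^sub>0..\<rho>\<^sub>1} k"
    unfolding k_def by (intro continuous_intros) (use J in force)
  have kpos: "k r > 0" if "r \<in> {\<rho>\<^sub>0..\<rho>\<^sub>1}" for r using J[OF that] \<epsilon> by (simp add: k_def)
  \<comment> \<open>\<open>G\<close> is the travel time from \<open>\<rho>\<^sub>0\<close> along the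
    orbit. It turns the equation into \<open>G (\<rho> x) = x\<close>, and the normalisation of
    \<open>J\<close> says \<open>G \<rho>\<^sub>1 = 1\<close>.\<close>
  define G where "G = (\<lambda>r. integral {\<rho>\<^sub>0..r} k)"
  have GD: "(G has_real_derivative k r) (at r within {\<rho>\<^sub>0..\<rho>\<^sub>1})" if "r \<in> {\<rho>\<^sub>0..\<rho>\<^sub>1}" for r
    unfolding G_def by (rule integral_has_real_derivative[OF kc that])
  have G1: "G \<rho>\<^sub>1 = 1" using int1 integral_lebesgue_on_cont[OF kc] by (simp add: G_def k_def)
  have Gx: "G (\<rho> x) = x" if y: "y \<in> {0..1}" and in_range: "\<And>z. z \<in> {0..y} \<Longrightarrow> \<rho> z \<in> {\<rho>\<^sub>0..\<rho>\<^sub>1}" and x: "x \<in> {0..y}" for x y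
  proof -
    have "((\<lambda>z. G (\<rho> z) - z) has_real_derivative 0) (at z within {0..y})" if z: "z \<in> {0..y}" for z
    proof -
      have 1: "(\<rho> has_real_derivative (flux (\<rho> z) - J) / \<epsilon>) (at z within {0..y})"
        by (rule DERIV_subset[OF D]) (use z y in auto)
      have 2: "(G has_real_derivative k (\<rho> z)) (at (\<rho> z) within \<rho> ` {0..y})"
        by (rule DERIV_subset[OF GD]) (use in_range z in auto)
      have "k (\<rho> z) * ((flux (\<rho> z) - J) / \<epsilon>) = 1"
        using J[OF in_range[OF z]] \<epsilon> by (simp add: k_def)
      then have "((G \<circ> \<rho>) has_real_derivative 1) (at z within {0..y})"
        using DERIV_image_chain[OF 2 1] by (simp only:)
      then show ?thesis by (auto intro!: derivative_eq_intros simp: o_def)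
    qed
    then have "\<exists>c. \<forall>z\<in>{0..y}. G (\<rho> z) - z = c"
      by (intro has_field_derivative_zero_constant) auto
    then obtain c where c: "\<And>z. z \<in> {0..y} \<Longrightarrow> G (\<rho> z) - z = c" by blast
    have "c = 0" using c[of 0] y \<rho>0 by (simp add: G_def)
    then show ?thesis using c[OF x] by simp
  qed
  \<comment> \<open>The first point \<open>y\<close> where \<open>\<rho>\<close> reaches
    \<open>\<rho>\<^sub>1\<close> satisfies \<open>y = G \<rho>\<^sub>1 = 1\<close>, so no later
    point is left at which \<open>\<rho>\<close> could be larger.\<close>
  have upper: "\<rho> x \<le> \<rho>\<^sub>1" if x: "x \<in> {0..1}" for x
  proof (rule ccontr)
    assume "\<not> \<rho> x \<le> \<rho>\<^sub>1"
    then have big: "\<rho>\<^sub>1 < \<rho> x" by simp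
    define S where "S = {z \<in> {0..x}. \<rho>\<^sub>1 \<le> \<rho> z}"
    have c0x: "continuous_on {0..x} \<rho>" using \<rho>c x by (auto intro: continuous_on_subset)
    have "closed S" unfolding S_def
      by (intro continuous_on_closed_Collect_le c0x continuous_on_const) auto
    moreover have "bounded S" unfolding S_def by (rule bounded_subset[of "{0..x}"]) auto
    ultimately have cS: "compact S" by (simp add: compact_eq_bounded_closed)
    have "x \<in> S" using big x by (simp add: S_def)
    then obtain y where y: "y \<in> S" "\<And>z. z \<in> S \<Longrightarrow> y \<le> z"
      using compact_attains_inf[OF cS] by blast
    have y01: "y \<in> {0..1}" "y \<le> x" using y(1) x by (auto simp: S_def)
    have below: "\<rho> z < \<rho>\<^sub>1" if "z \<in> {0..<y}" for z
      using y(2)[of z] that y01 by (force simp: S_def)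
    have ry: "\<rho> y = \<rho>\<^sub>1"
    proof (rule ccontr)
      assume "\<rho> y \<noteq> \<rho>\<^sub>1"
      then have gt: "\<rho>\<^sub>1 < \<rho> y" using y(1) by (auto simp: S_def)
      moreover have "continuous_on {0..y} \<rho>" using c0x y01 by (auto intro: continuous_on_subset)
      ultimately obtain z where z: "0 \<le> z" "z \<le> y" "\<rho> z = \<rho>\<^sub>1"
        using IVT'[of \<rho> 0 \<rho>\<^sub>1 y] \<rho>0 \<rho>01 y01 by auto
      then have "z \<noteq> y" using gt by auto
      then show False using below[of z] z by auto
    qed
    have "G (\<rho> y) = y"
      by (rule Gx[OF y01(1)]) (use lower below ry y01 x in \<open>force simp: less_le\<close>)+
    then have "y = 1" using ry G1 by simp
    then have "x = y" using y01 x by auto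
    then show False using ry big by simp
  qed
  have "G (\<rho> 1) = 1" by (rule Gx[of 1]) (use lower upper in auto)
  have r1: "\<rho> 1 = \<rho>\<^sub>1"
  proof (rule ccontr)
    assume "\<rho> 1 \<noteq> \<rho>\<^sub>1"
    then have lt: "\<rho> 1 < \<rho>\<^sub>1" using upper[of 1] by simp
    have "(G has_derivative (*) (k z)) (at z within {\<rho> 1..\<rho>\<^sub>1})" if "\<rho> 1 \<le> z" "z \<le> \<rho>\<^sub>1" for z
      using DERIV_subset[OF GD, of z "{\<rho> 1..\<rho>\<^sub>1}"] that lower[of 1] by (auto simp: has_field_derivative_def)
    from mvt_simple[OF lt this] obtain z where z: "z \<in> {\<rho> 1<..<\<rho>\<^sub>1}" "G \<rho>\<^sub>1 - G (\<rho> 1) = k z * (\<rho>\<^sub>1 - \<rho> 1)"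
      by blast
    have "k z > 0" using kpos[of z] z lower[of 1] by auto
    then show False using z G1 \<open>G (\<rho> 1) = 1\<close> lt by simp
  qed
  \<comment> \<open>The second factor is \<open>(r * (1 - r) - J) / \<epsilon>\<close> as a
    polynomial in \<open>r\<close>; by the chain rule \<open>Q (Suc j)\<close> represents the
    derivative of \<open>Q j\<close> along the orbit.\<close>
  define Q where "Q = rec_nat [:0, 1:] (\<lambda>_ q. pderiv q * [:- J / \<epsilon>, 1 / \<epsilon>, - 1 / \<epsilon>:])"
  have QS: "Q (Suc j) = pderiv (Q j) * [:- J / \<epsilon>, 1 / \<epsilon>, - 1 / \<epsilon>:]" for j by (simp only: Q_def nat.rec)
  define Dr where "Dr = (\<lambda>j x. poly (Q j) (\<rho> x))"
  have rhs: "poly [:- J / \<epsilon>, 1 / \<epsilon>, - 1 / \<epsilon>:] r = (flux r - J) / \<epsilon>" for r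
    using \<epsilon> by (simp add: flux_def field_simps)
  have DD: "(Dr j has_real_derivative Dr (Suc j) x) (at x within {0..1})" if x: "x \<in> {0..1}" for j x
  proof -
    have "((\<lambda>x. poly (Q j) (\<rho> x)) has_real_derivative poly (pderiv (Q j)) (\<rho> x) * ((flux (\<rho> x) - J) / \<epsilon>)) (at x within {0..1})"
      by (rule DERIV_chain2[OF poly_DERIV D[OF x]])
    moreover have "Dr (Suc j) x = poly (pderiv (Q j)) (\<rho> x) * ((flux (\<rho> x) - J) / \<epsilon>)"
      unfolding rhs[symmetric] by (simp only: Dr_def QS poly_mult)
    ultimately show ?thesis by (simp add: Dr_def)
  qed
  show ?thesis
  proof (rule that[of Dr J])
    show "Dr 0 = \<rho>" by (simp add: Dr_def Q_def fun_eq_iff)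
    have Q0: "pderiv (Q 0) = 1" by (simp add: Q_def pderiv_pCons)
    have "Dr 1 x = (flux (\<rho> x) - J) / \<epsilon>" for x
      unfolding rhs[symmetric] Dr_def One_nat_def QS Q0 by (simp only: mult_1)
    then show "\<epsilon> * Dr 1 x = flux (\<rho> x) - J" for x using \<epsilon> by simp
  qed (use DD lower upper \<rho>0 r1 in auto)
qed

section \<open>The weak* topology\<close>

lemma topspace_M_top: "topspace M_top = M_space"
  unfolding M_top_def topspace_pullback_topology by auto

lemma continuous_map_M_top_pairing:
  assumes "\<phi> \<in> L1_space"
  shows "continuous_map M_top euclideanreal (\<lambda>\<rho>. inner1 \<rho> \<phi>)"
proof -
  have "continuous_map M_top euclideanreal ((\<lambda>x. x \<phi>) \<circ> (\<lambda>\<rho>. restrict (\<lambda>\<phi>. inner1 \<rho> \<phi>) L1_space))"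
    unfolding M_top_def
    by (rule continuous_map_pullback, rule continuous_map_product_projection[OF assms, of "\<lambda>_. euclidean"])
  then show ?thesis using assms by (simp add: o_def)
qed

text \<open>The topology is initial for the pairings, so componentwise convergence in the product is
  enough.\<close>

lemma limitin_M_top:
  assumes \<rho>: "\<rho> \<in> M_space" and v: "\<And>j. v j \<in> M_space"
    and lim: "\<And>\<phi>. \<phi> \<in> L1_space \<Longrightarrow> (\<lambda>j. inner1 (v j) \<phi>) \<longlonglongrightarrow> inner1 \<rho> \<phi>"
  shows "limitin M_top v \<rho> sequentially"
proof -
  let ?f = "\<lambda>\<rho>. restrict (\<lambda>\<phi>. inner1 \<rho> \<phi>) L1_space"
  let ?P = "product_topology (\<lambda>_. euclideanreal) L1_space"
  have lp: "limitin ?P (\<lambda>j. ?f (v j)) (?f \<rho>) sequentially"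
    unfolding limitin_componentwise using lim by (auto simp: limitin_canonical_iff)
  show ?thesis unfolding limitin_def topspace_M_top
  proof (intro conjI \<rho> allI impI)
    fix S assume S: "openin M_top S \<and> \<rho> \<in> S"
    then obtain W where W: "openin ?P W" "S = ?f -` W \<inter> M_space"
      unfolding M_top_def openin_pullback_topology by blast
    then have "\<forall>\<^sub>F j in sequentially. ?f (v j) \<in> W"
      using lp S unfolding limitin_def by auto
    then show "\<forall>\<^sub>F j in sequentially. v j \<in> S"
      by eventually_elim (use W v in auto)
  qed
qed

lemma lower_semicontinuous_limit:
  assumes U: "lower_semicontinuous M_top U" and lim: "limitin M_top v \<rho> sequentially" and a: "a < U \<rho>"
  shows "\<forall>\<^sub>F j in sequentially. a < U (v j)"
proof -
  have "openin M_top {x \<in> topspace M_top. a < U x}" using U by (simp add: lower_semicontinuous_def)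
  moreover have "\<rho> \<in> {x \<in> topspace M_top. a < U x}" using lim a by (simp add: limitin_def)
  ultimately have "\<forall>\<^sub>F j in sequentially. v j \<in> {x \<in> topspace M_top. a < U x}"
    using lim unfolding limitin_def by blast
  then show ?thesis by eventually_elim auto
qed

text \<open>The topology cannot separate functions that are equal almost everywhere: the constant
  sequence \<open>\<rho>'\<close> converges to \<open>\<rho>\<close> and conversely, so lower
  semicontinuity compares the values in both directions.\<close>

lemma lower_semicontinuous_AE_eq:
  assumes U: "lower_semicontinuous M_top U" and M: "\<rho> \<in> M_space" "\<rho>' \<in> M_space"
    and eq: "AE x in lebesgue_on {0..1}. \<rho> x = \<rho>' x"
  shows "U \<rho> = U \<rho>'"
proof -
  have le: "U \<rho> \<le> U \<rho>'" if M: "\<rho> \<in> M_space" "\<rho>' \<in> M_space" and eq: "AE x in lebesgue_on {0..1}. \<rho> x = \<rho>' x" for \<rho> \<rho>'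
  proof (rule ccontr)
    assume "\<not> U \<rho> \<le> U \<rho>'"
    then have a: "U \<rho>' < U \<rho>" by simp
    have "inner1 \<rho>' \<phi> = inner1 \<rho> \<phi>" if "\<phi> \<in> L1_space" for \<phi>
      unfolding inner1_def
    proof (rule integral_cong_AE)
      show "(\<lambda>x. \<rho>' x * \<phi> x) \<in> borel_measurable (lebesgue_on {0..1})" "(\<lambda>x. \<rho> x * \<phi> x) \<in> borel_measurable (lebesgue_on {0..1})"
        using M that by (auto simp: M_space_def L1_space_def)
      show "AE x in lebesgue_on {0..1}. \<rho>' x * \<phi> x = \<rho> x * \<phi> x" using eq by eventually_elim simp
    qed
    then have "limitin M_top (\<lambda>_. \<rho>') \<rho> sequentially"
      by (intro limitin_M_top) (use M in auto)
    from lower_semicontinuous_limit[OF U this a] show False by simp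
  qed
  show ?thesis
    by (rule antisym) (use le M eq in \<open>auto simp: eq_commute\<close>)
qed

section \<open>Separable smooth functions\<close>

text \<open>Names the witness in \<open>smooth_rect\<close>, so that the derivatives taken by
  \<open>dt\<close> and \<open>dx\<close> can be identified with entries of
  \<open>D\<close>.\<close>

definition rect_derivs :: "real \<Rightarrow> (real \<Rightarrow> real \<Rightarrow> real) \<Rightarrow> (nat \<Rightarrow> nat \<Rightarrow> real \<Rightarrow> real \<Rightarrow> real) \<Rightarrow> bool" where
  "rect_derivs T u D \<longleftrightarrow>
     (\<forall>t\<in>{-T..0}. \<forall>x\<in>{0..1}. D 0 0 t x = u t x) \<and>
     (\<forall>i j. continuous_on ({-T..0} \<times> {0..1}) (\<lambda>(t, x). D i j t x) \<and>
       (\<forall>t\<in>{-T..0}. \<forall>x\<in>{0..1}.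
          ((\<lambda>s. D i j s x) has_real_derivative D (Suc i) j t x) (at t within {-T..0}) \<and>
          ((\<lambda>y. D i j t y) has_real_derivative D i (Suc j) t x) (at x within {0..1})))"

lemma smooth_rect_rect_derivs: "smooth_rect T u \<longleftrightarrow> (\<exists>D. rect_derivs T u D)"
  unfolding smooth_rect_def rect_derivs_def by blast

lemma vector_derivative_within_eqI:
  fixes f g :: "real \<Rightarrow> real"
  assumes "a < b" "x \<in> {a..b}" "(g has_real_derivative d) (at x within {a..b})"
    and "\<And>y. y \<in> {a..b} \<Longrightarrow> f y = g y"
  shows "vector_derivative f (at x within {a..b}) = d"
proof -
  have "(f has_real_derivative d) (at x within {a..b})"
    by (rule has_field_derivative_transform_within[OF assms(3), of 1]) (use assms in auto)
  then show ?thesis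
    using assms(1,2) by (intro vector_derivative_within_closed_interval)
      (auto simp: has_real_derivative_iff_has_vector_derivative)
qed

lemma rect_derivs_dt:
  assumes "rect_derivs T u D" "0 < T" "t \<in> {-T..0}" "x \<in> {0..1}"
  shows "dt T u t x = D 1 0 t x"
  unfolding dt_def
  by (rule vector_derivative_within_eqI[where g="\<lambda>s. D 0 0 s x"])
     (use assms in \<open>auto simp: rect_derivs_def\<close>)

lemma rect_derivs_dx:
  assumes "rect_derivs T u D" "t \<in> {-T..0}" "x \<in> {0..1}"
  shows "dx u t x = D 0 1 t x"
  unfolding dx_def deriv01_def
  by (rule vector_derivative_within_eqI[where g="\<lambda>y. D 0 0 t y"])
     (use assms in \<open>auto simp: rect_derivs_def\<close>)

lemma rect_derivs_dxx:
  assumes "rect_derivs T u D" "t \<in> {-T..0}" "x \<in> {0..1}"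
  shows "dx (dx u) t x = D 0 2 t x"
proof -
  have "((\<lambda>y. D 0 1 t y) has_real_derivative D 0 (Suc 1) t x) (at x within {0..1})"
    using assms unfolding rect_derivs_def by blast
  then show ?thesis
    unfolding dx_def[of "dx u"] deriv01_def
    by (intro vector_derivative_within_eqI[where g="\<lambda>y. D 0 1 t y"])
       (use assms rect_derivs_dx[OF assms(1,2)] in \<open>auto simp: numeral_2_eq_2\<close>)
qed

text \<open>The derivative of order \<open>j\<close> of \<open>sinn n\<close>: each differentiation
  multiplies by \<open>n * pi\<close> and shifts the phase by a quarter period.\<close>

definition sinn_diff :: "nat \<Rightarrow> nat \<Rightarrow> real \<Rightarrow> real" where
  "sinn_diff n j x = (real n * pi) ^ j * sin (real n * pi * x + real j * (pi / 2))"

lemma sinn_diff_deriv: "(sinn_diff n j has_real_derivative sinn_diff n (Suc j) x) (at x within S)"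
proof -
  have "sin (real n * pi * x + real (Suc j) * (pi / 2)) = cos (real n * pi * x + real j * (pi / 2))"
  proof -
    have "real n * pi * x + real (Suc j) * (pi / 2) = (real n * pi * x + real j * (pi / 2)) + pi / 2"
      by (simp add: algebra_simps add_divide_distrib)
    then show ?thesis by (simp only: sin_add cos_pi_half sin_pi_half mult_zero_right mult_1_right add_0)
  qed
  then show ?thesis
    unfolding sinn_diff_def by (auto intro!: derivative_eq_intros)
qed

lemma sinn_diff_simps [simp]:
  "sinn_diff n 0 = sinn n" "sinn_diff n (Suc 0) x = real n * pi * cosn n x"
  "sinn_diff n 2 x = - ((real n * pi)\<^sup>2 * sinn n x)"
  by (simp_all add: sinn_diff_def sinn_def cosn_def sin_add fun_eq_iff)

lemma continuous_on_sinn_diff [continuous_intros]: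
  fixes f :: "'a::t2_space \<Rightarrow> real"
  shows
  "continuous_on S f \<Longrightarrow> continuous_on S (\<lambda>x. sinn_diff n j (f x))"
  unfolding sinn_diff_def by (auto intro!: continuous_intros)

text \<open>All partial derivatives of a time-independent profile plus a sine sum whose coefficients
  are polynomials in time. With \<open>Dr\<close> the derivatives of the stationary solution it
  gives the smooth paths, with \<open>Dr\<close> zero the test functions.\<close>

definition sep :: "(nat \<Rightarrow> real \<Rightarrow> real) \<Rightarrow> nat \<Rightarrow> (nat \<Rightarrow> real poly) \<Rightarrow> nat \<Rightarrow> nat \<Rightarrow> real \<Rightarrow> real \<Rightarrow> real" where
  "sep Dr N p i j t x = (if i = 0 then Dr j x else 0)
     + (\<Sum>n\<in>{1..<N}. poly ((pderiv ^^ i) (p n)) t * sinn_diff n j x)"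

lemma rect_derivs_sep:
  assumes Dr: "\<And>j x. x \<in> {0..1} \<Longrightarrow> (Dr j has_real_derivative Dr (Suc j) x) (at x within {0..1})"
  shows "rect_derivs T (sep Dr N p 0 0) (sep Dr N p)"
  unfolding rect_derivs_def
proof (intro conjI ballI allI)
  fix i j
  have "continuous_on {0..1} (Dr j)" by (rule DERIV_continuous_on[OF Dr])
  then have "continuous_on ({-T..0} \<times> {0..1}) (\<lambda>z. Dr j (snd z))"
    by (rule continuous_on_compose2) (auto intro: continuous_intros)
  then have "continuous_on ({-T..0} \<times> {0..1}) (\<lambda>z. (if i = 0 then Dr j (snd z) else 0)
     + (\<Sum>n\<in>{1..<N}. poly ((pderiv ^^ i) (p n)) (fst z) * sinn_diff n j (snd z)))"
    by (cases "i = 0") (auto intro!: continuous_intros)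
  then show "continuous_on ({-T..0} \<times> {0..1}) (\<lambda>(t, x). sep Dr N p i j t x)"
    by (simp add: sep_def case_prod_unfold)
  fix t x :: real assume x: "x \<in> {0..1}"
  show "((\<lambda>s. sep Dr N p i j s x) has_real_derivative sep Dr N p (Suc i) j t x) (at t within {-T..0})"
    unfolding sep_def by (auto intro!: derivative_eq_intros)
  show "((\<lambda>y. sep Dr N p i j t y) has_real_derivative sep Dr N p i (Suc j) t x) (at x within {0..1})"
    unfolding sep_def using Dr[OF x]
    by (cases "i = 0") (auto intro!: derivative_eq_intros DERIV_sum DERIV_cmult sinn_diff_deriv simp: mult.commute)
qed auto

section \<open>Polynomial approximation\<close>

lemma poly_antiderivative: "\<exists>P :: real poly. pderiv P = p"
proof (intro exI poly_eqI)
  fix n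
  let ?P = "\<Sum>i\<le>degree p. monom (coeff p i / real (Suc i)) (Suc i)"
  have "coeff ?P (Suc n) = (\<Sum>i\<le>degree p. if i = n then coeff p n / real (Suc n) else 0)"
    unfolding coeff_sum by (intro sum.cong) auto
  also have "\<dots> = coeff p n / real (Suc n)" by (auto simp: coeff_eq_0)
  finally show "coeff (pderiv ?P) n = coeff p n" by (simp add: coeff_pderiv)
qed

lemma poly_approx_continuous:
  fixes f :: "real \<Rightarrow> real"
  assumes "continuous_on {a..b} f" "0 < e"
  obtains p where "\<And>x. x \<in> {a..b} \<Longrightarrow> \<bar>f x - poly p x\<bar> < e"
proof -
  obtain g where g: "real_polynomial_function g" "\<And>x. x \<in> {a..b} \<Longrightarrow> \<bar>f x - g x\<bar> < e"
    using Stone_Weierstrass_real_polynomial_function[OF _ assms] by auto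
  obtain c n where c: "g = (\<lambda>x. \<Sum>i\<le>n. c i * x ^ i)"
    using g(1) by (auto simp: real_polynomial_function_iff_sum)
  have "poly (\<Sum>i\<le>n. monom (c i) i) x = g x" for x
    by (simp add: c poly_sum poly_monom)
  then show ?thesis using that g(2) by metis
qed

text \<open>The derivative is approximated and integrated, which controls both functions; a linear
  correction then restores the value at \<open>b\<close>. Exact end values matter because test
  functions must vanish at both times and paths must start at the stationary solution.\<close>

lemma C1_poly_approx:
  fixes e e' :: "real \<Rightarrow> real"
  assumes ab: "a < b" and D: "\<And>t. t \<in> {a..b} \<Longrightarrow> (e has_real_derivative e' t) (at t within {a..b})"
    and e': "continuous_on {a..b} e'" and \<delta>: "0 < \<delta>"
  obtains p where "poly p a = e a" "poly p b = e b"
    "\<And>t. t \<in> {a..b} \<Longrightarrow> \<bar>poly p t - e t\<bar> \<le> \<delta>" "\<And>t. t \<in> {a..b} \<Longrightarrow> \<bar>poly (pderiv p) t - e' t\<bar> \<le> \<delta>"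
proof -
  \<comment> \<open>The error budget: the primitive is off by at most
    \<open>\<eta> * (b - a)\<close>, and the linear correction adds at most as much again, with
    slope at most \<open>\<eta>\<close>.\<close>
  define \<eta> where "\<eta> = \<delta> / (2 * (b - a) + 2)"
  have pos: "2 * (b - a) + 2 > 0" using ab by simp
  have \<eta>: "\<eta> > 0" using \<delta> pos by (simp add: \<eta>_def)
  have \<eta>\<delta>: "2 * (\<eta> * (b - a)) + 2 * \<eta> = \<delta>"
  proof -
    have "2 * (\<eta> * (b - a)) + 2 * \<eta> = \<eta> * (2 * (b - a) + 2)" by (simp add: algebra_simps)
    then show ?thesis using pos by (simp add: \<eta>_def)
  qed
  obtain q where q: "\<And>t. t \<in> {a..b} \<Longrightarrow> \<bar>e' t - poly q t\<bar> < \<eta>"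
    using poly_approx_continuous[OF e' \<eta>] by blast
  obtain P where P: "pderiv P = q" using poly_antiderivative by blast
  define P0 where "P0 = P + [:e a - poly P a:]"
  have dP0: "pderiv P0 = q" by (simp add: P0_def pderiv_add pderiv_pCons P)
  have P0a: "poly P0 a = e a" by (simp add: P0_def)
  have err: "\<bar>poly P0 t - e t\<bar> \<le> \<eta> * (b - a)" if t: "t \<in> {a..b}" for t
  proof (cases "t = a")
    case False
    then have at: "a < t" using t by auto
    have "((\<lambda>s. poly P0 s - e s) has_derivative (*) (poly q s - e' s)) (at s within {a..t})" if "a \<le> s" "s \<le> t" for s
    proof -
      have "((\<lambda>s. poly P0 s - e s) has_real_derivative (poly q s - e' s)) (at s within {a..t})"
        using DERIV_subset[OF D, of s "{a..t}"] that t poly_DERIV[of P0 s]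
        by (auto intro!: derivative_intros simp: dP0 intro: DERIV_subset[of _ _ _ UNIV])
      then show ?thesis by (simp add: has_field_derivative_def)
    qed
    from mvt_simple[OF at this] obtain s where s: "s \<in> {a<..<t}"
      "(poly P0 t - e t) - (poly P0 a - e a) = (poly q s - e' s) * (t - a)" by blast
    then have "\<bar>poly P0 t - e t\<bar> = \<bar>poly q s - e' s\<bar> * (t - a)" using at P0a by (simp add: abs_mult)
    also have "\<dots> \<le> \<eta> * (b - a)"
      using q[of s] s t at \<eta> by (intro mult_mono) auto
    finally show ?thesis .
  qed (use P0a \<eta> ab in auto)
  define d where "d = poly P0 b - e b"
  have d: "\<bar>d\<bar> \<le> \<eta> * (b - a)" using err[of b] ab by (simp add: d_def)
  define p where "p = P0 + smult (- d / (b - a)) [:- a, 1:]"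
  have pt: "poly p t = poly P0 t - d * ((t - a) / (b - a))" for t
    by (simp add: p_def diff_divide_distrib algebra_simps)
  have dp: "poly (pderiv p) t = poly q t - d / (b - a)" for t
    by (simp add: p_def pderiv_add pderiv_smult pderiv_pCons dP0)
  show ?thesis
  proof (rule that[of p])
    show "poly p a = e a" "poly p b = e b" using ab by (auto simp: pt P0a d_def)
    fix t assume t: "t \<in> {a..b}"
    have "\<bar>d * ((t - a) / (b - a))\<bar> \<le> \<bar>d\<bar> * 1"
      unfolding abs_mult using t ab by (intro mult_left_mono) auto
    moreover have "\<bar>A - X - E\<bar> \<le> \<delta>"
      if "\<bar>A - E\<bar> \<le> Y" "\<bar>X\<bar> \<le> \<bar>d\<bar> * 1" "\<bar>d\<bar> \<le> Y" "2 * Y + 2 * \<eta> = \<delta>" for A E X Y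
      using that \<eta> by linarith
    ultimately show "\<bar>poly p t - e t\<bar> \<le> \<delta>" using err[OF t] d \<eta>\<delta> unfolding pt by blast
    have "\<bar>d / (b - a)\<bar> \<le> \<eta>" using d ab by (simp add: divide_le_eq)
    moreover have "\<eta> * (b - a) > 0" using \<eta> ab by simp
    ultimately show "\<bar>poly (pderiv p) t - e' t\<bar> \<le> \<delta>"
      using q[OF t] \<eta>\<delta> unfolding dp by linarith
  qed
qed

section \<open>The action functional tested against sine polynomials\<close>

lemma openin_imp_sets_lebesgue_on:
  assumes "openin (top_of_set {a..b::real}) S"
  shows "S \<in> sets (lebesgue_on {a..b})"
proof -
  obtain V where "open V" "S = {a..b} \<inter> V" using assms by (auto simp: openin_open)
  then show ?thesis by (auto simp: sets_restrict_space)
qed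

lemma flux_le_tangent: "flux p \<le> (1 - 2 * c) * p + c\<^sup>2"
  using zero_le_power2[of "p - c"] by (simp add: flux_def power2_diff power2_eq_square algebra_simps)

lemma mobility_eq_flux: "mobility = flux"
  by (simp add: mobility_def flux_def fun_eq_iff)

lemma M_space_integrable:
  assumes "\<rho> \<in> M_space"
  shows "integrable (lebesgue_on {0..1}) \<rho>" "integrable (lebesgue_on {0..1}) (\<lambda>x. flux (\<rho> x))"
proof -
  have m: "\<rho> \<in> borel_measurable (lebesgue_on {0..1})" and A: "AE x in lebesgue_on {0..1}. 0 \<le> \<rho> x \<and> \<rho> x \<le> 1"
    using assms by (auto simp: M_space_def)
  have "AE x in lebesgue_on {0..1}. \<bar>\<rho> x\<bar> \<le> 1" using A by eventually_elim auto
  then show "integrable (lebesgue_on {0..1}) \<rho>" using m by (intro integrable_lebesgue_on_bounded) auto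
  have "AE x in lebesgue_on {0..1}. \<bar>flux (\<rho> x)\<bar> \<le> 1" using A
  proof eventually_elim
    case (elim x)
    then have "0 \<le> flux (\<rho> x)" by (simp add: flux_def)
    then show ?case using flux_le_quarter[of "\<rho> x"] by auto
  qed
  moreover have "(\<lambda>x. flux (\<rho> x)) \<in> borel_measurable (lebesgue_on {0..1})"
    unfolding flux_def using m by measurable
  ultimately show "integrable (lebesgue_on {0..1}) (\<lambda>x. flux (\<rho> x))"
    by (intro integrable_lebesgue_on_bounded) auto
qed

lemma M_space_flux_bounds:
  assumes "\<rho> \<in> M_space"
  shows "AE x in lebesgue_on {0..1}. 0 \<le> flux (\<rho> x) \<and> flux (\<rho> x) \<le> 1/4"
proof -
  have "AE x in lebesgue_on {0..1}. 0 \<le> \<rho> x \<and> \<rho> x \<le> 1" using assms by (simp add: M_space_def)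
  then show ?thesis by eventually_elim (intro conjI flux_le_quarter, simp add: flux_def)
qed

lemma integrable_sum_mult_cont:
  assumes "\<And>n. n \<in> A \<Longrightarrow> continuous_on {a..b} (c n)" "\<And>n. n \<in> A \<Longrightarrow> integrable (lebesgue_on {a..b::real}) (k n)"
  shows "integrable (lebesgue_on {a..b}) (\<lambda>t. \<Sum>n\<in>A. c n t * (k n t :: real))"
  using assms by (intro Bochner_Integration.integrable_sum integrable_mult_cont) auto

text \<open>The weights \<open>j * exp (- j * (t + T))\<close> have mass at most one and concentrate
  at the initial time, where \<open>f\<close> vanishes.\<close>

lemma boundary_layer_tendsto:
  fixes f :: "real \<Rightarrow> real"
  assumes T: "0 < T" and f: "continuous_on {-T..0} f" and f0: "f (-T) = 0"
  shows "(\<lambda>j. LINT t|lebesgue_on {-T..0}. real j * exp (- real j * (t + T)) * f t) \<longlonglongrightarrow> 0"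
proof (rule LIMSEQ_I)
  fix e :: real assume e: "0 < e"
  obtain K where K: "K \<ge> 0" "\<And>s t. s \<in> {-T..0} \<Longrightarrow> t \<in> {-T..0} \<Longrightarrow> \<bar>f s - f t\<bar> \<le> e/2 + K * \<bar>t - s\<bar>"
    using modulus_linear[OF f, of "e/2"] e by auto
  have "(\<lambda>j. K / real j) \<longlonglongrightarrow> 0" by (rule lim_const_over_n)
  then have "\<forall>\<^sub>F j in sequentially. K / real j < e/2" by (rule order_tendstoD) (use e in simp)
  then obtain j0 where j0: "\<And>j. j \<ge> j0 \<Longrightarrow> K / real j < e/2" by (auto simp: eventually_sequentially)
  have "norm ((LINT t|lebesgue_on {-T..0}. real j * exp (- real j * (t + T)) * f t) - 0) < e" if j: "j \<ge> max j0 1" for j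
  proof -
    let ?L = "lebesgue_on {-T..0}"
    let ?w = "\<lambda>t. real j * exp (- real j * (t + T))"
    have jp: "real j > 0" using j by simp
    have "norm (LINT t|?L. ?w t * f t) \<le> (LINT t|?L. norm (?w t * f t))" by (rule integral_norm_bound)
    also have "\<dots> \<le> (LINT t|?L. ?w t * (e/2 + K * (t + T)))"
    proof (rule integral_lebesgue_on_mono)
      fix t assume t: "t \<in> {-T..0}"
      have "\<bar>f t\<bar> \<le> e/2 + K * (t + T)" using K(2)[of t "-T"] t T f0 by (auto simp: abs_minus_commute)
      then show "norm (?w t * f t) \<le> ?w t * (e/2 + K * (t + T))"
        by (simp add: abs_mult mult_left_mono)
    qed (intro continuous_imp_integrable_real continuous_intros f)+
    also have "\<dots> = (- exp (- real j * (0 + T)) * (e/2 + K * (0 + T) + K / real j))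
       - (- exp (- real j * (- T + T)) * (e/2 + K * (- T + T) + K / real j))"
      by (rule FTC_lebesgue_on)
         (use T jp in \<open>auto intro!: continuous_intros derivative_eq_intros simp: field_simps\<close>)
    also have "\<dots> \<le> e/2 + K / real j"
      using K e jp T by (auto intro!: mult_nonneg_nonneg add_nonneg_nonneg)
    also have "\<dots> < e"
    proof -
      have "K / real j < e/2" using j by (intro j0) simp
      then show ?thesis by linarith
    qed
    finally show ?thesis by simp
  qed
  then show "\<exists>no. \<forall>n\<ge>no. norm ((LINT t|lebesgue_on {-T..0}. real n * exp (- real n * (t + T)) * f t) - 0) < e"
    by blast
qed

text \<open>One fixed path with a bound \<open>I\<close> on its action; the supremum in
  \<open>I_fun\<close> enters as one inequality per test function. \<open>J\<close> and
  \<open>Dr\<close> are the data provided by \<open>stationary_facts\<close>.\<close>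

locale finite_action_path =
  fixes \<epsilon> \<rho>\<^sub>0 \<rho>\<^sub>1 J T I :: real and \<rho>b :: "real \<Rightarrow> real" and Dr :: "nat \<Rightarrow> real \<Rightarrow> real"
    and u :: "real \<Rightarrow> real \<Rightarrow> real"
  assumes \<rho>01: "0 < \<rho>\<^sub>0" "\<rho>\<^sub>0 < \<rho>\<^sub>1" "\<rho>\<^sub>1 < 1" and \<epsilon>: "0 < \<epsilon>" and T: "0 < T" and I: "0 \<le> I"
    and Dr0: "Dr 0 = \<rho>b"
    and Dr: "\<And>j x. x \<in> {0..1} \<Longrightarrow> (Dr j has_real_derivative Dr (Suc j) x) (at x within {0..1})"
    and ode: "\<And>x. x \<in> {0..1} \<Longrightarrow> \<epsilon> * Dr 1 x = flux (\<rho>b x) - J"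
    and \<rho>b_range: "\<And>x. x \<in> {0..1} \<Longrightarrow> \<rho>\<^sub>0 \<le> \<rho>b x \<and> \<rho>b x \<le> \<rho>\<^sub>1"
    and \<rho>b_ends: "\<rho>b 0 = \<rho>\<^sub>0" "\<rho>b 1 = \<rho>\<^sub>1"
    and u_path: "continuous_map (top_of_set {-T..0}) M_top u"
    and u_init: "AE x in lebesgue_on {0..1}. u (-T) x = \<rho>b x"
    and action: "\<And>H. H \<in> test_C0 T \<Longrightarrow>
      L_fun \<epsilon> \<rho>\<^sub>0 \<rho>\<^sub>1 T u H - \<epsilon> * inner2 T (dx H) (\<lambda>t x. mobility (u t x) * dx H t x) \<le> I"
begin

abbreviation "Lt \<equiv> lebesgue_on {-T..0}"
abbreviation "Lx \<equiv> lebesgue_on {0..1::real}"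

text \<open>Let \<open>y\<close> be the space derivative of the test function. Since mobility and
  flux coincide, the two terms of the action that contain \<open>flux (u t x)\<close> combine to
  \<open>- flux (u t x) * psi y\<close>. The comparison of the actions rests on \<open>psi\<close>
  being convex and \<open>flux\<close> concave.\<close>

definition psi :: "real \<Rightarrow> real" where "psi y = y + \<epsilon> * y\<^sup>2"
definition b :: "nat \<Rightarrow> real \<Rightarrow> real" where "b n t = inner1 (u t) (sinn n) - inner1 \<rho>b (sinn n)"
definition s :: "nat \<Rightarrow> real" where "s n = inner1 (\<lambda>x. flux (\<rho>b x)) (cosn n)"
definition q :: "(real \<Rightarrow> real) \<Rightarrow> real \<Rightarrow> real" where "q \<phi> t = inner1 (\<lambda>x. flux (u t x)) \<phi>"
definition w :: "nat \<Rightarrow> real" where "w n = real n * pi"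

section \<open>Pairings with the path and their regularity in time\<close>

lemma \<rho>b_cont: "continuous_on {0..1} \<rho>b"
  using DERIV_continuous_on[OF Dr, of 0] by (simp add: Dr0)

lemma Dr_cont: "continuous_on {0..1} (Dr j)"
  by (rule DERIV_continuous_on[OF Dr])

lemma \<rho>b_int: "integrable Lx \<rho>b"
  by (rule continuous_imp_integrable_real[OF \<rho>b_cont])

lemma \<rho>b_flux_int: "integrable Lx (\<lambda>x. flux (\<rho>b x))"
  by (intro continuous_imp_integrable_real continuous_intros \<rho>b_cont)

lemma u_M: "t \<in> {-T..0} \<Longrightarrow> u t \<in> M_space"
  using continuous_map_image_subset_topspace[OF u_path] by (auto simp: topspace_M_top)

lemma u_int: "t \<in> {-T..0} \<Longrightarrow> integrable Lx (u t)"
  and u_flux_int: "t \<in> {-T..0} \<Longrightarrow> integrable Lx (\<lambda>x. flux (u t x))"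
  using u_M M_space_integrable by blast+

lemma u_pair_cont:
  assumes "integrable Lx \<phi>"
  shows "continuous_on {-T..0} (\<lambda>t. inner1 (u t) \<phi>)"
proof -
  have "continuous_map (top_of_set {-T..0}) euclideanreal ((\<lambda>\<rho>. inner1 \<rho> \<phi>) \<circ> u)"
    by (rule continuous_map_compose[OF u_path continuous_map_M_top_pairing])
       (use assms in \<open>simp add: L1_space_def\<close>)
  then show ?thesis by (simp add: o_def)
qed

lemma q_bounds:
  assumes t: "t \<in> {-T..0}" and \<phi>: "continuous_on {0..1} \<phi>" and B: "\<And>x. x \<in> {0..1} \<Longrightarrow> \<bar>\<phi> x\<bar> \<le> B"
  shows "\<bar>q \<phi> t\<bar> \<le> B"
proof -
  have "\<bar>LINT x|Lx. \<phi> x * flux (u t x)\<bar> \<le> 1/4 * (LINT x|Lx. \<bar>\<phi> x\<bar>)"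
  proof (rule abs_integral_le_bound[OF continuous_imp_integrable_real[OF \<phi>]])
    show "AE x in Lx. \<bar>flux (u t x)\<bar> \<le> 1/4"
      using M_space_flux_bounds[OF u_M[OF t]] by eventually_elim auto
  qed (use u_flux_int[OF t] in auto)
  also have "(LINT x|Lx. \<bar>\<phi> x\<bar>) \<le> B * (1 - 0)"
    by (rule integral_lebesgue_on_le_const) (use B in \<open>auto intro!: continuous_imp_integrable_real continuous_intros \<phi>\<close>)
  finally have "\<bar>q \<phi> t\<bar> \<le> 1/4 * B" by (simp add: q_def inner1_def mult.commute)
  moreover have "0 \<le> B" using B[of 0] by auto
  ultimately show ?thesis by linarith
qed

text \<open>For \<open>\<phi> \<ge> 0\<close> the map \<open>t \<mapsto> q \<phi> t\<close> is upper semicontinuous: near \<open>t0\<close>, the concave flux lies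
  below its tangent at \<open>u t0\<close>, whose pairing with \<open>\<phi>\<close> is continuous in \<open>t\<close>.\<close>

lemma q_measurable_nonneg:
  assumes \<phi>: "continuous_on {0..1} \<phi>" and nonneg: "\<And>x. x \<in> {0..1} \<Longrightarrow> 0 \<le> \<phi> x"
  shows "q \<phi> \<in> borel_measurable Lt"
  unfolding borel_measurable_iff_less
proof
  fix a
  have "openin (top_of_set {-T..0}) {t \<in> {-T..0}. q \<phi> t < a}"
    unfolding openin_subopen[of _ "{t \<in> {-T..0}. q \<phi> t < a}"]
  proof
    fix t0 assume "t0 \<in> {t \<in> {-T..0}. q \<phi> t < a}"
    then have t0: "t0 \<in> {-T..0}" and a: "q \<phi> t0 < a" by auto
    let ?c = "u t0"
    have cm: "?c \<in> borel_measurable Lx" and cb: "AE x in Lx. 0 \<le> ?c x \<and> ?c x \<le> 1"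
      using u_M[OF t0] by (auto simp: M_space_def)
    note phi_int = continuous_imp_integrable_real[OF \<phi>]
    have i1: "integrable Lx (\<lambda>x. \<phi> x * (1 - 2 * ?c x))"
    proof (rule integrable_mult_bounded[OF phi_int, of _ 1])
      show "AE x in Lx. \<bar>1 - 2 * ?c x\<bar> \<le> 1" using cb by eventually_elim auto
    qed (use cm in auto)
    have i2: "integrable Lx (\<lambda>x. \<phi> x * (?c x)\<^sup>2)"
    proof (rule integrable_mult_bounded[OF phi_int, of _ 1])
      show "AE x in Lx. \<bar>(?c x)\<^sup>2\<bar> \<le> 1" using cb by eventually_elim (auto simp: power_le_one)
    qed (use cm in auto)
    define G where "G = (\<lambda>t. inner1 (u t) (\<lambda>x. \<phi> x * (1 - 2 * ?c x)) + (LINT x|Lx. \<phi> x * (?c x)\<^sup>2))"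
    have Gc: "continuous_on {-T..0} G" unfolding G_def by (intro continuous_intros u_pair_cont i1)
    have Gi: "integrable Lx (\<lambda>x. u t x * (\<phi> x * (1 - 2 * ?c x)))" if t: "t \<in> {-T..0}" for t
    proof -
      have "AE x in Lx. \<bar>u t x\<bar> \<le> 1"
        using u_M[OF t] unfolding M_space_def by (auto elim: eventually_mono)
      then have "integrable Lx (\<lambda>x. (\<phi> x * (1 - 2 * ?c x)) * u t x)"
        using u_int[OF t] by (intro integrable_mult_bounded[OF i1]) auto
      then show ?thesis by (simp add: mult.commute)
    qed
    have Geq: "G t = (LINT x|Lx. \<phi> x * ((1 - 2 * ?c x) * u t x + (?c x)\<^sup>2))" if t: "t \<in> {-T..0}" for t
      using Gi[OF t] i2 by (simp add: G_def inner1_def algebra_simps flip: Bochner_Integration.integral_add)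
    have le: "q \<phi> t \<le> G t" if t: "t \<in> {-T..0}" for t
      unfolding Geq[OF t] q_def inner1_def
    proof (rule integral_lebesgue_on_mono)
      show "integrable Lx (\<lambda>x. flux (u t x) * \<phi> x)" by (rule inner1_integrable[OF u_flux_int[OF t] \<phi>])
      show "integrable Lx (\<lambda>x. \<phi> x * ((1 - 2 * ?c x) * u t x + (?c x)\<^sup>2))"
        using Bochner_Integration.integrable_add[OF Gi[OF t] i2] by (simp add: algebra_simps)
      fix x :: real assume "x \<in> {0..1}"
      then show "flux (u t x) * \<phi> x \<le> \<phi> x * ((1 - 2 * ?c x) * u t x + (?c x)\<^sup>2)"
        using mult_left_mono[OF flux_le_tangent[of "u t x" "?c x"] nonneg[of x]] by (simp only: mult.commute[of "flux (u t x)"])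
    qed
    have "G t0 = q \<phi> t0" unfolding Geq[OF t0] q_def inner1_def
      by (rule integral_lebesgue_on_cong) (simp add: flux_def power2_eq_square algebra_simps)
    then have "t0 \<in> {-T..0} \<inter> G -` {..<a}" using a t0 by auto
    moreover have "openin (top_of_set {-T..0}) ({-T..0} \<inter> G -` {..<a})"
      by (rule continuous_openin_preimage_gen[OF Gc]) auto
    moreover have "{-T..0} \<inter> G -` {..<a} \<subseteq> {t \<in> {-T..0}. q \<phi> t < a}" using le by fastforce
    ultimately show "\<exists>S. openin (top_of_set {-T..0}) S \<and> t0 \<in> S \<and> S \<subseteq> {t \<in> {-T..0}. q \<phi> t < a}" by blast
  qed
  then show "{t \<in> space Lt. q \<phi> t < a} \<in> sets Lt"
    using openin_imp_sets_lebesgue_on by simp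
qed

text \<open>Adding a constant makes \<open>\<phi>\<close> nonnegative, and the constant is
  nonnegative itself, so measurability follows by subtraction.\<close>

lemma q_int:
  assumes \<phi>: "continuous_on {0..1} \<phi>"
  shows "integrable Lt (q \<phi>)"
proof -
  have "bounded (\<phi> ` {0..1})" using \<phi> by (intro compact_imp_bounded compact_continuous_image) auto
  then obtain B where B: "B > 0" "\<forall>y\<in>\<phi> ` {0..1}. norm y \<le> B" unfolding bounded_pos by blast
  then have B': "\<bar>\<phi> x\<bar> \<le> B" if "x \<in> {0..1}" for x using that by auto
  have "0 \<le> \<phi> x + B" if "x \<in> {0..1}" for x using B'[OF that] by linarith
  then have m: "(\<lambda>t. q (\<lambda>x. \<phi> x + B) t - q (\<lambda>_. B) t) \<in> borel_measurable Lt"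
    using B(1) by (intro borel_measurable_diff q_measurable_nonneg continuous_intros \<phi>) auto
  have eq: "q \<phi> t = q (\<lambda>x. \<phi> x + B) t - q (\<lambda>_. B) t" if "t \<in> {-T..0}" for t
    using inner1_add_right[OF u_flux_int[OF that] \<phi>, of "\<lambda>_. B"] by (simp add: q_def)
  have "q \<phi> \<in> borel_measurable Lt"
    by (rule measurable_cong[THEN iffD1, OF _ m]) (simp add: eq)
  then show ?thesis
    by (rule integrable_lebesgue_on_bounded[of _ _ _ B]) (intro AE_lebesgue_onI q_bounds \<phi> B')
qed

lemma b_cont: "continuous_on {-T..0} (b n)"
  unfolding b_def by (intro continuous_intros u_pair_cont integrable_sinn)

lemma b_int: "integrable Lt (b n)"
  by (rule continuous_imp_integrable_real[OF b_cont])

lemma b_init: "b n (-T) = 0"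
proof -
  have "inner1 (u (-T)) (sinn n) = inner1 \<rho>b (sinn n)"
    unfolding inner1_def
  proof (rule integral_cong_AE)
    show "(\<lambda>x. u (- T) x * sinn n x) \<in> borel_measurable Lx" "(\<lambda>x. \<rho>b x * sinn n x) \<in> borel_measurable Lx"
      using inner1_integrable[OF u_int continuous_on_sinn] inner1_integrable[OF \<rho>b_int continuous_on_sinn] T by auto
    show "AE x in Lx. u (- T) x * sinn n x = \<rho>b x * sinn n x" using u_init by eventually_elim simp
  qed
  then show ?thesis by (simp add: b_def)
qed

section \<open>The action as a quadratic form in sine coefficients\<close>

definition A :: "nat \<Rightarrow> real \<Rightarrow> real" where
  "A n t = \<epsilon> * (w n)\<^sup>2 * b n t + w n * s n - w n * q (cosn n) t"
definition B :: "nat \<Rightarrow> nat \<Rightarrow> real \<Rightarrow> real" where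
  "B n m t = \<epsilon> * w n * w m * q (\<lambda>x. cosn n x * cosn m x) t"

lemma A_int: "integrable Lt (A n)"
  unfolding A_def using b_int q_int[OF continuous_on_cosn] by auto

lemma B_int: "integrable Lt (B n m)"
  unfolding B_def using q_int[of "\<lambda>x. cosn n x * cosn m x"] by (auto intro: continuous_intros)

text \<open>The time density of the action at the test function with sine coefficients
  \<open>c n\<close>. The time derivative \<open>c'\<close> is a separate argument because the time
  cut-offs will pair \<open>c\<close> with functions that are not its derivative.\<close>

definition Fint :: "nat \<Rightarrow> (nat \<Rightarrow> real \<Rightarrow> real) \<Rightarrow> (nat \<Rightarrow> real \<Rightarrow> real) \<Rightarrow> real \<Rightarrow> real" where
  "Fint N c c' t = (\<Sum>n\<in>{1..<N}. - c' n t * b n t) + (\<Sum>n\<in>{1..<N}. c n t * A n t)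
     - (\<Sum>n\<in>{1..<N}. \<Sum>m\<in>{1..<N}. (c n t * c m t) * B n m t)"

lemma Fint_int:
  assumes "\<And>n. n \<in> {1..<N} \<Longrightarrow> continuous_on {-T..0} (c n)" "\<And>n. n \<in> {1..<N} \<Longrightarrow> continuous_on {-T..0} (c' n)"
  shows "integrable Lt (\<lambda>t. \<Sum>n\<in>{1..<N}. - c' n t * b n t)"
    "integrable Lt (\<lambda>t. \<Sum>n\<in>{1..<N}. c n t * A n t)"
    "integrable Lt (\<lambda>t. \<Sum>n\<in>{1..<N}. \<Sum>m\<in>{1..<N}. (c n t * c m t) * B n m t)"
    "integrable Lt (Fint N c c')"
proof -
  show 1: "integrable Lt (\<lambda>t. \<Sum>n\<in>{1..<N}. - c' n t * b n t)"
    by (rule integrable_sum_mult_cont) (use assms b_int in \<open>auto intro: continuous_intros\<close>)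
  show 2: "integrable Lt (\<lambda>t. \<Sum>n\<in>{1..<N}. c n t * A n t)"
    by (rule integrable_sum_mult_cont) (use assms A_int in auto)
  show 3: "integrable Lt (\<lambda>t. \<Sum>n\<in>{1..<N}. \<Sum>m\<in>{1..<N}. (c n t * c m t) * B n m t)"
    by (intro Bochner_Integration.integrable_sum integrable_mult_cont continuous_intros B_int) (use assms in auto)
  show "integrable Lt (Fint N c c')" unfolding Fint_def using 1 2 3 by auto
qed

lemma sq_expand:
  assumes t: "t \<in> {-T..0}"
  shows "inner1 (\<lambda>x. flux (u t x)) (\<lambda>x. (\<Sum>n\<in>K. d n * cosn n x)\<^sup>2)
    = (\<Sum>n\<in>K. \<Sum>m\<in>K. d n * d m * q (\<lambda>x. cosn n x * cosn m x) t)"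
proof -
  have "(\<lambda>x. (\<Sum>n\<in>K. d n * cosn n x)\<^sup>2) = (\<lambda>x. \<Sum>n\<in>K. d n * (\<Sum>m\<in>K. d m * (cosn n x * cosn m x)))"
    by (simp add: fun_eq_iff power2_eq_square sum_product sum_distrib_left algebra_simps)
  then have "inner1 (\<lambda>x. flux (u t x)) (\<lambda>x. (\<Sum>n\<in>K. d n * cosn n x)\<^sup>2)
      = (\<Sum>n\<in>K. d n * inner1 (\<lambda>x. flux (u t x)) (\<lambda>x. \<Sum>m\<in>K. d m * (cosn n x * cosn m x)))"
    by (simp only:) (intro inner1_sum u_flux_int t continuous_intros)
  also have "\<dots> = (\<Sum>n\<in>K. d n * (\<Sum>m\<in>K. d m * q (\<lambda>x. cosn n x * cosn m x) t))"
    unfolding q_def by (intro sum.cong refl arg_cong2[where f="(*)"] inner1_sum u_flux_int t continuous_intros)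
  finally show ?thesis by (simp add: sum_distrib_left mult.assoc)
qed

lemma psi_expand:
  assumes t: "t \<in> {-T..0}"
  shows "inner1 (\<lambda>x. flux (u t x)) (\<lambda>x. psi (\<Sum>n\<in>K. d n * (w n * cosn n x)))
    = (\<Sum>n\<in>K. d n * (w n * q (cosn n) t)) + (\<Sum>n\<in>K. \<Sum>m\<in>K. (d n * d m) * B n m t)"
proof -
  have eq: "(\<Sum>n\<in>K. d n * (w n * cosn n x)) = (\<Sum>n\<in>K. (d n * w n) * cosn n x)" for x
    by (simp add: mult.assoc)
  have "inner1 (\<lambda>x. flux (u t x)) (\<lambda>x. psi (\<Sum>n\<in>K. (d n * w n) * cosn n x))
     = inner1 (\<lambda>x. flux (u t x)) (\<lambda>x. \<Sum>n\<in>K. (d n * w n) * cosn n x)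
     + inner1 (\<lambda>x. flux (u t x)) (\<lambda>x. \<epsilon> * (\<Sum>n\<in>K. (d n * w n) * cosn n x)\<^sup>2)"
    unfolding psi_def by (rule inner1_add_right[OF u_flux_int[OF t]]) (intro continuous_intros)+
  moreover have "inner1 (\<lambda>x. flux (u t x)) (\<lambda>x. \<Sum>n\<in>K. (d n * w n) * cosn n x) = (\<Sum>n\<in>K. (d n * w n) * q (cosn n) t)"
    unfolding q_def by (intro inner1_sum u_flux_int t continuous_intros)
  ultimately show ?thesis
    unfolding eq inner1_cmult_right sq_expand[OF t]
    by (simp add: B_def sum_distrib_left mult_ac)
qed

text \<open>Integration by parts and the stationary equation, whose constant \<open>J\<close> is
  orthogonal to \<open>cosn n\<close> for \<open>n > 0\<close>. The boundary term of
  \<open>L_fun\<close> is absorbed in this way: only the centred coefficients \<open>b n\<close> and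
  the stationary flux \<open>s n\<close> remain.\<close>

lemma \<rho>b_fourier: "\<epsilon> * w n * (\<rho>\<^sub>1 * cosn n 1 - \<rho>\<^sub>0 * cosn n 0) = w n * s n - \<epsilon> * (w n)\<^sup>2 * inner1 \<rho>b (sinn n)"
proof (cases "n = 0")
  case False
  have D: "(\<rho>b has_real_derivative Dr 1 x) (at x within {0..1})" if "x \<in> {0..1}" for x
    using Dr[OF that, of 0] by (simp add: Dr0)
  have "(LINT x|Lx. Dr 1 x * cosn n x + \<rho>b x * (- w n * sinn n x)) = \<rho>b 1 * cosn n 1 - \<rho>b 0 * cosn n 0"
    by (rule FTC_lebesgue_on)
       (use \<rho>b_cont Dr_cont D in \<open>auto intro!: continuous_intros derivative_eq_intros cosn_deriv simp: w_def\<close>)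
  moreover have "(LINT x|Lx. Dr 1 x * cosn n x + \<rho>b x * (- w n * sinn n x)) = inner1 (Dr 1) (cosn n) + inner1 \<rho>b (\<lambda>x. - w n * sinn n x)"
    unfolding inner1_def
    by (intro Bochner_Integration.integral_add continuous_imp_integrable_real continuous_intros \<rho>b_cont Dr_cont)
  ultimately have 1: "\<rho>\<^sub>1 * cosn n 1 - \<rho>\<^sub>0 * cosn n 0 = inner1 (Dr 1) (cosn n) - w n * inner1 \<rho>b (sinn n)"
    using inner1_cmult_right[of \<rho>b "- w n" "sinn n"] by (simp add: \<rho>b_ends)
  have "\<epsilon> * inner1 (Dr 1) (cosn n) = inner1 (\<lambda>x. \<epsilon> * Dr 1 x) (cosn n)" by (simp add: inner1_cmult_left)
  also have "\<dots> = inner1 (\<lambda>x. flux (\<rho>b x) - J * cosn 0 x) (cosn n)" by (rule inner1_cong) (simp_all add: ode del: One_nat_def)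
  also have "\<dots> = s n - J * inner1 (cosn 0) (cosn n)"
    unfolding s_def inner1_cmult_left[symmetric]
    by (intro inner1_diff_left \<rho>b_flux_int continuous_intros continuous_imp_integrable_real)
  finally have "\<epsilon> * inner1 (Dr 1) (cosn n) = s n" using False by (simp add: inner1_cosn_cosn del: cosn_0)
  then show ?thesis unfolding 1 by (simp add: algebra_simps power2_eq_square)
qed (simp add: w_def)

text \<open>Sine sums with polynomial coefficients are admissible test functions. Replacing
  \<open>u\<close> by \<open>u - \<rho>b\<close> in the term with the time derivative changes
  nothing, since \<open>\<rho>b\<close> does not depend on time and the coefficients vanish at both
  times.\<close>

lemma action_polynomial:
  assumes p: "\<And>n. n \<in> {1..<N} \<Longrightarrow> poly (p n) (-T) = 0 \<and> poly (p n) 0 = 0"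
  shows "(LINT t|Lt. Fint N (\<lambda>n. poly (p n)) (\<lambda>n. poly (pderiv (p n))) t) \<le> I"
proof -
  let ?K = "{1..<N}"
  let ?D = "sep (\<lambda>_ _. 0) N p"
  let ?H = "?D 0 0"
  let ?c = "\<lambda>n. poly (p n)" and ?c' = "\<lambda>n. poly (pderiv (p n))"
  have rd: "rect_derivs T ?H ?D" by (rule rect_derivs_sep) simp
  have cc: "continuous_on S (?c n)" "continuous_on S (?c' n)" for S n by (intro continuous_intros)+
  have "?H \<in> test_C0 T"
    unfolding test_C0_def test_lateral_def smooth_rect_rect_derivs
    using rd p by (auto simp: sep_def)
  note act = action[OF this]
  have Ht: "dt T ?H t x = (\<Sum>n\<in>?K. ?c' n t * sinn n x)" if "t \<in> {-T..0}" "x \<in> {0..1}" for t x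
    using rect_derivs_dt[OF rd T that] by (simp add: sep_def)
  have Hx: "dx ?H t x = (\<Sum>n\<in>?K. (?c n t * w n) * cosn n x)" if "t \<in> {-T..0}" "x \<in> {0..1}" for t x
    using rect_derivs_dx[OF rd that] by (simp add: sep_def w_def mult.assoc)
  have Hxx: "dx (dx ?H) t x = (\<Sum>n\<in>?K. (- ?c n t * (w n)\<^sup>2) * sinn n x)" if "t \<in> {-T..0}" "x \<in> {0..1}" for t x
    using rect_derivs_dxx[OF rd that] by (simp add: sep_def w_def mult.assoc)
  let ?bu = "\<lambda>n t. inner1 (u t) (sinn n)"
  have bui: "integrable Lt (?bu n)" for n
    by (rule continuous_imp_integrable_real[OF u_pair_cont]) simp
  let ?e1 = "\<lambda>t. \<Sum>n\<in>?K. ?c' n t * ?bu n t"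
  let ?e2 = "\<lambda>t. \<Sum>n\<in>?K. ?c n t * (w n * q (cosn n) t)"
  let ?e3 = "\<lambda>t. \<Sum>n\<in>?K. ?c n t * (- (w n)\<^sup>2 * ?bu n t)"
  let ?e4 = "\<lambda>t. \<Sum>n\<in>?K. ?c n t * (w n * (\<rho>\<^sub>1 * cosn n 1 - \<rho>\<^sub>0 * cosn n 0))"
  let ?e5 = "\<lambda>t. \<Sum>n\<in>?K. \<Sum>m\<in>?K. (?c n t * ?c m t) * (w n * w m * q (\<lambda>x. cosn n x * cosn m x) t)"
  let ?e6 = "\<lambda>t. \<Sum>n\<in>?K. ?c' n t * inner1 \<rho>b (sinn n)"
  have i1: "integrable Lt ?e1" and i2: "integrable Lt ?e2" and i3: "integrable Lt ?e3" and i4: "integrable Lt ?e4" and i6: "integrable Lt ?e6"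
    by (rule integrable_sum_mult_cont, rule cc, use q_int[OF continuous_on_cosn] bui in simp)+
  have i5: "integrable Lt ?e5"
    using q_int[of "\<lambda>x. cosn _ x * cosn _ x"]
    by (intro Bochner_Integration.integrable_sum integrable_mult_cont continuous_intros Bochner_Integration.integrable_mult_right)
       (auto intro!: continuous_intros)
  have 1: "inner2 T u (dt T ?H) = (LINT t|Lt. ?e1 t)"
    unfolding inner2_def
  proof (rule integral_lebesgue_on_cong)
    fix t assume t: "t \<in> {-T..0}"
    have "inner1 (u t) (dt T ?H t) = inner1 (u t) (\<lambda>x. \<Sum>n\<in>?K. ?c' n t * sinn n x)"
      by (rule inner1_cong[OF refl Ht[OF t]])
    also have "\<dots> = ?e1 t" by (rule inner1_sum[OF u_int[OF t]]) (intro continuous_intros)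
    finally show "inner1 (u t) (dt T ?H t) = ?e1 t" .
  qed
  have 2: "inner2 T (\<lambda>t x. flux (u t x)) (dx ?H) = (LINT t|Lt. ?e2 t)"
    unfolding inner2_def
  proof (rule integral_lebesgue_on_cong)
    fix t assume t: "t \<in> {-T..0}"
    have "inner1 (\<lambda>x. flux (u t x)) (dx ?H t) = inner1 (\<lambda>x. flux (u t x)) (\<lambda>x. \<Sum>n\<in>?K. (?c n t * w n) * cosn n x)"
      by (rule inner1_cong[OF refl Hx[OF t]])
    also have "\<dots> = ?e2 t" unfolding q_def mult.assoc[symmetric]
      by (rule inner1_sum[OF u_flux_int[OF t]]) (intro continuous_intros)
    finally show "inner1 (\<lambda>x. flux (u t x)) (dx ?H t) = ?e2 t" .
  qed
  have 3: "inner2 T u (dx (dx ?H)) = (LINT t|Lt. ?e3 t)"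
    unfolding inner2_def
  proof (rule integral_lebesgue_on_cong)
    fix t assume t: "t \<in> {-T..0}"
    have "inner1 (u t) (dx (dx ?H) t) = inner1 (u t) (\<lambda>x. \<Sum>n\<in>?K. (- ?c n t * (w n)\<^sup>2) * sinn n x)"
      by (rule inner1_cong[OF refl Hxx[OF t]])
    also have "\<dots> = (\<Sum>n\<in>?K. (- ?c n t * (w n)\<^sup>2) * ?bu n t)" by (rule inner1_sum[OF u_int[OF t]]) (intro continuous_intros)
    finally show "inner1 (u t) (dx (dx ?H) t) = ?e3 t" by (simp add: mult.assoc)
  qed
  have 4: "(LINT t|Lt. \<rho>\<^sub>1 * dx ?H t 1 - \<rho>\<^sub>0 * dx ?H t 0) = (LINT t|Lt. ?e4 t)"
    by (rule integral_lebesgue_on_cong)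
       (simp add: Hx sum_distrib_left sum_subtractf[symmetric] algebra_simps)
  have 5: "inner2 T (dx ?H) (\<lambda>t x. mobility (u t x) * dx ?H t x) = (LINT t|Lt. ?e5 t)"
    unfolding inner2_def mobility_eq_flux
  proof (rule integral_lebesgue_on_cong)
    fix t assume t: "t \<in> {-T..0}"
    have "inner1 (dx ?H t) (\<lambda>x. flux (u t x) * dx ?H t x) = inner1 (\<lambda>x. flux (u t x)) (\<lambda>x. (\<Sum>n\<in>?K. (?c n t * w n) * cosn n x)\<^sup>2)"
      unfolding inner1_def by (rule integral_lebesgue_on_cong) (simp add: Hx[OF t] power2_eq_square mult_ac)
    also have "\<dots> = ?e5 t" unfolding sq_expand[OF t] by (simp add: mult_ac)
    finally show "inner1 (dx ?H t) (\<lambda>x. flux (u t x) * dx ?H t x) = ?e5 t" .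
  qed
  have "(LINT t|Lt. ?e6 t) = (\<Sum>n\<in>?K. ?c n 0 * inner1 \<rho>b (sinn n)) - (\<Sum>n\<in>?K. ?c n (-T) * inner1 \<rho>b (sinn n))"
    by (rule FTC_lebesgue_on) (use T in \<open>auto intro!: continuous_intros derivative_eq_intros\<close>)
  then have 6: "(LINT t|Lt. ?e6 t) = 0" using p by simp
  have pw: "Fint N ?c ?c' t = - ?e1 t + ?e6 t - ?e2 t - \<epsilon> * ?e3 t + \<epsilon> * ?e4 t - \<epsilon> * ?e5 t" for t
  proof -
    have a: "(\<Sum>n\<in>?K. - ?c' n t * b n t) = - ?e1 t + ?e6 t"
      by (simp add: b_def algebra_simps sum.distrib sum_subtractf sum_negf)
    have "?c n t * A n t = - (?c n t * (w n * q (cosn n) t)) - \<epsilon> * (?c n t * (- (w n)\<^sup>2 * ?bu n t))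
        + \<epsilon> * (?c n t * (w n * (\<rho>\<^sub>1 * cosn n 1 - \<rho>\<^sub>0 * cosn n 0)))" for n
    proof -
      have "\<epsilon> * (?c n t * (w n * (\<rho>\<^sub>1 * cosn n 1 - \<rho>\<^sub>0 * cosn n 0))) = ?c n t * (\<epsilon> * w n * (\<rho>\<^sub>1 * cosn n 1 - \<rho>\<^sub>0 * cosn n 0))"
        by (simp only: mult_ac)
      then show ?thesis unfolding \<rho>b_fourier by (simp add: A_def b_def algebra_simps)
    qed
    then have bb: "(\<Sum>n\<in>?K. ?c n t * A n t) = - ?e2 t - \<epsilon> * ?e3 t + \<epsilon> * ?e4 t"
      by (simp only: sum.distrib sum_subtractf sum_negf sum_distrib_left)
    have "(\<Sum>n\<in>?K. \<Sum>m\<in>?K. (?c n t * ?c m t) * B n m t) = \<epsilon> * ?e5 t"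
      by (simp add: B_def sum_distrib_left mult_ac)
    then show ?thesis unfolding Fint_def a bb by simp
  qed
  have "(LINT t|Lt. Fint N ?c ?c' t) = - (LINT t|Lt. ?e1 t) + (LINT t|Lt. ?e6 t) - (LINT t|Lt. ?e2 t)
      - \<epsilon> * (LINT t|Lt. ?e3 t) + \<epsilon> * (LINT t|Lt. ?e4 t) - \<epsilon> * (LINT t|Lt. ?e5 t)"
    unfolding pw using i1 i2 i3 i4 i5 i6
    by (simp del: Bochner_Integration.integral_sum sum.cong)
  then show ?thesis using act 6 unfolding L_fun_def 1 2 3 4 5 by simp
qed

end

lemma AE_lebesgue_on_not_eq: "AE t in lebesgue_on {a..b::real}. t \<noteq> c"
proof -
  have "AE t in lebesgue. t \<notin> {c}" by (rule AE_not_in) (simp add: negligible_iff_null_sets[symmetric])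
  then have "AE t in lebesgue. t \<in> {a..b} \<longrightarrow> t \<noteq> c" by eventually_elim blast
  then show ?thesis by (subst AE_restrict_space_iff) simp_all
qed

context finite_action_path
begin

text \<open>Time cut-offs \<open>1 - exp (- j (t + T))\<close> turn test functions that vanish at the final time only
  into admissible ones; no boundary term survives because \<open>b n (-T) = 0\<close>.\<close>

lemma action_C1:
  assumes c: "\<And>n t. n \<in> {1..<N} \<Longrightarrow> t \<in> {-T..0} \<Longrightarrow> (c n has_real_derivative c' n t) (at t within {-T..0})"
    and c': "\<And>n. n \<in> {1..<N} \<Longrightarrow> continuous_on {-T..0} (c' n)"
    and c0: "\<And>n. n \<in> {1..<N} \<Longrightarrow> c n 0 = 0"
  shows "(LINT t|Lt. Fint N c c' t) \<le> I"
proof -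
  let ?K = "{1..<N}"
  have cc: "continuous_on {-T..0} (c n)" if "n \<in> ?K" for n by (rule DERIV_continuous_on[OF c[OF that]])
  define cut where "cut = (\<lambda>j t. 1 - exp (- real j * (t + T)))"
  define cut' where "cut' = (\<lambda>j t. real j * exp (- real j * (t + T)))"
  have cutD: "(cut j has_real_derivative cut' j t) (at t within S)" for j t S
    unfolding cut_def cut'_def by (auto intro!: derivative_eq_intros)
  have cutc: "continuous_on S (cut j)" "continuous_on S (cut' j)" for S j
    unfolding cut_def cut'_def by (intro continuous_intros)+
  have cut01: "\<bar>cut j t\<bar> \<le> 1" if "t \<in> {-T..0}" for j t
    using that by (simp add: cut_def mult_nonneg_nonneg)
  have "\<exists>p. n \<in> ?K \<longrightarrow> poly p (-T) = 0 \<and> poly p 0 = 0 \<and>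
      (\<forall>t\<in>{-T..0}. \<bar>poly p t - cut j t * c n t\<bar> \<le> 1 / real (Suc j) \<and>
        \<bar>poly (pderiv p) t - (cut' j t * c n t + cut j t * c' n t)\<bar> \<le> 1 / real (Suc j))" for j n
  proof (cases "n \<in> ?K")
    case True
    obtain p where "poly p (-T) = cut j (-T) * c n (-T)" "poly p 0 = cut j 0 * c n 0"
      "\<And>t. t \<in> {-T..0} \<Longrightarrow> \<bar>poly p t - cut j t * c n t\<bar> \<le> 1 / real (Suc j)"
      "\<And>t. t \<in> {-T..0} \<Longrightarrow> \<bar>poly (pderiv p) t - (cut' j t * c n t + cut j t * c' n t)\<bar> \<le> 1 / real (Suc j)"
    proof (rule C1_poly_approx[of "-T" 0 "\<lambda>t. cut j t * c n t" "\<lambda>t. cut' j t * c n t + cut j t * c' n t" "1 / real (Suc j)"])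
      show "((\<lambda>t. cut j t * c n t) has_real_derivative cut' j t * c n t + cut j t * c' n t) (at t within {-T..0})"
        if "t \<in> {-T..0}" for t
        using DERIV_mult'[OF cutD c[OF True that], of j] by (simp add: algebra_simps)
      show "continuous_on {-T..0} (\<lambda>t. cut' j t * c n t + cut j t * c' n t)"
        by (intro continuous_intros cutc cc c' True)
    qed (use T in auto)
    then show ?thesis using c0[OF True] by (auto simp: cut_def)
  qed auto
  then have "\<exists>p. \<forall>j n. n \<in> ?K \<longrightarrow> poly (p j n) (-T) = 0 \<and> poly (p j n) 0 = 0 \<and>
      (\<forall>t\<in>{-T..0}. \<bar>poly (p j n) t - cut j t * c n t\<bar> \<le> 1 / real (Suc j) \<and>
        \<bar>poly (pderiv (p j n)) t - (cut' j t * c n t + cut j t * c' n t)\<bar> \<le> 1 / real (Suc j))"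
    by (intro choice allI)
  then obtain p where P: "\<And>j n. n \<in> ?K \<longrightarrow> poly (p j n) (-T) = 0 \<and> poly (p j n) 0 = 0 \<and>
      (\<forall>t\<in>{-T..0}. \<bar>poly (p j n) t - cut j t * c n t\<bar> \<le> 1 / real (Suc j) \<and>
        \<bar>poly (pderiv (p j n)) t - (cut' j t * c n t + cut j t * c' n t)\<bar> \<le> 1 / real (Suc j))" by blast
  have p: "\<And>j n. n \<in> ?K \<Longrightarrow> poly (p j n) (-T) = 0 \<and> poly (p j n) 0 = 0"
    and p1: "\<And>j n t. n \<in> ?K \<Longrightarrow> t \<in> {-T..0} \<Longrightarrow> \<bar>poly (p j n) t - cut j t * c n t\<bar> \<le> 1 / real (Suc j)"
    and p2: "\<And>j n t. n \<in> ?K \<Longrightarrow> t \<in> {-T..0} \<Longrightarrow>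
        \<bar>poly (pderiv (p j n)) t - (cut' j t * c n t + cut j t * c' n t)\<bar> \<le> 1 / real (Suc j)"
    using P by blast+
  \<comment> \<open>The derivative of the cut-off is not dominated near \<open>-T\<close>. Its
    contribution \<open>cut' * c n\<close> is split off and treated as a boundary layer; what
    remains, \<open>r j n\<close>, is bounded by \<open>1 + |c' n|\<close>.\<close>
  define r where "r = (\<lambda>j n t. poly (pderiv (p j n)) t - cut' j t * c n t)"
  have rc: "continuous_on {-T..0} (r j n)" if "n \<in> ?K" for j n
    unfolding r_def by (intro continuous_intros cutc cc that)
  let ?G = "\<lambda>j. Fint N (\<lambda>n. poly (p j n)) (r j)"
  have Gint: "integrable Lt (?G j)" for j
    by (rule Fint_int) (auto intro: continuous_intros rc)
  have cbi: "integrable Lt (\<lambda>t. cut' j t * (c n t * b n t))" if "n \<in> ?K" for j n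
    by (intro continuous_imp_integrable_real continuous_intros cutc cc b_cont that)
  have le: "(LINT t|Lt. ?G j t) - (\<Sum>n\<in>?K. (LINT t|Lt. cut' j t * (c n t * b n t))) \<le> I" for j
  proof -
    have "(LINT t|Lt. Fint N (\<lambda>n. poly (p j n)) (\<lambda>n. poly (pderiv (p j n))) t)
        = (LINT t|Lt. ?G j t - (\<Sum>n\<in>?K. cut' j t * (c n t * b n t)))"
      by (rule integral_lebesgue_on_cong)
         (simp add: Fint_def r_def algebra_simps sum.distrib sum_subtractf sum_negf)
    also have "\<dots> = (LINT t|Lt. ?G j t) - (LINT t|Lt. (\<Sum>n\<in>?K. cut' j t * (c n t * b n t)))"
      by (rule Bochner_Integration.integral_diff[OF Gint]) (intro Bochner_Integration.integrable_sum cbi)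
    also have "(LINT t|Lt. (\<Sum>n\<in>?K. cut' j t * (c n t * b n t))) = (\<Sum>n\<in>?K. (LINT t|Lt. cut' j t * (c n t * b n t)))"
      by (rule Bochner_Integration.integral_sum) (rule cbi)
    finally show ?thesis using action_polynomial[of N "p j"] p by simp
  qed
  have lim2: "(\<lambda>j. \<Sum>n\<in>?K. (LINT t|Lt. cut' j t * (c n t * b n t))) \<longlonglongrightarrow> (\<Sum>n\<in>?K. 0)"
  proof (rule tendsto_sum)
    fix n assume n: "n \<in> ?K"
    show "(\<lambda>j. LINT t|Lt. cut' j t * (c n t * b n t)) \<longlonglongrightarrow> 0"
      unfolding cut'_def
      by (rule boundary_layer_tendsto[OF T]) (use n in \<open>auto intro!: continuous_intros cc b_cont simp: b_init\<close>)
  qed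
  have one_over: "(\<lambda>j. 1 / real (Suc j)) \<longlonglongrightarrow> 0" by (rule LIMSEQ_Suc[OF lim_const_over_n])
  have lim1: "(\<lambda>j. LINT t|Lt. ?G j t) \<longlonglongrightarrow> (LINT t|Lt. Fint N c c' t)"
  proof (rule integral_dominated_convergence[where w="\<lambda>t. (\<Sum>n\<in>?K. (1 + \<bar>c' n t\<bar>) * \<bar>b n t\<bar>)
      + (\<Sum>n\<in>?K. (1 + \<bar>c n t\<bar>) * \<bar>A n t\<bar>) + (\<Sum>n\<in>?K. \<Sum>m\<in>?K. ((1 + \<bar>c n t\<bar>) * (1 + \<bar>c m t\<bar>)) * \<bar>B n m t\<bar>)"])
    show "Fint N c c' \<in> borel_measurable Lt" using Fint_int(4)[OF cc c'] by auto
    show "?G j \<in> borel_measurable Lt" for j using Gint by auto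
    have i: "integrable Lt (\<lambda>t. \<bar>b n t\<bar>)" "integrable Lt (\<lambda>t. \<bar>A n t\<bar>)" "integrable Lt (\<lambda>t. \<bar>B n m t\<bar>)" for n m
      using b_int A_int B_int by auto
    show "integrable Lt (\<lambda>t. (\<Sum>n\<in>?K. (1 + \<bar>c' n t\<bar>) * \<bar>b n t\<bar>)
      + (\<Sum>n\<in>?K. (1 + \<bar>c n t\<bar>) * \<bar>A n t\<bar>) + (\<Sum>n\<in>?K. \<Sum>m\<in>?K. ((1 + \<bar>c n t\<bar>) * (1 + \<bar>c m t\<bar>)) * \<bar>B n m t\<bar>))"
      by (intro Bochner_Integration.integrable_add Bochner_Integration.integrable_sum integrable_mult_cont continuous_intros cc c' i)
    show "AE t in Lt. norm (?G j t) \<le> (\<Sum>n\<in>?K. (1 + \<bar>c' n t\<bar>) * \<bar>b n t\<bar>)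
      + (\<Sum>n\<in>?K. (1 + \<bar>c n t\<bar>) * \<bar>A n t\<bar>) + (\<Sum>n\<in>?K. \<Sum>m\<in>?K. ((1 + \<bar>c n t\<bar>) * (1 + \<bar>c m t\<bar>)) * \<bar>B n m t\<bar>)" for j
    proof (rule AE_lebesgue_onI)
      fix t assume t: "t \<in> {-T..0}"
      have j1: "1 / real (Suc j) \<le> 1" by simp
      have rb: "\<bar>r j n t\<bar> \<le> 1 + \<bar>c' n t\<bar>" if n: "n \<in> ?K" for n
      proof -
        have "\<bar>cut j t * c' n t\<bar> \<le> 1 * \<bar>c' n t\<bar>" unfolding abs_mult using cut01[OF t] by (intro mult_right_mono) auto
        then show ?thesis using p2[OF n t, of j] j1 unfolding r_def by linarith
      qed
      have pb: "\<bar>poly (p j n) t\<bar> \<le> 1 + \<bar>c n t\<bar>" if n: "n \<in> ?K" for n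
      proof -
        have "\<bar>cut j t * c n t\<bar> \<le> 1 * \<bar>c n t\<bar>" unfolding abs_mult using cut01[OF t] by (intro mult_right_mono) auto
        then show ?thesis using p1[OF n t, of j] j1 by linarith
      qed
      have "\<bar>\<Sum>n\<in>?K. - r j n t * b n t\<bar> \<le> (\<Sum>n\<in>?K. (1 + \<bar>c' n t\<bar>) * \<bar>b n t\<bar>)"
        by (rule order_trans[OF sum_abs sum_mono]) (simp add: abs_mult mult_right_mono rb)
      moreover have "\<bar>\<Sum>n\<in>?K. poly (p j n) t * A n t\<bar> \<le> (\<Sum>n\<in>?K. (1 + \<bar>c n t\<bar>) * \<bar>A n t\<bar>)"
        by (rule order_trans[OF sum_abs sum_mono]) (simp add: abs_mult mult_right_mono pb)
      moreover have "\<bar>\<Sum>n\<in>?K. \<Sum>m\<in>?K. (poly (p j n) t * poly (p j m) t) * B n m t\<bar>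
          \<le> (\<Sum>n\<in>?K. \<Sum>m\<in>?K. ((1 + \<bar>c n t\<bar>) * (1 + \<bar>c m t\<bar>)) * \<bar>B n m t\<bar>)"
        by (rule order_trans[OF sum_abs sum_mono], rule order_trans[OF sum_abs sum_mono])
           (auto simp: abs_mult intro!: mult_right_mono mult_mono pb)
      ultimately show "norm (?G j t) \<le> (\<Sum>n\<in>?K. (1 + \<bar>c' n t\<bar>) * \<bar>b n t\<bar>)
        + (\<Sum>n\<in>?K. (1 + \<bar>c n t\<bar>) * \<bar>A n t\<bar>) + (\<Sum>n\<in>?K. \<Sum>m\<in>?K. ((1 + \<bar>c n t\<bar>) * (1 + \<bar>c m t\<bar>)) * \<bar>B n m t\<bar>)"
        unfolding Fint_def real_norm_def by linarith
    qed
    have "AE t in Lt. t \<noteq> -T" by (rule AE_lebesgue_on_not_eq)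
    moreover have "AE t in Lt. t \<in> {-T..0}" by (rule AE_lebesgue_onI)
    ultimately show "AE t in Lt. (\<lambda>j. ?G j t) \<longlonglongrightarrow> Fint N c c' t"
    proof eventually_elim
      case (elim t)
      then have t: "t \<in> {-T..0}" and tp: "t + T > 0" by auto
      have "(\<lambda>j. exp (- (t + T)) ^ j) \<longlonglongrightarrow> 0" by (rule LIMSEQ_power_zero) (use tp in simp)
      moreover have "exp (- (t + T)) ^ j = exp (- real j * (t + T))" for j
        by (simp add: exp_of_nat_mult[symmetric] algebra_simps)
      ultimately have "(\<lambda>j. exp (- real j * (t + T))) \<longlonglongrightarrow> 0" by simp
      from tendsto_diff[OF tendsto_const[of 1] this] have chi: "(\<lambda>j. cut j t) \<longlonglongrightarrow> 1" by (simp add: cut_def)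
      have pl: "(\<lambda>j. poly (p j n) t) \<longlonglongrightarrow> c n t" if n: "n \<in> ?K" for n
      proof -
        have "(\<lambda>j. poly (p j n) t - cut j t * c n t) \<longlonglongrightarrow> 0"
          by (rule tendsto_rabs_zero_cancel, rule tendsto_sandwich[OF _ _ tendsto_const one_over])
             (use p1[OF n t] in auto)
        from tendsto_add[OF this tendsto_mult[OF chi tendsto_const[of "c n t"]]] show ?thesis by simp
      qed
      have rl: "(\<lambda>j. r j n t) \<longlonglongrightarrow> c' n t" if n: "n \<in> ?K" for n
      proof -
        have "(\<lambda>j. r j n t - cut j t * c' n t) \<longlonglongrightarrow> 0"
          by (rule tendsto_rabs_zero_cancel, rule tendsto_sandwich[OF _ _ tendsto_const one_over])
             (use p2[OF n t] in \<open>auto simp: r_def algebra_simps\<close>)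
        from tendsto_add[OF this tendsto_mult[OF chi tendsto_const[of "c' n t"]]] show ?thesis by simp
      qed
      show ?case unfolding Fint_def by (intro tendsto_intros pl rl)
    qed
  qed
  show ?thesis
    by (rule LIMSEQ_le_const2[where X="\<lambda>j. (LINT t|Lt. ?G j t) - (\<Sum>n\<in>?K. (LINT t|Lt. cut' j t * (c n t * b n t)))"])
       (use tendsto_diff[OF lim1 lim2] le in auto)
qed

end

section \<open>An energy estimate\<close>

lemma cos_parseval:
  "inner1 (\<lambda>x. \<Sum>n\<in>{1..<N}. d n * cosn n x) (\<lambda>x. \<Sum>n\<in>{1..<N}. d n * cosn n x) = (\<Sum>n\<in>{1..<N}. (d n)\<^sup>2) / 2"
proof -
  let ?X = "\<lambda>x. \<Sum>n\<in>{1..<N}. d n * cosn n x"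
  have Xi: "integrable (lebesgue_on {0..1}) ?X" by (intro continuous_imp_integrable_real continuous_intros)
  have "inner1 ?X (cosn n) = d n / 2" if n: "n \<in> {1..<N}" for n
  proof -
    have "inner1 (cosn n) ?X = (\<Sum>m\<in>{1..<N}. d m * inner1 (cosn n) (cosn m))"
      by (rule inner1_sum) (auto intro: continuous_intros)
    also have "\<dots> = (\<Sum>m\<in>{1..<N}. if m = n then d n / 2 else 0)"
      unfolding inner1_cosn_cosn using n by (intro sum.cong) auto
    also have "\<dots> = d n / 2" using n by simp
    finally show ?thesis by (simp add: inner1_commute)
  qed
  then have "(\<Sum>n\<in>{1..<N}. d n * inner1 ?X (cosn n)) = (\<Sum>n\<in>{1..<N}. (d n)\<^sup>2 / 2)"
    by (intro sum.cong refl) (simp add: power2_eq_square)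
  moreover have "inner1 ?X ?X = (\<Sum>n\<in>{1..<N}. d n * inner1 ?X (cosn n))"
    by (rule inner1_sum[OF Xi]) (intro continuous_intros)
  ultimately show ?thesis
    by (simp add: sum_divide_distrib)
qed

text \<open>Integrate the derivative from the nearer end and use Young's inequality
  \<open>|z| \<le> \<eta> z\<^sup>2 + 1 / (4 \<eta>)\<close>. This is the Hoelder bound with
  exponent one half, in a form linear in the energy \<open>E\<close>.\<close>

lemma sine_poly_modulus:
  assumes y: "y \<in> {0..1}" and \<eta>: "0 < \<eta>"
    and E: "(\<Sum>n\<in>{1..<N}. (real n * pi * d n)\<^sup>2) \<le> E"
  shows "\<bar>\<Sum>n\<in>{1..<N}. d n * sinn n y\<bar> \<le> \<eta> * E + min y (1 - y) / (4 * \<eta>)"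
proof -
  let ?f = "\<lambda>y. \<Sum>n\<in>{1..<N}. d n * sinn n y" and ?f' = "\<lambda>y. \<Sum>n\<in>{1..<N}. (real n * pi * d n) * cosn n y"
  have D: "(?f has_real_derivative ?f' x) (at x within S)" for x S
    by (auto intro!: derivative_eq_intros DERIV_sum sinn_deriv simp: algebra_simps)
  have f'c: "continuous_on S ?f'" for S by (intro continuous_intros)
  have ends: "?f 0 = 0" "?f 1 = 0" by simp_all
  have total: "integral {0..1} (\<lambda>x. (?f' x)\<^sup>2) \<le> E"
  proof -
    have "integral {0..1} (\<lambda>x. (?f' x)\<^sup>2) = inner1 ?f' ?f'"
      unfolding inner1_def power2_eq_square[symmetric]
      by (rule integral_lebesgue_on_cont[symmetric]) (intro continuous_intros)
    also have "\<dots> = (\<Sum>n\<in>{1..<N}. (real n * pi * d n)\<^sup>2) / 2" by (rule cos_parseval)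
    also have "\<dots> \<le> (\<Sum>n\<in>{1..<N}. (real n * pi * d n)\<^sup>2)" by (simp add: sum_nonneg)
    finally show ?thesis using E by simp
  qed
  have sq: "\<bar>z\<bar> \<le> \<eta> * z\<^sup>2 + 1 / (4 * \<eta>)" for z :: real
  proof -
    have "0 \<le> (2 * \<eta> * \<bar>z\<bar> - 1)\<^sup>2" by simp
    then have "4 * \<eta> * \<bar>z\<bar> \<le> 4 * \<eta> * (\<eta> * z\<^sup>2) + 1" by (simp add: power2_eq_square algebra_simps)
    then show ?thesis using \<eta> by (simp add: field_simps)
  qed
  have part: "\<bar>integral {a..c} ?f'\<bar> \<le> \<eta> * E + (c - a) / (4 * \<eta>)" if ac: "0 \<le> a" "a \<le> c" "c \<le> 1" for a c
  proof -
    have sqc: "(\<lambda>x. (?f' x)\<^sup>2) integrable_on {x..y}" for x y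
      by (intro integrable_continuous_real continuous_intros)
    have "norm (integral {a..c} ?f') \<le> integral {a..c} (\<lambda>x. \<eta> * (?f' x)\<^sup>2 + 1 / (4 * \<eta>))"
      by (rule integral_norm_bound_integral) (use sq in \<open>auto intro!: integrable_continuous_real continuous_intros\<close>)
    also have "\<dots> = integral {a..c} (\<lambda>x. \<eta> * (?f' x)\<^sup>2) + integral {a..c} (\<lambda>x. 1 / (4 * \<eta>))"
      by (intro Henstock_Kurzweil_Integration.integral_add integrable_on_mult_right sqc integrable_const_ivl)
    also have "\<dots> = \<eta> * integral {a..c} (\<lambda>x. (?f' x)\<^sup>2) + (c - a) / (4 * \<eta>)" using ac by simp
    also have "integral {a..c} (\<lambda>x. (?f' x)\<^sup>2) \<le> integral {0..1} (\<lambda>x. (?f' x)\<^sup>2)"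
      by (intro integral_subset_le sqc) (use ac in auto)
    finally show ?thesis using total \<eta> by (smt (verit) mult_left_mono real_norm_def)
  qed
  have i1: "integral {0..y} ?f' = ?f y - ?f 0"
    by (rule integral_unique, rule fundamental_theorem_of_calculus)
       (use y D in \<open>auto simp: has_real_derivative_iff_has_vector_derivative[symmetric]\<close>)
  have i2: "integral {y..1} ?f' = ?f 1 - ?f y"
    by (rule integral_unique, rule fundamental_theorem_of_calculus)
       (use y D in \<open>auto simp: has_real_derivative_iff_has_vector_derivative[symmetric]\<close>)
  have "\<bar>?f y\<bar> \<le> \<eta> * E + y / (4 * \<eta>)" using part[of 0 y] y i1 ends by simp
  moreover have "\<bar>?f y\<bar> \<le> \<eta> * E + (1 - y) / (4 * \<eta>)" using part[of y 1] y i2 ends by simp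
  ultimately show ?thesis by (simp add: min_def)
qed

context finite_action_path
begin

text \<open>Obtained from \<open>5/8 * \<epsilon> * S \<le> I + T / (8 * \<epsilon>)\<close>, with
  \<open>S\<close> the sum in \<open>energy_avg\<close>: the linear term gives
  \<open>\<epsilon> * S\<close>, and the nonlinear terms take back at most \<open>3/8\<close> of
  it.\<close>

definition CE :: real where "CE = (I + T / (8 * \<epsilon>)) * 8 / (5 * \<epsilon>)"

lemma w_pos: "n \<in> {1..<N} \<Longrightarrow> 0 < w n"
  by (simp add: w_def)

lemma abs_le_square: "\<bar>z\<bar> \<le> \<epsilon> * z\<^sup>2 + 1 / (4 * \<epsilon>)"
proof -
  have "0 \<le> (2 * \<epsilon> * \<bar>z\<bar> - 1)\<^sup>2" by simp
  then have "4 * \<epsilon> * \<bar>z\<bar> \<le> 4 * \<epsilon> * (\<epsilon> * z\<^sup>2) + 1" by (simp add: power2_eq_square algebra_simps)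
  then show ?thesis using \<epsilon> by (simp add: field_simps)
qed

text \<open>With both fluxes at most \<open>1/4\<close> and
  \<open>|y| \<le> \<epsilon> y\<^sup>2 + 1 / (4 \<epsilon>)\<close>, the stationary flux costs a
  quarter and the flux of \<open>u\<close> a half of \<open>\<epsilon> y\<^sup>2\<close>; Parseval
  halves the sum to \<open>3/8\<close>. What matters is that this is below one, the coefficient of
  the dissipation that has to absorb it.\<close>

lemma nonlinear_lower_bound:
  assumes t: "t \<in> {-T..0}"
  shows "- (3 / 8 * \<epsilon> * (\<Sum>n\<in>{1..<N}. (w n)\<^sup>2 * (d n)\<^sup>2)) - 1 / (8 * \<epsilon>)
    \<le> (\<Sum>n\<in>{1..<N}. d n * (w n * s n - w n * q (cosn n) t)) - (\<Sum>n\<in>{1..<N}. \<Sum>m\<in>{1..<N}. (d n * d m) * B n m t)"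
proof -
  let ?X = "\<lambda>x. \<Sum>n\<in>{1..<N}. d n * (w n * cosn n x)"
  have Xc: "continuous_on S ?X" for S by (intro continuous_intros)
  have psic: "continuous_on S (\<lambda>x. psi (?X x))" for S unfolding psi_def by (intro continuous_intros)
  have "inner1 ?X ?X = inner1 (\<lambda>x. \<Sum>n\<in>{1..<N}. (d n * w n) * cosn n x) (\<lambda>x. \<Sum>n\<in>{1..<N}. (d n * w n) * cosn n x)"
    by (simp only: mult.assoc)
  also have "\<dots> = (\<Sum>n\<in>{1..<N}. (w n)\<^sup>2 * (d n)\<^sup>2) / 2" unfolding cos_parseval by (simp add: power_mult_distrib mult.commute)
  finally have pars: "inner1 ?X ?X = (\<Sum>n\<in>{1..<N}. (w n)\<^sup>2 * (d n)\<^sup>2) / 2" .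
  have "inner1 (\<lambda>x. flux (\<rho>b x)) ?X = (\<Sum>n\<in>{1..<N}. d n * inner1 (\<lambda>x. flux (\<rho>b x)) (\<lambda>x. w n * cosn n x))"
    by (intro inner1_sum \<rho>b_flux_int continuous_intros)
  then have s_eq: "inner1 (\<lambda>x. flux (\<rho>b x)) ?X = (\<Sum>n\<in>{1..<N}. d n * (w n * s n))"
    by (simp add: inner1_cmult_right s_def)
  have i1: "integrable Lx (\<lambda>x. flux (\<rho>b x) * ?X x)" by (intro inner1_integrable \<rho>b_flux_int Xc)
  have i2: "integrable Lx (\<lambda>x. flux (u t x) * psi (?X x))" by (intro inner1_integrable u_flux_int t psic)
  have Xi: "integrable Lx (\<lambda>x. ?X x * ?X x)" by (intro continuous_imp_integrable_real continuous_intros)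
  have inside: "AE x in Lx. x \<in> {0..1}" by (rule AE_lebesgue_onI)
  have "(LINT x|Lx. - (3/4 * \<epsilon> * (?X x * ?X x)) - 1 / (8 * \<epsilon>)) \<le> (LINT x|Lx. flux (\<rho>b x) * ?X x - flux (u t x) * psi (?X x))"
  proof (rule integral_mono_AE)
    show "AE x in Lx. - (3/4 * \<epsilon> * (?X x * ?X x)) - 1 / (8 * \<epsilon>) \<le> flux (\<rho>b x) * ?X x - flux (u t x) * psi (?X x)"
      using M_space_flux_bounds[OF u_M[OF t]] inside
    proof eventually_elim
      case (elim x)
      let ?y = "?X x"
      have r: "0 < \<rho>b x" "\<rho>b x < 1" using \<rho>b_range[OF elim(2)] \<rho>01 by auto
      have f: "0 \<le> flux (\<rho>b x)" "flux (\<rho>b x) \<le> 1/4" 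
        using r by (simp add: flux_def) (rule flux_le_quarter)
      have y: "\<bar>?y\<bar> \<le> \<epsilon> * ?y\<^sup>2 + 1 / (4 * \<epsilon>)" by (rule abs_le_square)
      have "flux (\<rho>b x) * \<bar>?y\<bar> \<le> 1/4 * (\<epsilon> * ?y\<^sup>2 + 1 / (4 * \<epsilon>))"
        using f y \<epsilon> by (intro mult_mono) auto
      moreover have "- (flux (\<rho>b x) * \<bar>?y\<bar>) \<le> flux (\<rho>b x) * ?y"
        using mult_left_mono[OF abs_ge_minus_self[of ?y] f(1)] by simp
      ultimately have 1: "- (1/4 * (\<epsilon> * ?y\<^sup>2 + 1 / (4 * \<epsilon>))) \<le> flux (\<rho>b x) * ?y" by linarith
      have "psi ?y \<le> 2 * (\<epsilon> * ?y\<^sup>2) + 1 / (4 * \<epsilon>)" using y unfolding psi_def by linarith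
      then have "flux (u t x) * psi ?y \<le> flux (u t x) * (2 * (\<epsilon> * ?y\<^sup>2) + 1 / (4 * \<epsilon>))"
        using elim by (intro mult_left_mono) auto
      also have "\<dots> \<le> 1/4 * (2 * (\<epsilon> * ?y\<^sup>2) + 1 / (4 * \<epsilon>))"
        using elim \<epsilon> by (intro mult_right_mono add_nonneg_nonneg mult_nonneg_nonneg) auto
      finally have 2: "flux (u t x) * psi ?y \<le> 1/4 * (2 * (\<epsilon> * ?y\<^sup>2) + 1 / (4 * \<epsilon>))" .
      have 3: "- (3/4 * \<epsilon> * (?y * ?y)) - 1 / (8 * \<epsilon>)
        = - (1/4 * (\<epsilon> * ?y\<^sup>2 + 1 / (4 * \<epsilon>))) - 1/4 * (2 * (\<epsilon> * ?y\<^sup>2) + 1 / (4 * \<epsilon>))"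
        by (simp add: power2_eq_square add_divide_distrib algebra_simps)
      show ?case unfolding 3 by (rule diff_mono[OF 1 2])
    qed
  qed (use i1 i2 Xi in auto)
  also have "(LINT x|Lx. flux (\<rho>b x) * ?X x - flux (u t x) * psi (?X x)) = inner1 (\<lambda>x. flux (\<rho>b x)) ?X - inner1 (\<lambda>x. flux (u t x)) (\<lambda>x. psi (?X x))"
    unfolding inner1_def by (rule Bochner_Integration.integral_diff[OF i1 i2])
  also have "\<dots> = (\<Sum>n\<in>{1..<N}. d n * (w n * s n - w n * q (cosn n) t)) - (\<Sum>n\<in>{1..<N}. \<Sum>m\<in>{1..<N}. (d n * d m) * B n m t)"
    unfolding s_eq psi_expand[OF t] by (simp add: right_diff_distrib sum_subtractf)
  also have "(LINT x|Lx. - (3/4 * \<epsilon> * (?X x * ?X x)) - 1 / (8 * \<epsilon>)) = - (3/4 * \<epsilon> * inner1 ?X ?X) - 1 / (8 * \<epsilon>)"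
  proof -
    have "(LINT x|Lx. - (3/4 * \<epsilon> * (?X x * ?X x)) - 1 / (8 * \<epsilon>)) = (LINT x|Lx. - (3/4 * \<epsilon> * (?X x * ?X x))) - (LINT x|Lx. 1 / (8 * \<epsilon>))"
      using Xi by (intro Bochner_Integration.integral_diff) auto
    then show ?thesis
      using integral_lebesgue_on_const[of 0 1 "1 / (8 * \<epsilon>)"] by (simp add: inner1_def del: lebesgue_integral_const)
  qed
  finally show ?thesis unfolding pars by simp
qed

text \<open>The test function is the adjoint mean of the mean \<open>\<beta>\<close> of
  \<open>b\<close>. By duality its pairing with \<open>b\<close> is the squared norm of
  \<open>\<beta>\<close>, and the term with the time derivative is the integral of
  \<open>\<beta> \<beta>'\<close>, that is \<open>\<beta>(0)\<^sup>2 / 2\<close>, which is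
  nonnegative.\<close>

lemma energy_avg:
  assumes \<tau>: "0 < \<tau>"
  shows "(\<Sum>n\<in>{1..<N}. (w n)\<^sup>2 * (LINT t|Lt. (avg T \<tau> (b n) t)\<^sup>2)) \<le> CE"
proof -
  interpret ta: time_average T \<tau> by unfold_locales (use T \<tau> in auto)
  let ?K = "{1..<N}"
  define \<beta> where "\<beta> = (\<lambda>n. avg T \<tau> (b n))"
  define c where "c = (\<lambda>n. adv \<tau> (\<beta> n))"
  define c' where "c' = (\<lambda>n t. (c n t - \<beta> n t) / \<tau>)"
  have \<beta>c: "continuous_on {-T..0} (\<beta> n)" for n unfolding \<beta>_def by (rule ta.avg_continuous[OF b_int])
  have \<beta>i: "integrable Lt (\<beta> n)" for n by (rule continuous_imp_integrable_real[OF \<beta>c])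
  have cc: "continuous_on {-T..0} (c n)" for n unfolding c_def by (rule ta.adv_continuous[OF \<beta>i])
  have c'c: "continuous_on {-T..0} (c' n)" for n unfolding c'_def using \<tau> by (intro continuous_intros cc \<beta>c) auto
  have cD: "(c n has_real_derivative c' n t) (at t within {-T..0})" if "t \<in> {-T..0}" for n t
    unfolding c_def c'_def by (rule ta.adv_deriv[OF \<beta>c that])
  have act: "(LINT t|Lt. Fint N c c' t) \<le> I"
    by (rule action_C1) (use cD c'c in \<open>auto simp: c_def\<close>)
  let ?S = "\<Sum>n\<in>?K. (w n)\<^sup>2 * (LINT t|Lt. (\<beta> n t)\<^sup>2)"
  have ii: "integrable Lt (\<lambda>t. - c' n t * b n t)" "integrable Lt (\<lambda>t. c n t * b n t)" "integrable Lt (\<lambda>t. (c n t)\<^sup>2)"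
    "integrable Lt (\<lambda>t. \<beta> n t * b n t)" "integrable Lt (\<lambda>t. (\<beta> n t)\<^sup>2)" for n
    by (intro continuous_imp_integrable_real continuous_intros cc c'c b_cont \<beta>c)+
  have dual: "(LINT t|Lt. c n t * b n t) = (LINT t|Lt. (\<beta> n t)\<^sup>2)" for n
    using ta.avg_adv_duality[OF b_int \<beta>c, of n n] by (simp add: c_def \<beta>_def power2_eq_square mult.commute)
  have T1: "0 \<le> (LINT t|Lt. - c' n t * b n t)" for n
  proof -
    have "(LINT t|Lt. - c' n t * b n t) = (LINT t|Lt. (\<beta> n t * b n t - c n t * b n t) / \<tau>)"
      by (rule integral_lebesgue_on_cong) (simp add: c'_def minus_divide_left left_diff_distrib)
    also have "\<dots> = ((LINT t|Lt. \<beta> n t * b n t) - (LINT t|Lt. (\<beta> n t)\<^sup>2)) / \<tau>"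
      using ii[of n] by (simp add: dual)
    also have "\<dots> = (LINT t|Lt. (\<beta> n t * b n t - (\<beta> n t)\<^sup>2) / \<tau>)" using ii[of n] by simp
    also have "\<dots> = (\<beta> n 0)\<^sup>2 / 2 - (\<beta> n (-T))\<^sup>2 / 2"
    proof (rule FTC_lebesgue_on)
      fix t assume t: "t \<in> {-T..0}"
      have "(\<beta> n has_real_derivative (b n t - \<beta> n t) / \<tau>) (at t within {-T..0})"
        unfolding \<beta>_def by (rule ta.avg_deriv[OF b_cont t])
      then show "((\<lambda>t. (\<beta> n t)\<^sup>2 / 2) has_real_derivative (\<beta> n t * b n t - (\<beta> n t)\<^sup>2) / \<tau>) (at t within {-T..0})"
        using \<tau> by (auto intro!: derivative_eq_intros simp: power2_eq_square field_simps)
    qed (use T \<tau> in \<open>auto intro!: continuous_intros \<beta>c b_cont\<close>)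
    also have "\<dots> \<ge> 0" by (simp add: \<beta>_def)
    finally show ?thesis .
  qed
  \<comment> \<open>The adjoint mean contracts the square norm: Jensen in time, then duality with
    total mass at most one.\<close>
  have c2: "(LINT t|Lt. (c n t)\<^sup>2) \<le> (LINT t|Lt. (\<beta> n t)\<^sup>2)" for n
  proof -
    have sqc: "continuous_on {-T..0} (\<lambda>t. (\<beta> n t)\<^sup>2)" by (intro continuous_intros \<beta>c)
    have "(LINT t|Lt. (c n t)\<^sup>2) \<le> (LINT t|Lt. adv \<tau> (\<lambda>t. (\<beta> n t)\<^sup>2) t)"
      by (rule integral_lebesgue_on_mono)
         (use ii ta.adv_square_le[OF \<beta>c] in \<open>auto simp: c_def intro!: continuous_imp_integrable_real ta.adv_continuous sqc\<close>)
    also have "\<dots> = (LINT t|Lt. (\<beta> n t)\<^sup>2 * avg T \<tau> (\<lambda>_. 1) t)"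
      using ta.avg_adv_duality[OF _ sqc, of "\<lambda>_. 1"] by simp
    also have "\<dots> \<le> (LINT t|Lt. (\<beta> n t)\<^sup>2)"
      by (rule integral_lebesgue_on_mono)
         (use ii ta.avg_1_bounds in \<open>auto intro!: continuous_imp_integrable_real continuous_intros sqc ta.avg_continuous mult_left_le\<close>)
    finally show ?thesis .
  qed
  let ?R = "\<lambda>t. (\<Sum>n\<in>?K. - c' n t * b n t) + (\<Sum>n\<in>?K. \<epsilon> * (w n)\<^sup>2 * (c n t * b n t))
    - (\<Sum>n\<in>?K. 3/8 * \<epsilon> * (w n)\<^sup>2 * (c n t)\<^sup>2) - 1 / (8 * \<epsilon>)"
  have sums: "integrable Lt (\<lambda>t. \<Sum>n\<in>?K. - c' n t * b n t)" "integrable Lt (\<lambda>t. \<Sum>n\<in>?K. \<epsilon> * (w n)\<^sup>2 * (c n t * b n t))"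
    "integrable Lt (\<lambda>t. \<Sum>n\<in>?K. 3/8 * \<epsilon> * (w n)\<^sup>2 * (c n t)\<^sup>2)"
    by (intro Bochner_Integration.integrable_sum Bochner_Integration.integrable_mult_right ii)+
  have "(LINT t|Lt. ?R t) \<le> (LINT t|Lt. Fint N c c' t)"
  proof (rule integral_lebesgue_on_mono)
    fix t assume t: "t \<in> {-T..0}"
    have "(\<Sum>n\<in>?K. c n t * A n t) = (\<Sum>n\<in>?K. \<epsilon> * (w n)\<^sup>2 * (c n t * b n t)) + (\<Sum>n\<in>?K. c n t * (w n * s n - w n * q (cosn n) t))"
      by (simp add: A_def sum.distrib[symmetric] algebra_simps)
    moreover have "3/8 * \<epsilon> * (\<Sum>n\<in>?K. (w n)\<^sup>2 * (c n t)\<^sup>2) = (\<Sum>n\<in>?K. 3/8 * \<epsilon> * (w n)\<^sup>2 * (c n t)\<^sup>2)"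
      by (simp add: sum_distrib_left mult.assoc)
    ultimately show "?R t \<le> Fint N c c' t"
      using nonlinear_lower_bound[OF t, where N=N and d="\<lambda>n. c n t"] unfolding Fint_def by linarith
  qed (use sums Fint_int(4)[OF cc c'c] in auto)
  moreover have "(LINT t|Lt. ?R t) = (\<Sum>n\<in>?K. (LINT t|Lt. - c' n t * b n t)) + (\<Sum>n\<in>?K. \<epsilon> * (w n)\<^sup>2 * (LINT t|Lt. (\<beta> n t)\<^sup>2))
    - (\<Sum>n\<in>?K. 3/8 * \<epsilon> * (w n)\<^sup>2 * (LINT t|Lt. (c n t)\<^sup>2)) - T / (8 * \<epsilon>)"
  proof -
    have "(LINT t|Lt. ?R t) = (LINT t|Lt. (\<Sum>n\<in>?K. - c' n t * b n t)) + (LINT t|Lt. (\<Sum>n\<in>?K. \<epsilon> * (w n)\<^sup>2 * (c n t * b n t)))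
      - (LINT t|Lt. (\<Sum>n\<in>?K. 3/8 * \<epsilon> * (w n)\<^sup>2 * (c n t)\<^sup>2)) - (LINT t|Lt. 1 / (8 * \<epsilon>))"
      using sums by (subst Bochner_Integration.integral_diff, simp, simp, subst Bochner_Integration.integral_diff, simp, simp,
          subst Bochner_Integration.integral_add) simp_all
    also have "(LINT t|Lt. 1 / (8 * \<epsilon>)) = T / (8 * \<epsilon>)" using integral_lebesgue_on_const[of "-T" 0] T by simp
    also have "(LINT t|Lt. (\<Sum>n\<in>?K. - c' n t * b n t)) = (\<Sum>n\<in>?K. (LINT t|Lt. - c' n t * b n t))"
      by (rule Bochner_Integration.integral_sum) (rule ii)
    also have "(LINT t|Lt. (\<Sum>n\<in>?K. \<epsilon> * (w n)\<^sup>2 * (c n t * b n t))) = (\<Sum>n\<in>?K. (LINT t|Lt. \<epsilon> * (w n)\<^sup>2 * (c n t * b n t)))"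
      by (rule Bochner_Integration.integral_sum) (intro Bochner_Integration.integrable_mult_right ii)
    also have "(LINT t|Lt. (\<Sum>n\<in>?K. 3/8 * \<epsilon> * (w n)\<^sup>2 * (c n t)\<^sup>2)) = (\<Sum>n\<in>?K. (LINT t|Lt. 3/8 * \<epsilon> * (w n)\<^sup>2 * (c n t)\<^sup>2))"
      by (rule Bochner_Integration.integral_sum) (intro Bochner_Integration.integrable_mult_right ii)
    finally show ?thesis by (simp only: integral_mult_right_zero dual)
  qed
  moreover have "0 \<le> (\<Sum>n\<in>?K. (LINT t|Lt. - c' n t * b n t))" by (intro sum_nonneg T1)
  moreover have "(\<Sum>n\<in>?K. \<epsilon> * (w n)\<^sup>2 * (LINT t|Lt. (\<beta> n t)\<^sup>2)) = \<epsilon> * ?S"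
    by (simp add: sum_distrib_left mult.assoc)
  moreover have "(\<Sum>n\<in>?K. 3/8 * \<epsilon> * (w n)\<^sup>2 * (LINT t|Lt. (c n t)\<^sup>2)) \<le> (\<Sum>n\<in>?K. 3/8 * \<epsilon> * (w n)\<^sup>2 * (LINT t|Lt. (\<beta> n t)\<^sup>2))"
    using \<epsilon> by (intro sum_mono mult_left_mono c2) auto
  moreover have "(\<Sum>n\<in>?K. 3/8 * \<epsilon> * (w n)\<^sup>2 * (LINT t|Lt. (\<beta> n t)\<^sup>2)) = 3/8 * (\<epsilon> * ?S)"
    by (simp add: sum_distrib_left mult.assoc)
  ultimately have "5/8 * (\<epsilon> * ?S) \<le> I + T / (8 * \<epsilon>)" using act by linarith
  then have "?S \<le> CE" using \<epsilon> by (simp add: CE_def field_simps)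
  then show ?thesis by (simp add: \<beta>_def)
qed

lemma avg_b_tendsto: "t \<in> {-T..0} \<Longrightarrow> ((\<lambda>\<tau>. avg T \<tau> (b n) t) \<longlongrightarrow> b n t) (at_right 0)"
proof (rule tendstoI)
  fix e :: real assume t: "t \<in> {-T..0}" and e: "0 < e"
  have "\<forall>\<^sub>F \<tau> in at_right 0. \<forall>t\<in>{-T..0}. \<bar>avg T \<tau> (b n) t - b n t\<bar> \<le> e / 2"
    by (rule avg_uniform_limit[OF T b_cont b_init]) (use e in simp)
  then show "\<forall>\<^sub>F \<tau> in at_right 0. dist (avg T \<tau> (b n) t) (b n t) < e"
  proof eventually_elim
    case (elim \<tau>)
    then have "\<bar>avg T \<tau> (b n) t - b n t\<bar> \<le> e / 2" using t by blast
    then show ?case using e by (simp add: dist_real_def)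
  qed
qed

text \<open>Letting \<open>\<tau>\<close> tend to zero with \<open>N\<close> fixed removes the time
  mean, so that \<open>energy_pointwise\<close> can apply Jensen to \<open>b\<close> itself.\<close>

lemma energy_b: "(\<Sum>n\<in>{1..<N}. (w n)\<^sup>2 * (LINT t|Lt. (b n t)\<^sup>2)) \<le> CE"
proof -
  define \<tau> where "\<tau> = (\<lambda>j. 1 / real (Suc j))"
  have \<tau>pos: "\<tau> j > 0" for j by (simp add: \<tau>_def)
  have "(\<lambda>j. \<tau> j) \<longlonglongrightarrow> 0" unfolding \<tau>_def by (rule LIMSEQ_Suc[OF lim_const_over_n])
  then have \<tau>lim: "filterlim \<tau> (at_right 0) sequentially"
    by (rule tendsto_imp_filterlim_at_right) (simp add: \<tau>pos)
  have "(\<lambda>j. LINT t|Lt. (avg T (\<tau> j) (b n) t)\<^sup>2) \<longlonglongrightarrow> (LINT t|Lt. (b n t)\<^sup>2)" for n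
  proof -
    have "bounded (b n ` {-T..0})" by (intro compact_imp_bounded compact_continuous_image b_cont) auto
    then obtain C where C: "C > 0" "\<forall>y\<in>b n ` {-T..0}. norm y \<le> C" unfolding bounded_pos by blast
    show ?thesis
    proof (rule integral_dominated_convergence[where w="\<lambda>_. C\<^sup>2"])
      show "(\<lambda>t. (b n t)\<^sup>2) \<in> borel_measurable Lt"
        using continuous_imp_integrable_real[OF b_cont[of n]] by auto
      fix j
      interpret ta: time_average T "\<tau> j" by unfold_locales (use T \<tau>pos in auto)
      show "(\<lambda>t. (avg T (\<tau> j) (b n) t)\<^sup>2) \<in> borel_measurable Lt"
        using continuous_imp_integrable_real[OF ta.avg_continuous[OF b_int, of n]] by auto
      show "AE t in Lt. norm ((avg T (\<tau> j) (b n) t)\<^sup>2) \<le> C\<^sup>2"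
      proof (rule AE_lebesgue_onI)
        fix t assume t: "t \<in> {-T..0}"
        have "\<bar>avg T (\<tau> j) (b n) t\<bar> \<le> C" by (rule ta.avg_bound[OF b_int _ t]) (use C in auto)
        then have "\<bar>avg T (\<tau> j) (b n) t\<bar>\<^sup>2 \<le> C\<^sup>2" by (rule power_mono) simp
        then show "norm ((avg T (\<tau> j) (b n) t)\<^sup>2) \<le> C\<^sup>2" by simp
      qed
    next
      show "AE t in Lt. (\<lambda>j. (avg T (\<tau> j) (b n) t)\<^sup>2) \<longlonglongrightarrow> (b n t)\<^sup>2"
        by (rule AE_lebesgue_onI) (intro tendsto_power filterlim_compose[OF avg_b_tendsto \<tau>lim])
    qed simp
  qed
  then have "(\<lambda>j. \<Sum>n\<in>{1..<N}. (w n)\<^sup>2 * (LINT t|Lt. (avg T (\<tau> j) (b n) t)\<^sup>2)) \<longlonglongrightarrow> (\<Sum>n\<in>{1..<N}. (w n)\<^sup>2 * (LINT t|Lt. (b n t)\<^sup>2))"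
    by (intro tendsto_intros)
  then show ?thesis by (rule LIMSEQ_le_const2) (use energy_avg[OF \<tau>pos] in auto)
qed

text \<open>The square of the mean is at most the mean of the square, whose kernel is bounded by
  \<open>1 / \<tau>\<close>. The bound holds at every time but blows up with \<open>\<tau>\<close>,
  which forces the order of the limits.\<close>

lemma energy_pointwise:
  assumes \<tau>: "0 < \<tau>" and t: "t \<in> {-T..0}"
  shows "(\<Sum>n\<in>{1..<N}. (w n)\<^sup>2 * (avg T \<tau> (b n) t)\<^sup>2) \<le> CE / \<tau>"
proof -
  interpret ta: time_average T \<tau> by unfold_locales (use T \<tau> in auto)
  have "(avg T \<tau> (b n) t)\<^sup>2 \<le> (LINT t|Lt. (b n t)\<^sup>2) / \<tau>" for n
    by (rule order_trans[OF ta.avg_square_le[OF b_cont t]], rule ta.avg_le_integral[OF _ _ t])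
       (auto intro!: continuous_imp_integrable_real continuous_intros b_cont)
  then have "(\<Sum>n\<in>{1..<N}. (w n)\<^sup>2 * (avg T \<tau> (b n) t)\<^sup>2) \<le> (\<Sum>n\<in>{1..<N}. (w n)\<^sup>2 * ((LINT t|Lt. (b n t)\<^sup>2) / \<tau>))"
    by (intro sum_mono mult_left_mono) auto
  also have "\<dots> = (\<Sum>n\<in>{1..<N}. (w n)\<^sup>2 * (LINT t|Lt. (b n t)\<^sup>2)) / \<tau>"
    by (simp add: sum_divide_distrib)
  also have "\<dots> \<le> CE / \<tau>" using energy_b \<tau> by (intro divide_right_mono) auto
  finally show ?thesis .
qed

section \<open>Pairings with \<open>u - \<rho>b\<close> and smallness of the corner term\<close>

definition pr :: "(real \<Rightarrow> real) \<Rightarrow> real \<Rightarrow> real" where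
  "pr \<phi> t = inner1 (u t) \<phi> - inner1 \<rho>b \<phi>"

lemma b_pr: "b n = pr (sinn n)" by (simp add: b_def pr_def fun_eq_iff)

lemma pr_cont: "integrable Lx \<phi> \<Longrightarrow> continuous_on {-T..0} (pr \<phi>)"
  unfolding pr_def by (intro continuous_on_diff u_pair_cont continuous_on_const)

lemma pr_int: "integrable Lx \<phi> \<Longrightarrow> integrable Lt (pr \<phi>)"
  by (rule continuous_imp_integrable_real, rule pr_cont)

lemma pr_sum:
  assumes "\<And>n. n \<in> K \<Longrightarrow> continuous_on {0..1} (\<phi> n)" "t \<in> {-T..0}"
  shows "pr (\<lambda>x. \<Sum>n\<in>K. c n * \<phi> n x) t = (\<Sum>n\<in>K. c n * pr (\<phi> n) t)"
proof -
  have "inner1 (u t) (\<lambda>x. \<Sum>n\<in>K. c n * \<phi> n x) = (\<Sum>n\<in>K. c n * inner1 (u t) (\<phi> n))"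
    "inner1 \<rho>b (\<lambda>x. \<Sum>n\<in>K. c n * \<phi> n x) = (\<Sum>n\<in>K. c n * inner1 \<rho>b (\<phi> n))"
    by (intro inner1_sum u_int assms \<rho>b_int; simp)+
  then show ?thesis unfolding pr_def by (simp add: right_diff_distrib sum_subtractf)
qed

lemma pr_init:
  assumes "integrable Lx \<phi>"
  shows "pr \<phi> (-T) = 0"
proof -
  have "inner1 (u (-T)) \<phi> = inner1 \<rho>b \<phi>"
    unfolding inner1_def
  proof (rule integral_cong_AE)
    show "(\<lambda>x. u (- T) x * \<phi> x) \<in> borel_measurable Lx" "(\<lambda>x. \<rho>b x * \<phi> x) \<in> borel_measurable Lx"
      using u_int[of "-T"] \<rho>b_int assms T by auto
    show "AE x in Lx. u (- T) x * \<phi> x = \<rho>b x * \<phi> x" using u_init by eventually_elim simp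
  qed
  then show ?thesis by (simp add: pr_def)
qed

lemma pr_bound:
  assumes \<phi>: "integrable Lx \<phi>" and t: "t \<in> {-T..0}"
  shows "\<bar>pr \<phi> t\<bar> \<le> (LINT x|Lx. \<bar>\<phi> x\<bar>)"
proof -
  have ub: "AE x in Lx. \<bar>u t x\<bar> \<le> 1" using u_M[OF t] unfolding M_space_def by (auto elim: eventually_mono)
  have rb: "AE x in Lx. \<bar>\<rho>b x\<bar> \<le> 1"
    by (rule AE_lebesgue_onI) (use \<rho>b_range \<rho>01 in force)
  have d: "AE x in Lx. \<bar>u t x - \<rho>b x\<bar> \<le> 1"
  proof -
    have "AE x in Lx. 0 \<le> u t x \<and> u t x \<le> 1" using u_M[OF t] by (simp add: M_space_def)
    moreover have "AE x in Lx. 0 \<le> \<rho>b x \<and> \<rho>b x \<le> 1"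
      by (rule AE_lebesgue_onI) (use \<rho>b_range \<rho>01 in force)
    ultimately show ?thesis by eventually_elim auto
  qed
  have "pr \<phi> t = (LINT x|Lx. \<phi> x * u t x) - (LINT x|Lx. \<phi> x * \<rho>b x)"
    by (simp add: pr_def inner1_def mult.commute)
  also have "\<dots> = (LINT x|Lx. \<phi> x * (u t x - \<rho>b x))"
    using integrable_mult_bounded[OF \<phi> _ ub] integrable_mult_bounded[OF \<phi> _ rb] u_int[OF t] \<rho>b_int
    by (subst Bochner_Integration.integral_diff[symmetric]) (auto simp: algebra_simps)
  finally have eq: "pr \<phi> t = (LINT x|Lx. \<phi> x * (u t x - \<rho>b x))" .
  have "\<bar>pr \<phi> t\<bar> \<le> 1 * (LINT x|Lx. \<bar>\<phi> x\<bar>)"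
    unfolding eq by (rule abs_integral_le_bound[OF \<phi> _ d]) (use u_int[OF t] \<rho>b_int in auto)
  then show ?thesis by simp
qed

lemma pr_diff:
  assumes "integrable Lx \<phi>" "integrable Lx \<phi>'" "t \<in> {-T..0}"
  shows "pr (\<lambda>x. \<phi> x - \<phi>' x) t = pr \<phi> t - pr \<phi>' t"
proof -
  have "inner1 f (\<lambda>x. \<phi> x - \<phi>' x) = inner1 f \<phi> - inner1 f \<phi>'"
    if "f \<in> borel_measurable Lx" "AE x in Lx. \<bar>f x\<bar> \<le> 1" for f
    unfolding inner1_def using integrable_mult_bounded[OF assms(1) that] integrable_mult_bounded[OF assms(2) that]
    by (subst Bochner_Integration.integral_diff[symmetric]) (auto simp: algebra_simps)
  moreover have "AE x in Lx. \<bar>u t x\<bar> \<le> 1" using u_M[OF assms(3)] unfolding M_space_def by (auto elim: eventually_mono)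
  moreover have "AE x in Lx. \<bar>\<rho>b x\<bar> \<le> 1"
    by (rule AE_lebesgue_onI) (use \<rho>b_range \<rho>01 in force)
  ultimately show ?thesis unfolding pr_def using u_int[OF assms(3)] \<rho>b_int by auto
qed

lemma avg_pr_kerD:
  assumes \<phi>: "integrable Lx \<phi>" and \<tau>: "0 < \<tau>" and t: "t \<in> {-T..0}"
  shows "avg T \<tau> (pr (\<lambda>y. inner1 \<phi> (kerD M y))) t
    = (\<Sum>n\<in>{1..<M}. (2 * fejer_coeff M n * inner1 \<phi> (sinn n)) * avg T \<tau> (b n) t)"
proof -
  interpret ta: time_average T \<tau> by unfold_locales (use T \<tau> in auto)
  have "avg T \<tau> (pr (\<lambda>y. inner1 \<phi> (kerD M y))) t
      = avg T \<tau> (\<lambda>s. \<Sum>n\<in>{1..<M}. (2 * fejer_coeff M n * inner1 \<phi> (sinn n)) * b n s) t"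
    unfolding avg_def
  proof (intro arg_cong2[where f="(*)"] refl Henstock_Kurzweil_Integration.integral_cong)
    fix r assume "r \<in> {-T..t}"
    then have r: "r \<in> {-T..0}" using t by auto
    have "pr (\<lambda>y. inner1 \<phi> (kerD M y)) r = pr (\<lambda>y. \<Sum>n\<in>{1..<M}. (2 * fejer_coeff M n * inner1 \<phi> (sinn n)) * sinn n y) r"
      by (simp add: inner1_kerD[OF \<phi>] mult_ac)
    also have "\<dots> = (\<Sum>n\<in>{1..<M}. (2 * fejer_coeff M n * inner1 \<phi> (sinn n)) * b n r)"
      unfolding b_pr by (rule pr_sum[OF _ r]) (intro continuous_intros)
    finally show "pr (\<lambda>y. inner1 \<phi> (kerD M y)) r = \<dots>" .
  qed
  also have "\<dots> = (\<Sum>n\<in>{1..<M}. (2 * fejer_coeff M n * inner1 \<phi> (sinn n)) * avg T \<tau> (b n) t)"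
    by (rule ta.avg_sum) (use b_int t in auto)
  finally show ?thesis .
qed

text \<open>\<open>u - \<rho>b\<close> is bounded by one, so the error is at most the L1 error of
  the Dirichlet mean, uniformly in time and in \<open>\<tau>\<close>.\<close>

lemma avg_pr_kerD_tendsto:
  assumes \<phi>: "integrable Lx \<phi>" and \<tau>: "0 < \<tau>" and t: "t \<in> {-T..0}"
  shows "\<bar>avg T \<tau> (pr (\<lambda>y. inner1 \<phi> (kerD M y))) t - avg T \<tau> (pr \<phi>) t\<bar>
    \<le> (LINT x|Lx. \<bar>inner1 \<phi> (kerD M x) - \<phi> x\<bar>)"
proof -
  interpret ta: time_average T \<tau> by unfold_locales (use T \<tau> in auto)
  let ?\<phi> = "\<lambda>y. inner1 \<phi> (kerD M y)"
  have i: "integrable Lx ?\<phi>" by (intro continuous_imp_integrable_real continuous_on_inner1_kerD \<phi>)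
  have "avg T \<tau> (\<lambda>s. pr ?\<phi> s + (-1) * pr \<phi> s) t = avg T \<tau> (pr ?\<phi>) t + avg T \<tau> (\<lambda>s. (-1) * pr \<phi> s) t"
    by (rule ta.avg_add) (use pr_int[OF i] pr_int[OF \<phi>] t in \<open>auto simp del: mult_minus1 intro!: Bochner_Integration.integrable_mult_right\<close>)
  then have eq: "avg T \<tau> (pr ?\<phi>) t - avg T \<tau> (pr \<phi>) t = avg T \<tau> (\<lambda>s. pr ?\<phi> s + (-1) * pr \<phi> s) t"
    unfolding ta.avg_cmult by simp
  show ?thesis
    unfolding eq
  proof (rule ta.avg_bound[OF _ _ t])
    show "integrable Lt (\<lambda>s. pr ?\<phi> s + (-1) * pr \<phi> s)" using pr_int[OF i] pr_int[OF \<phi>] by simp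
    fix s assume s: "s \<in> {-T..0}"
    show "\<bar>pr ?\<phi> s + (-1) * pr \<phi> s\<bar> \<le> (LINT x|Lx. \<bar>?\<phi> x - \<phi> x\<bar>)"
      using pr_bound[of "\<lambda>x. ?\<phi> x - \<phi> x", OF _ s] pr_diff[OF i \<phi> s] i \<phi> by simp
  qed
qed

text \<open>For fixed \<open>\<tau>\<close> the averaged difference \<open>u - \<rho>b\<close> has
  bounded energy at every time, so its Dirichlet means are at most
  \<open>e / 4 + K' * sinn 1\<close>, and the corner kernel nearly annihilates such functions. The
  order \<open>M\<close> of these auxiliary means is independent of \<open>N\<close> and tends to
  infinity while \<open>N\<close> is fixed.\<close>

lemma corner_small:
  assumes \<tau>: "0 < \<tau>" and e: "0 < e"
  shows "\<forall>\<^sub>F N in sequentially. \<forall>t\<in>{-T..0}. \<forall>x\<in>{0..1}.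
    \<bar>avg T \<tau> (pr (\<lambda>y. kerN N x y - kerD N x y)) t\<bar> \<le> e"
proof -
  \<comment> \<open>The factor \<open>4\<close> is the square of the coefficient \<open>2\<close> in
    the Dirichlet mean of order \<open>M\<close>; the damping by \<open>fejer_coeff\<close> only
    decreases the energy.\<close>
  define E where "E = 4 * (CE / \<tau>)"
  have E0: "0 \<le> E" using I \<epsilon> T \<tau> by (simp add: E_def CE_def)
  define \<eta> where "\<eta> = e / (8 * (E + 1))"
  have \<eta>: "0 < \<eta>" using e E0 by (simp add: \<eta>_def)
  have \<eta>E: "\<eta> * E \<le> e / 8"
  proof -
    have "\<eta> * E \<le> \<eta> * (E + 1)" using \<eta> by simp
    also have "\<dots> = e / 8" using E0 by (simp add: \<eta>_def divide_simps)
    finally show ?thesis .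
  qed
  have "continuous_on {0..1::real} (\<lambda>y. min y (1 - y))" by (intro continuous_intros)
  then obtain K where K: "K \<ge> 0" "\<And>y. y \<in> {0..1} \<Longrightarrow> \<bar>min y (1 - y)\<bar> \<le> \<eta> * e / 2 + K * sinn 1 y"
    using vanishing_modulus[of "\<lambda>y. min y (1 - y)" "\<eta> * e / 2"] e \<eta> by auto
  define K' where "K' = K / (4 * \<eta>)"
  have K': "K' \<ge> 0" using K \<eta> by (simp add: K'_def)
  have "e / (4 * (K' + 1)) > 0" using e K' by simp
  from corner_sinn[OF this] show ?thesis
  proof eventually_elim
    case (elim N)
    show ?case
    proof (intro ballI)
      fix t x assume t: "t \<in> {-T..0}" and x: "x \<in> {0..1::real}"
      let ?\<phi> = "\<lambda>y. kerN N x y - kerD N x y"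
      have \<phi>: "integrable Lx ?\<phi>" by (intro continuous_imp_integrable_real continuous_intros continuous_on_kerN continuous_on_kerD)
      have \<phi>c: "continuous_on {0..1} ?\<phi>" by (intro continuous_intros continuous_on_kerN continuous_on_kerD)
      have approx: "\<bar>avg T \<tau> (pr (\<lambda>y. inner1 ?\<phi> (kerD M y))) t\<bar> \<le> e" for M
      proof -
        let ?d = "\<lambda>n. 2 * fejer_coeff M n * avg T \<tau> (b n) t"
        let ?\<omega> = "\<lambda>y. \<Sum>n\<in>{1..<M}. ?d n * sinn n y"
        have \<omega>i: "integrable Lx ?\<omega>" by (intro continuous_imp_integrable_real continuous_intros)
        \<comment> \<open>The Dirichlet mean is moved from the corner kernel to the averaged path,
          where the energy bound is available.\<close>
        have eq: "avg T \<tau> (pr (\<lambda>y. inner1 ?\<phi> (kerD M y))) t = inner1 ?\<omega> ?\<phi>"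
          unfolding avg_pr_kerD[OF \<phi> \<tau> t] inner1_commute[of ?\<omega>]
          by (subst inner1_sum[OF \<phi>]) (auto intro: continuous_intros simp: mult_ac)
        have "(\<Sum>n\<in>{1..<M}. (real n * pi * ?d n)\<^sup>2) \<le> (\<Sum>n\<in>{1..<M}. 4 * ((w n)\<^sup>2 * (avg T \<tau> (b n) t)\<^sup>2))"
        proof (rule sum_mono)
          fix n assume n: "n \<in> {1..<M}"
          have "(real n * pi * ?d n)\<^sup>2 = (fejer_coeff M n)\<^sup>2 * (4 * ((w n)\<^sup>2 * (avg T \<tau> (b n) t)\<^sup>2))"
            by (simp add: w_def power_mult_distrib)
          also have "\<dots> \<le> 1 * (4 * ((w n)\<^sup>2 * (avg T \<tau> (b n) t)\<^sup>2))"
            using fejer_coeff_bounds[OF n] by (intro mult_right_mono) (auto simp: power_le_one)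
          finally show "(real n * pi * ?d n)\<^sup>2 \<le> 4 * ((w n)\<^sup>2 * (avg T \<tau> (b n) t)\<^sup>2)" by simp
        qed
        also have "\<dots> \<le> E" using energy_pointwise[OF \<tau> t, of M] by (simp add: E_def sum_distrib_left[symmetric])
        finally have En: "(\<Sum>n\<in>{1..<M}. (real n * pi * ?d n)\<^sup>2) \<le> E" .
        have bd: "\<bar>?\<omega> y\<bar> \<le> e / 4 + K' * sinn 1 y" if y: "y \<in> {0..1}" for y
        proof -
          have "\<bar>?\<omega> y\<bar> \<le> \<eta> * E + min y (1 - y) / (4 * \<eta>)" by (rule sine_poly_modulus[OF y \<eta> En])
          also have "\<dots> \<le> e / 8 + (\<eta> * e / 2 + K * sinn 1 y) / (4 * \<eta>)"
            using K(2)[OF y] \<eta> \<eta>E by (intro add_mono divide_right_mono) auto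
          also have "\<dots> = e / 4 + K' * sinn 1 y" using \<eta> by (simp add: K'_def add_divide_distrib)
          finally show ?thesis .
        qed
        have "\<bar>inner1 ?\<omega> ?\<phi>\<bar> \<le> 2 * (e / 4) + K' * (e / (4 * (K' + 1)))"
          by (rule corner_bound[OF \<omega>i bd]) (use elim x e K' in auto)
        also have "K' * (e / (4 * (K' + 1))) \<le> e / 4" using e K' by (simp add: field_simps)
        finally show ?thesis unfolding eq using e by simp
      qed
      have lim: "(\<lambda>M. avg T \<tau> (pr (\<lambda>y. inner1 ?\<phi> (kerD M y))) t) \<longlonglongrightarrow> avg T \<tau> (pr ?\<phi>) t"
      proof (rule LIM_zero_cancel, rule tendsto_rabs_zero_cancel, rule tendsto_sandwich[OF _ _ tendsto_const kerD_L1_tendsto[OF \<phi>]])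
        show "\<forall>\<^sub>F M in sequentially. \<bar>avg T \<tau> (pr (\<lambda>y. inner1 ?\<phi> (kerD M y))) t - avg T \<tau> (pr ?\<phi>) t\<bar>
            \<le> (LINT x|Lx. \<bar>inner1 ?\<phi> (kerD M x) - ?\<phi> x\<bar>)"
          by (rule always_eventually) (intro allI avg_pr_kerD_tendsto \<phi> \<tau> t)
      qed simp
      show "\<bar>avg T \<tau> (pr ?\<phi>) t\<bar> \<le> e"
        by (rule LIMSEQ_le_const2[OF tendsto_rabs[OF lim]]) (use approx in auto)
    qed
  qed
qed

end

section \<open>The Lagrangian of the mollified path\<close>

lemma inner1_param_continuous:
  fixes f :: "real \<Rightarrow> real \<Rightarrow> real"
  assumes f: "continuous_on (S \<times> {0..1}) (\<lambda>(t, x). f t x)" and \<phi>: "continuous_on {0..1} \<phi>"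
  shows "continuous_on S (\<lambda>t. inner1 (f t) \<phi>)"
proof -
  have fc: "continuous_on {0..1} (f t)" if "t \<in> S" for t
  proof -
    have "continuous_on {0..1} (\<lambda>x. (\<lambda>(t, x). f t x) (t, x))"
      by (rule continuous_on_compose2[OF f]) (use that in \<open>auto intro: continuous_intros\<close>)
    then show ?thesis by simp
  qed
  have "continuous_on (S \<times> {0..1}) (\<lambda>z. (\<lambda>(t, x). f t x) z * \<phi> (snd z))"
    by (intro continuous_intros f continuous_on_compose2[OF \<phi>]) auto
  then have "continuous_on (S \<times> cbox 0 1) (\<lambda>(t, x). f t x * \<phi> x)"
    by (simp add: case_prod_unfold)
  then have "continuous_on S (\<lambda>t. integral (cbox 0 1) (\<lambda>x. f t x * \<phi> x))"
    by (rule integral_continuous_on_param)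
  then show ?thesis
    by (rule continuous_on_cong[THEN iffD1, rotated 2])
       (auto simp: inner1_def intro!: integral_lebesgue_on_cont[symmetric] continuous_intros fc \<phi>)
qed

lemma continuous_on_slice:
  assumes "continuous_on (S \<times> R) (\<lambda>(t, x). f t x)" "t \<in> S"
  shows "continuous_on R (f t)"
proof -
  have "continuous_on R (\<lambda>x. (\<lambda>(t, x). f t x) (t, x))"
    by (rule continuous_on_compose2[OF assms(1)]) (use assms(2) in \<open>auto intro: continuous_intros\<close>)
  then show ?thesis by simp
qed

context finite_action_path
begin

definition vv :: "nat \<Rightarrow> (nat \<Rightarrow> real \<Rightarrow> real) \<Rightarrow> real \<Rightarrow> real \<Rightarrow> real" where
  "vv N \<gamma> t x = \<rho>b x + (\<Sum>n\<in>{1..<N}. \<gamma> n t * sinn n x)"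

text \<open>When \<open>\<gamma>'\<close> is the time derivative of \<open>\<gamma>\<close>, this is
  the primitive in \<open>x\<close>, vanishing at \<open>0\<close>, of the time derivative of
  \<open>vv\<close>.\<close>

definition VV :: "nat \<Rightarrow> (nat \<Rightarrow> real \<Rightarrow> real) \<Rightarrow> real \<Rightarrow> real \<Rightarrow> real" where
  "VV N \<gamma>' t x = (\<Sum>n\<in>{1..<N}. \<gamma>' n t * ((1 - cosn n x) / w n))"

text \<open>The drift \<open>\<epsilon> v\<^sub>x - \<integral>\<^sub>0\<^sup>x v\<^sub>t - f(v)\<close>, whose variance with weight \<open>1 / (4 \<epsilon> f(v))\<close> is the Lagrangian.\<close>

definition WW :: "nat \<Rightarrow> (nat \<Rightarrow> real \<Rightarrow> real) \<Rightarrow> (nat \<Rightarrow> real \<Rightarrow> real) \<Rightarrow> real \<Rightarrow> real \<Rightarrow> real" where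
  "WW N \<gamma> \<gamma>' t x = \<epsilon> * (Dr 1 x + (\<Sum>n\<in>{1..<N}. \<gamma> n t * (w n * cosn n x))) - VV N \<gamma>' t x - flux (vv N \<gamma> t x)"

lemma continuous_on_fst: "continuous_on {-T..0} f \<Longrightarrow> continuous_on ({-T..0} \<times> {0..1}) (\<lambda>z. f (fst z))"
  by (rule continuous_on_compose2) (auto intro: continuous_intros)

lemma continuous_on_snd: "continuous_on {0..1} f \<Longrightarrow> continuous_on ({-T..0} \<times> {0..1}) (\<lambda>z. f (snd z))"
  by (rule continuous_on_compose2) (auto intro: continuous_intros)

lemma vv_cont:
  assumes "\<And>n. n \<in> {1..<N} \<Longrightarrow> continuous_on {-T..0} (\<gamma> n)"
  shows "continuous_on ({-T..0} \<times> {0..1}) (\<lambda>(t, x). vv N \<gamma> t x)"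
  unfolding vv_def case_prod_unfold
  by (intro continuous_intros continuous_on_fst continuous_on_snd \<rho>b_cont assms continuous_on_sinn)

lemma WW_cont:
  assumes "\<And>n. n \<in> {1..<N} \<Longrightarrow> continuous_on {-T..0} (\<gamma> n)" "\<And>n. n \<in> {1..<N} \<Longrightarrow> continuous_on {-T..0} (\<gamma>' n)"
  shows "continuous_on ({-T..0} \<times> {0..1}) (\<lambda>(t, x). WW N \<gamma> \<gamma>' t x)"
proof -
  have "continuous_on ({-T..0} \<times> {0..1}) (\<lambda>z. flux ((\<lambda>(t, x). vv N \<gamma> t x) z))"
    by (intro continuous_on_flux vv_cont assms)
  then have F: "continuous_on ({-T..0} \<times> {0..1}) (\<lambda>z. flux (vv N \<gamma> (fst z) (snd z)))"
    by (simp only: case_prod_unfold)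
  have L: "continuous_on ({-T..0} \<times> {0..1}) (\<lambda>z. \<epsilon> * (Dr 1 (snd z) + (\<Sum>n\<in>{1..<N}. \<gamma> n (fst z) * (w n * cosn n (snd z))))
     - (\<Sum>n\<in>{1..<N}. \<gamma>' n (fst z) * ((1 - cosn n (snd z)) / w n)))"
    by (intro continuous_intros continuous_on_fst continuous_on_snd Dr_cont assms continuous_on_cosn) (use w_pos in force)+
  show ?thesis unfolding WW_def VV_def case_prod_unfold by (rule continuous_on_diff[OF L F])
qed

text \<open>Sine coefficients of the mollified difference \<open>u - \<rho>b\<close>. The factor
  \<open>2\<close> normalises the sines, whose squares integrate to \<open>1/2\<close>;
  \<open>gam'\<close> is the time derivative, read off from the equation that the time mean
  satisfies.\<close>

definition gam :: "nat \<Rightarrow> real \<Rightarrow> real \<Rightarrow> nat \<Rightarrow> real \<Rightarrow> real" where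
  "gam N \<tau> lam n t = (1 - lam) * (2 * fejer_coeff N n * avg T \<tau> (b n) t)"
definition gam' :: "nat \<Rightarrow> real \<Rightarrow> real \<Rightarrow> nat \<Rightarrow> real \<Rightarrow> real" where
  "gam' N \<tau> lam n t = (1 - lam) * (2 * fejer_coeff N n * ((b n t - avg T \<tau> (b n) t) / \<tau>))"
text \<open>The mean of \<open>flux u\<close> over time and, with the Neumann kernel, over space; as
  a finite cosine sum it is visibly jointly continuous.\<close>

definition KS :: "nat \<Rightarrow> real \<Rightarrow> real \<Rightarrow> real \<Rightarrow> real" where
  "KS N \<tau> t x = avg T \<tau> (q (\<lambda>_. 1)) t + (\<Sum>n\<in>{1..<N}. 2 * fejer_coeff N n * cosn n x * avg T \<tau> (q (cosn n)) t)"

text \<open>Against \<open>p\<close> of mean zero everything constant in \<open>x\<close> drops out: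
  \<open>J\<close> from the stationary equation and the constant part of the primitive
  \<open>VV\<close>.\<close>

lemma linear_part:
  assumes p: "continuous_on {0..1} p" and p0: "inner1 p (\<lambda>_. 1) = 0"
  shows "inner1 (\<lambda>x. \<epsilon> * (Dr 1 x + (\<Sum>n\<in>{1..<N}. \<gamma> n t * (w n * cosn n x))) - VV N \<gamma>' t x) p
    = inner1 (\<lambda>x. flux (\<rho>b x)) p + (\<Sum>n\<in>{1..<N}. (\<epsilon> * \<gamma> n t * w n + \<gamma>' n t / w n) * inner1 p (cosn n))"
proof -
  let ?K0 = "- J - (\<Sum>n\<in>{1..<N}. \<gamma>' n t / w n)"
  note pi = continuous_imp_integrable_real[OF p]
  have "inner1 (\<lambda>x. \<epsilon> * (Dr 1 x + (\<Sum>n\<in>{1..<N}. \<gamma> n t * (w n * cosn n x))) - VV N \<gamma>' t x) p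
    = inner1 p (\<lambda>x. (flux (\<rho>b x) + ?K0 * 1) + (\<Sum>n\<in>{1..<N}. (\<epsilon> * \<gamma> n t * w n + \<gamma>' n t / w n) * cosn n x))"
    unfolding inner1_commute[of p]
  proof (rule inner1_cong)
    fix x :: real assume x: "x \<in> {0..1}"
    have "\<epsilon> * (Dr 1 x + (\<Sum>n\<in>{1..<N}. \<gamma> n t * (w n * cosn n x))) = flux (\<rho>b x) - J + (\<Sum>n\<in>{1..<N}. \<epsilon> * \<gamma> n t * w n * cosn n x)"
      using ode[OF x] by (simp add: distrib_left sum_distrib_left mult_ac)
    moreover have "VV N \<gamma>' t x = (\<Sum>n\<in>{1..<N}. \<gamma>' n t / w n) - (\<Sum>n\<in>{1..<N}. \<gamma>' n t / w n * cosn n x)"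
      by (simp add: VV_def sum_subtractf[symmetric] diff_divide_distrib right_diff_distrib)
    ultimately show "\<epsilon> * (Dr 1 x + (\<Sum>n\<in>{1..<N}. \<gamma> n t * (w n * cosn n x))) - VV N \<gamma>' t x
      = (flux (\<rho>b x) + ?K0 * 1) + (\<Sum>n\<in>{1..<N}. (\<epsilon> * \<gamma> n t * w n + \<gamma>' n t / w n) * cosn n x)"
      by (simp add: distrib_right sum.distrib)
  qed simp
  also have "\<dots> = inner1 p (\<lambda>x. flux (\<rho>b x) + ?K0 * 1) + inner1 p (\<lambda>x. \<Sum>n\<in>{1..<N}. (\<epsilon> * \<gamma> n t * w n + \<gamma>' n t / w n) * cosn n x)"
    by (intro inner1_add_right pi continuous_intros \<rho>b_cont)
  also have "inner1 p (\<lambda>x. flux (\<rho>b x) + ?K0 * 1) = inner1 p (\<lambda>x. flux (\<rho>b x)) + inner1 p (\<lambda>x. ?K0 * 1)"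
    by (intro inner1_add_right pi continuous_intros \<rho>b_cont)
  also have "inner1 p (\<lambda>x. ?K0 * 1) = 0" unfolding inner1_cmult_right p0 by simp
  also have "inner1 p (\<lambda>x. \<Sum>n\<in>{1..<N}. (\<epsilon> * \<gamma> n t * w n + \<gamma>' n t / w n) * cosn n x)
      = (\<Sum>n\<in>{1..<N}. (\<epsilon> * \<gamma> n t * w n + \<gamma>' n t / w n) * inner1 p (cosn n))"
    by (intro inner1_sum pi continuous_intros)
  finally show ?thesis by (simp add: inner1_commute)
qed

lemma psi_tangent: "(1 + 2 * \<epsilon> * c) * y - \<epsilon> * c\<^sup>2 \<le> psi y"
proof -
  have "0 \<le> \<epsilon> * (y - c)\<^sup>2" using \<epsilon> by simp
  then show ?thesis by (simp add: psi_def power2_eq_square algebra_simps)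
qed

lemma psi_cont: "continuous_on S f \<Longrightarrow> continuous_on S (\<lambda>x. psi (f x))"
  unfolding psi_def by (intro continuous_intros)

text \<open>Jensen in space and time at once, from the tangent of \<open>psi\<close> at the mean
  \<open>X\<close>. The spatial kernel has mass one; the temporal mass is at most one and multiplies
  the constant \<open>- \<epsilon> X\<^sup>2\<close>, so its deficit is harmless.\<close>

lemma jensen_psi:
  assumes \<tau>: "0 < \<tau>" and p: "continuous_on ({-T..0} \<times> {0..1}) (\<lambda>(t, x). p t x)" and t: "t \<in> {-T..0}"
  shows "psi (adv \<tau> (\<lambda>r. inner1 (p r) (kerN N y)) t) \<le> adv \<tau> (\<lambda>r. inner1 (\<lambda>x. psi (p r x)) (kerN N y)) t"
proof -
  interpret ta: time_average T \<tau> by unfold_locales (use T \<tau> in auto)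
  define X where "X = adv \<tau> (\<lambda>r. inner1 (p r) (kerN N y)) t"
  have psip: "continuous_on ({-T..0} \<times> {0..1}) (\<lambda>(t, x). psi (p t x))"
    using psi_cont[OF p] by (simp add: case_prod_unfold)
  have c1: "continuous_on {-T..0} (\<lambda>r. inner1 (p r) (kerN N y))"
    by (rule inner1_param_continuous[OF p continuous_on_kerN])
  have c2: "continuous_on {-T..0} (\<lambda>r. inner1 (\<lambda>x. psi (p r x)) (kerN N y))"
    by (rule inner1_param_continuous[OF psip continuous_on_kerN])
  have "adv \<tau> (\<lambda>r. (1 + 2 * \<epsilon> * X) * inner1 (p r) (kerN N y) + (- \<epsilon> * X\<^sup>2)) t \<le> adv \<tau> (\<lambda>r. inner1 (\<lambda>x. psi (p r x)) (kerN N y)) t"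
  proof (rule ta.adv_mono[OF _ _ _ t])
    fix r assume r: "r \<in> {-T..0}"
    have pc: "continuous_on {0..1} (p r)" by (rule continuous_on_slice[OF p r])
    have pi: "integrable Lx (p r)" by (rule continuous_imp_integrable_real[OF pc])
    have "inner1 (\<lambda>x. (1 + 2 * \<epsilon> * X) * p r x + (- \<epsilon> * X\<^sup>2) * 1) (kerN N y)
       = inner1 (\<lambda>x. (1 + 2 * \<epsilon> * X) * p r x) (kerN N y) + inner1 (\<lambda>x. (- \<epsilon> * X\<^sup>2) * 1) (kerN N y)"
      by (rule inner1_add_left) (use pi in \<open>auto intro: continuous_on_kerN\<close>)
    then have "(1 + 2 * \<epsilon> * X) * inner1 (p r) (kerN N y) + (- \<epsilon> * X\<^sup>2) = inner1 (\<lambda>x. (1 + 2 * \<epsilon> * X) * p r x + (- \<epsilon> * X\<^sup>2) * 1) (kerN N y)"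
      unfolding inner1_cmult_left kerN_one by simp
    also have "\<dots> \<le> inner1 (\<lambda>x. psi (p r x)) (kerN N y)"
    proof (rule inner1_kerN_le)
      show "(1 + 2 * \<epsilon> * X) * p r x + (- \<epsilon> * X\<^sup>2) * 1 \<le> psi (p r x)" for x
        using psi_tangent[of X "p r x"] by simp
    qed (intro continuous_intros pc psi_cont)+
    finally show "(1 + 2 * \<epsilon> * X) * inner1 (p r) (kerN N y) + (- \<epsilon> * X\<^sup>2) \<le> inner1 (\<lambda>x. psi (p r x)) (kerN N y)" .
  qed (intro continuous_imp_integrable_real continuous_intros c1 c2)+
  also have "adv \<tau> (\<lambda>r. (1 + 2 * \<epsilon> * X) * inner1 (p r) (kerN N y) + (- \<epsilon> * X\<^sup>2)) t
      = (1 + 2 * \<epsilon> * X) * X + (- \<epsilon> * X\<^sup>2) * adv \<tau> (\<lambda>_. 1) t"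
    using continuous_imp_integrable_real[OF c1]
    by (subst ta.adv_add[OF _ _ t]) (auto simp: ta.adv_cmult X_def ta.adv_const[of "- (\<epsilon> * _)"])
  finally have le: "(1 + 2 * \<epsilon> * X) * X + (- \<epsilon> * X\<^sup>2) * adv \<tau> (\<lambda>_. 1) t \<le> adv \<tau> (\<lambda>r. inner1 (\<lambda>x. psi (p r x)) (kerN N y)) t" .
  have "\<epsilon> * X\<^sup>2 * adv \<tau> (\<lambda>_. 1) t \<le> \<epsilon> * X\<^sup>2 * 1"
    using \<epsilon> ta.adv_1_bounds[OF t] by (intro mult_left_mono) auto
  then have "psi X \<le> (1 + 2 * \<epsilon> * X) * X + (- \<epsilon> * X\<^sup>2) * adv \<tau> (\<lambda>_. 1) t"
    by (simp add: psi_def power2_eq_square algebra_simps)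
  then show ?thesis using le by (simp add: X_def)
qed

text \<open>The test function has as its space derivative the adjoint time mean of the Neumann mean
  of \<open>p\<close>. Duality moves the means in the linear terms from \<open>p\<close> to the
  path, where \<open>b n\<close> becomes a coefficient of the mollified path. The \<open>psi\<close>
  term is bounded by \<open>jensen_psi\<close> before the same is done, and there the means fall on
  \<open>flux u\<close>, which gives \<open>KS\<close>.\<close>

lemma dual_bound:
  assumes \<tau>: "0 < \<tau>" and lam: "lam < 1"
    and p: "continuous_on ({-T..0} \<times> {0..1}) (\<lambda>(t, x). p t x)"
    and p0: "\<And>t. t \<in> {-T..0} \<Longrightarrow> inner1 (p t) (\<lambda>_. 1) = 0"
  shows "(LINT t|Lt. inner1 (\<lambda>x. \<epsilon> * (Dr 1 x + (\<Sum>n\<in>{1..<N}. gam N \<tau> lam n t * (w n * cosn n x))) - VV N (gam' N \<tau> lam) t x) (p t))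
    \<le> (1 - lam) * I + (LINT t|Lt. inner1 (\<lambda>x. flux (\<rho>b x)) (p t)
        - (1 - lam) * avg T \<tau> (\<lambda>_. 1) t * inner1 (\<lambda>x. inner1 (\<lambda>x. flux (\<rho>b x)) (kerN N x)) (p t)
        + (1 - lam) * inner1 (KS N \<tau> t) (\<lambda>x. psi (p t x)))"
proof -
  interpret ta: time_average T \<tau> by unfold_locales (use T \<tau> in auto)
  let ?K = "{1..<N}"
  let ?a = "\<lambda>n. 2 * fejer_coeff N n"
  define pn where "pn = (\<lambda>n t. inner1 (p t) (cosn n))"
  \<comment> \<open>Division by \<open>w n\<close> integrates the cosine series of \<open>p\<close>,
    so that the space derivative of the test function is a mean of \<open>p\<close> itself.\<close>
  define r where "r = (\<lambda>n t. ?a n * pn n t / w n)"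
  define c where "c = (\<lambda>n. adv \<tau> (r n))"
  define c' where "c' = (\<lambda>n t. (c n t - r n t) / \<tau>)"
  define \<beta> where "\<beta> = (\<lambda>n. avg T \<tau> (b n))"
  define yn where "yn = (\<lambda>n t. inner1 (\<lambda>x. psi (p t x)) (cosn n))"
  have psip: "continuous_on ({-T..0} \<times> {0..1}) (\<lambda>(t, x). psi (p t x))"
    using psi_cont[OF p] by (simp add: case_prod_unfold)
  have pnc: "continuous_on {-T..0} (pn n)" for n unfolding pn_def by (intro inner1_param_continuous[OF p] continuous_on_cosn)
  have ync: "continuous_on {-T..0} (yn n)" for n unfolding yn_def by (intro inner1_param_continuous[OF psip] continuous_on_cosn)
  have rc: "continuous_on {-T..0} (r n)" if "n \<in> ?K" for n
    unfolding r_def using w_pos[OF that] by (intro continuous_intros pnc) auto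
  have ri: "integrable Lt (r n)" if "n \<in> ?K" for n by (rule continuous_imp_integrable_real[OF rc[OF that]])
  have cc: "continuous_on {-T..0} (c n)" if "n \<in> ?K" for n unfolding c_def by (rule ta.adv_continuous[OF ri[OF that]])
  have c'c: "continuous_on {-T..0} (c' n)" if "n \<in> ?K" for n
    unfolding c'_def using \<tau> by (intro continuous_intros cc rc that) auto
  have \<beta>c: "continuous_on {-T..0} (\<beta> n)" for n unfolding \<beta>_def by (rule ta.avg_continuous[OF b_int])
  have act: "(LINT t|Lt. Fint N c c' t) \<le> I"
  proof (rule action_C1)
    show "(c n has_real_derivative c' n t) (at t within {-T..0})" if "n \<in> ?K" "t \<in> {-T..0}" for n t
      unfolding c_def c'_def by (rule ta.adv_deriv[OF rc[OF that(1)] that(2)])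
  qed (use c'c in \<open>auto simp: c_def\<close>)
  have q1i: "integrable Lt (q (\<lambda>_. 1))" by (rule q_int) simp
  have qni: "integrable Lt (q (cosn n))" for n by (intro q_int continuous_on_cosn)
  define F1 where "F1 = (\<lambda>t. \<Sum>n\<in>?K. r n t * ((b n t - \<beta> n t) / \<tau> + \<epsilon> * (w n)\<^sup>2 * \<beta> n t))"
  define F2 where "F2 = (\<lambda>t. \<Sum>n\<in>?K. (w n * s n) * (avg T \<tau> (\<lambda>_. 1) t * r n t))"
  define F3 where "F3 = (\<lambda>t. avg T \<tau> (q (\<lambda>_. 1)) t * yn 0 t + (\<Sum>n\<in>?K. ?a n * (avg T \<tau> (q (cosn n)) t * yn n t)))"
  have F1i: "integrable Lt F1" unfolding F1_def using \<tau>
    by (intro continuous_imp_integrable_real continuous_intros rc b_cont \<beta>c) auto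
  have F2i: "integrable Lt F2" unfolding F2_def
    by (intro continuous_imp_integrable_real continuous_intros rc ta.avg_continuous ta.integrable_const_T) auto
  have F3i: "integrable Lt F3" unfolding F3_def
    by (intro continuous_imp_integrable_real continuous_intros ync ta.avg_continuous q1i qni)
  have main: "(LINT t|Lt. F1 t) + (LINT t|Lt. F2 t) - (LINT t|Lt. F3 t) \<le> I"
  proof -
    \<comment> \<open>A minorant of the action density that is linear in the adjoint means, so that
      duality applies term by term.\<close>
    let ?G = "\<lambda>t. (\<Sum>n\<in>?K. - c' n t * b n t + \<epsilon> * (w n)\<^sup>2 * (c n t * b n t)) + (\<Sum>n\<in>?K. (w n * s n) * c n t)
        - (q (\<lambda>_. 1) t * adv \<tau> (yn 0) t + (\<Sum>n\<in>?K. ?a n * (q (cosn n) t * adv \<tau> (yn n) t)))"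
    have yni: "integrable Lt (yn n)" for n by (rule continuous_imp_integrable_real[OF ync])
    have i1: "integrable Lt (\<lambda>t. - c' n t * b n t + \<epsilon> * (w n)\<^sup>2 * (c n t * b n t))" if "n \<in> ?K" for n
      by (intro continuous_imp_integrable_real continuous_intros cc c'c b_cont that)
    have i2: "integrable Lt (\<lambda>t. (w n * s n) * c n t)" if "n \<in> ?K" for n
      by (intro continuous_imp_integrable_real continuous_intros cc that)
    have i3: "integrable Lt (\<lambda>t. q (\<lambda>_. 1) t * adv \<tau> (yn 0) t)"
      using integrable_mult_cont[OF q1i ta.adv_continuous[OF yni[of 0]]] by (simp add: mult.commute)
    have i4: "integrable Lt (\<lambda>t. ?a n * (q (cosn n) t * adv \<tau> (yn n) t))" for n
      using integrable_mult_cont[OF qni ta.adv_continuous[OF yni[of n]], of n] by (simp add: mult.commute)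
    have Gi: "integrable Lt ?G"
      by (intro Bochner_Integration.integrable_diff Bochner_Integration.integrable_add Bochner_Integration.integrable_sum i1 i2 i3 i4)
    have "(LINT t|Lt. ?G t) \<le> (LINT t|Lt. Fint N c c' t)"
    proof (rule integral_lebesgue_on_mono[OF Gi Fint_int(4)[OF cc c'c]])
      fix t assume t: "t \<in> {-T..0}"
      let ?X = "\<lambda>x. \<Sum>n\<in>?K. c n t * (w n * cosn n x)"
      let ?Y = "\<lambda>x. adv \<tau> (yn 0) t + (\<Sum>n\<in>?K. (?a n * adv \<tau> (yn n) t) * cosn n x)"
      have X_eq: "?X y = adv \<tau> (\<lambda>r. inner1 (p r) (kerN N y)) t" for y
      proof -
        have "adv \<tau> (\<lambda>r. inner1 (p r) (kerN N y)) t = adv \<tau> (\<lambda>z. \<Sum>n\<in>?K. (w n * cosn n y) * r n z) t"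
          unfolding adv_def
        proof (intro arg_cong2[where f="(*)"] refl Henstock_Kurzweil_Integration.integral_cong)
          fix z assume "z \<in> {t..0}"
          then have z: "z \<in> {-T..0}" using t by auto
          have "inner1 (p z) (kerN N y) = (\<Sum>n\<in>?K. ?a n * cosn n y * pn n z)"
            using p0[OF z] inner1_kerN[OF continuous_imp_integrable_real[OF continuous_on_slice[OF p z]]] by (simp add: pn_def)
          also have "\<dots> = (\<Sum>n\<in>?K. (w n * cosn n y) * r n z)"
            by (intro sum.cong refl) (use w_pos in \<open>force simp: r_def\<close>)
          finally show "inner1 (p z) (kerN N y) = \<dots>" .
        qed
        also have "\<dots> = (\<Sum>n\<in>?K. (w n * cosn n y) * c n t)" unfolding c_def
          by (rule ta.adv_sum) (use ri t in auto)
        finally show ?thesis by (simp add: mult_ac)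
      qed
      have Y_eq: "?Y y = adv \<tau> (\<lambda>r. inner1 (\<lambda>x. psi (p r x)) (kerN N y)) t" for y
      proof -
        have "adv \<tau> (\<lambda>r. inner1 (\<lambda>x. psi (p r x)) (kerN N y)) t = adv \<tau> (\<lambda>z. yn 0 z + (\<Sum>n\<in>?K. (?a n * cosn n y) * yn n z)) t"
          unfolding adv_def
        proof (intro arg_cong2[where f="(*)"] refl Henstock_Kurzweil_Integration.integral_cong)
          fix z assume "z \<in> {t..0}"
          then have z: "z \<in> {-T..0}" using t by auto
          show "inner1 (\<lambda>x. psi (p z x)) (kerN N y) = yn 0 z + (\<Sum>n\<in>?K. (?a n * cosn n y) * yn n z)"
            using inner1_kerN[OF continuous_imp_integrable_real[OF psi_cont[OF continuous_on_slice[OF p z]]]] by (simp add: yn_def)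
        qed
        also have "\<dots> = adv \<tau> (yn 0) t + adv \<tau> (\<lambda>z. \<Sum>n\<in>?K. (?a n * cosn n y) * yn n z) t"
          by (rule ta.adv_add[OF _ _ t]) (auto intro!: yni Bochner_Integration.integrable_sum Bochner_Integration.integrable_mult_right)
        also have "adv \<tau> (\<lambda>z. \<Sum>n\<in>?K. (?a n * cosn n y) * yn n z) t = (\<Sum>n\<in>?K. (?a n * cosn n y) * adv \<tau> (yn n) t)"
          by (rule ta.adv_sum) (use yni t in auto)
        finally show ?thesis by (simp add: mult_ac)
      qed
      \<comment> \<open>Jensen's inequality may be multiplied by \<open>flux (u t x)\<close> because
        the flux is nonnegative almost everywhere.\<close>
      have "inner1 (\<lambda>x. flux (u t x)) (\<lambda>x. psi (?X x)) \<le> inner1 (\<lambda>x. flux (u t x)) ?Y"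
        unfolding inner1_def
      proof (rule integral_mono_AE)
        show "AE x in Lx. flux (u t x) * psi (?X x) \<le> flux (u t x) * ?Y x"
          using M_space_flux_bounds[OF u_M[OF t]]
          by eventually_elim (simp only: X_eq Y_eq, intro mult_left_mono jensen_psi[OF \<tau> p t], simp)
      qed (intro inner1_integrable u_flux_int t continuous_intros psi_cont)+
      also have "inner1 (\<lambda>x. flux (u t x)) ?Y = inner1 (\<lambda>x. flux (u t x)) (\<lambda>_. adv \<tau> (yn 0) t * 1)
          + inner1 (\<lambda>x. flux (u t x)) (\<lambda>x. \<Sum>n\<in>?K. (?a n * adv \<tau> (yn n) t) * cosn n x)"
        unfolding mult_1_right by (intro inner1_add_right u_flux_int t continuous_intros)
      also have "\<dots> = q (\<lambda>_. 1) t * adv \<tau> (yn 0) t + (\<Sum>n\<in>?K. ?a n * (q (cosn n) t * adv \<tau> (yn n) t))"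
        unfolding inner1_cmult_right
        by (subst inner1_sum[OF u_flux_int[OF t]]) (auto simp: q_def mult_ac intro: continuous_intros)
      finally have "(\<Sum>n\<in>?K. c n t * (w n * q (cosn n) t)) + (\<Sum>n\<in>?K. \<Sum>m\<in>?K. (c n t * c m t) * B n m t)
          \<le> q (\<lambda>_. 1) t * adv \<tau> (yn 0) t + (\<Sum>n\<in>?K. ?a n * (q (cosn n) t * adv \<tau> (yn n) t))"
        unfolding psi_expand[OF t] .
      moreover have "(\<Sum>n\<in>?K. - c' n t * b n t) + (\<Sum>n\<in>?K. c n t * A n t)
          = (\<Sum>n\<in>?K. - c' n t * b n t + \<epsilon> * (w n)\<^sup>2 * (c n t * b n t)) + (\<Sum>n\<in>?K. (w n * s n) * c n t)
            - (\<Sum>n\<in>?K. c n t * (w n * q (cosn n) t))"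
        by (simp add: A_def sum.distrib[symmetric] sum_subtractf[symmetric] algebra_simps)
      ultimately show "?G t \<le> Fint N c c' t" unfolding Fint_def by linarith
    qed
    moreover have "(LINT t|Lt. ?G t) = (LINT t|Lt. F1 t) + (LINT t|Lt. F2 t) - (LINT t|Lt. F3 t)"
    proof -
      \<comment> \<open>Duality replaces \<open>c n * b n\<close> by \<open>r n * \<beta> n\<close>,
        and the derivative of \<open>c n\<close> is thereby traded for
        \<open>(b n - \<beta> n) / \<tau>\<close>, the derivative of the time mean.\<close>
      have e1: "(LINT t|Lt. - c' n t * b n t + \<epsilon> * (w n)\<^sup>2 * (c n t * b n t))
          = (LINT t|Lt. r n t * ((b n t - \<beta> n t) / \<tau> + \<epsilon> * (w n)\<^sup>2 * \<beta> n t))" if n: "n \<in> ?K" for n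
      proof -
        have ii: "integrable Lt (\<lambda>t. r n t * b n t)" "integrable Lt (\<lambda>t. c n t * b n t)" "integrable Lt (\<lambda>t. r n t * \<beta> n t)"
          by (intro continuous_imp_integrable_real continuous_intros rc cc b_cont \<beta>c n)+
        have dual: "(LINT t|Lt. c n t * b n t) = (LINT t|Lt. r n t * \<beta> n t)"
          using ta.avg_adv_duality[OF b_int rc[OF n], of n] by (simp add: c_def \<beta>_def mult.commute)
        have "(LINT t|Lt. - c' n t * b n t + \<epsilon> * (w n)\<^sup>2 * (c n t * b n t))
            = (LINT t|Lt. 1/\<tau> * (r n t * b n t) + (\<epsilon> * (w n)\<^sup>2 - 1/\<tau>) * (c n t * b n t))"
          by (rule integral_lebesgue_on_cong) (simp add: c'_def diff_divide_distrib algebra_simps)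
        also have "\<dots> = 1/\<tau> * (LINT t|Lt. r n t * b n t) + (\<epsilon> * (w n)\<^sup>2 - 1/\<tau>) * (LINT t|Lt. c n t * b n t)"
          using ii by (subst Bochner_Integration.integral_add) auto
        also have "\<dots> = (LINT t|Lt. 1/\<tau> * (r n t * b n t) + (\<epsilon> * (w n)\<^sup>2 - 1/\<tau>) * (r n t * \<beta> n t))"
          unfolding dual using ii by (subst Bochner_Integration.integral_add) auto
        also have "\<dots> = (LINT t|Lt. r n t * ((b n t - \<beta> n t) / \<tau> + \<epsilon> * (w n)\<^sup>2 * \<beta> n t))"
          by (rule integral_lebesgue_on_cong) (simp add: diff_divide_distrib algebra_simps)
        finally show ?thesis .
      qed
      have e2: "(LINT t|Lt. (w n * s n) * c n t) = (LINT t|Lt. (w n * s n) * (avg T \<tau> (\<lambda>_. 1) t * r n t))" if n: "n \<in> ?K" for n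
        using ta.avg_adv_duality[OF ta.integrable_const_T[of 1] rc[OF n]] by (simp add: c_def mult.commute)
      have e3: "(LINT t|Lt. q (\<lambda>_. 1) t * adv \<tau> (yn 0) t) = (LINT t|Lt. avg T \<tau> (q (\<lambda>_. 1)) t * yn 0 t)"
        using ta.avg_adv_duality[OF q1i ync[of 0]] by (simp add: mult.commute)
      have e4: "(LINT t|Lt. ?a n * (q (cosn n) t * adv \<tau> (yn n) t)) = (LINT t|Lt. ?a n * (avg T \<tau> (q (cosn n)) t * yn n t))" for n
        using ta.avg_adv_duality[OF qni ync[of n], of n] by (simp add: mult.commute)
      have j1: "integrable Lt (\<lambda>t. r n t * ((b n t - \<beta> n t) / \<tau> + \<epsilon> * (w n)\<^sup>2 * \<beta> n t))" if "n \<in> ?K" for n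
        using \<tau> by (intro continuous_imp_integrable_real continuous_intros rc b_cont \<beta>c that) auto
      have j2: "integrable Lt (\<lambda>t. (w n * s n) * (avg T \<tau> (\<lambda>_. 1) t * r n t))" if "n \<in> ?K" for n
        by (intro continuous_imp_integrable_real continuous_intros rc ta.avg_continuous ta.integrable_const_T that)
      have j3: "integrable Lt (\<lambda>t. avg T \<tau> (q (\<lambda>_. 1)) t * yn 0 t)"
        by (intro continuous_imp_integrable_real continuous_intros ync ta.avg_continuous q1i)
      have j4: "integrable Lt (\<lambda>t. ?a n * (avg T \<tau> (q (cosn n)) t * yn n t))" for n
        by (intro continuous_imp_integrable_real continuous_intros ync ta.avg_continuous qni)
      have s1: "(LINT t|Lt. (\<Sum>n\<in>?K. - c' n t * b n t + \<epsilon> * (w n)\<^sup>2 * (c n t * b n t))) = (LINT t|Lt. F1 t)"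
        unfolding F1_def by (subst (1 2) Bochner_Integration.integral_sum) (use i1 j1 e1 in \<open>auto intro!: sum.cong\<close>)
      have s2: "(LINT t|Lt. (\<Sum>n\<in>?K. (w n * s n) * c n t)) = (LINT t|Lt. F2 t)"
        unfolding F2_def by (subst (1 2) Bochner_Integration.integral_sum) (use i2 j2 e2 in \<open>auto intro!: sum.cong\<close>)
      have s4: "(LINT t|Lt. (\<Sum>n\<in>?K. ?a n * (q (cosn n) t * adv \<tau> (yn n) t))) = (LINT t|Lt. (\<Sum>n\<in>?K. ?a n * (avg T \<tau> (q (cosn n)) t * yn n t)))"
        by (subst (1 2) Bochner_Integration.integral_sum, rule j4, rule i4, rule sum.cong[OF refl e4])
      have s3: "(LINT t|Lt. q (\<lambda>_. 1) t * adv \<tau> (yn 0) t + (\<Sum>n\<in>?K. ?a n * (q (cosn n) t * adv \<tau> (yn n) t))) = (LINT t|Lt. F3 t)"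
        unfolding F3_def
        by (subst (1 2) Bochner_Integration.integral_add) (use i3 j3 i4 j4 e3 s4 in \<open>auto intro!: Bochner_Integration.integrable_sum simp del: Bochner_Integration.integral_sum\<close>)
      show ?thesis unfolding s1[symmetric] s2[symmetric] s3[symmetric]
        by (subst Bochner_Integration.integral_diff, intro Bochner_Integration.integrable_add Bochner_Integration.integrable_sum i1 i2,
            assumption, assumption, intro Bochner_Integration.integrable_add Bochner_Integration.integrable_sum i3 i4,
            subst Bochner_Integration.integral_add, intro Bochner_Integration.integrable_sum i1, assumption,
            intro Bochner_Integration.integrable_sum i2, assumption, rule refl)
    qed
    ultimately show ?thesis using act by linarith
  qed
  have lin: "inner1 (\<lambda>x. \<epsilon> * (Dr 1 x + (\<Sum>n\<in>?K. gam N \<tau> lam n t * (w n * cosn n x))) - VV N (gam' N \<tau> lam) t x) (p t)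
      = inner1 (\<lambda>x. flux (\<rho>b x)) (p t) + (1 - lam) * F1 t" if t: "t \<in> {-T..0}" for t
  proof -
    have "(\<epsilon> * gam N \<tau> lam n t * w n + gam' N \<tau> lam n t / w n) * pn n t = (1 - lam) * (r n t * ((b n t - \<beta> n t) / \<tau> + \<epsilon> * (w n)\<^sup>2 * \<beta> n t))" if "n \<in> ?K" for n
    proof -
      have alg: "(\<epsilon> * ((1 - lam) * (a * \<beta>)) * w + (1 - lam) * (a * z) / w) * p = (1 - lam) * ((a * p / w) * (z + \<epsilon> * w\<^sup>2 * \<beta>))"
        if "w > 0" for a \<beta> z w p :: real
        using that by (simp add: field_simps power2_eq_square)
      show ?thesis unfolding gam_def gam'_def r_def \<beta>_def by (rule alg[OF w_pos[OF that]])
    qed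
    then have "(\<Sum>n\<in>?K. (\<epsilon> * gam N \<tau> lam n t * w n + gam' N \<tau> lam n t / w n) * inner1 (p t) (cosn n)) = (1 - lam) * F1 t"
      unfolding F1_def sum_distrib_left pn_def by (intro sum.cong refl)
    then show ?thesis
      using linear_part[OF continuous_on_slice[OF p t] p0[OF t], where N=N and \<gamma>="gam N \<tau> lam" and \<gamma>'="gam' N \<tau> lam" and t=t]
      by simp
  qed
  have F2_eq: "F2 t = avg T \<tau> (\<lambda>_. 1) t * inner1 (\<lambda>x. inner1 (\<lambda>x. flux (\<rho>b x)) (kerN N x)) (p t)" if t: "t \<in> {-T..0}" for t
  proof -
    note pti = continuous_imp_integrable_real[OF continuous_on_slice[OF p t]]
    have "inner1 (\<lambda>x. inner1 (\<lambda>x. flux (\<rho>b x)) (kerN N x)) (p t)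
       = inner1 (p t) (\<lambda>x. inner1 (\<lambda>x. flux (\<rho>b x)) (\<lambda>_. 1) * 1 + (\<Sum>n\<in>?K. (?a n * s n) * cosn n x))"
      unfolding inner1_commute[of "p t"] by (rule inner1_cong) (simp_all add: inner1_kerN[OF \<rho>b_flux_int] s_def mult_ac)
    also have "\<dots> = inner1 (p t) (\<lambda>x. inner1 (\<lambda>x. flux (\<rho>b x)) (\<lambda>_. 1) * 1) + inner1 (p t) (\<lambda>x. \<Sum>n\<in>?K. (?a n * s n) * cosn n x)"
      by (intro inner1_add_right pti continuous_intros)
    also have "\<dots> = (\<Sum>n\<in>?K. (?a n * s n) * pn n t)"
      unfolding inner1_cmult_right p0[OF t] by (subst inner1_sum[OF pti]) (auto simp: pn_def intro: continuous_intros)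
    finally have "inner1 (\<lambda>x. inner1 (\<lambda>x. flux (\<rho>b x)) (kerN N x)) (p t) = (\<Sum>n\<in>?K. (?a n * s n) * pn n t)" .
    moreover have F2n: "(w n * s n) * (avg T \<tau> (\<lambda>_. 1) t * r n t) = avg T \<tau> (\<lambda>_. 1) t * ((?a n * s n) * pn n t)" if "n \<in> ?K" for n
      using w_pos[OF that] by (simp add: r_def)
    have "F2 t = (\<Sum>n\<in>?K. avg T \<tau> (\<lambda>_. 1) t * ((?a n * s n) * pn n t))"
      unfolding F2_def by (intro sum.cong refl F2n)
    ultimately show ?thesis by (simp add: sum_distrib_left)
  qed
  have F3_eq: "F3 t = inner1 (KS N \<tau> t) (\<lambda>x. psi (p t x))" if t: "t \<in> {-T..0}" for t
  proof -
    have psii: "integrable Lx (\<lambda>x. psi (p t x))"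
      by (intro continuous_imp_integrable_real psi_cont continuous_on_slice[OF p t])
    have "inner1 (KS N \<tau> t) (\<lambda>x. psi (p t x)) = inner1 (\<lambda>x. psi (p t x)) (\<lambda>x. avg T \<tau> (q (\<lambda>_. 1)) t * 1 + (\<Sum>n\<in>?K. (?a n * avg T \<tau> (q (cosn n)) t) * cosn n x))"
      unfolding inner1_commute[of "\<lambda>x. psi (p t x)"] by (rule inner1_cong) (simp_all add: KS_def mult_ac)
    also have "\<dots> = inner1 (\<lambda>x. psi (p t x)) (\<lambda>x. avg T \<tau> (q (\<lambda>_. 1)) t * 1) + inner1 (\<lambda>x. psi (p t x)) (\<lambda>x. \<Sum>n\<in>?K. (?a n * avg T \<tau> (q (cosn n)) t) * cosn n x)"
      by (intro inner1_add_right psii continuous_intros)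
    also have "\<dots> = F3 t"
      unfolding inner1_cmult_right by (subst inner1_sum[OF psii]) (auto simp: F3_def yn_def mult_ac intro: continuous_intros)
    finally show ?thesis by simp
  qed
  have \<rho>pi: "integrable Lt (\<lambda>t. inner1 (\<lambda>x. flux (\<rho>b x)) (p t))"
    unfolding inner1_commute[of "\<lambda>x. flux (\<rho>b x)"]
    by (intro continuous_imp_integrable_real inner1_param_continuous[OF p] continuous_intros \<rho>b_cont)
  have "(LINT t|Lt. inner1 (\<lambda>x. \<epsilon> * (Dr 1 x + (\<Sum>n\<in>?K. gam N \<tau> lam n t * (w n * cosn n x))) - VV N (gam' N \<tau> lam) t x) (p t))
      = (LINT t|Lt. inner1 (\<lambda>x. flux (\<rho>b x)) (p t) + (1 - lam) * F1 t)"
    by (rule integral_lebesgue_on_cong) (rule lin)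
  also have "\<dots> = (LINT t|Lt. inner1 (\<lambda>x. flux (\<rho>b x)) (p t)) + (1 - lam) * (LINT t|Lt. F1 t)"
    using \<rho>pi F1i by simp
  also have "\<dots> \<le> (LINT t|Lt. inner1 (\<lambda>x. flux (\<rho>b x)) (p t)) + (1 - lam) * (I - (LINT t|Lt. F2 t) + (LINT t|Lt. F3 t))"
    using main lam by (intro add_left_mono mult_left_mono) auto
  also have "\<dots> = (1 - lam) * I + ((LINT t|Lt. inner1 (\<lambda>x. flux (\<rho>b x)) (p t)) - (1 - lam) * (LINT t|Lt. F2 t) + (1 - lam) * (LINT t|Lt. F3 t))"
    by (simp add: algebra_simps)
  also have "(LINT t|Lt. inner1 (\<lambda>x. flux (\<rho>b x)) (p t)) - (1 - lam) * (LINT t|Lt. F2 t) + (1 - lam) * (LINT t|Lt. F3 t)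
     = (LINT t|Lt. inner1 (\<lambda>x. flux (\<rho>b x)) (p t) - (1 - lam) * F2 t + (1 - lam) * F3 t)"
    using \<rho>pi F2i F3i by simp
  also have "\<dots> = (LINT t|Lt. inner1 (\<lambda>x. flux (\<rho>b x)) (p t)
        - (1 - lam) * avg T \<tau> (\<lambda>_. 1) t * inner1 (\<lambda>x. inner1 (\<lambda>x. flux (\<rho>b x)) (kerN N x)) (p t)
        + (1 - lam) * inner1 (KS N \<tau> t) (\<lambda>x. psi (p t x)))"
    by (rule integral_lebesgue_on_cong) (simp add: F2_eq F3_eq)
  finally show ?thesis .
qed

end

section \<open>The concavity defect and the gap between Neumann and Dirichlet means\<close>

lemma avg_cong:
  assumes "\<And>s. s \<in> {-T..0} \<Longrightarrow> f s = g s" "t \<in> {-T..0}"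
  shows "avg T \<tau> f t = avg T \<tau> g t"
  unfolding avg_def
  by (intro arg_cong2[where f="(*)"] refl Henstock_Kurzweil_Integration.integral_cong) (use assms in auto)

lemma flux_lipschitz:
  assumes "0 \<le> a" "a \<le> 1" "0 \<le> b" "b \<le> 1"
  shows "\<bar>flux a - flux b\<bar> \<le> \<bar>a - b\<bar>"
proof -
  have "flux a - flux b = (a - b) * (1 - a - b)" by (simp add: flux_def algebra_simps)
  moreover have "\<bar>a - b\<bar> * \<bar>1 - a - b\<bar> \<le> \<bar>a - b\<bar> * 1" using assms by (intro mult_left_mono) auto
  ultimately show ?thesis by (simp add: abs_mult)
qed

context finite_action_path
begin

abbreviation jcont :: "(real \<Rightarrow> real \<Rightarrow> real) \<Rightarrow> bool" where
  "jcont f \<equiv> continuous_on ({-T..0} \<times> {0..1}) (\<lambda>z. f (fst z) (snd z))"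

lemma jcont_slice: "jcont f \<Longrightarrow> t \<in> {-T..0} \<Longrightarrow> continuous_on {0..1} (f t)"
  using continuous_on_slice[of "{-T..0}" "{0..1}" f t] by (simp add: case_prod_unfold)

lemma jcont_inner1: "jcont f \<Longrightarrow> continuous_on {0..1} \<phi> \<Longrightarrow> continuous_on {-T..0} (\<lambda>t. inner1 (f t) \<phi>)"
  using inner1_param_continuous[of "{-T..0}" f \<phi>] by (simp add: case_prod_unfold)

lemma jcont_integral: "jcont f \<Longrightarrow> continuous_on {-T..0} (\<lambda>t. LINT x|Lx. f t x)"
  using jcont_inner1[of f "\<lambda>_. 1"] by (simp add: inner1_def)

lemma kerN_average:
  assumes \<tau>: "0 < \<tau>" and t: "t \<in> {-T..0}"
    and f: "\<And>s. s \<in> {-T..0} \<Longrightarrow> integrable Lx (f s)"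
    and F: "\<And>n. integrable Lt (\<lambda>s. inner1 (f s) (cosn n))"
  shows "avg T \<tau> (\<lambda>s. inner1 (f s) (kerN N x)) t = avg T \<tau> (\<lambda>s. inner1 (f s) (\<lambda>_. 1)) t
     + (\<Sum>n\<in>{1..<N}. 2 * fejer_coeff N n * cosn n x * avg T \<tau> (\<lambda>s. inner1 (f s) (cosn n)) t)"
proof -
  interpret ta: time_average T \<tau> by unfold_locales (use T \<tau> in auto)
  have "avg T \<tau> (\<lambda>s. inner1 (f s) (kerN N x)) t = avg T \<tau> (\<lambda>s. inner1 (f s) (\<lambda>_. 1)
     + (\<Sum>n\<in>{1..<N}. (2 * fejer_coeff N n * cosn n x) * inner1 (f s) (cosn n))) t"
    by (rule avg_cong[OF _ t]) (rule inner1_kerN[OF f])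
  also have "\<dots> = avg T \<tau> (\<lambda>s. inner1 (f s) (\<lambda>_. 1)) t
     + avg T \<tau> (\<lambda>s. \<Sum>n\<in>{1..<N}. (2 * fejer_coeff N n * cosn n x) * inner1 (f s) (cosn n)) t"
    by (rule ta.avg_add[OF _ _ t])
       (use F[of 0] in \<open>auto intro!: Bochner_Integration.integrable_sum Bochner_Integration.integrable_mult_right F\<close>)
  also have "avg T \<tau> (\<lambda>s. \<Sum>n\<in>{1..<N}. (2 * fejer_coeff N n * cosn n x) * inner1 (f s) (cosn n)) t
     = (\<Sum>n\<in>{1..<N}. (2 * fejer_coeff N n * cosn n x) * avg T \<tau> (\<lambda>s. inner1 (f s) (cosn n)) t)"
    by (rule ta.avg_sum) (use F t in auto)
  finally show ?thesis .
qed

text \<open>\<open>vN\<close> is a convex combination of space-time means of \<open>\<rho>b\<close> and of \<open>u\<close>, and \<open>PF\<close>, \<open>KS\<close> are the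
  corresponding means of their fluxes, so that \<open>ep\<close> is a defect of concavity.\<close>

definition Rw :: "real \<Rightarrow> real \<Rightarrow> real \<Rightarrow> real" where "Rw \<tau> lam t = 1 - (1 - lam) * avg T \<tau> (\<lambda>_. 1) t"
definition PF :: "nat \<Rightarrow> real \<Rightarrow> real" where "PF N x = inner1 (\<lambda>x. flux (\<rho>b x)) (kerN N x)"
definition vN :: "nat \<Rightarrow> real \<Rightarrow> real \<Rightarrow> real \<Rightarrow> real \<Rightarrow> real" where
  "vN N \<tau> lam t x = Rw \<tau> lam t * inner1 \<rho>b (kerN N x) + (1 - lam) * (avg T \<tau> (\<lambda>s. inner1 (u s) (\<lambda>_. 1)) t
     + (\<Sum>n\<in>{1..<N}. 2 * fejer_coeff N n * cosn n x * avg T \<tau> (\<lambda>s. inner1 (u s) (cosn n)) t))"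
definition ep :: "nat \<Rightarrow> real \<Rightarrow> real \<Rightarrow> real \<Rightarrow> real \<Rightarrow> real" where
  "ep N \<tau> lam t x = flux (vN N \<tau> lam t x) - Rw \<tau> lam t * PF N x - (1 - lam) * KS N \<tau> t x"
abbreviation va :: "nat \<Rightarrow> real \<Rightarrow> real \<Rightarrow> real \<Rightarrow> real \<Rightarrow> real" where
  "va N \<tau> lam \<equiv> vv N (gam N \<tau> lam)"

lemma u_pair_int: "integrable Lx \<phi> \<Longrightarrow> integrable Lt (\<lambda>s. inner1 (u s) \<phi>)"
  by (rule continuous_imp_integrable_real) (rule u_pair_cont)

lemma Rw_bounds:
  assumes "0 < \<tau>" "0 < lam" "lam < 1" "t \<in> {-T..0}"
  shows "lam \<le> Rw \<tau> lam t" "Rw \<tau> lam t \<le> 1"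
proof -
  interpret ta: time_average T \<tau> by unfold_locales (use T assms in auto)
  have "(1 - lam) * avg T \<tau> (\<lambda>_. 1) t \<le> (1 - lam) * 1"
    using ta.avg_1_bounds assms by (intro mult_left_mono) auto
  then show "lam \<le> Rw \<tau> lam t" by (simp add: Rw_def)
  show "Rw \<tau> lam t \<le> 1" using ta.avg_1_bounds[OF assms(4)] assms by (simp add: Rw_def)
qed

lemma vN_eq:
  assumes "0 < \<tau>" "t \<in> {-T..0}"
  shows "vN N \<tau> lam t x = Rw \<tau> lam t * inner1 \<rho>b (kerN N x) + (1 - lam) * avg T \<tau> (\<lambda>s. inner1 (u s) (kerN N x)) t"
  unfolding vN_def by (subst kerN_average[OF assms]) (auto intro: u_int u_pair_int)

lemma KS_eq:
  assumes "0 < \<tau>" "t \<in> {-T..0}"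
  shows "KS N \<tau> t x = avg T \<tau> (q (kerN N x)) t"
proof -
  have "integrable Lt (\<lambda>s. inner1 (\<lambda>x. flux (u s x)) (cosn n))" for n
    using q_int[OF continuous_on_cosn, of n] by (simp add: q_def[abs_def])
  from kerN_average[OF assms u_flux_int this]
  show ?thesis unfolding KS_def q_def[abs_def] by simp
qed

lemma rhob_kerN_bounds:
  shows "\<rho>\<^sub>0 \<le> inner1 \<rho>b (kerN N x)" "inner1 \<rho>b (kerN N x) \<le> \<rho>\<^sub>1"
proof -
  have c: "inner1 (\<lambda>_. c) (kerN N x) = c" for c :: real
    using inner1_cmult_left[of c "\<lambda>_. 1" "kerN N x"] by (simp add: kerN_one)
  show "\<rho>\<^sub>0 \<le> inner1 \<rho>b (kerN N x)" "inner1 \<rho>b (kerN N x) \<le> \<rho>\<^sub>1"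
    using inner1_kerN_le[of "\<lambda>_. \<rho>\<^sub>0" \<rho>b N x] inner1_kerN_le[of \<rho>b "\<lambda>_. \<rho>\<^sub>1" N x] \<rho>b_cont \<rho>b_range
    by (simp_all add: c)
qed

lemma u_kerN_bounds:
  assumes t: "t \<in> {-T..0}"
  shows "0 \<le> inner1 (u t) (kerN N x)" "inner1 (u t) (kerN N x) \<le> 1"
proof -
  have i: "integrable Lx (\<lambda>y. u t y * kerN N x y)" by (rule inner1_integrable[OF u_int[OF t] continuous_on_kerN])
  have A: "AE y in Lx. 0 \<le> u t y \<and> u t y \<le> 1" using u_M[OF t] by (simp add: M_space_def)
  have "(LINT y|Lx. 0) \<le> inner1 (u t) (kerN N x)" unfolding inner1_def
  proof (rule integral_mono_AE[OF _ i])
    show "AE y in Lx. 0 \<le> u t y * kerN N x y" using A by eventually_elim (simp add: kerN_nonneg)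
  qed simp
  then show "0 \<le> inner1 (u t) (kerN N x)" by simp
  have "inner1 (u t) (kerN N x) \<le> (LINT y|Lx. kerN N x y)" unfolding inner1_def
  proof (rule integral_mono_AE[OF i])
    show "AE y in Lx. u t y * kerN N x y \<le> kerN N x y"
      using A by eventually_elim (simp add: kerN_nonneg mult_left_le_one_le)
  qed (intro continuous_imp_integrable_real continuous_on_kerN)
  then show "inner1 (u t) (kerN N x) \<le> 1" by (simp add: integral_kerN)
qed

text \<open>A share of at least \<open>lam\<close> of the total mass sits on the stationary
  solution, whose values lie in \<open>{\<rho>\<^sub>0..\<rho>\<^sub>1}\<close>; the rest averages
  values in \<open>{0..1}\<close>.\<close>

lemma vN_bounds:
  assumes \<tau>: "0 < \<tau>" and lam: "0 < lam" "lam < 1" and t: "t \<in> {-T..0}"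
  shows "lam * \<rho>\<^sub>0 \<le> vN N \<tau> lam t x" "vN N \<tau> lam t x \<le> 1 - lam * (1 - \<rho>\<^sub>1)"
proof -
  interpret ta: time_average T \<tau> by unfold_locales (use T \<tau> in auto)
  let ?U = "\<lambda>s. inner1 (u s) (kerN N x)"
  have Ui: "integrable Lt ?U" by (intro u_pair_int continuous_imp_integrable_real continuous_on_kerN)
  have "avg T \<tau> (\<lambda>_. 0) t \<le> avg T \<tau> ?U t" by (rule ta.avg_mono[OF _ Ui _ t]) (auto simp: u_kerN_bounds)
  then have U0: "0 \<le> avg T \<tau> ?U t" unfolding avg_def by simp
  have U1: "avg T \<tau> ?U t \<le> avg T \<tau> (\<lambda>_. 1) t" by (rule ta.avg_mono[OF Ui _ _ t]) (auto simp: u_kerN_bounds)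
  have R: "lam \<le> Rw \<tau> lam t" "Rw \<tau> lam t \<le> 1" using Rw_bounds[OF \<tau> lam t] .
  have "lam * \<rho>\<^sub>0 \<le> Rw \<tau> lam t * inner1 \<rho>b (kerN N x)"
    using R rhob_kerN_bounds[of N x] \<rho>01 lam by (intro mult_mono) auto
  moreover have "0 \<le> (1 - lam) * avg T \<tau> ?U t" using U0 lam by simp
  ultimately show "lam * \<rho>\<^sub>0 \<le> vN N \<tau> lam t x" unfolding vN_eq[OF \<tau> t] by linarith
  have "lam * (1 - \<rho>\<^sub>1) \<le> Rw \<tau> lam t * (1 - inner1 \<rho>b (kerN N x))"
    using R rhob_kerN_bounds[of N x] \<rho>01 lam by (intro mult_mono) auto
  moreover have "(1 - lam) * avg T \<tau> ?U t \<le> (1 - lam) * avg T \<tau> (\<lambda>_. 1) t"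
    using U1 lam by (intro mult_left_mono) auto
  ultimately show "vN N \<tau> lam t x \<le> 1 - lam * (1 - \<rho>\<^sub>1)"
    unfolding vN_eq[OF \<tau> t] by (simp add: Rw_def algebra_simps)
qed

text \<open>Jensen for the concave flux by its tangent at the mean \<open>c\<close>. The weight
  \<open>Rw\<close> completes the time mean to total mass exactly one, hence the tangent averages to
  \<open>flux c\<close>.\<close>

lemma ep_nonneg:
  assumes \<tau>: "0 < \<tau>" and lam: "0 < lam" "lam < 1" and t: "t \<in> {-T..0}"
  shows "0 \<le> ep N \<tau> lam t x"
proof -
  interpret ta: time_average T \<tau> by unfold_locales (use T \<tau> in auto)
  define c where "c = vN N \<tau> lam t x"
  let ?U = "\<lambda>s. inner1 (u s) (kerN N x)"
  have Ui: "integrable Lt ?U" by (intro u_pair_int continuous_imp_integrable_real continuous_on_kerN)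
  have tangent: "inner1 (\<lambda>x. flux (f x)) (kerN N x) \<le> (1 - 2 * c) * inner1 f (kerN N x) + c\<^sup>2"
    if f: "integrable Lx f" "integrable Lx (\<lambda>x. flux (f x))" for f
  proof -
    have i: "integrable Lx (\<lambda>y. (1 - 2 * c) * f y)" using f by simp
    have "inner1 (\<lambda>x. flux (f x)) (kerN N x) \<le> inner1 (\<lambda>y. (1 - 2 * c) * f y + c\<^sup>2 * 1) (kerN N x)"
      unfolding inner1_def
    proof (rule integral_lebesgue_on_mono)
      show "integrable Lx (\<lambda>y. flux (f y) * kerN N x y)" "integrable Lx (\<lambda>y. ((1 - 2 * c) * f y + c\<^sup>2 * 1) * kerN N x y)"
        by (rule inner1_integrable; use f i in \<open>auto intro: continuous_on_kerN\<close>)+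
      show "flux (f y) * kerN N x y \<le> ((1 - 2 * c) * f y + c\<^sup>2 * 1) * kerN N x y" for y
        using mult_right_mono[OF flux_le_tangent kerN_nonneg] by simp
    qed
    also have "\<dots> = inner1 (\<lambda>y. (1 - 2 * c) * f y) (kerN N x) + inner1 (\<lambda>y. c\<^sup>2 * 1) (kerN N x)"
      by (rule inner1_add_left) (use i in \<open>auto intro: continuous_on_kerN\<close>)
    finally show ?thesis unfolding inner1_cmult_left kerN_one by simp
  qed
  have "Rw \<tau> lam t * PF N x \<le> Rw \<tau> lam t * ((1 - 2 * c) * inner1 \<rho>b (kerN N x) + c\<^sup>2)"
    unfolding PF_def using Rw_bounds[OF \<tau> lam t] lam by (intro mult_left_mono tangent \<rho>b_int \<rho>b_flux_int) auto
  moreover have "(1 - lam) * KS N \<tau> t x \<le> (1 - lam) * ((1 - 2 * c) * avg T \<tau> ?U t + c\<^sup>2 * avg T \<tau> (\<lambda>_. 1) t)"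
  proof (rule mult_left_mono)
    have "KS N \<tau> t x \<le> avg T \<tau> (\<lambda>s. (1 - 2 * c) * ?U s + c\<^sup>2) t"
      unfolding KS_eq[OF \<tau> t]
    proof (rule ta.avg_mono[OF q_int[OF continuous_on_kerN] _ _ t])
      show "q (kerN N x) s \<le> (1 - 2 * c) * ?U s + c\<^sup>2" if "s \<in> {-T..0}" for s
        unfolding q_def by (rule tangent[OF u_int[OF that] u_flux_int[OF that]])
    qed (use Ui in auto)
    also have "\<dots> = (1 - 2 * c) * avg T \<tau> ?U t + c\<^sup>2 * avg T \<tau> (\<lambda>_. 1) t"
      using Ui by (subst ta.avg_add[OF _ _ t]) (auto simp: ta.avg_cmult ta.avg_const[of "c\<^sup>2"])
    finally show "KS N \<tau> t x \<le> (1 - 2 * c) * avg T \<tau> ?U t + c\<^sup>2 * avg T \<tau> (\<lambda>_. 1) t" .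
  qed (use lam in simp)
  moreover have "Rw \<tau> lam t * ((1 - 2 * c) * inner1 \<rho>b (kerN N x) + c\<^sup>2) + (1 - lam) * ((1 - 2 * c) * avg T \<tau> ?U t + c\<^sup>2 * avg T \<tau> (\<lambda>_. 1) t)
      = flux c"
  proof -
    have "Rw \<tau> lam t * ((1 - 2 * c) * inner1 \<rho>b (kerN N x) + c\<^sup>2) + (1 - lam) * ((1 - 2 * c) * avg T \<tau> ?U t + c\<^sup>2 * avg T \<tau> (\<lambda>_. 1) t)
      = (1 - 2 * c) * (Rw \<tau> lam t * inner1 \<rho>b (kerN N x) + (1 - lam) * avg T \<tau> ?U t) + c\<^sup>2 * (Rw \<tau> lam t + (1 - lam) * avg T \<tau> (\<lambda>_. 1) t)"
      by (simp add: algebra_simps)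
    also have "\<dots> = (1 - 2 * c) * c + c\<^sup>2 * 1" unfolding c_def by (subst (3) vN_eq[OF \<tau> t]) (simp add: Rw_def)
    finally show ?thesis by (simp add: flux_def power2_eq_square algebra_simps)
  qed
  ultimately show ?thesis unfolding ep_def c_def by linarith
qed

text \<open>\<open>va\<close> takes Dirichlet means of \<open>u - \<rho>b\<close> to keep the
  boundary values, \<open>vN\<close> takes Neumann means of \<open>u\<close> and
  \<open>\<rho>b\<close> for the sake of concavity. They differ by the Fejer error of
  \<open>\<rho>b\<close> and by the term that \<open>corner_small\<close> controls.\<close>

lemma vN_minus_va:
  assumes \<tau>: "0 < \<tau>" and t: "t \<in> {-T..0}"
  shows "vN N \<tau> lam t x - va N \<tau> lam t x = (inner1 \<rho>b (kerN N x) - \<rho>b x)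
    + (1 - lam) * avg T \<tau> (pr (\<lambda>y. kerN N x y - kerD N x y)) t"
proof -
  interpret ta: time_average T \<tau> by unfold_locales (use T \<tau> in auto)
  have kNi: "integrable Lx (kerN N x)" and kDi: "integrable Lx (kerD N x)"
    by (intro continuous_imp_integrable_real continuous_on_kerN continuous_on_kerD)+
  have "avg T \<tau> (pr (kerD N x)) t = avg T \<tau> (\<lambda>s. \<Sum>n\<in>{1..<N}. (2 * fejer_coeff N n * sinn n x) * b n s) t"
  proof (rule avg_cong[OF _ t])
    fix s assume s: "s \<in> {-T..0}"
    have "pr (kerD N x) s = pr (\<lambda>y. \<Sum>n\<in>{1..<N}. (2 * fejer_coeff N n * sinn n x) * sinn n y) s"
      by (simp add: kerD_def[abs_def] sum_distrib_left mult_ac)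
    also have "\<dots> = (\<Sum>n\<in>{1..<N}. (2 * fejer_coeff N n * sinn n x) * b n s)"
      unfolding b_pr by (rule pr_sum[OF _ s]) (intro continuous_intros)
    finally show "pr (kerD N x) s = \<dots>" .
  qed
  also have "\<dots> = (\<Sum>n\<in>{1..<N}. (2 * fejer_coeff N n * sinn n x) * avg T \<tau> (b n) t)"
    by (rule ta.avg_sum) (use b_int t in auto)
  finally have D: "(1 - lam) * avg T \<tau> (pr (kerD N x)) t = (\<Sum>n\<in>{1..<N}. gam N \<tau> lam n t * sinn n x)"
    by (simp add: gam_def sum_distrib_left mult_ac)
  have "avg T \<tau> (\<lambda>s. inner1 (u s) (kerN N x)) t = avg T \<tau> (\<lambda>s. pr (kerN N x) s + inner1 \<rho>b (kerN N x)) t"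
    by (simp add: pr_def)
  also have "\<dots> = avg T \<tau> (pr (kerN N x)) t + inner1 \<rho>b (kerN N x) * avg T \<tau> (\<lambda>_. 1) t"
    using pr_int[OF kNi] by (subst ta.avg_add[OF _ _ t]) (auto simp: ta.avg_const[of "inner1 _ _"])
  finally have Nn: "avg T \<tau> (\<lambda>s. inner1 (u s) (kerN N x)) t = avg T \<tau> (pr (kerN N x)) t + inner1 \<rho>b (kerN N x) * avg T \<tau> (\<lambda>_. 1) t" .
  have "avg T \<tau> (pr (\<lambda>y. kerN N x y - kerD N x y)) t = avg T \<tau> (\<lambda>s. pr (kerN N x) s + (-1) * pr (kerD N x) s) t"
    by (rule avg_cong[OF _ t]) (simp add: pr_diff[OF kNi kDi])
  also have "\<dots> = avg T \<tau> (pr (kerN N x)) t + avg T \<tau> (\<lambda>s. (-1) * pr (kerD N x) s) t"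
    by (rule ta.avg_add[OF _ _ t]) (use pr_int[OF kNi] pr_int[OF kDi] in auto)
  finally have "avg T \<tau> (pr (\<lambda>y. kerN N x y - kerD N x y)) t = avg T \<tau> (pr (kerN N x)) t - avg T \<tau> (pr (kerD N x)) t"
    unfolding ta.avg_cmult by simp
  then have diff: "(1 - lam) * avg T \<tau> (pr (\<lambda>y. kerN N x y - kerD N x y)) t
     = (1 - lam) * avg T \<tau> (pr (kerN N x)) t - (\<Sum>n\<in>{1..<N}. gam N \<tau> lam n t * sinn n x)"
    using D by (simp add: right_diff_distrib)
  show ?thesis unfolding diff vN_eq[OF \<tau> t] Nn vv_def by (simp add: Rw_def algebra_simps)
qed

lemma vN_close:
  assumes \<tau>: "0 < \<tau>" and lam: "0 < lam" "lam < 1" and \<theta>: "0 < \<theta>"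
  shows "\<forall>\<^sub>F N in sequentially. \<forall>t\<in>{-T..0}. \<forall>x\<in>{0..1}. \<bar>vN N \<tau> lam t x - va N \<tau> lam t x\<bar> \<le> \<theta>"
proof -
  have "\<theta> / 2 > 0" using \<theta> by simp
  from kerN_uniform[OF \<rho>b_cont this] corner_small[OF \<tau> this] show ?thesis
  proof eventually_elim
    case (elim N)
    show ?case
    proof (intro ballI)
      fix t x :: real assume t: "t \<in> {-T..0}" and x: "x \<in> {0..1}"
      let ?z = "avg T \<tau> (pr (\<lambda>y. kerN N x y - kerD N x y)) t"
      have "\<bar>(1 - lam) * ?z\<bar> \<le> 1 * \<bar>?z\<bar>" unfolding abs_mult using lam by (intro mult_right_mono) auto
      moreover have "\<bar>?z\<bar> \<le> \<theta> / 2" "\<bar>inner1 \<rho>b (kerN N x) - \<rho>b x\<bar> \<le> \<theta> / 2" using elim t x by blast+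
      ultimately show "\<bar>vN N \<tau> lam t x - va N \<tau> lam t x\<bar> \<le> \<theta>" unfolding vN_minus_va[OF \<tau> t] by linarith
    qed
  qed
qed

lemma gam_cont: "0 < \<tau> \<Longrightarrow> continuous_on {-T..0} (gam N \<tau> lam n)" "0 < \<tau> \<Longrightarrow> continuous_on {-T..0} (gam' N \<tau> lam n)"
proof -
  assume \<tau>: "0 < \<tau>"
  interpret ta: time_average T \<tau> by unfold_locales (use T \<tau> in auto)
  show "continuous_on {-T..0} (gam N \<tau> lam n)" "continuous_on {-T..0} (gam' N \<tau> lam n)"
    unfolding gam_def gam'_def using \<tau> by (intro continuous_intros ta.avg_continuous b_int b_cont; simp)+
qed

lemma gam_deriv:
  assumes "0 < \<tau>" "t \<in> {-T..0}"
  shows "(gam N \<tau> lam n has_real_derivative gam' N \<tau> lam n t) (at t within {-T..0})"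
proof -
  interpret ta: time_average T \<tau> by unfold_locales (use T assms in auto)
  show ?thesis unfolding gam_def[abs_def] gam'_def
    by (intro DERIV_cmult ta.avg_deriv b_cont assms)
qed

lemma jcont_intros:
  assumes \<tau>: "0 < \<tau>"
  shows "jcont (va N \<tau> lam)" "jcont (WW N (gam N \<tau> lam) (gam' N \<tau> lam))" "jcont (vN N \<tau> lam)" "jcont (KS N \<tau>)" "jcont (ep N \<tau> lam)"
proof -
  interpret ta: time_average T \<tau> by unfold_locales (use T \<tau> in auto)
  show "jcont (va N \<tau> lam)" using vv_cont[of N "gam N \<tau> lam"] gam_cont[OF \<tau>] by (simp add: case_prod_unfold)
  show "jcont (WW N (gam N \<tau> lam) (gam' N \<tau> lam))"
    using WW_cont[of N "gam N \<tau> lam" "gam' N \<tau> lam"] gam_cont[OF \<tau>] by (simp add: case_prod_unfold)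
  show v: "jcont (vN N \<tau> lam)"
    unfolding vN_def Rw_def
    by (intro continuous_intros continuous_on_fst continuous_on_snd ta.avg_continuous u_pair_int integrable_cosn
        continuous_on_inner1_kerN \<rho>b_int continuous_on_cosn ta.integrable_const_T integrable_const01)
  show k: "jcont (KS N \<tau>)"
    unfolding KS_def
    by (intro continuous_intros continuous_on_fst continuous_on_snd ta.avg_continuous q_int continuous_on_cosn continuous_on_const)
  show "jcont (ep N \<tau> lam)"
    unfolding ep_def Rw_def PF_def
    by (intro continuous_intros v k continuous_on_fst continuous_on_snd ta.avg_continuous
        continuous_on_inner1_kerN \<rho>b_flux_int ta.integrable_const_T)
qed

text \<open>Neumann means preserve integrals over \<open>{0..1}\<close>, so the kernel disappears
  from the total defect except inside \<open>vN\<close>.\<close>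

lemma ep_integral:
  assumes \<tau>: "0 < \<tau>" and t: "t \<in> {-T..0}"
  shows "(LINT x|Lx. ep N \<tau> lam t x) = (LINT x|Lx. flux (vN N \<tau> lam t x))
    - Rw \<tau> lam t * (LINT x|Lx. flux (\<rho>b x)) - (1 - lam) * avg T \<tau> (q (\<lambda>_. 1)) t"
proof -
  have z: "(LINT x|Lx. a + (\<Sum>n\<in>{1..<N}. d n * cosn n x)) = a" for a d
  proof -
    have "(LINT x|Lx. a + (\<Sum>n\<in>{1..<N}. d n * cosn n x)) = inner1 (\<lambda>_. 1) (\<lambda>x. a * 1 + (\<Sum>n\<in>{1..<N}. d n * cosn n x))"
      by (simp add: inner1_def)
    also have "\<dots> = inner1 (\<lambda>_. 1) (\<lambda>x. a * 1) + inner1 (\<lambda>_. 1) (\<lambda>x. \<Sum>n\<in>{1..<N}. d n * cosn n x)"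
      by (intro inner1_add_right integrable_const01 continuous_intros)
    also have "inner1 (\<lambda>_. 1) (\<lambda>x. \<Sum>n\<in>{1..<N}. d n * cosn n x) = (\<Sum>n\<in>{1..<N}. d n * inner1 (\<lambda>_. 1) (cosn n))"
      by (intro inner1_sum integrable_const01 continuous_intros)
    also have "\<dots> = 0" using inner1_cosn_cosn[of 0] by (intro sum.neutral) auto
    also have "inner1 (\<lambda>_. 1) (\<lambda>x. a * 1) = a" unfolding inner1_cmult_right using inner1_cosn_cosn[of 0 0] by simp
    finally show ?thesis by simp
  qed
  have P: "(LINT x|Lx. PF N x) = (LINT x|Lx. flux (\<rho>b x))"
    unfolding PF_def inner1_kerN[OF \<rho>b_flux_int]
    using z[of "inner1 (\<lambda>x. flux (\<rho>b x)) (\<lambda>_. 1)" "\<lambda>n. 2 * fejer_coeff N n * inner1 (\<lambda>x. flux (\<rho>b x)) (cosn n)"]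
    by (simp add: inner1_def mult_ac)
  have K: "(LINT x|Lx. KS N \<tau> t x) = avg T \<tau> (q (\<lambda>_. 1)) t"
    unfolding KS_def
    using z[of "avg T \<tau> (q (\<lambda>_. 1)) t" "\<lambda>n. 2 * fejer_coeff N n * avg T \<tau> (q (cosn n)) t"]
    by (simp add: mult_ac)
  have i1: "integrable Lx (\<lambda>x. flux (vN N \<tau> lam t x))"
    by (intro continuous_imp_integrable_real continuous_on_flux jcont_slice[OF jcont_intros(3)[OF \<tau>] t])
  have i2: "integrable Lx (PF N)" unfolding PF_def by (intro continuous_imp_integrable_real continuous_on_inner1_kerN \<rho>b_flux_int)
  have i3: "integrable Lx (KS N \<tau> t)"
    by (intro continuous_imp_integrable_real jcont_slice[OF jcont_intros(4)[OF \<tau>] t])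
  show ?thesis unfolding ep_def using i1 i2 i3 P K by simp
qed

text \<open>\<open>cst W f\<close> minimises \<open>c \<mapsto> lag W f c\<close>.\<close>

definition cst :: "(real \<Rightarrow> real) \<Rightarrow> (real \<Rightarrow> real) \<Rightarrow> real" where
  "cst W f = (LINT x|Lx. W x / f x) / (LINT x|Lx. 1 / f x)"
definition lag :: "(real \<Rightarrow> real) \<Rightarrow> (real \<Rightarrow> real) \<Rightarrow> real \<Rightarrow> real" where
  "lag W f c = (LINT x|Lx. (W x - c)\<^sup>2 / (4 * \<epsilon> * f x))"

text \<open>Let \<open>p = (W - k) / (2 \<epsilon> f)\<close>, the maximiser of the dual problem
  among functions of mean zero. The Lagrangian then equals a linear pairing with \<open>p\<close>
  minus the integral of \<open>f psi(p)\<close>, and \<open>dual_bound\<close> applies. The leftover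
  \<open>D\<close> is at most \<open>3 * \<theta> / c0\<close> times the Lagrangian, which is
  absorbed on the left, plus a small constant and the defect divided by
  \<open>4 * \<epsilon>\<close>.\<close>

lemma main_bound:
  assumes \<tau>: "0 < \<tau>" and lam: "0 < lam" "lam < 1" and c0: "0 < c0" and \<theta>: "0 \<le> \<theta>"
    and h1: "\<And>t x. t \<in> {-T..0} \<Longrightarrow> x \<in> {0..1} \<Longrightarrow> \<bar>vN N \<tau> lam t x - va N \<tau> lam t x\<bar> \<le> \<theta>"
    and h2: "\<And>x. x \<in> {0..1} \<Longrightarrow> \<bar>PF N x - flux (\<rho>b x)\<bar> \<le> \<theta>"
    and h3: "\<And>t x. t \<in> {-T..0} \<Longrightarrow> x \<in> {0..1} \<Longrightarrow> 0 \<le> va N \<tau> lam t x \<and> va N \<tau> lam t x \<le> 1 \<and> c0 \<le> flux (va N \<tau> lam t x)"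
  defines "W \<equiv> WW N (gam N \<tau> lam) (gam' N \<tau> lam)" and "f \<equiv> \<lambda>t x. flux (va N \<tau> lam t x)"
  shows "continuous_on {-T..0} (\<lambda>t. cst (W t) (f t))"
    and "(1 - 3 * \<theta> / c0) * (LINT t|Lt. lag (W t) (f t) (cst (W t) (f t)))
      \<le> I + \<theta> * T / (2 * \<epsilon>) + (LINT t|Lt. LINT x|Lx. ep N \<tau> lam t x) / (4 * \<epsilon>)"
proof -
  interpret ta: time_average T \<tau> by unfold_locales (use T \<tau> in auto)
  have Wc: "jcont W" and vc: "jcont (va N \<tau> lam)" and epc: "jcont (ep N \<tau> lam)" and KSc: "jcont (KS N \<tau>)"
    unfolding W_def by (rule jcont_intros[OF \<tau>])+
  have fc: "jcont f" unfolding f_def by (intro continuous_on_flux vc)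
  have fpos: "0 < f t x" "c0 \<le> f t x" if "t \<in> {-T..0}" "x \<in> {0..1}" for t x using h3[OF that] c0 by (auto simp: f_def)
  have fnz: "f (fst z) (snd z) \<noteq> 0" if "z \<in> {-T..0} \<times> {0..1}" for z using fpos(1)[of "fst z" "snd z"] that by auto
  have c1: "continuous_on {-T..0} (\<lambda>t. LINT x|Lx. W t x / f t x)"
    by (rule jcont_integral) (intro continuous_intros Wc fc, use fnz in auto)
  have c2: "continuous_on {-T..0} (\<lambda>t. LINT x|Lx. 1 / f t x)"
    by (rule jcont_integral) (intro continuous_intros fc, use fnz in auto)
  have den: "(LINT x|Lx. 1 / f t x) > 0" if t: "t \<in> {-T..0}" for t
  proof -
    have "(LINT x|Lx. 1) \<le> (LINT x|Lx. 1 / f t x)"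
    proof (rule integral_lebesgue_on_mono)
      show "integrable Lx (\<lambda>x. 1 / f t x)"
        by (intro continuous_imp_integrable_real continuous_intros jcont_slice[OF fc t]) (use fpos(1)[OF t] in force)
      fix x :: real assume x: "x \<in> {0..1}"
      have "f t x \<le> 1" unfolding f_def using flux_le_quarter[of "va N \<tau> lam t x"] by simp
      then show "1 \<le> 1 / f t x" using fpos(1)[OF t x] by simp
    qed simp
    then show ?thesis using integral_lebesgue_on_const[of 0 1 1] by simp
  qed
  show cc: "continuous_on {-T..0} (\<lambda>t. cst (W t) (f t))"
    unfolding cst_def by (intro continuous_intros c1 c2) (use den in force)
  define k where "k = (\<lambda>t. cst (W t) (f t))"
  have kc: "continuous_on {-T..0} k" unfolding k_def by (rule cc)
  \<comment> \<open>The constant \<open>k t\<close> is exactly the one that gives \<open>p t\<close>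
    mean zero, as \<open>dual_bound\<close> requires.\<close>
  define p where "p = (\<lambda>t x. (W t x - k t) / (2 * \<epsilon> * f t x))"
  have pj: "jcont p" unfolding p_def
    by (intro continuous_intros Wc fc continuous_on_fst kc) (use fnz \<epsilon> in auto)
  then have pc: "continuous_on ({-T..0} \<times> {0..1}) (\<lambda>(t, x). p t x)" by (simp add: case_prod_unfold)
  have psij: "jcont (\<lambda>t x. psi (p t x))" by (rule psi_cont[OF pj])
  have p0: "inner1 (p t) (\<lambda>_. 1) = 0" if t: "t \<in> {-T..0}" for t
  proof -
    have i1: "integrable Lx (\<lambda>x. W t x / f t x)" and i2: "integrable Lx (\<lambda>x. 1 / f t x)"
      by (intro continuous_imp_integrable_real continuous_intros jcont_slice[OF fc t] jcont_slice[OF Wc t]; use fpos(1)[OF t] in force)+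
    have "inner1 (p t) (\<lambda>_. 1) = (LINT x|Lx. 1 / (2 * \<epsilon>) * (W t x / f t x) - k t / (2 * \<epsilon>) * (1 / f t x))"
      unfolding inner1_def by (rule integral_lebesgue_on_cong) (simp add: p_def diff_divide_distrib)
    also have "\<dots> = 1 / (2 * \<epsilon>) * (LINT x|Lx. W t x / f t x) - k t / (2 * \<epsilon>) * (LINT x|Lx. 1 / f t x)"
      by (subst Bochner_Integration.integral_diff, intro Bochner_Integration.integrable_mult_right i1,
          intro Bochner_Integration.integrable_mult_right i2) (simp only: integral_mult_right_zero)
    also have "\<dots> = 0" using den[OF t] \<epsilon> by (simp add: k_def cst_def)
    finally show ?thesis .
  qed
  let ?lin = "\<lambda>t x. \<epsilon> * (Dr 1 x + (\<Sum>n\<in>{1..<N}. gam N \<tau> lam n t * (w n * cosn n x))) - VV N (gam' N \<tau> lam) t x"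
  have Wlin: "?lin t x = W t x + f t x" for t x by (simp add: W_def f_def WW_def)
  define m where "m = (\<lambda>t. lag (W t) (f t) (k t))"
  have mc: "continuous_on {-T..0} m" unfolding m_def lag_def
    by (rule jcont_integral) (intro continuous_intros Wc fc continuous_on_fst kc, use fnz \<epsilon> in auto)
  have m_sq: "m t = (LINT x|Lx. \<epsilon> * f t x * (p t x)\<^sup>2)" if t: "t \<in> {-T..0}" for t
    unfolding m_def lag_def
  proof (rule integral_lebesgue_on_cong)
    fix x :: real assume x: "x \<in> {0..1}"
    show "(W t x - k t)\<^sup>2 / (4 * \<epsilon> * f t x) = \<epsilon> * f t x * (p t x)\<^sup>2"
      using fpos(1)[OF t x] \<epsilon> by (simp add: p_def power_divide power2_eq_square)
  qed
  have slices: "continuous_on {0..1} (W t)" "continuous_on {0..1} (f t)" "continuous_on {0..1} (p t)" "continuous_on {0..1} (\<lambda>x. psi (p t x))"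
      "continuous_on {0..1} (ep N \<tau> lam t)" "continuous_on {0..1} (KS N \<tau> t)" if t: "t \<in> {-T..0}" for t
    using jcont_slice[OF Wc t] jcont_slice[OF fc t] jcont_slice[OF pj t] jcont_slice[OF psij t] jcont_slice[OF epc t] jcont_slice[OF KSc t] by auto
  have PFc: "continuous_on {0..1} (PF N)" unfolding PF_def by (intro continuous_on_inner1_kerN \<rho>b_flux_int)
  have m_eq: "m t = inner1 (?lin t) (p t) - inner1 (f t) (\<lambda>x. psi (p t x))" if t: "t \<in> {-T..0}" for t
  proof -
    have pint: "integrable Lx (p t)" by (rule continuous_imp_integrable_real[OF slices(3)[OF t]])
    have "inner1 (?lin t) (p t) - inner1 (f t) (\<lambda>x. psi (p t x)) = (LINT x|Lx. (W t x + f t x) * p t x - f t x * psi (p t x))"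
      unfolding inner1_def Wlin
      by (intro Bochner_Integration.integral_diff[symmetric] continuous_imp_integrable_real continuous_intros slices[OF t])
    also have "\<dots> = (LINT x|Lx. \<epsilon> * f t x * (p t x)\<^sup>2 + k t * (p t x * 1))"
    proof (rule integral_lebesgue_on_cong)
      fix x :: real assume x: "x \<in> {0..1}"
      have "W t x = k t + 2 * \<epsilon> * f t x * p t x" using fpos(1)[OF t x] \<epsilon> by (simp add: p_def)
      then show "(W t x + f t x) * p t x - f t x * psi (p t x) = \<epsilon> * f t x * (p t x)\<^sup>2 + k t * (p t x * 1)"
        by (simp add: psi_def power2_eq_square algebra_simps)
    qed
    also have "\<dots> = (LINT x|Lx. \<epsilon> * f t x * (p t x)\<^sup>2) + (LINT x|Lx. k t * (p t x * 1))"
      by (intro Bochner_Integration.integral_add continuous_imp_integrable_real continuous_intros slices[OF t])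
    also have "(LINT x|Lx. k t * (p t x * 1)) = 0" using p0[OF t] by (simp add: inner1_def)
    finally show ?thesis using m_sq[OF t] by simp
  qed
  define D where "D = (\<lambda>t. inner1 (\<lambda>x. flux (\<rho>b x)) (p t)
        - (1 - lam) * avg T \<tau> (\<lambda>_. 1) t * inner1 (\<lambda>x. inner1 (\<lambda>x. flux (\<rho>b x)) (kerN N x)) (p t)
        + (1 - lam) * inner1 (KS N \<tau> t) (\<lambda>x. psi (p t x)) - inner1 (f t) (\<lambda>x. psi (p t x)))"
  let ?E = "\<lambda>t. LINT x|Lx. ep N \<tau> lam t x"
  have Dle: "D t \<le> 3 * \<theta> / c0 * m t + \<theta> / (2 * \<epsilon>) + ?E t / (4 * \<epsilon>)" if t: "t \<in> {-T..0}" for t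
  proof -
    define R where "R = Rw \<tau> lam t"
    have R: "0 \<le> R" "R \<le> 1" using Rw_bounds[OF \<tau> lam t] lam by (auto simp: R_def)
    have R1: "(1 - lam) * avg T \<tau> (\<lambda>_. 1) t = 1 - R" by (simp add: R_def Rw_def)
    have "D t = (LINT x|Lx. flux (\<rho>b x) * p t x - (1 - R) * (PF N x * p t x) + (1 - lam) * (KS N \<tau> t x * psi (p t x)) - f t x * psi (p t x))"
      unfolding D_def R1 inner1_def PF_def[unfolded inner1_def, symmetric]
      by (subst Bochner_Integration.integral_diff Bochner_Integration.integral_add integral_mult_right_zero[symmetric],
          (intro continuous_imp_integrable_real continuous_intros slices[OF t] \<rho>b_cont PFc)+)+ simp
    also have "\<dots> \<le> (LINT x|Lx. 3 * \<theta> / c0 * (\<epsilon> * f t x * (p t x)\<^sup>2) + \<theta> / (2 * \<epsilon>) + ep N \<tau> lam t x / (4 * \<epsilon>))"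
    proof (rule integral_lebesgue_on_mono)
      fix x :: real assume x: "x \<in> {0..1}"
      define P where "P = PF N x"
      define z where "z = p t x"
      define e where "e = ep N \<tau> lam t x"
      define sr where "sr = flux (\<rho>b x)"
      define g where "g = flux (vN N \<tau> lam t x)"
      have e0: "0 \<le> e" unfolding e_def by (rule ep_nonneg[OF \<tau> lam t])
      have P0: "0 \<le> P"
      proof -
        have "inner1 (\<lambda>_. 0) (kerN N x) \<le> P" unfolding P_def PF_def
          by (rule inner1_kerN_le) (use \<rho>b_range \<rho>01 in \<open>auto intro!: continuous_intros \<rho>b_cont simp: flux_def mult_nonneg_nonneg\<close>, force?)
        then show ?thesis by (simp add: inner1_def)
      qed
      have sP: "\<bar>sr - P\<bar> \<le> \<theta>" using h2[OF x] by (simp add: P_def sr_def abs_minus_commute)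
      have vNb: "0 \<le> vN N \<tau> lam t x" "vN N \<tau> lam t x \<le> 1"
      proof -
        have "0 \<le> lam * \<rho>\<^sub>0" "0 \<le> lam * (1 - \<rho>\<^sub>1)" using lam \<rho>01 by auto
        then show "0 \<le> vN N \<tau> lam t x" "vN N \<tau> lam t x \<le> 1" using vN_bounds[OF \<tau> lam t, of N x] by linarith+
      qed
      have gf: "\<bar>g - f t x\<bar> \<le> \<theta>"
        using flux_lipschitz[OF vNb, of "va N \<tau> lam t x"] h3[OF t x] h1[OF t x] unfolding g_def f_def by linarith
      have KSx: "(1 - lam) * KS N \<tau> t x = g - R * P - e" by (simp add: e_def ep_def g_def R_def P_def)
      have z1: "\<bar>z\<bar> \<le> \<epsilon> * z\<^sup>2 + 1 / (4 * \<epsilon>)" by (rule abs_le_square)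
      have psilow: "- (1 / (4 * \<epsilon>)) \<le> psi z" using z1 unfolding psi_def by linarith
      have ez0: "0 \<le> \<epsilon> * z\<^sup>2" using \<epsilon> by simp
      have psiab: "\<bar>psi z\<bar> \<le> \<bar>z\<bar> + \<epsilon> * z\<^sup>2" using ez0 unfolding psi_def by linarith
      \<comment> \<open>Expressing \<open>KS\<close> by the defect \<open>e\<close> groups the
        terms: the Fejer error of the stationary flux, a term of favourable sign, the gap between
        Neumann and Dirichlet means, and \<open>e\<close> against \<open>- psi z\<close>, which is
        at most \<open>1 / (4 * \<epsilon>)\<close>.\<close>
      have "sr * z - (1 - R) * (P * z) + (g - R * P - e) * psi z - f t x * psi z
          = (sr - P) * z - R * P * (\<epsilon> * z\<^sup>2) + (g - f t x) * psi z - e * psi z"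
        by (simp add: psi_def algebra_simps)
      also have "\<dots> \<le> \<theta> * \<bar>z\<bar> - 0 + \<theta> * (\<bar>z\<bar> + \<epsilon> * z\<^sup>2) + e * (1 / (4 * \<epsilon>))"
      proof -
        have a: "(sr - P) * z \<le> \<theta> * \<bar>z\<bar>"
          using mult_right_mono[OF sP abs_ge_zero[of z]] abs_ge_self[of "(sr - P) * z"] by (simp add: abs_mult)
        have b: "0 \<le> R * P * (\<epsilon> * z\<^sup>2)" using R P0 ez0 by simp
        have c: "(g - f t x) * psi z \<le> \<theta> * (\<bar>z\<bar> + \<epsilon> * z\<^sup>2)"
        proof -
          have "(g - f t x) * psi z \<le> \<bar>g - f t x\<bar> * \<bar>psi z\<bar>" unfolding abs_mult[symmetric] by (rule abs_ge_self)
          also have "\<dots> \<le> \<theta> * (\<bar>z\<bar> + \<epsilon> * z\<^sup>2)" using gf psiab \<theta> by (intro mult_mono) auto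
          finally show ?thesis .
        qed
        have d: "- (e * psi z) \<le> e * (1 / (4 * \<epsilon>))"
          using mult_left_mono[OF psilow e0] by linarith
        show ?thesis using a b c d by linarith
      qed
      also have "\<dots> \<le> \<theta> * (3 * (\<epsilon> * z\<^sup>2) + 1 / (2 * \<epsilon>)) + e * (1 / (4 * \<epsilon>))"
      proof -
        have "\<theta> * (2 * \<bar>z\<bar> + \<epsilon> * z\<^sup>2) \<le> \<theta> * (3 * (\<epsilon> * z\<^sup>2) + 1 / (2 * \<epsilon>))"
        proof (rule mult_left_mono[OF _ \<theta>])
          have "2 * (1 / (4 * \<epsilon>)) = 1 / (2 * \<epsilon>)" by simp
          then show "2 * \<bar>z\<bar> + \<epsilon> * z\<^sup>2 \<le> 3 * (\<epsilon> * z\<^sup>2) + 1 / (2 * \<epsilon>)" using z1 by linarith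
        qed
        then show ?thesis by (simp add: algebra_simps)
      qed
      \<comment> \<open>Since \<open>c0\<close> bounds the flux from below,
        \<open>\<epsilon> * z\<^sup>2\<close> is at most the Lagrangian density divided by
        \<open>c0\<close>.\<close>
      also have "\<dots> \<le> 3 * \<theta> / c0 * (\<epsilon> * f t x * z\<^sup>2) + \<theta> / (2 * \<epsilon>) + e / (4 * \<epsilon>)"
      proof -
        have "c0 * (\<epsilon> * z\<^sup>2) \<le> f t x * (\<epsilon> * z\<^sup>2)" using fpos(2)[OF t x] ez0 by (intro mult_right_mono) auto
        then have "3 * \<theta> / c0 * (c0 * (\<epsilon> * z\<^sup>2)) \<le> 3 * \<theta> / c0 * (f t x * (\<epsilon> * z\<^sup>2))"
          using \<theta> c0 by (intro mult_left_mono) auto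
        then show ?thesis using c0 by (simp add: algebra_simps)
      qed
      finally show "flux (\<rho>b x) * p t x - (1 - R) * (PF N x * p t x) + (1 - lam) * (KS N \<tau> t x * psi (p t x)) - f t x * psi (p t x)
          \<le> 3 * \<theta> / c0 * (\<epsilon> * f t x * (p t x)\<^sup>2) + \<theta> / (2 * \<epsilon>) + ep N \<tau> lam t x / (4 * \<epsilon>)"
        unfolding mult.assoc[of "1 - lam", symmetric] KSx unfolding sr_def[symmetric] P_def[symmetric] z_def[symmetric] e_def[symmetric] .
    qed (use \<epsilon> c0 in \<open>auto intro!: continuous_imp_integrable_real continuous_intros slices[OF t] \<rho>b_cont PFc\<close>)
    also have "\<dots> = 3 * \<theta> / c0 * m t + \<theta> / (2 * \<epsilon>) + ?E t / (4 * \<epsilon>)"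
    proof -
      have i1: "integrable Lx (\<lambda>x. \<epsilon> * f t x * (p t x)\<^sup>2)" and i2: "integrable Lx (ep N \<tau> lam t)"
        by (intro continuous_imp_integrable_real continuous_intros slices[OF t])+
      show ?thesis unfolding m_sq[OF t] using i1 i2 integral_lebesgue_on_const[of 0 1 "\<theta> / (2 * \<epsilon>)"]
        by (simp del: lebesgue_integral_const)
    qed
    finally show ?thesis .
  qed
  have mi: "integrable Lt m" by (rule continuous_imp_integrable_real[OF mc])
  have Ei: "integrable Lt ?E" by (rule continuous_imp_integrable_real[OF jcont_integral[OF epc]])
  have PTc: "continuous_on {-T..0} (\<lambda>t. inner1 (\<lambda>x. flux (\<rho>b x)) (p t))"
    "continuous_on {-T..0} (\<lambda>t. inner1 (\<lambda>x. inner1 (\<lambda>x. flux (\<rho>b x)) (kerN N x)) (p t))"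
    unfolding inner1_commute[of _ "p _"]
    by (intro jcont_inner1[OF pj] continuous_intros \<rho>b_cont continuous_on_inner1_kerN \<rho>b_flux_int)+
  have KTc: "continuous_on {-T..0} (\<lambda>t. inner1 (KS N \<tau> t) (\<lambda>x. psi (p t x)))"
    "continuous_on {-T..0} (\<lambda>t. inner1 (f t) (\<lambda>x. psi (p t x)))"
    unfolding inner1_def by (intro jcont_integral continuous_intros KSc psij fc)+
  define D1 where "D1 = (\<lambda>t. inner1 (\<lambda>x. flux (\<rho>b x)) (p t)
        - (1 - lam) * avg T \<tau> (\<lambda>_. 1) t * inner1 (\<lambda>x. inner1 (\<lambda>x. flux (\<rho>b x)) (kerN N x)) (p t)
        + (1 - lam) * inner1 (KS N \<tau> t) (\<lambda>x. psi (p t x)))"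
  have D1i: "integrable Lt D1" unfolding D1_def
    by (intro continuous_imp_integrable_real continuous_intros PTc KTc ta.avg_continuous ta.integrable_const_T)
  have fpi: "integrable Lt (\<lambda>t. inner1 (f t) (\<lambda>x. psi (p t x)))" by (rule continuous_imp_integrable_real[OF KTc(2)])
  have lini: "integrable Lt (\<lambda>t. inner1 (?lin t) (p t))"
    unfolding inner1_def Wlin
    by (intro continuous_imp_integrable_real jcont_integral continuous_intros Wc fc pj)
  have "(LINT t|Lt. m t) = (LINT t|Lt. inner1 (?lin t) (p t) - inner1 (f t) (\<lambda>x. psi (p t x)))"
    by (rule integral_lebesgue_on_cong) (rule m_eq)
  also have "\<dots> = (LINT t|Lt. inner1 (?lin t) (p t)) - (LINT t|Lt. inner1 (f t) (\<lambda>x. psi (p t x)))"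
    by (rule Bochner_Integration.integral_diff[OF lini fpi])
  also have "\<dots> \<le> ((1 - lam) * I + (LINT t|Lt. D1 t)) - (LINT t|Lt. inner1 (f t) (\<lambda>x. psi (p t x)))"
    unfolding D1_def using dual_bound[OF \<tau> lam(2) pc p0, of N] by (intro diff_right_mono)
  also have "\<dots> = (1 - lam) * I + (LINT t|Lt. D t)"
  proof -
    have "(LINT t|Lt. D t) = (LINT t|Lt. D1 t - inner1 (f t) (\<lambda>x. psi (p t x)))" by (simp add: D_def D1_def)
    also have "\<dots> = (LINT t|Lt. D1 t) - (LINT t|Lt. inner1 (f t) (\<lambda>x. psi (p t x)))"
      by (rule Bochner_Integration.integral_diff[OF D1i fpi])
    finally show ?thesis by simp
  qed
  also have "\<dots> \<le> I + (LINT t|Lt. 3 * \<theta> / c0 * m t + \<theta> / (2 * \<epsilon>) + ?E t / (4 * \<epsilon>))"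
  proof (rule add_mono)
    show "(1 - lam) * I \<le> I" using lam I by (simp add: mult_left_le_one_le)
    have Di: "integrable Lt D"
      using Bochner_Integration.integrable_diff[OF D1i fpi] by (simp add: D_def D1_def)
    show "(LINT t|Lt. D t) \<le> (LINT t|Lt. 3 * \<theta> / c0 * m t + \<theta> / (2 * \<epsilon>) + ?E t / (4 * \<epsilon>))"
      by (rule integral_lebesgue_on_mono[OF Di _ Dle]) (use mi Ei in auto)
  qed
  also have "(LINT t|Lt. 3 * \<theta> / c0 * m t + \<theta> / (2 * \<epsilon>) + ?E t / (4 * \<epsilon>))
      = 3 * \<theta> / c0 * (LINT t|Lt. m t) + \<theta> / (2 * \<epsilon>) * T + (LINT t|Lt. ?E t) / (4 * \<epsilon>)"
    using mi Ei T integral_lebesgue_on_const[of "-T" 0 "\<theta> / (2 * \<epsilon>)"] by (simp del: lebesgue_integral_const)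
  finally show "(1 - 3 * \<theta> / c0) * (LINT t|Lt. lag (W t) (f t) (cst (W t) (f t)))
      \<le> I + \<theta> * T / (2 * \<epsilon>) + (LINT t|Lt. LINT x|Lx. ep N \<tau> lam t x) / (4 * \<epsilon>)"
    by (simp add: m_def k_def left_diff_distrib)
qed


definition m0 :: real where "m0 = min \<rho>\<^sub>0 (1 - \<rho>\<^sub>1)"

lemma m0: "0 < m0" "m0 \<le> \<rho>\<^sub>0" "m0 \<le> 1 - \<rho>\<^sub>1"
  using \<rho>01 by (auto simp: m0_def)

lemma flux_ge_square: "0 \<le> d \<Longrightarrow> d \<le> a \<Longrightarrow> a \<le> 1 - d \<Longrightarrow> d\<^sup>2 \<le> flux a"
  unfolding flux_def power2_eq_square by (intro mult_mono) auto

lemma main_eventually: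
  assumes \<tau>: "0 < \<tau>" and lam: "0 < lam" "lam < 1" and \<zeta>: "0 < \<zeta>"
  shows "\<forall>\<^sub>F N in sequentially.
    (\<forall>t\<in>{-T..0}. \<forall>x\<in>{0..1}. lam * m0 / 2 \<le> va N \<tau> lam t x \<and> va N \<tau> lam t x \<le> 1 - lam * m0 / 2
        \<and> \<bar>vN N \<tau> lam t x - va N \<tau> lam t x\<bar> \<le> \<zeta>) \<and>
    continuous_on {-T..0} (\<lambda>t. cst (WW N (gam N \<tau> lam) (gam' N \<tau> lam) t) (\<lambda>x. flux (va N \<tau> lam t x))) \<and>
    (1 - \<zeta>) * (LINT t|Lt. lag (WW N (gam N \<tau> lam) (gam' N \<tau> lam) t) (\<lambda>x. flux (va N \<tau> lam t x))
        (cst (WW N (gam N \<tau> lam) (gam' N \<tau> lam) t) (\<lambda>x. flux (va N \<tau> lam t x))))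
      \<le> I + \<zeta> + (LINT t|Lt. LINT x|Lx. ep N \<tau> lam t x) / (4 * \<epsilon>)"
proof -
  define d where "d = lam * m0 / 2"
  have d: "0 < d" using lam m0 by (simp add: d_def)
  define c0 where "c0 = d\<^sup>2"
  have c0: "0 < c0" using d by (simp add: c0_def)
  \<comment> \<open>The four entries serve the closeness to \<open>vN\<close>, the loss of at most
    half of the margin \<open>2 * d\<close> of \<open>vN\<close>, the absorption
    \<open>3 * \<theta> / c0 \<le> \<zeta>\<close>, and the additive error
    \<open>\<theta> * T / (2 * \<epsilon>) \<le> \<zeta>\<close>.\<close>
  define \<theta> where "\<theta> = min \<zeta> (min d (min (\<zeta> * c0 / 3) (2 * \<epsilon> * \<zeta> / T)))"
  have \<theta>: "0 < \<theta>" "\<theta> \<le> \<zeta>" "\<theta> \<le> d" "\<theta> \<le> \<zeta> * c0 / 3" "\<theta> \<le> 2 * \<epsilon> * \<zeta> / T"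
    using \<zeta> d c0 \<epsilon> T by (auto simp: \<theta>_def)
  have fc: "continuous_on {0..1} (\<lambda>x. flux (\<rho>b x))" by (intro continuous_intros \<rho>b_cont)
  from vN_close[OF \<tau> lam \<theta>(1)] kerN_uniform[OF fc \<theta>(1)] show ?thesis
  proof eventually_elim
    case (elim N)
    have h1: "\<bar>vN N \<tau> lam t x - va N \<tau> lam t x\<bar> \<le> \<theta>" if "t \<in> {-T..0}" "x \<in> {0..1}" for t x using elim that by blast
    have h2: "\<bar>PF N x - flux (\<rho>b x)\<bar> \<le> \<theta>" if "x \<in> {0..1}" for x using elim that by (simp add: PF_def)
    have range: "d \<le> va N \<tau> lam t x" "va N \<tau> lam t x \<le> 1 - d" if "t \<in> {-T..0}" "x \<in> {0..1}" for t x
    proof -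
      have "2 * d \<le> lam * \<rho>\<^sub>0" "2 * d \<le> lam * (1 - \<rho>\<^sub>1)" unfolding d_def using m0 lam by (auto intro: mult_left_mono)
      then show "d \<le> va N \<tau> lam t x" "va N \<tau> lam t x \<le> 1 - d"
        using vN_bounds[OF \<tau> lam that(1), of N x] h1[OF that] \<theta>(3) by linarith+
    qed
    have h3: "0 \<le> va N \<tau> lam t x \<and> va N \<tau> lam t x \<le> 1 \<and> c0 \<le> flux (va N \<tau> lam t x)" if "t \<in> {-T..0}" "x \<in> {0..1}" for t x
      using range[OF that] d flux_ge_square[of d "va N \<tau> lam t x"] by (auto simp: c0_def)
    note mb = main_bound[OF \<tau> lam c0 less_imp_le[OF \<theta>(1)] h1 h2 h3]
    let ?m = "\<lambda>t. lag (WW N (gam N \<tau> lam) (gam' N \<tau> lam) t) (\<lambda>x. flux (va N \<tau> lam t x))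
        (cst (WW N (gam N \<tau> lam) (gam' N \<tau> lam) t) (\<lambda>x. flux (va N \<tau> lam t x)))"
    have mpos: "0 \<le> (LINT t|Lt. ?m t)"
    proof (rule Bochner_Integration.integral_nonneg_AE, rule AE_lebesgue_onI)
      fix t assume t: "t \<in> {-T..0}"
      show "0 \<le> ?m t" unfolding lag_def
      proof (rule Bochner_Integration.integral_nonneg_AE, rule AE_lebesgue_onI)
        fix x :: real assume "x \<in> {0..1}"
        then have "0 < flux (va N \<tau> lam t x)" using h3[OF t] c0 by fastforce
        then show "0 \<le> (WW N (gam N \<tau> lam) (gam' N \<tau> lam) t x - cst (WW N (gam N \<tau> lam) (gam' N \<tau> lam) t) (\<lambda>x. flux (va N \<tau> lam t x)))\<^sup>2
            / (4 * \<epsilon> * flux (va N \<tau> lam t x))" using \<epsilon> by simp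
      qed
    qed
    have "3 * \<theta> / c0 \<le> \<zeta>" using \<theta>(4) c0 by (simp add: field_simps)
    then have "(1 - \<zeta>) * (LINT t|Lt. ?m t) \<le> (1 - 3 * \<theta> / c0) * (LINT t|Lt. ?m t)"
      using mpos by (intro mult_right_mono) auto
    also have "\<dots> \<le> I + \<theta> * T / (2 * \<epsilon>) + (LINT t|Lt. LINT x|Lx. ep N \<tau> lam t x) / (4 * \<epsilon>)"
      using mb(2) .
    also have "\<theta> * T / (2 * \<epsilon>) \<le> \<zeta>" using \<theta>(5) \<epsilon> T by (simp add: field_simps)
    finally have "(1 - \<zeta>) * (LINT t|Lt. ?m t) \<le> I + \<zeta> + (LINT t|Lt. LINT x|Lx. ep N \<tau> lam t x) / (4 * \<epsilon>)" by simp
    moreover have "\<bar>vN N \<tau> lam t x - va N \<tau> lam t x\<bar> \<le> \<zeta>" if "t \<in> {-T..0}" "x \<in> {0..1}" for t x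
      using h1[OF that] \<theta>(2) by linarith
    ultimately show ?case using range mb(1) unfolding d_def by blast
  qed
qed

text \<open>As time means of continuous functions the coefficients \<open>gam\<close> are in general
  only once differentiable, whereas smooth paths are required. Polynomials close to them together
  with the derivatives change the Lagrangian by at most \<open>\<delta>\<close>, because its
  integrand is uniformly continuous on a compact set of arguments. The constant \<open>k\<close> is
  carried over and need not be optimal for the new path.\<close>

lemma poly_stage:
  fixes N \<tau> lam
  defines "W \<equiv> WW N (gam N \<tau> lam) (gam' N \<tau> lam)" and "f \<equiv> \<lambda>t x. flux (va N \<tau> lam t x)"
  assumes \<tau>: "0 < \<tau>" and d: "0 < d"
    and range: "\<And>t x. t \<in> {-T..0} \<Longrightarrow> x \<in> {0..1} \<Longrightarrow> d \<le> va N \<tau> lam t x \<and> va N \<tau> lam t x \<le> 1 - d"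
    and kc: "continuous_on {-T..0} k" and \<delta>: "0 < \<delta>"
  obtains p where "\<And>n. n \<in> {1..<N} \<Longrightarrow> poly (p n) (-T) = 0"
    "\<And>t x. t \<in> {-T..0} \<Longrightarrow> x \<in> {0..1} \<Longrightarrow> \<bar>vv N (\<lambda>n. poly (p n)) t x - va N \<tau> lam t x\<bar> \<le> \<delta>"
    "\<And>t x. t \<in> {-T..0} \<Longrightarrow> x \<in> {0..1} \<Longrightarrow> 0 < vv N (\<lambda>n. poly (p n)) t x \<and> vv N (\<lambda>n. poly (p n)) t x < 1"
    "continuous_on {-T..0} (\<lambda>t. lag (WW N (\<lambda>n. poly (p n)) (\<lambda>n. poly (pderiv (p n))) t) (\<lambda>x. flux (vv N (\<lambda>n. poly (p n)) t x)) (k t))"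
    "(LINT t|Lt. lag (WW N (\<lambda>n. poly (p n)) (\<lambda>n. poly (pderiv (p n))) t) (\<lambda>x. flux (vv N (\<lambda>n. poly (p n)) t x)) (k t))
      \<le> (LINT t|Lt. lag (W t) (f t) (k t)) + \<delta>"
proof -
  interpret ta: time_average T \<tau> by unfold_locales (use T \<tau> in auto)
  let ?K = "{1..<N}"
  have Wc: "jcont W" and vc: "jcont (va N \<tau> lam)" unfolding W_def by (rule jcont_intros[OF \<tau>])+
  have fc: "jcont f" unfolding f_def by (intro continuous_on_flux vc)
  have fb: "d\<^sup>2 \<le> f t x" "f t x \<le> 1" if "t \<in> {-T..0}" "x \<in> {0..1}" for t x
    using flux_ge_square[of d "va N \<tau> lam t x"] range[OF that] d flux_le_quarter[of "va N \<tau> lam t x"] unfolding f_def by auto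
  have ac: "jcont (\<lambda>t x. W t x - k t)" by (intro continuous_intros Wc continuous_on_fst kc)
  then have "bounded ((\<lambda>z. W (fst z) (snd z) - k (fst z)) ` ({-T..0} \<times> {0..1}))"
    by (intro compact_imp_bounded compact_continuous_image compact_Times) auto
  then obtain B0 where B0: "\<forall>y\<in>(\<lambda>z. W (fst z) (snd z) - k (fst z)) ` ({-T..0} \<times> {0..1}). norm y \<le> B0"
    unfolding bounded_pos by blast
  have B0': "\<bar>W t x - k t\<bar> \<le> B0" if "t \<in> {-T..0}" "x \<in> {0..1}" for t x
  proof -
    have "(\<lambda>z. W (fst z) (snd z) - k (fst z)) (t, x) \<in> (\<lambda>z. W (fst z) (snd z) - k (fst z)) ` ({-T..0} \<times> {0..1})"
      by (rule imageI) (use that in auto)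
    then show ?thesis using B0 by fastforce
  qed
  \<comment> \<open>The range of the unperturbed arguments, enlarged by one in the first coordinate
    and with half the lower bound \<open>d\<^sup>2\<close> in the second, so that the perturbed
    arguments stay inside.\<close>
  define S where "S = {- B0 - 1..B0 + 1} \<times> {d\<^sup>2 / 2..1}"
  define \<Phi> where "\<Phi> = (\<lambda>z::real\<times>real. (fst z)\<^sup>2 / (4 * \<epsilon> * snd z))"
  have "compact S" unfolding S_def by (intro compact_Times) auto
  moreover have "snd z \<noteq> 0" if "z \<in> S" for z
  proof -
    have "0 < d\<^sup>2 / 2" using d by simp
    then show ?thesis using that by (auto simp: S_def)
  qed
  then have "continuous_on S \<Phi>" unfolding \<Phi>_def using \<epsilon> by (intro continuous_intros) auto
  ultimately have "uniformly_continuous_on S \<Phi>" by (intro compact_uniformly_continuous)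
  moreover have "\<delta> / T > 0" using \<delta> T by simp
  ultimately obtain \<nu> where \<nu>: "\<nu> > 0" "\<And>z z'. z \<in> S \<Longrightarrow> z' \<in> S \<Longrightarrow> dist z' z < \<nu> \<Longrightarrow> dist (\<Phi> z') (\<Phi> z) < \<delta> / T"
    unfolding uniformly_continuous_on_def by metis
  define \<mu> where "\<mu> = min \<delta> (min (d / 2) (min (d\<^sup>2 / 2) (min 1 (\<nu> / 3))))"
  have \<mu>: "0 < \<mu>" "\<mu> \<le> \<delta>" "\<mu> \<le> d / 2" "\<mu> \<le> d\<^sup>2 / 2" "\<mu> \<le> 1" "\<mu> \<le> \<nu> / 3"
  proof -
    have "0 < d\<^sup>2" using d by simp
    then show "0 < \<mu>" using \<delta> d \<nu>(1) by (simp add: \<mu>_def)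
  qed (simp_all add: \<mu>_def min_le_iff_disj)
  \<comment> \<open>The sensitivity to the coefficient \<open>n\<close>: \<open>1\<close> for the
    path, \<open>\<epsilon> * w n\<close> for its space derivative, and \<open>2 / w n\<close> for
    the primitive of its time derivative, since \<open>1 - cosn n x\<close> is at most
    \<open>2\<close>.\<close>
  define Ct where "Ct = (\<Sum>n\<in>?K. 1 + (\<epsilon> * w n + 2 / w n))"
  have wnn: "0 \<le> \<epsilon> * w n + 2 / w n" if "n \<in> ?K" for n
    using w_pos[OF that] \<epsilon> by (simp add: add_nonneg_nonneg)
  have Ct0: "0 \<le> Ct" unfolding Ct_def by (rule sum_nonneg, drule wnn, simp)
  define \<eta> where "\<eta> = \<mu> / (Ct + 1)"
  have \<eta>: "0 < \<eta>" using \<mu> Ct0 by (simp add: \<eta>_def)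
  have \<eta>C: "\<eta> * Ct \<le> \<mu>"
  proof -
    have "\<eta> * Ct \<le> \<eta> * (Ct + 1)" using \<eta> by simp
    also have "\<dots> = \<mu>" using Ct0 by (simp add: \<eta>_def)
    finally show ?thesis .
  qed
  have "\<forall>n. \<exists>p. poly p (-T) = 0 \<and> (\<forall>t\<in>{-T..0}. \<bar>poly p t - gam N \<tau> lam n t\<bar> \<le> \<eta> \<and> \<bar>poly (pderiv p) t - gam' N \<tau> lam n t\<bar> \<le> \<eta>)"
  proof
    fix n
    have g0: "gam N \<tau> lam n (-T) = 0" by (simp add: gam_def)
    obtain p where "poly p (-T) = gam N \<tau> lam n (-T)"
      "\<And>t. t \<in> {-T..0} \<Longrightarrow> \<bar>poly p t - gam N \<tau> lam n t\<bar> \<le> \<eta>" "\<And>t. t \<in> {-T..0} \<Longrightarrow> \<bar>poly (pderiv p) t - gam' N \<tau> lam n t\<bar> \<le> \<eta>"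
      by (rule C1_poly_approx[OF _ gam_deriv[OF \<tau>, of _ N lam n] gam_cont(2)[OF \<tau>] \<eta>]) (use T in auto)
    then show "\<exists>p. poly p (-T) = 0 \<and> (\<forall>t\<in>{-T..0}. \<bar>poly p t - gam N \<tau> lam n t\<bar> \<le> \<eta> \<and> \<bar>poly (pderiv p) t - gam' N \<tau> lam n t\<bar> \<le> \<eta>)"
      using g0 by (intro exI[of _ p]) auto
  qed
  then obtain p where p0: "\<And>n. poly (p n) (-T) = 0"
    and p1: "\<And>n t. t \<in> {-T..0} \<Longrightarrow> \<bar>poly (p n) t - gam N \<tau> lam n t\<bar> \<le> \<eta>"
    and p2: "\<And>n t. t \<in> {-T..0} \<Longrightarrow> \<bar>poly (pderiv (p n)) t - gam' N \<tau> lam n t\<bar> \<le> \<eta>" by metis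
  let ?v = "vv N (\<lambda>n. poly (p n))" and ?W = "WW N (\<lambda>n. poly (p n)) (\<lambda>n. poly (pderiv (p n)))"
  have vdiff: "\<bar>?v t x - va N \<tau> lam t x\<bar> \<le> \<eta> * (\<Sum>n\<in>?K. 1)" if t: "t \<in> {-T..0}" for t x
  proof -
    have "?v t x - va N \<tau> lam t x = (\<Sum>n\<in>?K. (poly (p n) t - gam N \<tau> lam n t) * sinn n x)"
      by (simp add: vv_def left_diff_distrib sum_subtractf)
    moreover have "\<bar>(poly (p n) t - gam N \<tau> lam n t) * sinn n x\<bar> \<le> \<eta> * 1" for n
      unfolding abs_mult by (rule mult_mono[OF p1[OF t] sinn_le_1]) (use \<eta> in auto)
    then have "\<bar>\<Sum>n\<in>?K. (poly (p n) t - gam N \<tau> lam n t) * sinn n x\<bar> \<le> (\<Sum>n\<in>?K. \<eta> * 1)"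
      by (intro order_trans[OF sum_abs sum_mono])
    ultimately show ?thesis by (simp only: sum_distrib_left)
  qed
  have sum_le: "\<eta> * (\<Sum>n\<in>?K. 1) + \<eta> * (\<Sum>n\<in>?K. \<epsilon> * w n + 2 / w n) \<le> \<mu>"
    using \<eta>C unfolding Ct_def by (simp add: sum.distrib distrib_left)
  have sum_nn: "0 \<le> \<eta> * (\<Sum>n\<in>?K. \<epsilon> * w n + 2 / w n)"
    using \<eta> by (intro mult_nonneg_nonneg sum_nonneg wnn) auto
  have vmu: "\<bar>?v t x - va N \<tau> lam t x\<bar> \<le> \<mu>" if t: "t \<in> {-T..0}" for t x
    using vdiff[OF t, of x] sum_le sum_nn by linarith
  have vrange: "d / 2 \<le> ?v t x" "?v t x \<le> 1 - d / 2" if "t \<in> {-T..0}" "x \<in> {0..1}" for t x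
    using vmu[OF that(1), of x] range[OF that] \<mu>(3) by linarith+
  have fdiff: "\<bar>flux (?v t x) - f t x\<bar> \<le> \<eta> * (\<Sum>n\<in>?K. 1)" if tx: "t \<in> {-T..0}" "x \<in> {0..1}" for t x
    using flux_lipschitz[of "?v t x" "va N \<tau> lam t x"] vrange[OF tx] range[OF tx] vdiff[OF tx(1), of x] d unfolding f_def by linarith
  have Wdiff: "\<bar>?W t x - W t x\<bar> \<le> \<mu>" if tx: "t \<in> {-T..0}" "x \<in> {0..1}" for t x
  proof -
    have "?W t x - W t x = (\<Sum>n\<in>?K. (poly (p n) t - gam N \<tau> lam n t) * (\<epsilon> * w n * cosn n x)
        - (poly (pderiv (p n)) t - gam' N \<tau> lam n t) * ((1 - cosn n x) / w n)) - (flux (?v t x) - f t x)"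
    proof -
      have "(\<Sum>n\<in>?K. (poly (p n) t - gam N \<tau> lam n t) * (\<epsilon> * w n * cosn n x)
        - (poly (pderiv (p n)) t - gam' N \<tau> lam n t) * ((1 - cosn n x) / w n))
        = (\<Sum>n\<in>?K. \<epsilon> * (poly (p n) t * (w n * cosn n x))) - (\<Sum>n\<in>?K. \<epsilon> * (gam N \<tau> lam n t * (w n * cosn n x)))
        - ((\<Sum>n\<in>?K. poly (pderiv (p n)) t * ((1 - cosn n x) / w n)) - (\<Sum>n\<in>?K. gam' N \<tau> lam n t * ((1 - cosn n x) / w n)))"
        unfolding sum_subtractf[symmetric] by (rule sum.cong) (simp_all only: algebra_simps)
      then show ?thesis unfolding W_def f_def WW_def VV_def distrib_left sum_distrib_left by linarith
    qed
    moreover have "\<bar>\<Sum>n\<in>?K. (poly (p n) t - gam N \<tau> lam n t) * (\<epsilon> * w n * cosn n x)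
        - (poly (pderiv (p n)) t - gam' N \<tau> lam n t) * ((1 - cosn n x) / w n)\<bar> \<le> (\<Sum>n\<in>?K. \<eta> * (\<epsilon> * w n + 2 / w n))"
    proof (rule order_trans[OF sum_abs sum_mono])
      fix n assume n: "n \<in> ?K"
      have wn: "0 < w n" by (rule w_pos[OF n])
      have c: "\<bar>cosn n x\<bar> \<le> 1" by (rule cosn_le_1)
      have "\<bar>(poly (p n) t - gam N \<tau> lam n t) * (\<epsilon> * w n * cosn n x)\<bar> \<le> \<eta> * (\<epsilon> * w n * 1)"
        unfolding abs_mult using p1[OF tx(1), of n] c wn \<epsilon> \<eta> by (intro mult_mono) auto
      moreover have "\<bar>(poly (pderiv (p n)) t - gam' N \<tau> lam n t) * ((1 - cosn n x) / w n)\<bar> \<le> \<eta> * (2 / w n)"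
        unfolding abs_mult abs_divide using p2[OF tx(1), of n] c wn \<eta> by (intro mult_mono frac_le) auto
      ultimately show "\<bar>(poly (p n) t - gam N \<tau> lam n t) * (\<epsilon> * w n * cosn n x)
        - (poly (pderiv (p n)) t - gam' N \<tau> lam n t) * ((1 - cosn n x) / w n)\<bar> \<le> \<eta> * (\<epsilon> * w n + 2 / w n)"
        unfolding distrib_left by linarith
    qed
    ultimately show ?thesis using fdiff[OF tx] sum_le by (simp only: sum_distrib_left[symmetric])
  qed
  have close: "\<Phi> (?W t x - k t, flux (?v t x)) \<le> \<Phi> (W t x - k t, f t x) + \<delta> / T" if tx: "t \<in> {-T..0}" "x \<in> {0..1}" for t x
  proof -
    have fm: "\<bar>flux (?v t x) - f t x\<bar> \<le> \<mu>" using fdiff[OF tx] sum_le sum_nn by linarith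
    have "0 \<le> d\<^sup>2" by simp
    then have 1: "(W t x - k t, f t x) \<in> S"
      using B0'[OF tx] fb[OF tx] unfolding S_def mem_Times_iff fst_conv snd_conv atLeastAtMost_iff by linarith
    have "flux (?v t x) \<le> 1" using flux_le_quarter[of "?v t x"] by simp
    then have 2: "(?W t x - k t, flux (?v t x)) \<in> S"
      using B0'[OF tx] fb[OF tx] Wdiff[OF tx] fm \<mu> unfolding S_def mem_Times_iff fst_conv snd_conv atLeastAtMost_iff by linarith
    have "dist (?W t x - k t, flux (?v t x)) (W t x - k t, f t x) \<le> \<bar>?W t x - W t x\<bar> + \<bar>flux (?v t x) - f t x\<bar>"
      unfolding dist_Pair_Pair dist_real_def using sqrt_sum_squares_le_sum_abs[of "\<bar>?W t x - k t - (W t x - k t)\<bar>" "\<bar>flux (?v t x) - f t x\<bar>"] by simp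
    also have "\<dots> < \<nu>" using Wdiff[OF tx] fm \<mu> \<nu>(1) by linarith
    finally have "dist (\<Phi> (?W t x - k t, flux (?v t x))) (\<Phi> (W t x - k t, f t x)) < \<delta> / T" by (rule \<nu>(2)[OF 1 2])
    then show ?thesis unfolding dist_real_def by linarith
  qed
  have W'c: "jcont ?W" using WW_cont[of N "\<lambda>n. poly (p n)" "\<lambda>n. poly (pderiv (p n))"] by (simp add: case_prod_unfold continuous_intros)
  have v'c: "jcont ?v" using vv_cont[of N "\<lambda>n. poly (p n)"] by (simp add: case_prod_unfold continuous_intros)
  have f'nz: "flux (?v t x) \<noteq> 0" if "t \<in> {-T..0}" "x \<in> {0..1}" for t x
    using vrange[OF that] d unfolding flux_def by auto
  have fnz: "f t x \<noteq> 0" if "t \<in> {-T..0}" "x \<in> {0..1}" for t x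
  proof -
    have "0 < d\<^sup>2" using d by simp
    then show ?thesis using fb[OF that] by linarith
  qed
  have j1: "jcont (\<lambda>t x. (?W t x - k t)\<^sup>2 / (4 * \<epsilon> * flux (?v t x)))"
    by (intro continuous_intros continuous_on_flux W'c v'c continuous_on_fst kc) (use f'nz \<epsilon> in auto)
  have j2: "jcont (\<lambda>t x. (W t x - k t)\<^sup>2 / (4 * \<epsilon> * f t x))"
    by (intro continuous_intros Wc fc continuous_on_fst kc) (use fnz \<epsilon> in auto)
  have lc: "continuous_on {-T..0} (\<lambda>t. lag (?W t) (\<lambda>x. flux (?v t x)) (k t))"
    unfolding lag_def by (rule jcont_integral[OF j1])
  have lc2: "continuous_on {-T..0} (\<lambda>t. lag (W t) (f t) (k t))"
    unfolding lag_def by (rule jcont_integral[OF j2])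
  have "(LINT t|Lt. lag (?W t) (\<lambda>x. flux (?v t x)) (k t)) \<le> (LINT t|Lt. lag (W t) (f t) (k t) + \<delta> / T)"
  proof (rule integral_lebesgue_on_mono)
    fix t assume t: "t \<in> {-T..0}"
    have "lag (?W t) (\<lambda>x. flux (?v t x)) (k t) \<le> (LINT x|Lx. (W t x - k t)\<^sup>2 / (4 * \<epsilon> * f t x) + \<delta> / T)"
      unfolding lag_def
    proof (rule integral_lebesgue_on_mono)
      show "(?W t x - k t)\<^sup>2 / (4 * \<epsilon> * flux (?v t x)) \<le> (W t x - k t)\<^sup>2 / (4 * \<epsilon> * f t x) + \<delta> / T" if "x \<in> {0..1}" for x
        using close[OF t that] by (simp add: \<Phi>_def)
    qed (use continuous_imp_integrable_real[OF jcont_slice[OF j1 t]] continuous_imp_integrable_real[OF jcont_slice[OF j2 t]] in auto)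
    also have "\<dots> = lag (W t) (f t) (k t) + \<delta> / T"
      using continuous_imp_integrable_real[OF jcont_slice[OF j2 t]] integral_lebesgue_on_const[of 0 1 "\<delta> / T"]
      by (simp add: lag_def del: lebesgue_integral_const)
    finally show "lag (?W t) (\<lambda>x. flux (?v t x)) (k t) \<le> lag (W t) (f t) (k t) + \<delta> / T" .
  qed (use continuous_imp_integrable_real[OF lc] continuous_imp_integrable_real[OF lc2] in auto)
  also have "\<dots> = (LINT t|Lt. lag (W t) (f t) (k t)) + \<delta>"
    using continuous_imp_integrable_real[OF lc2] integral_lebesgue_on_const[of "-T" 0 "\<delta> / T"] T
    by (simp del: lebesgue_integral_const)
  finally have "(LINT t|Lt. lag (?W t) (\<lambda>x. flux (?v t x)) (k t)) \<le> (LINT t|Lt. lag (W t) (f t) (k t)) + \<delta>" .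
  moreover have "\<bar>?v t x - va N \<tau> lam t x\<bar> \<le> \<delta>" if "t \<in> {-T..0}" for t x
    using vmu[OF that, of x] \<mu>(2) by linarith
  moreover have "0 < ?v t x \<and> ?v t x < 1" if "t \<in> {-T..0}" "x \<in> {0..1}" for t x
    using vrange[OF that] d by linarith
  ultimately show ?thesis using that p0 lc by blast
qed

end

section \<open>Entropy dissipation along smooth paths\<close>

text \<open>After integration by parts the left side is the integral of
  \<open>(E - V - f) * g - \<epsilon> * f * g\<^sup>2\<close>, with \<open>g\<close> the weak
  derivative of \<open>h\<close>. As \<open>g\<close> has mean zero, any constant \<open>c\<close>
  may be subtracted before the square is completed pointwise.\<close>

lemma H10_completing_square:
  assumes h: "h \<in> H10" and \<epsilon>: "0 < \<epsilon>"
    and V: "\<And>x. x \<in> {0..1} \<Longrightarrow> (V has_real_derivative V' x) (at x within {0..1})" and V': "continuous_on {0..1} V'"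
    and E: "continuous_on {0..1} E" and f: "continuous_on {0..1} f" and fpos: "\<And>x. x \<in> {0..1} \<Longrightarrow> 0 < f x"
  shows "inner1 h V' - (\<epsilon> * inner1 (weak_deriv h) (\<lambda>x. f x * weak_deriv h x) - inner1 (\<lambda>x. E x - f x) (weak_deriv h))
    \<le> (LINT x|lebesgue_on {0..1}. (E x - V x - f x - c)\<^sup>2 / (4 * \<epsilon> * f x))"
proof -
  let ?g = "weak_deriv h" and ?L = "lebesgue_on {0..1::real}"
  note wd = H10_weak_deriv[OF h]
  have Vc: "continuous_on {0..1} V" by (rule DERIV_continuous_on[OF V])
  have i1: "integrable ?L (\<lambda>x. ?g x * V x)" by (rule inner1_integrable[OF wd(3) Vc])
  have i2: "integrable ?L (\<lambda>x. ?g x * (E x - f x))" by (rule inner1_integrable[OF wd(3)]) (intro continuous_intros E f)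
  have i3: "integrable ?L (\<lambda>x. (?g x)\<^sup>2 * f x)" by (rule inner1_integrable[OF wd(4) f])
  have "inner1 h V' = - (LINT x|?L. ?g x * V x)"
    using H10_integration_by_parts[OF h V V'] by (simp add: inner1_def)
  moreover have "\<epsilon> * inner1 ?g (\<lambda>x. f x * ?g x) = \<epsilon> * (LINT x|?L. (?g x)\<^sup>2 * f x)"
    by (simp add: inner1_def power2_eq_square mult_ac)
  moreover have "inner1 (\<lambda>x. E x - f x) ?g = (LINT x|?L. ?g x * (E x - f x))"
    by (simp add: inner1_def mult_ac)
  moreover have "(LINT x|?L. ?g x * (E x - f x) - ?g x * V x - \<epsilon> * ((?g x)\<^sup>2 * f x) - c * ?g x)
      = (LINT x|?L. ?g x * (E x - f x)) - (LINT x|?L. ?g x * V x) - \<epsilon> * (LINT x|?L. (?g x)\<^sup>2 * f x)"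
    using i1 i2 i3 wd(3) H10_weak_deriv_integral_0[OF h] by simp
  moreover have "(LINT x|?L. ?g x * (E x - f x) - ?g x * V x - \<epsilon> * ((?g x)\<^sup>2 * f x) - c * ?g x)
      \<le> (LINT x|?L. (E x - V x - f x - c)\<^sup>2 / (4 * \<epsilon> * f x))"
  proof (rule integral_lebesgue_on_mono)
    show "integrable ?L (\<lambda>x. ?g x * (E x - f x) - ?g x * V x - \<epsilon> * ((?g x)\<^sup>2 * f x) - c * ?g x)"
      using i1 i2 i3 wd(3) by simp
    show "integrable ?L (\<lambda>x. (E x - V x - f x - c)\<^sup>2 / (4 * \<epsilon> * f x))"
      by (intro continuous_imp_integrable_real continuous_intros E f Vc) (use fpos \<epsilon> in fastforce)
    fix x :: real assume x: "x \<in> {0..1}"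
    have f0: "0 < f x" by (rule fpos[OF x])
    have "0 \<le> (E x - V x - f x - c - 2 * \<epsilon> * f x * ?g x)\<^sup>2 / (4 * \<epsilon> * f x)" using f0 \<epsilon> by simp
    also have "\<dots> = (E x - V x - f x - c)\<^sup>2 / (4 * \<epsilon> * f x) - (E x - V x - f x - c) * ?g x + \<epsilon> * ((?g x)\<^sup>2 * f x)"
      using f0 \<epsilon> by (simp add: power2_eq_square divide_simps) (simp add: algebra_simps)
    finally show "?g x * (E x - f x) - ?g x * V x - \<epsilon> * ((?g x)\<^sup>2 * f x) - c * ?g x \<le> (E x - V x - f x - c)\<^sup>2 / (4 * \<epsilon> * f x)"
      by (simp add: algebra_simps)
  qed
  ultimately show ?thesis by linarith
qed

text \<open>The Hamiltonian is known to be nonpositive at the partition times only. This is the cost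
  of passing to a nearby time; the uniform bound \<open>C\<close> on the norms makes it independent
  of \<open>h\<close>.\<close>

lemma H10_hamiltonian_perturbation:
  assumes h: "h \<in> H10" "H10_norm h \<le> C" and \<epsilon>: "0 < \<epsilon>"
    and c: "continuous_on {0..1} f" "continuous_on {0..1} f'" "continuous_on {0..1} g" "continuous_on {0..1} g'"
    and ff': "\<And>x. x \<in> {0..1} \<Longrightarrow> \<bar>f x - f' x\<bar> \<le> \<delta>" and gg': "\<And>x. x \<in> {0..1} \<Longrightarrow> \<bar>g x - g' x\<bar> \<le> \<delta>"
  shows "\<epsilon> * inner1 (weak_deriv h) (\<lambda>x. f x * weak_deriv h x) - inner1 g (weak_deriv h)
    \<le> \<epsilon> * inner1 (weak_deriv h) (\<lambda>x. f' x * weak_deriv h x) - inner1 g' (weak_deriv h) + \<delta> * (\<epsilon> * C\<^sup>2 + 1 + C\<^sup>2)"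
proof -
  let ?g = "weak_deriv h" and ?L = "lebesgue_on {0..1::real}"
  note wd = H10_weak_deriv[OF h(1)]
  have \<delta>: "0 \<le> \<delta>" using ff'[of 0] by auto
  have n2: "(LINT x|?L. (?g x)\<^sup>2) \<le> C\<^sup>2"
  proof -
    have nn: "0 \<le> (LINT x|?L. (?g x)\<^sup>2)" by simp
    have "0 \<le> H10_norm h" using nn by (simp add: H10_norm_def)
    then have "(H10_norm h)\<^sup>2 \<le> C\<^sup>2" using h(2) by (intro power_mono)
    moreover have "(H10_norm h)\<^sup>2 = (LINT x|?L. (?g x)\<^sup>2)" unfolding H10_norm_def by (rule real_sqrt_pow2[OF nn])
    ultimately show ?thesis by simp
  qed
  have i: "integrable ?L (\<lambda>x. (?g x)\<^sup>2 * f x)" "integrable ?L (\<lambda>x. (?g x)\<^sup>2 * f' x)"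
    "integrable ?L (\<lambda>x. ?g x * g x)" "integrable ?L (\<lambda>x. ?g x * g' x)"
    by (rule inner1_integrable[OF wd(4) c(1)] inner1_integrable[OF wd(4) c(2)]
        inner1_integrable[OF wd(3) c(3)] inner1_integrable[OF wd(3) c(4)])+
  have cst: "integrable ?L (\<lambda>x. 1 :: real)" by (intro continuous_imp_integrable_real continuous_intros)
  have "(LINT x|?L. \<epsilon> * ((?g x)\<^sup>2 * f x) - ?g x * g x)
      \<le> (LINT x|?L. \<epsilon> * ((?g x)\<^sup>2 * f' x) - ?g x * g' x + \<delta> * (\<epsilon> * (?g x)\<^sup>2 + 1 + (?g x)\<^sup>2))"
  proof (rule integral_lebesgue_on_mono)
    show "integrable ?L (\<lambda>x. \<epsilon> * ((?g x)\<^sup>2 * f x) - ?g x * g x)" using i by simp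
    show "integrable ?L (\<lambda>x. \<epsilon> * ((?g x)\<^sup>2 * f' x) - ?g x * g' x + \<delta> * (\<epsilon> * (?g x)\<^sup>2 + 1 + (?g x)\<^sup>2))"
      using i wd(4) cst by simp
    fix x :: real assume x: "x \<in> {0..1}"
    have "(?g x)\<^sup>2 * (f x - f' x) \<le> (?g x)\<^sup>2 * \<delta>" using ff'[OF x] by (intro mult_left_mono) auto
    then have 1: "\<epsilon> * ((?g x)\<^sup>2 * f x) \<le> \<epsilon> * ((?g x)\<^sup>2 * f' x) + \<delta> * (\<epsilon> * (?g x)\<^sup>2)"
      using mult_left_mono[of "(?g x)\<^sup>2 * (f x - f' x)" "(?g x)\<^sup>2 * \<delta>" \<epsilon>] \<epsilon> by (simp add: algebra_simps)
    have "0 \<le> (\<bar>?g x\<bar> - 1)\<^sup>2 + \<bar>?g x\<bar>" by simp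
    then have "\<bar>?g x\<bar> \<le> 1 + (?g x)\<^sup>2" by (simp add: power2_eq_square algebra_simps)
    then have "\<bar>?g x\<bar> * \<bar>g x - g' x\<bar> \<le> (1 + (?g x)\<^sup>2) * \<delta>" using gg'[OF x] by (intro mult_mono) auto
    then have "\<bar>?g x * (g x - g' x)\<bar> \<le> \<delta> + \<delta> * (?g x)\<^sup>2" by (simp only: abs_mult distrib_right mult_1 mult.commute[of \<delta>])
    then have "- (?g x * g x) \<le> - (?g x * g' x) + \<delta> + \<delta> * (?g x)\<^sup>2" unfolding right_diff_distrib by linarith
    with 1 show "\<epsilon> * ((?g x)\<^sup>2 * f x) - ?g x * g x
        \<le> \<epsilon> * ((?g x)\<^sup>2 * f' x) - ?g x * g' x + \<delta> * (\<epsilon> * (?g x)\<^sup>2 + 1 + (?g x)\<^sup>2)"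
      unfolding distrib_left by linarith
  qed
  also have "\<dots> = \<epsilon> * (LINT x|?L. (?g x)\<^sup>2 * f' x) - (LINT x|?L. ?g x * g' x)
      + \<delta> * (\<epsilon> * (LINT x|?L. (?g x)\<^sup>2) + 1 + (LINT x|?L. (?g x)\<^sup>2))"
    using i wd(4) cst integral_lebesgue_on_const[of 0 1 1] by (simp del: lebesgue_integral_const)
  also have "\<dots> \<le> \<epsilon> * (LINT x|?L. (?g x)\<^sup>2 * f' x) - (LINT x|?L. ?g x * g' x) + \<delta> * (\<epsilon> * C\<^sup>2 + 1 + C\<^sup>2)"
    using n2 \<delta> \<epsilon> by (intro add_left_mono mult_left_mono add_mono) auto
  finally have "\<epsilon> * (LINT x|?L. (?g x)\<^sup>2 * f x) - (LINT x|?L. ?g x * g x)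
      \<le> \<epsilon> * (LINT x|?L. (?g x)\<^sup>2 * f' x) - (LINT x|?L. ?g x * g' x) + \<delta> * (\<epsilon> * C\<^sup>2 + 1 + C\<^sup>2)"
    using i by simp
  then show ?thesis by (simp add: inner1_def power2_eq_square mult_ac)
qed

text \<open>The filter \<open>mesh_to_0\<close> ranges over all partitions, but a property holding
  eventually is used along a single equidistant one, whose mesh \<open>T / n\<close> can be made as
  small as desired.\<close>

lemma frequently_uniform_partition:
  assumes T: "0 < T" and ev: "\<forall>\<^sub>F P in mesh_to_0 T. Q P" and \<mu>: "0 < \<mu>"
  obtains n :: nat where "0 < n" "T / n < \<mu>" "map (\<lambda>i. T * real i / real n) [0..<Suc n] \<in> partitions T"
    "Q (map (\<lambda>i. T * real i / real n) [0..<Suc n])"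
proof -
  from ev obtain R where R: "eventually R (at_right (0::real))" "\<And>P. R (mesh P) \<Longrightarrow> P \<in> partitions T \<Longrightarrow> Q P"
    unfolding mesh_to_0_def eventually_inf_principal eventually_filtercomap by blast
  then obtain d where d: "0 < d" "\<And>y. 0 < y \<Longrightarrow> y < d \<Longrightarrow> R y"
    unfolding eventually_at_right_field by blast
  obtain n :: nat where n: "n > 0" "T / n < min d \<mu>"
  proof -
    obtain n :: nat where n: "real n > T / min d \<mu>" using reals_Archimedean2 by blast
    have m: "0 < min d \<mu>" using d \<mu> by simp
    have "0 < T / min d \<mu>" using T m by simp
    then have "0 < n" using n by linarith
    moreover have "T / n < min d \<mu>" using n m \<open>0 < n\<close> by (simp add: pos_divide_less_eq mult.commute del: min_less_iff_conj)
    ultimately show thesis by (rule that)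
  qed
  let ?P = "map (\<lambda>i. T * real i / real n) [0..<Suc n]"
  have nth: "?P ! i = T * real i / real n" if "i \<le> n" for i using that by (simp add: nth_append less_Suc_eq_le del: upt_Suc)
  have P: "?P \<in> partitions T"
    unfolding partitions_def
  proof (intro CollectI conjI)
    show "sorted_wrt (<) ?P"
      unfolding sorted_wrt_iff_nth_less using nth T n(1)
      by (auto simp del: upt_Suc simp: divide_strict_right_mono)
    show "hd ?P = 0" by (simp add: hd_map del: upt_Suc)
    show "last ?P = T" using n(1) by simp
  qed simp
  have nc: "num_cells ?P = n" by (simp add: num_cells_def)
  have "\<bar>?P ! (k - 1) - ?P ! k\<bar> = T / n" if "k \<in> {1..num_cells ?P}" for k
  proof -
    have k: "1 \<le> k" "k \<le> n" using that nc by auto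
    have "\<bar>?P ! (k - 1) - ?P ! k\<bar> = \<bar>T * real (k - 1) / real n - T * real k / real n\<bar>"
      using k by (simp only: nth diff_le_self le_trans)
    also have "\<dots> = \<bar>- (T / n)\<bar>" using k n(1) by (simp add: of_nat_diff field_simps)
    finally show ?thesis using T by simp
  qed
  then have "(\<lambda>k. \<bar>?P ! (k - 1) - ?P ! k\<bar>) ` {1..num_cells ?P} = (\<lambda>_. T / n) ` {1..num_cells ?P}" by (rule image_cong[OF refl])
  also have "\<dots> = {T / n}" unfolding nc using n(1) by (auto intro!: image_eqI[of _ _ 1])
  finally have "mesh ?P = T / n" unfolding mesh_def by simp
  moreover have "R (T / n)" using d(2)[of "T / n"] n T by simp
  ultimately have "Q ?P" using R(2) P by simp
  then show thesis using that[of n] n P by auto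
qed

text \<open>On each cell the Hamiltonian is nonpositive at the initial time and varies little, so
  the pairing of \<open>h\<close> with the time derivative is at most the integral of the Lagrangian
  up to a small error; the increments of \<open>U\<close> telescope. The constants
  \<open>\<kappa> t\<close> are arbitrary, since the completed square allows any of them.\<close>

lemma entropy_le_action:
  fixes h :: "real list \<Rightarrow> nat \<Rightarrow> real \<Rightarrow> real" and \<epsilon> :: real
  defines "\<Lambda> \<equiv> \<lambda>W f c. LINT x|lebesgue_on {0..1}. (W x - c)\<^sup>2 / (4 * \<epsilon> * f x)"
  assumes T: "0 < T" and \<epsilon>: "0 < \<epsilon>" and rd: "rect_derivs T v D"
    and range: "\<And>t x. t \<in> {-T..0} \<Longrightarrow> x \<in> {0..1} \<Longrightarrow> 0 < v t x \<and> v t x < 1"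
    and V: "\<And>t x. t \<in> {-T..0} \<Longrightarrow> x \<in> {0..1} \<Longrightarrow> (V t has_real_derivative D 1 0 t x) (at x within {0..1})"
    and \<Lambda>c: "continuous_on {-T..0} (\<lambda>t. \<Lambda> (\<lambda>x. \<epsilon> * D 0 1 t x - V t x - flux (v t x)) (\<lambda>x. flux (v t x)) (\<kappa> t))"
    and h: "\<And>P k. P \<in> partitions T \<Longrightarrow> k \<in> {1..num_cells P} \<Longrightarrow>
      h P k \<in> H10 \<and> H10_norm (h P k) \<le> C \<and> Ham \<epsilon> (v (- (P ! k))) (h P k) \<le> 0"
    and ls: "Limsup (mesh_to_0 T)
          (\<lambda>P. ereal (\<Sum>k=1..num_cells P.
             U (v (- (P ! (k - 1)))) - U (v (- (P ! k)))
             - (LINT t|lebesgue_on {- (P ! k)..- (P ! (k - 1))}. inner1 (h P k) (dt T v t)))) \<le> 0"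
  shows "U (v 0) - U (v (-T))
    \<le> (LINT t|lebesgue_on {-T..0}. \<Lambda> (\<lambda>x. \<epsilon> * D 0 1 t x - V t x - flux (v t x)) (\<lambda>x. flux (v t x)) (\<kappa> t))"
proof (rule field_le_epsilon)
  fix e :: real assume e: "0 < e"
  define lg where "lg = (\<lambda>t. \<Lambda> (\<lambda>x. \<epsilon> * D 0 1 t x - V t x - flux (v t x)) (\<lambda>x. flux (v t x)) (\<kappa> t))"
  define Q where "Q = {-T..0} \<times> {0..1::real}"
  have Dc: "continuous_on Q (\<lambda>z. D i j (fst z) (snd z))" for i j
    using rd unfolding rect_derivs_def Q_def case_prod_unfold by blast
  have vD: "v t x = D 0 0 t x" if "t \<in> {-T..0}" "x \<in> {0..1}" for t x
    using rd that unfolding rect_derivs_def by simp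
  have Dt: "continuous_on {0..1} (D i j t)" if "t \<in> {-T..0}" for i j t
    by (rule continuous_on_slice[of "{-T..0}"]) (use Dc[of i j] that in \<open>auto simp: Q_def case_prod_unfold\<close>)
  define F where "F = (\<lambda>t x. flux (D 0 0 t x))"
  define G where "G = (\<lambda>t x. \<epsilon> * D 0 1 t x - flux (D 0 0 t x))"
  have Fc: "continuous_on {0..1} (F t)" and Gc: "continuous_on {0..1} (G t)" if "t \<in> {-T..0}" for t
    unfolding F_def G_def by (intro continuous_intros Dt that)+
  \<comment> \<open>The perturbation of the Hamiltonian, summed over cells of total length
    \<open>T\<close>, costs \<open>e / 2\<close>; the other half of \<open>e\<close> is spent on the
    upper limit.\<close>
  define \<delta> where "\<delta> = e / (2 * (T * (\<epsilon> * C\<^sup>2 + 1 + C\<^sup>2)))"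
  have K: "0 < \<epsilon> * C\<^sup>2 + 1 + C\<^sup>2" using \<epsilon> by (intro add_pos_nonneg add_nonneg_pos) auto
  have \<delta>: "0 < \<delta>" using e T K by (simp add: \<delta>_def)
  have unif: "\<exists>\<mu>>0. \<forall>s\<in>{-T..0}. \<forall>t\<in>{-T..0}. \<forall>x\<in>{0..1}. \<bar>s - t\<bar> < \<mu> \<longrightarrow> \<bar>\<Phi> s x - \<Phi> t x\<bar> \<le> \<delta>"
    if "continuous_on Q (\<lambda>z. \<Phi> (fst z) (snd z))" for \<Phi> :: "real \<Rightarrow> real \<Rightarrow> real"
  proof -
    have "uniformly_continuous_on Q (\<lambda>z. \<Phi> (fst z) (snd z))"
      by (rule compact_uniformly_continuous[OF that]) (auto simp: Q_def intro: compact_Times)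
    then obtain \<mu> where \<mu>: "0 < \<mu>" "\<forall>z\<in>Q. \<forall>z'\<in>Q. dist z' z < \<mu> \<longrightarrow> dist (\<Phi> (fst z') (snd z')) (\<Phi> (fst z) (snd z)) < \<delta>"
      unfolding uniformly_continuous_on_def using \<delta> by blast
    have "\<bar>\<Phi> s x - \<Phi> t x\<bar> \<le> \<delta>" if "s \<in> {-T..0}" "t \<in> {-T..0}" "x \<in> {0..1}" "\<bar>s - t\<bar> < \<mu>" for s t x
    proof -
      have "(s, x) \<in> Q" "(t, x) \<in> Q" "dist (s, x) (t, x) < \<mu>"
        using that by (auto simp: Q_def dist_Pair_Pair dist_real_def)
      then have "dist (\<Phi> s x) (\<Phi> t x) < \<delta>" using \<mu>(2) by fastforce
      then show ?thesis by (simp add: dist_real_def)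
    qed
    then show ?thesis using \<mu>(1) by blast
  qed
  obtain \<mu>1 where \<mu>1: "0 < \<mu>1" "\<And>s t x. s \<in> {-T..0} \<Longrightarrow> t \<in> {-T..0} \<Longrightarrow> x \<in> {0..1} \<Longrightarrow> \<bar>s - t\<bar> < \<mu>1 \<Longrightarrow> \<bar>F s x - F t x\<bar> \<le> \<delta>"
  proof -
    have "continuous_on Q (\<lambda>z. F (fst z) (snd z))" unfolding F_def by (intro continuous_intros Dc)
    from unif[OF this] show thesis using that by blast
  qed
  obtain \<mu>2 where \<mu>2: "0 < \<mu>2" "\<And>s t x. s \<in> {-T..0} \<Longrightarrow> t \<in> {-T..0} \<Longrightarrow> x \<in> {0..1} \<Longrightarrow> \<bar>s - t\<bar> < \<mu>2 \<Longrightarrow> \<bar>G s x - G t x\<bar> \<le> \<delta>"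
  proof -
    have "continuous_on Q (\<lambda>z. G (fst z) (snd z))" unfolding G_def by (intro continuous_intros Dc)
    from unif[OF this] show thesis using that by blast
  qed
  define S where "S = (\<lambda>P. \<Sum>k=1..num_cells P. U (v (- (P ! (k - 1)))) - U (v (- (P ! k)))
             - (LINT t|lebesgue_on {- (P ! k)..- (P ! (k - 1))}. inner1 (h P k) (dt T v t)))"
  have "\<forall>\<^sub>F P in mesh_to_0 T. ereal (S P) < ereal (e / 2)"
  proof -
    have "0 < ereal (e / 2)" using e by simp
    then show ?thesis using ls unfolding Limsup_le_iff S_def by blast
  qed
  then have "\<forall>\<^sub>F P in mesh_to_0 T. S P < e / 2" by simp
  from frequently_uniform_partition[OF T this, of "min \<mu>1 \<mu>2"] \<mu>1(1) \<mu>2(1)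
  obtain n :: nat where n: "0 < n" "T / n < min \<mu>1 \<mu>2" and P: "map (\<lambda>i. T * real i / real n) [0..<Suc n] \<in> partitions T"
    and SP: "S (map (\<lambda>i. T * real i / real n) [0..<Suc n]) < e / 2" by auto
  define P where "P = map (\<lambda>i. T * real i / real n) [0..<Suc n]"
  have nth: "P ! i = T * real i / real n" if "i \<le> n" for i
    using that unfolding P_def by (simp add: nth_append less_Suc_eq_le del: upt_Suc)
  have nc: "num_cells P = n" by (simp add: num_cells_def P_def)
  have dtD: "dt T v t x = D 1 0 t x" if "t \<in> {-T..0}" "x \<in> {0..1}" for t x
    by (rule rect_derivs_dt[OF rd T that])
  have ham: "Ham \<epsilon> (v s) g = \<epsilon> * inner1 (weak_deriv g) (\<lambda>x. F s x * weak_deriv g x) - inner1 (G s) (weak_deriv g)"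
    if "s \<in> {-T..0}" for s g
  proof -
    have "deriv01 (v s) x = D 0 1 s x" if "x \<in> {0..1}" for x
      using rect_derivs_dx[OF rd \<open>s \<in> {-T..0}\<close> that] by (simp add: dx_def)
    then show ?thesis
      unfolding Ham_def mobility_eq_flux F_def G_def
      by (intro arg_cong2[where f="(-)"] arg_cong2[where f="(*)"] inner1_cong refl) (use vD that in auto)
  qed
  have lgc: "continuous_on {a..b} lg" if "-T \<le> a" "b \<le> 0" for a b
    unfolding lg_def by (rule continuous_on_subset[OF \<Lambda>c]) (use that in auto)
  have lgi: "integrable (lebesgue_on {a..b}) lg" if "-T \<le> a" "b \<le> 0" for a b
    by (rule continuous_imp_integrable_real[OF lgc[OF that]])
  \<comment> \<open>The primitive of the Lagrangian turns its integrals over cells into increments,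
    which telescope together with those of \<open>U\<close>.\<close>
  define \<Gamma> where "\<Gamma> = (\<lambda>t. integral {-T..t} lg)"
  have cell: "(LINT t|lebesgue_on {- (P ! k)..- (P ! (k - 1))}. inner1 (h P k) (dt T v t))
      \<le> \<Gamma> (- (P ! (k - 1))) - \<Gamma> (- (P ! k)) + e / (2 * n)" if k: "k \<in> {1..n}" for k
  proof -
    define a b where "a = - (P ! k)" and "b = - (P ! (k - 1))"
    have ab: "a = - (T * real k / real n)" "b = - (T * real (k - 1) / real n)"
      using k nth by (auto simp: a_def b_def)
    have kn: "real k / n \<le> 1" using k n(1) by (simp add: field_simps)
    have aT: "-T \<le> a" using mult_left_mono[OF kn, of T] T by (simp add: ab)
    have b0: "b \<le> 0" using T n(1) by (simp add: ab)
    have len: "b - a = T / n" using k n(1) by (simp add: ab of_nat_diff field_simps)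
    have "0 < T / n" using T n(1) by simp
    then have alb: "a \<le> b" using len by linarith
    have sub: "{a..b} \<subseteq> {-T..0}" using aT b0 by auto
    have aI: "a \<in> {-T..0}" using aT alb b0 by auto
    have hk: "h P k \<in> H10" "H10_norm (h P k) \<le> C" "Ham \<epsilon> (v a) (h P k) \<le> 0"
      using h[of P k] P k nc unfolding P_def[symmetric] a_def by auto
    have pw: "inner1 (h P k) (dt T v t) \<le> lg t + \<delta> * (\<epsilon> * C\<^sup>2 + 1 + C\<^sup>2)" if t: "t \<in> {a..b}" for t
    proof -
      have tI: "t \<in> {-T..0}" using t sub by blast
      have fpos: "0 < F t x" if "x \<in> {0..1}" for x
        using range[OF tI that] vD[OF tI that] by (simp add: F_def flux_def)
      let ?g = "weak_deriv (h P k)"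
      have "inner1 (h P k) (D 1 0 t) - (\<epsilon> * inner1 ?g (\<lambda>x. F t x * ?g x) - inner1 (\<lambda>x. \<epsilon> * D 0 1 t x - F t x) ?g)
        \<le> (LINT x|lebesgue_on {0..1}. (\<epsilon> * D 0 1 t x - V t x - F t x - c)\<^sup>2 / (4 * \<epsilon> * F t x))" for c
        by (rule H10_completing_square[OF hk(1) \<epsilon> V[OF tI] Dt[OF tI] _ Fc[OF tI] fpos]) (auto intro!: continuous_intros Dt[OF tI])
      from this[of "\<kappa> t"] have 1: "inner1 (h P k) (D 1 0 t) - (\<epsilon> * inner1 ?g (\<lambda>x. F t x * ?g x) - inner1 (G t) ?g) \<le> lg t"
        unfolding lg_def \<Lambda>_def G_def F_def
        by (rule order_trans[OF _ eq_refl]) (rule integral_lebesgue_on_cong, simp add: vD[OF tI])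
      have st: "\<bar>t - a\<bar> < min \<mu>1 \<mu>2" using t len n(2) by auto
      have "\<epsilon> * inner1 ?g (\<lambda>x. F t x * ?g x) - inner1 (G t) ?g
          \<le> \<epsilon> * inner1 ?g (\<lambda>x. F a x * ?g x) - inner1 (G a) ?g + \<delta> * (\<epsilon> * C\<^sup>2 + 1 + C\<^sup>2)"
        by (rule H10_hamiltonian_perturbation[OF hk(1,2) \<epsilon> Fc[OF tI] Fc[OF aI] Gc[OF tI] Gc[OF aI]])
           (use \<mu>1(2)[OF tI aI] \<mu>2(2)[OF tI aI] st in auto)
      with 1 hk(3) ham[OF aI, of "h P k"]
      have "inner1 (h P k) (D 1 0 t) \<le> lg t + \<delta> * (\<epsilon> * C\<^sup>2 + 1 + C\<^sup>2)" by linarith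
      moreover have "inner1 (h P k) (dt T v t) = inner1 (h P k) (D 1 0 t)"
        by (rule inner1_cong) (use dtD[OF tI] in auto)
      ultimately show ?thesis by simp
    qed
    have ic: "continuous_on {-T..0} (\<lambda>t. inner1 (D 1 0 t) (h P k))"
      by (rule inner1_param_continuous) (use Dc[of 1 0] hk(1) in \<open>auto simp: Q_def case_prod_unfold H10_def\<close>)
    have ic': "continuous_on {a..b} (\<lambda>t. inner1 (h P k) (dt T v t))"
    proof (rule continuous_on_eq[OF continuous_on_subset[OF ic sub]])
      fix t assume "t \<in> {a..b}"
      then have tI: "t \<in> {-T..0}" using sub by blast
      show "inner1 (D 1 0 t) (h P k) = inner1 (h P k) (dt T v t)"
        unfolding inner1_commute[of "D 1 0 t"] by (rule inner1_cong) (use dtD[OF tI] in auto)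
    qed
    have "(LINT t|lebesgue_on {a..b}. inner1 (h P k) (dt T v t)) \<le> (LINT t|lebesgue_on {a..b}. lg t + \<delta> * (\<epsilon> * C\<^sup>2 + 1 + C\<^sup>2))"
      by (rule integral_lebesgue_on_mono[OF _ _ pw])
         (intro continuous_imp_integrable_real ic' continuous_intros lgc[OF aT b0])+
    also have "\<dots> = (LINT t|lebesgue_on {a..b}. lg t) + (LINT t|lebesgue_on {a..b}. \<delta> * (\<epsilon> * C\<^sup>2 + 1 + C\<^sup>2))"
      by (rule Bochner_Integration.integral_add) (intro lgi aT b0 continuous_imp_integrable_real continuous_intros)+
    also have "(LINT t|lebesgue_on {a..b}. \<delta> * (\<epsilon> * C\<^sup>2 + 1 + C\<^sup>2)) = e / (2 * n)"
    proof -
      have "(LINT t|lebesgue_on {a..b}. \<delta> * (\<epsilon> * C\<^sup>2 + 1 + C\<^sup>2)) = \<delta> * (\<epsilon> * C\<^sup>2 + 1 + C\<^sup>2) * (T / n)"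
        unfolding integral_lebesgue_on_const[OF alb] len ..
      also have "\<dots> = e / (2 * n)"
      proof -
        have "e / (2 * (T * y)) * y * (T / n) = e / (2 * n)" if "0 < y" for y
          using T that by simp
        from this[OF K] show ?thesis unfolding \<delta>_def .
      qed
      finally show ?thesis .
    qed
    also have "(LINT t|lebesgue_on {a..b}. lg t) = \<Gamma> b - \<Gamma> a"
    proof -
      have "integral {-T..a} lg + integral {a..b} lg = integral {-T..b} lg"
        by (rule Henstock_Kurzweil_Integration.integral_combine[OF aT alb])
           (intro integrable_continuous_real lgc; use b0 in simp)
      then show ?thesis unfolding \<Gamma>_def integral_lebesgue_on_cont[OF lgc[OF aT b0]] by simp
    qed
    finally show ?thesis unfolding a_def b_def .
  qed
  have tele: "(\<Sum>k=1..n. g (k - 1) - g k) = g 0 - g n" for g :: "nat \<Rightarrow> real"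
    by (induction n) (auto)
  have P0: "P ! 0 = 0" "P ! n = T" using nth n(1) by auto
  have "(\<Sum>k=1..n. (U (v (- (P ! (k - 1)))) - U (v (- (P ! k)))) - (\<Gamma> (- (P ! (k - 1))) - \<Gamma> (- (P ! k))) - e / (2 * n)) \<le> S P"
    unfolding S_def nc by (rule sum_mono) (use cell in fastforce)
  moreover have "(\<Sum>k=1..n. (U (v (- (P ! (k - 1)))) - U (v (- (P ! k)))) - (\<Gamma> (- (P ! (k - 1))) - \<Gamma> (- (P ! k))) - e / (2 * n))
      = (U (v 0) - U (v (-T))) - (\<Gamma> 0 - \<Gamma> (-T)) - e / 2"
    unfolding sum_subtractf[of _ "\<lambda>_. e / (2 * n)"] sum_subtractf[of "\<lambda>k. U (v (- (P ! (k - 1)))) - U (v (- (P ! k)))"]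
      tele[of "\<lambda>k. U (v (- (P ! k)))"] tele[of "\<lambda>k. \<Gamma> (- (P ! k))"] P0 using n(1) by simp
  moreover have "\<Gamma> (-T) = 0" by (simp add: \<Gamma>_def)
  moreover have "\<Gamma> 0 = (LINT t|lebesgue_on {-T..0}. lg t)" unfolding \<Gamma>_def by (rule integral_lebesgue_on_cont[symmetric], rule lgc) auto
  ultimately have "U (v 0) - U (v (-T)) \<le> (LINT t|lebesgue_on {-T..0}. lg t) + e"
    using SP unfolding P_def[symmetric] by linarith
  then show "U (v 0) - U (v (-T))
    \<le> (LINT t|lebesgue_on {-T..0}. \<Lambda> (\<lambda>x. \<epsilon> * D 0 1 t x - V t x - flux (v t x)) (\<lambda>x. flux (v t x)) (\<kappa> t)) + e"
    unfolding lg_def .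
qed

section \<open>Passage to the limit\<close>

context finite_action_path
begin

text \<open>For fixed \<open>\<tau>\<close> and \<open>lam\<close> and all large \<open>N\<close>,
  the polynomial path lies in \<open>smooth_paths\<close>, starts at \<open>\<rho>b\<close>, and its
  action exceeds that of \<open>va\<close> by at most \<open>\<zeta>\<close>. Its final value
  \<open>v\<close> is remembered only through its distance to \<open>va\<close> at time
  \<open>0\<close>, which suffices for the weak limit.\<close>

lemma approx_step:
  assumes \<tau>: "0 < \<tau>" and lam: "0 < lam" "lam < 1" and \<zeta>: "0 < \<zeta>" "\<zeta> < 1"
    and hyp: "\<And>v. v \<in> smooth_paths \<rho>\<^sub>0 \<rho>\<^sub>1 T \<Longrightarrow>
      \<exists>(h :: real list \<Rightarrow> nat \<Rightarrow> real \<Rightarrow> real) C.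
        (\<forall>P\<in>partitions T. \<forall>k\<in>{1..num_cells P}.
            h P k \<in> H10 \<and> H10_norm (h P k) \<le> C \<and> Ham \<epsilon> (v (- (P ! k))) (h P k) \<le> 0) \<and>
        Limsup (mesh_to_0 T)
          (\<lambda>P. ereal (\<Sum>k=1..num_cells P.
             U (v (- (P ! (k - 1)))) - U (v (- (P ! k)))
             - (LINT t|lebesgue_on {- (P ! k)..- (P ! (k - 1))}. inner1 (h P k) (dt T v t)))) \<le> 0"
  shows "\<forall>\<^sub>F N in sequentially.
    (\<forall>t\<in>{-T..0}. \<forall>x\<in>{0..1}. 0 \<le> va N \<tau> lam t x \<and> va N \<tau> lam t x \<le> 1 \<and> \<bar>vN N \<tau> lam t x - va N \<tau> lam t x\<bar> \<le> \<zeta>) \<and>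
    (\<exists>v\<in>M_space. continuous_on {0..1} v \<and> (\<forall>x\<in>{0..1}. \<bar>v x - va N \<tau> lam 0 x\<bar> \<le> \<zeta>) \<and>
      (1 - \<zeta>) * (U v - U \<rho>b - \<zeta>) \<le> I + \<zeta> + (LINT t|Lt. LINT x|Lx. ep N \<tau> lam t x) / (4 * \<epsilon>))"
  using main_eventually[OF \<tau> lam \<zeta>(1)]
proof eventually_elim
  case (elim N)
  let ?W = "WW N (gam N \<tau> lam) (gam' N \<tau> lam)" and ?f = "\<lambda>t x. flux (va N \<tau> lam t x)"
  let ?k = "\<lambda>t. cst (?W t) (?f t)"
  have d: "0 < lam * m0 / 2" using lam m0 by simp
  have range: "lam * m0 / 2 \<le> va N \<tau> lam t x \<and> va N \<tau> lam t x \<le> 1 - lam * m0 / 2" if "t \<in> {-T..0}" "x \<in> {0..1}" for t x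
    using elim that by blast
  have kc: "continuous_on {-T..0} ?k" using elim by blast
  obtain p where p0: "\<And>n. n \<in> {1..<N} \<Longrightarrow> poly (p n) (-T) = 0"
    and p1: "\<And>t x. t \<in> {-T..0} \<Longrightarrow> x \<in> {0..1} \<Longrightarrow> \<bar>vv N (\<lambda>n. poly (p n)) t x - va N \<tau> lam t x\<bar> \<le> \<zeta>"
    and p2: "\<And>t x. t \<in> {-T..0} \<Longrightarrow> x \<in> {0..1} \<Longrightarrow> 0 < vv N (\<lambda>n. poly (p n)) t x \<and> vv N (\<lambda>n. poly (p n)) t x < 1"
    and p3: "continuous_on {-T..0} (\<lambda>t. lag (WW N (\<lambda>n. poly (p n)) (\<lambda>n. poly (pderiv (p n))) t) (\<lambda>x. flux (vv N (\<lambda>n. poly (p n)) t x)) (?k t))"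
    and p4: "(LINT t|Lt. lag (WW N (\<lambda>n. poly (p n)) (\<lambda>n. poly (pderiv (p n))) t) (\<lambda>x. flux (vv N (\<lambda>n. poly (p n)) t x)) (?k t))
      \<le> (LINT t|Lt. lag (?W t) (?f t) (?k t)) + \<zeta>"
  proof -
    show thesis by (rule poly_stage[OF \<tau> d range kc \<zeta>(1)]) (assumption, assumption, fact that)
  qed
  let ?v = "vv N (\<lambda>n. poly (p n))" and ?V = "VV N (\<lambda>n. poly (pderiv (p n)))"
  let ?D = "sep Dr N p"
  have veq: "?v = ?D 0 0" by (simp add: vv_def sep_def Dr0 fun_eq_iff)
  have rd: "rect_derivs T ?v ?D" unfolding veq by (rule rect_derivs_sep) (rule Dr)
  have vs: "?v \<in> smooth_paths \<rho>\<^sub>0 \<rho>\<^sub>1 T"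
    unfolding smooth_paths_def smooth_rect_rect_derivs
    using rd p2 \<rho>b_ends by (auto simp: vv_def)
  from hyp[OF vs] obtain h C where
    h: "\<And>P k. P \<in> partitions T \<Longrightarrow> k \<in> {1..num_cells P} \<Longrightarrow>
      h P k \<in> H10 \<and> H10_norm (h P k) \<le> C \<and> Ham \<epsilon> (?v (- (P ! k))) (h P k) \<le> 0"
    and ls: "Limsup (mesh_to_0 T)
          (\<lambda>P. ereal (\<Sum>k=1..num_cells P.
             U (?v (- (P ! (k - 1)))) - U (?v (- (P ! k)))
             - (LINT t|lebesgue_on {- (P ! k)..- (P ! (k - 1))}. inner1 (h P k) (dt T ?v t)))) \<le> 0"
    by blast
  have Weq: "(\<lambda>x. \<epsilon> * ?D 0 1 t x - ?V t x - flux (?v t x)) = WW N (\<lambda>n. poly (p n)) (\<lambda>n. poly (pderiv (p n))) t" for t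
    by (simp add: WW_def sep_def w_def fun_eq_iff)
  then have Weq': "\<epsilon> * ?D 0 1 t x - ?V t x - flux (?v t x) = WW N (\<lambda>n. poly (p n)) (\<lambda>n. poly (pderiv (p n))) t x" for t x
    by (simp only: fun_eq_iff)
  have Vd: "(?V t has_real_derivative ?D 1 0 t x) (at x within {0..1})" for t x
  proof -
    have "((\<lambda>x. poly (pderiv (p n)) t * ((1 - cosn n x) / w n)) has_real_derivative poly (pderiv (p n)) t * sinn n x) (at x within {0..1})"
      if n: "n \<in> {1..<N}" for n
      using n unfolding w_def cosn_def sinn_def by (auto intro!: derivative_eq_intros)
    then show ?thesis unfolding VV_def[abs_def] sep_def by (auto intro!: DERIV_sum)
  qed
  have "U (?v 0) - U (?v (-T)) \<le> (LINT t|Lt. lag (\<lambda>x. \<epsilon> * ?D 0 1 t x - ?V t x - flux (?v t x)) (\<lambda>x. flux (?v t x)) (?k t))"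
    unfolding lag_def
    by (rule entropy_le_action[OF T \<epsilon> rd p2 Vd _ h ls]) (use p3 in \<open>simp_all only: Weq' lag_def\<close>)
  also have "\<dots> \<le> (LINT t|Lt. lag (?W t) (?f t) (?k t)) + \<zeta>" unfolding Weq by (rule p4)
  finally have le: "U (?v 0) - U (?v (-T)) - \<zeta> \<le> (LINT t|Lt. lag (?W t) (?f t) (?k t))" by simp
  have vT: "?v (-T) = \<rho>b" using p0 by (simp add: vv_def fun_eq_iff)
  have "(1 - \<zeta>) * (U (?v 0) - U \<rho>b - \<zeta>) \<le> (1 - \<zeta>) * (LINT t|Lt. lag (?W t) (?f t) (?k t))"
    using le \<zeta> unfolding vT by (intro mult_left_mono) auto
  also have "\<dots> \<le> I + \<zeta> + (LINT t|Lt. LINT x|Lx. ep N \<tau> lam t x) / (4 * \<epsilon>)" using elim by blast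
  finally have main: "(1 - \<zeta>) * (U (?v 0) - U \<rho>b - \<zeta>) \<le> I + \<zeta> + (LINT t|Lt. LINT x|Lx. ep N \<tau> lam t x) / (4 * \<epsilon>)" .
  have vc: "continuous_on {0..1} (?v 0)"
    unfolding vv_def by (intro continuous_intros \<rho>b_cont continuous_on_sinn)
  then have "?v 0 \<in> borel_measurable Lx" by (rule continuous_imp_measurable_on_sets_lebesgue) simp
  then have "?v 0 \<in> M_space"
    unfolding M_space_def using p2[of 0] T by (auto intro!: AE_lebesgue_onI simp: less_imp_le)
  moreover have "\<forall>x\<in>{0..1}. \<bar>?v 0 x - va N \<tau> lam 0 x\<bar> \<le> \<zeta>" using p1[of 0] T by auto
  moreover have "0 \<le> va N \<tau> lam t x \<and> va N \<tau> lam t x \<le> 1" if "t \<in> {-T..0}" "x \<in> {0..1}" for t x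
    using range[OF that] d by linarith
  moreover have "\<forall>t\<in>{-T..0}. \<forall>x\<in>{0..1}. \<bar>vN N \<tau> lam t x - va N \<tau> lam t x\<bar> \<le> \<zeta>" using elim by blast
  ultimately show ?case using main vc by blast
qed

text \<open>The kernel \<open>kerD\<close> is symmetric, so the Dirichlet mean may be moved from the
  path to \<open>\<phi>\<close>.\<close>

lemma va_pairing:
  assumes \<tau>: "0 < \<tau>" and t: "t \<in> {-T..0}" and \<phi>: "integrable Lx \<phi>"
  shows "inner1 (va N \<tau> lam t) \<phi> = inner1 \<rho>b \<phi> + (1 - lam) * avg T \<tau> (pr (\<lambda>y. inner1 \<phi> (kerD N y))) t"
proof -
  have "va N \<tau> lam t = (\<lambda>x. \<rho>b x + (\<Sum>n\<in>{1..<N}. gam N \<tau> lam n t * sinn n x))"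
    by (simp add: vv_def fun_eq_iff)
  then have "inner1 (va N \<tau> lam t) \<phi> = inner1 \<phi> (\<lambda>x. \<rho>b x + (\<Sum>n\<in>{1..<N}. gam N \<tau> lam n t * sinn n x))"
    by (simp only: inner1_commute[of _ \<phi>])
  also have "\<dots> = inner1 \<phi> \<rho>b + inner1 \<phi> (\<lambda>x. \<Sum>n\<in>{1..<N}. gam N \<tau> lam n t * sinn n x)"
    by (intro inner1_add_right \<phi> \<rho>b_cont continuous_intros continuous_on_sinn)
  also have "inner1 \<phi> (\<lambda>x. \<Sum>n\<in>{1..<N}. gam N \<tau> lam n t * sinn n x) = (\<Sum>n\<in>{1..<N}. gam N \<tau> lam n t * inner1 \<phi> (sinn n))"
    by (rule inner1_sum[OF \<phi>]) (rule continuous_on_sinn)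
  also have "\<dots> = (1 - lam) * avg T \<tau> (pr (\<lambda>y. inner1 \<phi> (kerD N y))) t"
    unfolding avg_pr_kerD[OF \<phi> \<tau> t] by (simp add: gam_def sum_distrib_left mult_ac)
  finally show ?thesis by (simp only: inner1_commute[of \<phi> \<rho>b])
qed

text \<open>With the Dirichlet mean on \<open>\<phi>\<close>, its L1 convergence settles the space
  part uniformly in \<open>\<tau>\<close>, and the time part is \<open>avg_uniform_limit\<close> for
  the fixed continuous function \<open>pr \<phi>\<close>. The rates of \<open>N\<close>,
  \<open>\<tau>\<close> and \<open>lam\<close> are thus independent of each other.\<close>

lemma va_weak_limit:
  assumes \<tau>: "\<And>j. 0 < \<tau> j" "\<tau> \<longlonglongrightarrow> 0" and lam: "lam \<longlonglongrightarrow> 0" and N: "filterlim N at_top sequentially"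
    and t: "t \<in> {-T..0}" and \<phi>: "integrable Lx \<phi>"
  shows "(\<lambda>j. inner1 (va (N j) (\<tau> j) (lam j) t) \<phi>) \<longlonglongrightarrow> inner1 (u t) \<phi>"
proof -
  have "filterlim \<tau> (at_right 0) sequentially"
  proof -
    have "\<tau> j \<in> {0<..} \<and> \<tau> j \<noteq> 0" for j using \<tau>(1)[of j] by simp
    then show ?thesis using \<tau>(2) by (simp add: filterlim_at)
  qed
  then have a: "(\<lambda>j. avg T (\<tau> j) (pr \<phi>) t) \<longlonglongrightarrow> pr \<phi> t"
  proof (rule filterlim_compose[rotated])
    show "((\<lambda>\<tau>. avg T \<tau> (pr \<phi>) t) \<longlongrightarrow> pr \<phi> t) (at_right 0)"
    proof (rule tendstoI)
      fix e :: real assume e: "0 < e"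
      have "\<forall>\<^sub>F \<tau> in at_right 0. \<forall>t\<in>{-T..0}. \<bar>avg T \<tau> (pr \<phi>) t - pr \<phi> t\<bar> \<le> e / 2"
        by (rule avg_uniform_limit[OF T pr_cont[OF \<phi>] pr_init[OF \<phi>]]) (use e in simp)
      then show "\<forall>\<^sub>F \<tau> in at_right 0. dist (avg T \<tau> (pr \<phi>) t) (pr \<phi> t) < e"
        by eventually_elim (use t e in \<open>force simp: dist_real_def\<close>)
    qed
  qed
  have "(\<lambda>j. LINT x|Lx. \<bar>inner1 \<phi> (kerD (N j) x) - \<phi> x\<bar>) \<longlonglongrightarrow> 0"
    by (rule filterlim_compose[OF kerD_L1_tendsto[OF \<phi>] N])
  then have "(\<lambda>j. avg T (\<tau> j) (pr (\<lambda>y. inner1 \<phi> (kerD (N j) y))) t - avg T (\<tau> j) (pr \<phi>) t) \<longlonglongrightarrow> 0"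
    by (rule Lim_null_comparison[rotated]) (auto intro!: always_eventually avg_pr_kerD_tendsto[OF \<phi> \<tau>(1) t])
  from tendsto_add[OF this a]
  have "(\<lambda>j. avg T (\<tau> j) (pr (\<lambda>y. inner1 \<phi> (kerD (N j) y))) t) \<longlonglongrightarrow> pr \<phi> t" by simp
  then have "(\<lambda>j. inner1 \<rho>b \<phi> + (1 - lam j) * avg T (\<tau> j) (pr (\<lambda>y. inner1 \<phi> (kerD (N j) y))) t) \<longlonglongrightarrow> inner1 \<rho>b \<phi> + (1 - 0) * pr \<phi> t"
    by (intro tendsto_intros lam)
  then show ?thesis unfolding va_pairing[OF \<tau>(1) t \<phi>] by (simp add: pr_def)
qed

text \<open>Up to vanishing errors the integral of the defect is at most the flux integral of
  \<open>va\<close> minus that of \<open>u\<close>. The flux integral is upper semicontinuous for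
  the weak* topology, by the tangent at \<open>u t\<close>, and time averaging loses only a mass of
  order \<open>\<tau>\<close>.\<close>

lemma ep_limit:
  assumes \<tau>: "\<And>j. 0 < \<tau> j" "\<tau> \<longlonglongrightarrow> 0" and lam: "\<And>j. 0 < lam j \<and> lam j < 1" "lam \<longlonglongrightarrow> 0"
    and N: "filterlim N at_top sequentially" and \<zeta>: "\<zeta> \<longlonglongrightarrow> 0"
    and va: "\<And>j t x. t \<in> {-T..0} \<Longrightarrow> x \<in> {0..1} \<Longrightarrow> 0 \<le> va (N j) (\<tau> j) (lam j) t x \<and> va (N j) (\<tau> j) (lam j) t x \<le> 1
      \<and> \<bar>vN (N j) (\<tau> j) (lam j) t x - va (N j) (\<tau> j) (lam j) t x\<bar> \<le> \<zeta> j"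
  obtains E where "E \<longlonglongrightarrow> 0" "\<And>j. (LINT t|Lt. LINT x|Lx. ep (N j) (\<tau> j) (lam j) t x) \<le> E j"
proof -
  let ?va = "\<lambda>j. va (N j) (\<tau> j) (lam j)" and ?vN = "\<lambda>j. vN (N j) (\<tau> j) (lam j)"
  let ?q1 = "q (\<lambda>_. 1)"
  define g where "g = (\<lambda>j t. LINT x|Lx. flux (?va j t x))"
  have q1: "integrable Lt ?q1" by (rule q_int) auto
  have q1_eq: "?q1 t = (LINT x|Lx. flux (u t x))" for t by (simp add: q_def inner1_def)
  have q1_le: "?q1 t \<le> 1" if "t \<in> {-T..0}" for t using q_bounds[OF that, of "\<lambda>_. 1" 1] by auto
  have q1_ge: "0 \<le> ?q1 t" if "t \<in> {-T..0}" for t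
    unfolding q1_eq by (rule Bochner_Integration.integral_nonneg_AE) (use M_space_flux_bounds[OF u_M[OF that]] in eventually_elim, simp)
  have vaj: "jcont (?va j)" and vNj: "jcont (?vN j)" for j by (rule jcont_intros[OF \<tau>(1)])+
  have vai: "integrable Lx (?va j t)" "integrable Lx (\<lambda>x. flux (?va j t x))" if "t \<in> {-T..0}" for j t
    by (intro continuous_imp_integrable_real continuous_on_flux jcont_slice[OF vaj that])+
  have gc: "continuous_on {-T..0} (g j)" for j
    unfolding g_def by (rule jcont_integral) (intro continuous_on_flux vaj)
  have g_le: "g j t \<le> 1" if "t \<in> {-T..0}" for j t
  proof -
    have "flux (?va j t x) \<le> 1" for x using flux_le_quarter[of "?va j t x"] by simp
    then show ?thesis using integral_lebesgue_on_le_const[OF vai(2)[OF that, of j], of 1] by (simp add: g_def)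
  qed
  \<comment> \<open>Only the upper limit of \<open>g j t\<close> is controlled. Taking the maximum
    with the target value turns this into convergence, so that dominated convergence
    applies.\<close>
  have lim: "(\<lambda>j. max (g j t) (?q1 t)) \<longlonglongrightarrow> ?q1 t" if t: "t \<in> {-T..0}" for t
  proof -
    define c where "c = (LINT x|Lx. u t x - flux (u t x))"
    have ui: "integrable Lx (u t)" "integrable Lx (\<lambda>x. flux (u t x))" by (rule u_int[OF t] u_flux_int[OF t])+
    have um: "u t \<in> borel_measurable Lx" "AE x in Lx. \<bar>u t x\<bar> \<le> 1"
      using u_M[OF t] unfolding M_space_def by (auto elim: eventually_mono)
    have \<phi>: "integrable Lx (\<lambda>x. 1 - 2 * u t x)" using ui continuous_imp_integrable_real[of 0 1 "\<lambda>_. 1 :: real"] by simp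
    have \<phi>m: "(\<lambda>x. 1 - 2 * u t x) \<in> borel_measurable Lx" "AE x in Lx. \<bar>1 - 2 * u t x\<bar> \<le> 3"
      using um by (auto elim: eventually_mono)
    have "g j t \<le> inner1 (?va j t) (\<lambda>x. 1 - 2 * u t x) + c" for j
    proof -
      have i: "integrable Lx (\<lambda>x. ?va j t x * (1 - 2 * u t x))" by (rule integrable_mult_bounded[OF vai(1)[OF t] \<phi>m])
      have "g j t \<le> (LINT x|Lx. ?va j t x * (1 - 2 * u t x) + (u t x - flux (u t x)))"
        unfolding g_def
      proof (rule integral_lebesgue_on_mono[OF vai(2)[OF t]])
        show "integrable Lx (\<lambda>x. ?va j t x * (1 - 2 * u t x) + (u t x - flux (u t x)))" using i ui by simp
        show "flux (?va j t x) \<le> ?va j t x * (1 - 2 * u t x) + (u t x - flux (u t x))" for x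
          using flux_le_tangent[of "?va j t x" "u t x"] by (simp add: flux_def power2_eq_square algebra_simps)
      qed
      also have "\<dots> = inner1 (?va j t) (\<lambda>x. 1 - 2 * u t x) + c"
        unfolding inner1_def c_def using i ui by (intro Bochner_Integration.integral_add) auto
      finally show ?thesis .
    qed
    then have up: "max (g j t) (?q1 t) \<le> max (inner1 (?va j t) (\<lambda>x. 1 - 2 * u t x) + c) (?q1 t)" for j
      by (intro max.mono) auto
    have "inner1 (u t) (\<lambda>x. 1 - 2 * u t x) + c = ?q1 t"
    proof -
      have "integrable Lx (\<lambda>x. u t x * (1 - 2 * u t x))" by (rule integrable_mult_bounded[OF ui(1) \<phi>m])
      then have "inner1 (u t) (\<lambda>x. 1 - 2 * u t x) + c = (LINT x|Lx. u t x * (1 - 2 * u t x) + (u t x - flux (u t x)))"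
        unfolding inner1_def c_def using ui by simp
      also have "\<dots> = ?q1 t" unfolding q1_eq by (rule Bochner_Integration.integral_cong) (auto simp: flux_def algebra_simps)
      finally show ?thesis .
    qed
    with tendsto_add[OF va_weak_limit[OF \<tau> lam(2) N t \<phi>] tendsto_const[of c]]
    have "(\<lambda>j. inner1 (?va j t) (\<lambda>x. 1 - 2 * u t x) + c) \<longlonglongrightarrow> ?q1 t" by simp
    from tendsto_max[OF this tendsto_const[of "?q1 t"]]
    have "(\<lambda>j. max (inner1 (?va j t) (\<lambda>x. 1 - 2 * u t x) + c) (?q1 t)) \<longlonglongrightarrow> ?q1 t" by simp
    then show ?thesis
      by (rule tendsto_sandwich[OF _ _ tendsto_const[of "?q1 t"], rotated 2]) (use up in \<open>auto intro!: always_eventually\<close>)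
  qed
  have mi: "integrable Lt (\<lambda>t. max (g j t) (?q1 t))" for j
    by (rule Bochner_Integration.integrable_max[OF continuous_imp_integrable_real[OF gc] q1])
  have "(\<lambda>j. LINT t|Lt. max (g j t) (?q1 t)) \<longlonglongrightarrow> (LINT t|Lt. ?q1 t)"
  proof (rule integral_dominated_convergence[where w="\<lambda>_. 1"])
    show "integrable Lt (\<lambda>_. 1 :: real)" by (intro continuous_imp_integrable_real continuous_intros)
    show "AE t in Lt. (\<lambda>j. max (g j t) (?q1 t)) \<longlonglongrightarrow> ?q1 t" by (rule AE_lebesgue_onI, rule lim)
    show "AE t in Lt. norm (max (g j t) (?q1 t)) \<le> 1" for j
    proof (rule AE_lebesgue_onI)
      fix t assume "t \<in> {-T..0}"
      from g_le[OF this, of j] q1_le[OF this] q1_ge[OF this] show "norm (max (g j t) (?q1 t)) \<le> 1" by simp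
    qed
  qed (use q1 mi in auto)
  then have Elim: "(\<lambda>j. (LINT t|Lt. max (g j t) (?q1 t)) + \<zeta> j * T - (1 - lam j) * ((LINT t|Lt. ?q1 t) - 1 * \<tau> j))
      \<longlonglongrightarrow> (LINT t|Lt. ?q1 t) + 0 * T - (1 - 0) * ((LINT t|Lt. ?q1 t) - 1 * 0)"
    by (intro tendsto_intros \<zeta> lam(2) \<tau>(2))
  show thesis
  proof (rule that)
    show "(\<lambda>j. (LINT t|Lt. max (g j t) (?q1 t)) + \<zeta> j * T - (1 - lam j) * ((LINT t|Lt. ?q1 t) - 1 * \<tau> j)) \<longlonglongrightarrow> 0"
      using Elim by simp
    fix j
    interpret ta: time_average T "\<tau> j" by unfold_locales (use T \<tau> in auto)
    have ai: "integrable Lt (avg T (\<tau> j) ?q1)" by (intro continuous_imp_integrable_real ta.avg_continuous q1)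
    have ci: "integrable Lt (\<lambda>_. \<zeta> j)" by (intro continuous_imp_integrable_real continuous_intros)
    have "(LINT t|Lt. LINT x|Lx. ep (N j) (\<tau> j) (lam j) t x) \<le> (LINT t|Lt. (max (g j t) (?q1 t) + \<zeta> j) - (1 - lam j) * avg T (\<tau> j) ?q1 t)"
    proof (rule integral_lebesgue_on_mono)
      show "integrable Lt (\<lambda>t. LINT x|Lx. ep (N j) (\<tau> j) (lam j) t x)"
        by (intro continuous_imp_integrable_real jcont_integral jcont_intros \<tau>)
      show "integrable Lt (\<lambda>t. (max (g j t) (?q1 t) + \<zeta> j) - (1 - lam j) * avg T (\<tau> j) ?q1 t)"
        by (intro Bochner_Integration.integrable_diff Bochner_Integration.integrable_add mi ci Bochner_Integration.integrable_mult_right ai)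
      fix t assume t: "t \<in> {-T..0}"
      have fi: "integrable Lx (\<lambda>x. flux (?vN j t x))" by (intro continuous_imp_integrable_real continuous_on_flux jcont_slice[OF vNj t])
      have zi: "integrable Lx (\<lambda>x. \<zeta> j)" by (intro continuous_imp_integrable_real continuous_intros)
      have "(LINT x|Lx. flux (?vN j t x)) \<le> (LINT x|Lx. flux (?va j t x) + \<zeta> j)"
      proof (rule integral_lebesgue_on_mono[OF fi])
        show "integrable Lx (\<lambda>x. flux (?va j t x) + \<zeta> j)" using vai(2)[OF t, of j] zi by simp
        fix x :: real assume x: "x \<in> {0..1}"
        have l: "0 < lam j" "lam j < 1" using lam by auto
        have "0 \<le> lam j * \<rho>\<^sub>0" "0 \<le> lam j * (1 - \<rho>\<^sub>1)" using l \<rho>01 by auto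
        then have "0 \<le> ?vN j t x" "?vN j t x \<le> 1"
          using vN_bounds[OF \<tau>(1) l t, of "N j" j x] by linarith+
        then show "flux (?vN j t x) \<le> flux (?va j t x) + \<zeta> j"
          using va[OF t x, of j] flux_lipschitz[of "?vN j t x" "?va j t x"] by linarith
      qed
      also have "\<dots> = g j t + \<zeta> j"
        using vai(2)[OF t, of j] zi integral_lebesgue_on_const[of 0 1 "\<zeta> j"] by (simp add: g_def del: lebesgue_integral_const)
      finally have 1: "(LINT x|Lx. flux (?vN j t x)) \<le> g j t + \<zeta> j" .
      have "0 \<le> (LINT x|Lx. flux (\<rho>b x))"
      proof (rule Bochner_Integration.integral_nonneg_AE, rule AE_lebesgue_onI)
        fix x :: real assume "x \<in> {0..1}"
        then show "0 \<le> flux (\<rho>b x)" using \<rho>b_range[of x] \<rho>01 by (auto simp: flux_def)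
      qed
      moreover have "0 \<le> Rw (\<tau> j) (lam j) t" using Rw_bounds(1)[OF \<tau>(1), of "lam j" t j] lam(1)[of j] t by linarith
      ultimately have "0 \<le> Rw (\<tau> j) (lam j) t * (LINT x|Lx. flux (\<rho>b x))" by simp
      then show "(LINT x|Lx. ep (N j) (\<tau> j) (lam j) t x) \<le> (max (g j t) (?q1 t) + \<zeta> j) - (1 - lam j) * avg T (\<tau> j) ?q1 t"
        unfolding ep_integral[OF \<tau>(1) t] using 1 by linarith
    qed
    also have "\<dots> = (LINT t|Lt. max (g j t) (?q1 t)) + (LINT t|Lt. \<zeta> j) - (1 - lam j) * (LINT t|Lt. avg T (\<tau> j) ?q1 t)"
      using mi ci ai by (simp del: lebesgue_integral_const)
    also have "(LINT t|Lt. \<zeta> j) = \<zeta> j * T" using integral_lebesgue_on_const[of "-T" 0 "\<zeta> j"] T by simp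
    also have "(LINT t|Lt. max (g j t) (?q1 t)) + \<zeta> j * T - (1 - lam j) * (LINT t|Lt. avg T (\<tau> j) ?q1 t)
      \<le> (LINT t|Lt. max (g j t) (?q1 t)) + \<zeta> j * T - (1 - lam j) * ((LINT t|Lt. ?q1 t) - 1 * \<tau> j)"
      using ta.integral_avg_ge[OF q1 q1_le] lam(1)[of j] by (intro diff_left_mono mult_left_mono) auto
    finally show "(LINT t|Lt. LINT x|Lx. ep (N j) (\<tau> j) (lam j) t x)
      \<le> (LINT t|Lt. max (g j t) (?q1 t)) + \<zeta> j * T - (1 - lam j) * ((LINT t|Lt. ?q1 t) - 1 * \<tau> j)" .
  qed
qed

text \<open>A diagonal sequence: one null sequence \<open>r\<close> serves as \<open>\<tau>\<close>,
  \<open>lam\<close> and \<open>\<zeta>\<close>, and \<open>N j\<close> is then chosen large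
  depending on \<open>r j\<close>, and at least \<open>j\<close>. The final values converge weak* to
  \<open>u 0\<close>, and lower semicontinuity carries the bound to the limit.\<close>

lemma entropy_le_path_action:
  assumes U: "lower_semicontinuous M_top U"
    and hyp: "\<And>v. v \<in> smooth_paths \<rho>\<^sub>0 \<rho>\<^sub>1 T \<Longrightarrow>
      \<exists>(h :: real list \<Rightarrow> nat \<Rightarrow> real \<Rightarrow> real) C.
        (\<forall>P\<in>partitions T. \<forall>k\<in>{1..num_cells P}.
            h P k \<in> H10 \<and> H10_norm (h P k) \<le> C \<and> Ham \<epsilon> (v (- (P ! k))) (h P k) \<le> 0) \<and>
        Limsup (mesh_to_0 T)
          (\<lambda>P. ereal (\<Sum>k=1..num_cells P.
             U (v (- (P ! (k - 1)))) - U (v (- (P ! k)))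
             - (LINT t|lebesgue_on {- (P ! k)..- (P ! (k - 1))}. inner1 (h P k) (dt T v t)))) \<le> 0"
  shows "U (u 0) - U \<rho>b \<le> I"
proof -
  \<comment> \<open>The shift by \<open>2\<close> keeps \<open>r j\<close> strictly below
    one.\<close>
  define r where "r = (\<lambda>j. 1 / (real j + 2))"
  have r: "0 < r j" "r j < 1" for j by (auto simp: r_def)
  have rlim: "r \<longlonglongrightarrow> 0"
    using LIMSEQ_ignore_initial_segment[OF lim_1_over_n[where 'a=real], of 2] by (simp add: r_def add.commute)
  define Q where "Q = (\<lambda>j N v. (\<forall>t\<in>{-T..0}. \<forall>x\<in>{0..1}. 0 \<le> va N (r j) (r j) t x \<and> va N (r j) (r j) t x \<le> 1
        \<and> \<bar>vN N (r j) (r j) t x - va N (r j) (r j) t x\<bar> \<le> r j) \<and>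
    v \<in> M_space \<and> continuous_on {0..1} v \<and> (\<forall>x\<in>{0..1}. \<bar>v x - va N (r j) (r j) 0 x\<bar> \<le> r j) \<and>
      (1 - r j) * (U v - U \<rho>b - r j) \<le> I + r j + (LINT t|Lt. LINT x|Lx. ep N (r j) (r j) t x) / (4 * \<epsilon>))"
  have "\<exists>N v. j \<le> N \<and> Q j N v" for j
  proof -
    have "\<forall>\<^sub>F N in sequentially. j \<le> N \<and> (\<exists>v. Q j N v)"
    proof -
      note st = approx_step[of "r j" "r j" "r j" U, OF r(1) r(1) r(2) r(1) r(2)]
      show ?thesis
        by (rule eventually_mono[OF eventually_conj[OF st eventually_ge_at_top[of j]]]) (erule hyp, auto simp: Q_def)
    qed
    then show ?thesis by (auto simp: eventually_sequentially)
  qed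
  then obtain N v where N: "\<And>j. j \<le> N j" and Q: "\<And>j. Q j (N j) (v j)" by metis
  have Nlim: "filterlim N at_top sequentially"
    by (rule filterlim_at_top_mono[OF filterlim_ident]) (use N in auto)
  have va: "0 \<le> va (N j) (r j) (r j) t x \<and> va (N j) (r j) (r j) t x \<le> 1
      \<and> \<bar>vN (N j) (r j) (r j) t x - va (N j) (r j) (r j) t x\<bar> \<le> r j" if "t \<in> {-T..0}" "x \<in> {0..1}" for j t x
    using Q[of j] that unfolding Q_def by blast
  have v: "v j \<in> M_space" "continuous_on {0..1} (v j)" for j using Q[of j] unfolding Q_def by blast+
  have vclose: "\<bar>v j x - va (N j) (r j) (r j) 0 x\<bar> \<le> r j" if "x \<in> {0..1}" for j x
    using Q[of j] that unfolding Q_def by blast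
  have main: "(1 - r j) * (U (v j) - U \<rho>b - r j) \<le> I + r j + (LINT t|Lt. LINT x|Lx. ep (N j) (r j) (r j) t x) / (4 * \<epsilon>)" for j
    using Q[of j] unfolding Q_def by blast
  have rr: "0 < r j \<and> r j < 1" for j using r[of j] by simp
  obtain E where E: "E \<longlonglongrightarrow> 0" "\<And>j. (LINT t|Lt. LINT x|Lx. ep (N j) (r j) (r j) t x) \<le> E j"
  proof -
    show thesis by (rule ep_limit[OF r(1) rlim rr rlim Nlim rlim va]) (assumption, assumption, fact that)
  qed
  have 0: "0 \<in> {-T..0}" using T by simp
  have lim: "limitin M_top v (u 0) sequentially"
  proof (rule limitin_M_top[OF u_M[OF 0] v(1)])
    fix \<phi> assume "\<phi> \<in> L1_space"
    then have \<phi>: "integrable Lx \<phi>" by (simp add: L1_space_def)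
    let ?a = "\<lambda>j. va (N j) (r j) (r j) 0"
    have nb: "norm (inner1 (v j) \<phi> - inner1 (?a j) \<phi>) \<le> r j * (LINT x|Lx. \<bar>\<phi> x\<bar>)" for j
    proof -
      have ac: "continuous_on {0..1} (?a j)" by (rule jcont_slice[OF jcont_intros(1)[OF r(1)] 0])
      have "inner1 (v j) \<phi> - inner1 (?a j) \<phi> = (LINT x|Lx. \<phi> x * (v j x - ?a j x))"
        using inner1_diff_right[OF \<phi> v(2) ac] by (simp add: inner1_def mult.commute)
      moreover have "\<bar>LINT x|Lx. \<phi> x * (v j x - ?a j x)\<bar> \<le> r j * (LINT x|Lx. \<bar>\<phi> x\<bar>)"
      proof (rule abs_integral_le_bound[OF \<phi>])
        show "(\<lambda>x. v j x - ?a j x) \<in> borel_measurable Lx"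
          by (rule borel_measurable_integrable) (intro continuous_imp_integrable_real continuous_on_diff v(2) ac)
        show "AE x in Lx. \<bar>v j x - ?a j x\<bar> \<le> r j" by (rule AE_lebesgue_onI) (rule vclose)
      qed
      ultimately show ?thesis by simp
    qed
    have "(\<lambda>j. r j * (LINT x|Lx. \<bar>\<phi> x\<bar>)) \<longlonglongrightarrow> 0" by (rule tendsto_mult_left_zero[OF rlim])
    then have "(\<lambda>j. inner1 (v j) \<phi> - inner1 (?a j) \<phi>) \<longlonglongrightarrow> 0"
      by (rule Lim_null_comparison[rotated]) (rule always_eventually, rule allI, rule nb)
    from tendsto_add[OF this va_weak_limit[OF r(1) rlim rlim Nlim 0 \<phi>]]
    show "(\<lambda>j. inner1 (v j) \<phi>) \<longlonglongrightarrow> inner1 (u 0) \<phi>" by simp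
  qed
  \<comment> \<open>Lower semicontinuity is applied at each level \<open>a\<close> below the target,
    because \<open>U (v j)\<close> need not converge.\<close>
  show ?thesis
  proof (rule dense_le)
    fix a assume a: "a < U (u 0) - U \<rho>b"
    have "\<forall>\<^sub>F j in sequentially. U \<rho>b + a < U (v j)"
      by (rule lower_semicontinuous_limit[where U=U and v=v, OF U lim]) (use a in simp)
    then have ev: "\<forall>\<^sub>F j in sequentially. (1 - r j) * (a - r j) \<le> I + r j + E j / (4 * \<epsilon>)"
    proof eventually_elim
      case (elim j)
      have "(1 - r j) * (a - r j) \<le> (1 - r j) * (U (v j) - U \<rho>b - r j)"
        using elim r[of j] by (intro mult_left_mono) auto
      also note main[of j]
      also have "I + r j + (LINT t|Lt. LINT x|Lx. ep (N j) (r j) (r j) t x) / (4 * \<epsilon>) \<le> I + r j + E j / (4 * \<epsilon>)"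
        using E(2)[of j] \<epsilon> by (intro add_left_mono divide_right_mono) auto
      finally show ?case .
    qed
    have l1: "(\<lambda>j. (1 - r j) * (a - r j)) \<longlonglongrightarrow> (1 - 0) * (a - 0)" by (intro tendsto_intros rlim)
    have l2: "(\<lambda>j. I + r j + E j / (4 * \<epsilon>)) \<longlonglongrightarrow> I + 0 + 0 / (4 * \<epsilon>)" using \<epsilon> by (intro tendsto_intros rlim E(1)) auto
    show "a \<le> I" using tendsto_le[OF _ l2 l1 ev] by simp
  qed
qed

end

section \<open>The infimum over all paths\<close>

lemma I_fun_nonneg: "0 \<le> I_fun \<epsilon> \<rho>\<^sub>0 \<rho>\<^sub>1 T u" if T: "0 < T"
proof (cases "energy T u < \<infinity>")
  case True
  let ?H = "\<lambda>_ _. 0 :: real"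
  have rd: "rect_derivs T ?H (\<lambda>_ _. ?H)" by (auto simp: rect_derivs_def)
  have "?H \<in> test_C0 T" using rd by (auto simp: test_C0_def test_lateral_def smooth_rect_rect_derivs)
  then have "ereal (L_fun \<epsilon> \<rho>\<^sub>0 \<rho>\<^sub>1 T u ?H - \<epsilon> * inner2 T (dx ?H) (\<lambda>t x. mobility (u t x) * dx ?H t x)) \<le> I_fun \<epsilon> \<rho>\<^sub>0 \<rho>\<^sub>1 T u"
    unfolding I_fun_def if_P[OF True] by (rule SUP_upper)
  moreover have "inner2 T f g = 0" if "\<And>t x. t \<in> {-T..0} \<Longrightarrow> x \<in> {0..1} \<Longrightarrow> f t x * g t x = 0" for f g
  proof -
    have "inner1 (f t) (g t) = 0" if "t \<in> {-T..0}" for t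
      using integral_lebesgue_on_cong[of 0 1 "\<lambda>x. f t x * g t x" "\<lambda>_. 0"] \<open>\<And>t x. _ \<Longrightarrow> _ \<Longrightarrow> f t x * g t x = 0\<close>[OF that]
      by (simp add: inner1_def)
    then show ?thesis
      using integral_lebesgue_on_cong[of "-T" 0 "\<lambda>t. inner1 (f t) (g t)" "\<lambda>_. 0"] by (simp add: inner2_def)
  qed
  moreover have "(LINT t|lebesgue_on {-T..0}. \<rho>\<^sub>1 * dx ?H t 1 - \<rho>\<^sub>0 * dx ?H t 0) = (LINT t|lebesgue_on {-T..0}. 0)"
    by (rule integral_lebesgue_on_cong) (simp add: rect_derivs_dx[OF rd])
  ultimately show ?thesis
    by (simp add: L_fun_def rect_derivs_dt[OF rd T] rect_derivs_dx[OF rd] rect_derivs_dxx[OF rd] zero_ereal_def)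
qed (simp add: I_fun_def)

theorem theorem7p2:
  fixes \<rho>\<^sub>0 \<rho>\<^sub>1 \<epsilon> :: real
    and \<rho>bar :: "real \<Rightarrow> real"
    and U :: "(real \<Rightarrow> real) \<Rightarrow> real"
  assumes "0 < \<rho>\<^sub>0" "\<rho>\<^sub>0 < \<rho>\<^sub>1" "\<rho>\<^sub>1 < 1" "0 < \<epsilon>"
    and "stationary \<epsilon> \<rho>\<^sub>0 \<rho>\<^sub>1 \<rho>bar"
    and "lower_semicontinuous M_top U"
    and "U \<rho>bar = 0"
    and "\<And>T u. T > 0 \<Longrightarrow> u \<in> smooth_paths \<rho>\<^sub>0 \<rho>\<^sub>1 T \<Longrightarrow>
      \<exists>(h :: real list \<Rightarrow> nat \<Rightarrow> real \<Rightarrow> real) C.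
        (\<forall>P\<in>partitions T. \<forall>k\<in>{1..num_cells P}.
            h P k \<in> H10 \<and> H10_norm (h P k) \<le> C \<and> Ham \<epsilon> (u (- (P ! k))) (h P k) \<le> 0) \<and>
        Limsup (mesh_to_0 T)
          (\<lambda>P. ereal (\<Sum>k=1..num_cells P.
             U (u (- (P ! (k - 1)))) - U (u (- (P ! k)))
             - (LINT t|lebesgue_on {- (P ! k)..- (P ! (k - 1))}. inner1 (h P k) (dt T u t)))) \<le> 0"
  shows "\<forall>\<rho>\<in>M_space. quasi_potential \<epsilon> \<rho>\<^sub>0 \<rho>\<^sub>1 \<rho>bar \<rho> \<ge> ereal (U \<rho>)"
  unfolding quasi_potential_def
proof (intro ballI INF_greatest)
  fix \<rho> T u
  assume \<rho>: "\<rho> \<in> M_space" and "T \<in> {0::real<..}" and u: "u \<in> paths T \<rho>bar \<rho>"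
  then have T: "0 < T" by simp
  show "ereal (U \<rho>) \<le> I_fun \<epsilon> \<rho>\<^sub>0 \<rho>\<^sub>1 T u"
  proof (cases "I_fun \<epsilon> \<rho>\<^sub>0 \<rho>\<^sub>1 T u = \<infinity>")
    case False
    then obtain I where Ieq: "I_fun \<epsilon> \<rho>\<^sub>0 \<rho>\<^sub>1 T u = ereal I" and I0: "0 \<le> I"
      using I_fun_nonneg[OF T, of \<epsilon> \<rho>\<^sub>0 \<rho>\<^sub>1 u] by (cases "I_fun \<epsilon> \<rho>\<^sub>0 \<rho>\<^sub>1 T u") auto
    have "energy T u < \<infinity>" using False unfolding I_fun_def by (auto split: if_splits)
    then have action: "L_fun \<epsilon> \<rho>\<^sub>0 \<rho>\<^sub>1 T u H - \<epsilon> * inner2 T (dx H) (\<lambda>t x. mobility (u t x) * dx H t x) \<le> I"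
      if "H \<in> test_C0 T" for H
      using Ieq that unfolding I_fun_def by (metis (no_types, lifting) SUP_upper ereal_less_eq(3))
    obtain J Dr where "Dr 0 = \<rho>bar"
      "\<And>j x. x \<in> {0..1} \<Longrightarrow> (Dr j has_real_derivative Dr (Suc j) x) (at x within {0..1})"
      "\<And>x. x \<in> {0..1} \<Longrightarrow> \<epsilon> * Dr 1 x = flux (\<rho>bar x) - J"
      "\<And>x. x \<in> {0..1} \<Longrightarrow> \<rho>\<^sub>0 \<le> \<rho>bar x \<and> \<rho>bar x \<le> \<rho>\<^sub>1" "\<rho>bar 0 = \<rho>\<^sub>0" "\<rho>bar 1 = \<rho>\<^sub>1"
    proof -
      show thesis by (rule stationary_facts[OF assms(5,4,2)]) (fact that)
    qed
    then interpret finite_action_path \<epsilon> \<rho>\<^sub>0 \<rho>\<^sub>1 J T I \<rho>bar Dr u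
      using assms(1-4) T I0 action u by unfold_locales (auto simp: paths_def)
    have "U (u 0) - U \<rho>bar \<le> I"
      by (rule entropy_le_path_action[OF assms(6)]) (rule assms(8)[OF T])
    \<comment> \<open>The path ends at \<open>\<rho>\<close> only up to a null set, and
      \<open>U\<close> does not see null sets.\<close>
    moreover have "U (u 0) = U \<rho>"
      by (rule lower_semicontinuous_AE_eq[OF assms(6) u_M \<rho>]) (use u T in \<open>auto simp: paths_def\<close>)
    ultimately show ?thesis using assms(7) Ieq by simp
  qed simp
qed

end
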